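(* Let $\mathcal D$ be a triangulated category and suppose that $\mathcal H$ is a finite rigid heart (of a bounded t-structure) in $\mathcal D$ with an abelian subcategory $\mathcal K\subset\mathcal H$ such that $\mathrm{Sim}\,\mathcal K\subset\mathrm{Sim}\,\mathcal H$. Denote $\mathcal V=\mathrm{thick}(\mathcal K)$. Let $S\in\mathrm{Sim}\,\mathcal H\setminus\mathrm{Sim}\,\mathcal K$ satisfy $\mathrm{Ext}^1(\mathcal K,S)=0$. Then the simple (forward) tilting $\mathcal H\xrightarrow{S}\mathcal H^\sharp_S$ in $\mathcal D$ induces a simple (forward) tilting of quotient hearts $$\overline{\mathcal H}\xrightarrow{\overline S}\overline{\mathcal H}^\sharp_{\overline S}=\overline{\mathcal H^\sharp_S}$$ in $\mathcal D/\mathcal V$, where $\overline{?}$ is the essential image of $?$ under the Verdier quotient functor $\mathcal D\to\mathcal D/\mathcal V$.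
   Context: All categories are linear over an algebraically closed field and subcategories are full. $\mathrm{Sim}$ denotes the set of (isomorphism classes of) simple objects. A heart is finite if it is a finite length abelian category with finitely many simples; it is rigid if its simples $T$ satisfy $\mathrm{Ext}^1(T,T)=0$. $\mathcal K$ is again a finite length abelian category, so it consists of the objects of $\mathcal H$ with all composition factors in $\mathrm{Sim}\,\mathcal K$. $\mathrm{thick}(\mathcal K)$ is the smallest thick triangulated subcategory of $\mathcal D$ containing $\mathcal K$. For a torsion pair $(\mathcal T,\mathcal F)$ in a heart $\mathcal H$, the forward tilt is the heart $\{M: \exists\text{ triangle } F[1]\to M\to T\to, F\in\mathcal F,T\in\mathcal T\}$, i.e. the extension closure of $\mathcal F[1]$ and $\mathcal T$. The forward tilt is simple at a simple $S$ if $\mathcal F=\langle S\rangle$ is the extension closure of $S$; for a finite heart and rigid simple $S$ it exists and is denoted $\mathcal H^\sharp_S$. *)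

theory Defs
  imports "HOL-Computational_Algebra.Polynomial"
begin

section \<open>Linear categories\<close>

record ('o, 'm, 'k) lin_cat =
  Obj :: "'o set"
  Arr :: "'m set"
  Dom :: "'m \<Rightarrow> 'o"
  Cod :: "'m \<Rightarrow> 'o"
  Ide :: "'o \<Rightarrow> 'm"
  Comp :: "'m \<Rightarrow> 'm \<Rightarrow> 'm"  (infixl "\<cdot>\<index>" 70)
  Null :: "'o \<Rightarrow> 'o \<Rightarrow> 'm"
  Add :: "'m \<Rightarrow> 'm \<Rightarrow> 'm"  (infixl "\<oplus>\<index>" 65)
  Scale :: "'k \<Rightarrow> 'm \<Rightarrow> 'm"  (infixr "\<odot>\<index>" 75)

definition hom :: "('o, 'm, 'k, 'z) lin_cat_scheme \<Rightarrow> 'o \<Rightarrow> 'o \<Rightarrow> 'm set" where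
  "hom C X Y = {f \<in> Arr C. Dom C f = X \<and> Cod C f = Y}"

definition is_iso :: "('o, 'm, 'k, 'z) lin_cat_scheme \<Rightarrow> 'm \<Rightarrow> bool" where
  "is_iso C f \<longleftrightarrow> f \<in> Arr C \<and>
     (\<exists>g \<in> hom C (Cod C f) (Dom C f).
        g \<cdot>\<^bsub>C\<^esub> f = Ide C (Dom C f) \<and> f \<cdot>\<^bsub>C\<^esub> g = Ide C (Cod C f))"

definition isomorphic :: "('o, 'm, 'k, 'z) lin_cat_scheme \<Rightarrow> 'o \<Rightarrow> 'o \<Rightarrow> bool" where
  "isomorphic C X Y \<longleftrightarrow> (\<exists>f \<in> hom C X Y. is_iso C f)"

definition zero_obj :: "('o, 'm, 'k, 'z) lin_cat_scheme \<Rightarrow> 'o \<Rightarrow> bool" where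
  "zero_obj C Z \<longleftrightarrow> Z \<in> Obj C \<and> Ide C Z = Null C Z Z"

definition hom_zero :: "('o, 'm, 'k, 'z) lin_cat_scheme \<Rightarrow> 'o \<Rightarrow> 'o \<Rightarrow> bool" where
  "hom_zero C X Y \<longleftrightarrow> hom C X Y = {Null C X Y}"

definition is_biproduct :: "('o, 'm, 'k, 'z) lin_cat_scheme \<Rightarrow> 'o \<Rightarrow> 'o \<Rightarrow> 'o \<Rightarrow> bool" where
  "is_biproduct C X Y B \<longleftrightarrow>
     (\<exists>i \<in> hom C X B. \<exists>j \<in> hom C Y B. \<exists>p \<in> hom C B X. \<exists>q \<in> hom C B Y.
        p \<cdot>\<^bsub>C\<^esub> i = Ide C X \<and> q \<cdot>\<^bsub>C\<^esub> j = Ide C Y \<and>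
        p \<cdot>\<^bsub>C\<^esub> j = Null C Y X \<and> q \<cdot>\<^bsub>C\<^esub> i = Null C X Y \<and>
        (i \<cdot>\<^bsub>C\<^esub> p) \<oplus>\<^bsub>C\<^esub> (j \<cdot>\<^bsub>C\<^esub> q) = Ide C B)"

locale linear_category =
  fixes C :: "('o, 'm, 'k::field, 'z) lin_cat_scheme" (structure)
  assumes dom_obj: "f \<in> Arr C \<Longrightarrow> Dom C f \<in> Obj C"
    and cod_obj: "f \<in> Arr C \<Longrightarrow> Cod C f \<in> Obj C"
    and ide_hom: "X \<in> Obj C \<Longrightarrow> Ide C X \<in> hom C X X"
    and comp_hom: "\<lbrakk>f \<in> hom C X Y; g \<in> hom C Y Z\<rbrakk> \<Longrightarrow> g \<cdot> f \<in> hom C X Z"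
    and comp_assoc: "\<lbrakk>f \<in> hom C X Y; g \<in> hom C Y Z; h \<in> hom C Z W\<rbrakk>
                       \<Longrightarrow> (h \<cdot> g) \<cdot> f = h \<cdot> (g \<cdot> f)"
    and comp_ide: "f \<in> hom C X Y \<Longrightarrow> f \<cdot> Ide C X = f"
    and ide_comp: "f \<in> hom C X Y \<Longrightarrow> Ide C Y \<cdot> f = f"
    and null_hom: "\<lbrakk>X \<in> Obj C; Y \<in> Obj C\<rbrakk> \<Longrightarrow> Null C X Y \<in> hom C X Y"
    and add_hom: "\<lbrakk>f \<in> hom C X Y; g \<in> hom C X Y\<rbrakk> \<Longrightarrow> f \<oplus> g \<in> hom C X Y"
    and scale_hom: "f \<in> hom C X Y \<Longrightarrow> a \<odot> f \<in> hom C X Y"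
    and add_assoc: "\<lbrakk>f \<in> hom C X Y; g \<in> hom C X Y; h \<in> hom C X Y\<rbrakk>
                      \<Longrightarrow> (f \<oplus> g) \<oplus> h = f \<oplus> (g \<oplus> h)"
    and add_commute: "\<lbrakk>f \<in> hom C X Y; g \<in> hom C X Y\<rbrakk> \<Longrightarrow> f \<oplus> g = g \<oplus> f"
    and add_null: "f \<in> hom C X Y \<Longrightarrow> f \<oplus> Null C X Y = f"
    and add_neg: "f \<in> hom C X Y \<Longrightarrow> f \<oplus> (-1) \<odot> f = Null C X Y"
    and scale_one: "f \<in> hom C X Y \<Longrightarrow> 1 \<odot> f = f"
    and scale_scale: "f \<in> hom C X Y \<Longrightarrow> a \<odot> b \<odot> f = (a * b) \<odot> f"
    and scale_add_left: "f \<in> hom C X Y \<Longrightarrow> (a + b) \<odot> f = (a \<odot> f) \<oplus> (b \<odot> f)"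
    and scale_add_right: "\<lbrakk>f \<in> hom C X Y; g \<in> hom C X Y\<rbrakk>
                            \<Longrightarrow> a \<odot> (f \<oplus> g) = (a \<odot> f) \<oplus> (a \<odot> g)"
    and comp_add_left: "\<lbrakk>f \<in> hom C X Y; g \<in> hom C Y Z; h \<in> hom C Y Z\<rbrakk>
                          \<Longrightarrow> (g \<oplus> h) \<cdot> f = (g \<cdot> f) \<oplus> (h \<cdot> f)"
    and comp_add_right: "\<lbrakk>f \<in> hom C X Y; g \<in> hom C X Y; h \<in> hom C Y Z\<rbrakk>
                           \<Longrightarrow> h \<cdot> (f \<oplus> g) = (h \<cdot> f) \<oplus> (h \<cdot> g)"
    and comp_scale_left: "\<lbrakk>f \<in> hom C X Y; g \<in> hom C Y Z\<rbrakk> \<Longrightarrow> (a \<odot> g) \<cdot> f = a \<odot> (g \<cdot> f)"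
    and comp_scale_right: "\<lbrakk>f \<in> hom C X Y; g \<in> hom C Y Z\<rbrakk> \<Longrightarrow> g \<cdot> (a \<odot> f) = a \<odot> (g \<cdot> f)"

locale additive_linear_category = linear_category +
  assumes ex_zero: "\<exists>Z. zero_obj C Z"
    and ex_biproduct: "\<lbrakk>X \<in> Obj C; Y \<in> Obj C\<rbrakk> \<Longrightarrow> \<exists>B. is_biproduct C X Y B"


section \<open>Abelian full subcategories\<close>

text \<open>
  A full subcategory is given by its set of objects. The notions below are those of the
  full subcategory on \<open>A\<close>: test objects range over \<open>A\<close>, not over all objects of \<open>C\<close>.
\<close>

definition arr_in :: "('o, 'm, 'k, 'z) lin_cat_scheme \<Rightarrow> 'o set \<Rightarrow> 'm \<Rightarrow> bool" where
  "arr_in C A f \<longleftrightarrow> f \<in> Arr C \<and> Dom C f \<in> A \<and> Cod C f \<in> A"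

definition mono_in :: "('o, 'm, 'k, 'z) lin_cat_scheme \<Rightarrow> 'o set \<Rightarrow> 'm \<Rightarrow> bool" where
  "mono_in C A f \<longleftrightarrow> arr_in C A f \<and>
     (\<forall>U \<in> A. \<forall>g \<in> hom C U (Dom C f). \<forall>h \<in> hom C U (Dom C f).
        f \<cdot>\<^bsub>C\<^esub> g = f \<cdot>\<^bsub>C\<^esub> h \<longrightarrow> g = h)"

definition epi_in :: "('o, 'm, 'k, 'z) lin_cat_scheme \<Rightarrow> 'o set \<Rightarrow> 'm \<Rightarrow> bool" where
  "epi_in C A f \<longleftrightarrow> arr_in C A f \<and>
     (\<forall>U \<in> A. \<forall>g \<in> hom C (Cod C f) U. \<forall>h \<in> hom C (Cod C f) U.
        g \<cdot>\<^bsub>C\<^esub> f = h \<cdot>\<^bsub>C\<^esub> f \<longrightarrow> g = h)"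

definition is_kernel :: "('o, 'm, 'k, 'z) lin_cat_scheme \<Rightarrow> 'o set \<Rightarrow> 'm \<Rightarrow> 'm \<Rightarrow> bool" where
  "is_kernel C A k f \<longleftrightarrow> arr_in C A k \<and> arr_in C A f \<and> Cod C k = Dom C f \<and>
     f \<cdot>\<^bsub>C\<^esub> k = Null C (Dom C k) (Cod C f) \<and>
     (\<forall>U \<in> A. \<forall>g \<in> hom C U (Dom C f). f \<cdot>\<^bsub>C\<^esub> g = Null C U (Cod C f) \<longrightarrow>
        (\<exists>!h. h \<in> hom C U (Dom C k) \<and> k \<cdot>\<^bsub>C\<^esub> h = g))"

definition is_cokernel :: "('o, 'm, 'k, 'z) lin_cat_scheme \<Rightarrow> 'o set \<Rightarrow> 'm \<Rightarrow> 'm \<Rightarrow> bool" where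
  "is_cokernel C A c f \<longleftrightarrow> arr_in C A c \<and> arr_in C A f \<and> Dom C c = Cod C f \<and>
     c \<cdot>\<^bsub>C\<^esub> f = Null C (Dom C f) (Cod C c) \<and>
     (\<forall>U \<in> A. \<forall>g \<in> hom C (Cod C f) U. g \<cdot>\<^bsub>C\<^esub> f = Null C (Dom C f) U \<longrightarrow>
        (\<exists>!h. h \<in> hom C (Cod C c) U \<and> h \<cdot>\<^bsub>C\<^esub> c = g))"

definition abelian_on :: "('o, 'm, 'k, 'z) lin_cat_scheme \<Rightarrow> 'o set \<Rightarrow> bool" where
  "abelian_on C A \<longleftrightarrow> A \<subseteq> Obj C \<and>
     (\<exists>Z \<in> A. zero_obj C Z) \<and>
     (\<forall>X \<in> A. \<forall>Y \<in> A. \<exists>B \<in> A. is_biproduct C X Y B) \<and>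
     (\<forall>f. arr_in C A f \<longrightarrow> (\<exists>k. is_kernel C A k f) \<and> (\<exists>c. is_cokernel C A c f)) \<and>
     (\<forall>f. mono_in C A f \<longrightarrow> (\<exists>g. is_kernel C A f g)) \<and>
     (\<forall>f. epi_in C A f \<longrightarrow> (\<exists>g. is_cokernel C A f g))"

text \<open>Full subcategories which are abelian and whose inclusion is exact.\<close>

definition abelian_subcategory :: "('o, 'm, 'k, 'z) lin_cat_scheme \<Rightarrow> 'o set \<Rightarrow> 'o set \<Rightarrow> bool" where
  "abelian_subcategory C A B \<longleftrightarrow> B \<subseteq> A \<and> abelian_on C B \<and>
     (\<forall>k f. is_kernel C B k f \<longrightarrow> is_kernel C A k f) \<and>
     (\<forall>c f. is_cokernel C B c f \<longrightarrow> is_cokernel C A c f)"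

definition short_exact :: "('o, 'm, 'k, 'z) lin_cat_scheme \<Rightarrow> 'o set \<Rightarrow> 'm \<Rightarrow> 'm \<Rightarrow> bool" where
  "short_exact C A f g \<longleftrightarrow> is_kernel C A f g \<and> is_cokernel C A g f"

text \<open>\<open>Sim C A\<close> is a set of objects closed under isomorphism in \<open>A\<close>, not a set of classes.\<close>

definition Sim :: "('o, 'm, 'k, 'z) lin_cat_scheme \<Rightarrow> 'o set \<Rightarrow> 'o set" where
  "Sim C A = {X \<in> A. \<not> zero_obj C X \<and>
     (\<forall>f. mono_in C A f \<and> Cod C f = X \<longrightarrow> zero_obj C (Dom C f) \<or> is_iso C f)}"

text \<open>\<open>comp_series C A X Ts\<close>: \<open>X\<close> has a composition series in \<open>A\<close> with factors \<open>Ts\<close>, top first.\<close>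

inductive comp_series :: "('o, 'm, 'k, 'z) lin_cat_scheme \<Rightarrow> 'o set \<Rightarrow> 'o \<Rightarrow> 'o list \<Rightarrow> bool"
  for C A where
  Nil: "\<lbrakk>X \<in> A; zero_obj C X\<rbrakk> \<Longrightarrow> comp_series C A X []"
| Cons: "\<lbrakk>short_exact C A f g; comp_series C A (Dom C f) Ts; Cod C g \<in> Sim C A\<rbrakk>
           \<Longrightarrow> comp_series C A (Cod C f) (Cod C g # Ts)"

definition comp_factor :: "('o, 'm, 'k, 'z) lin_cat_scheme \<Rightarrow> 'o set \<Rightarrow> 'o \<Rightarrow> 'o \<Rightarrow> bool" where
  "comp_factor C A X T \<longleftrightarrow> (\<exists>Ts. comp_series C A X Ts \<and> T \<in> set Ts)"

definition finite_length :: "('o, 'm, 'k, 'z) lin_cat_scheme \<Rightarrow> 'o set \<Rightarrow> bool" where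
  "finite_length C A \<longleftrightarrow> abelian_on C A \<and> (\<forall>X \<in> A. \<exists>Ts. comp_series C A X Ts)"

definition finitely_many_simples :: "('o, 'm, 'k, 'z) lin_cat_scheme \<Rightarrow> 'o set \<Rightarrow> bool" where
  "finitely_many_simples C A \<longleftrightarrow> (\<exists>R. finite R \<and> (\<forall>T \<in> Sim C A. \<exists>T' \<in> R. isomorphic C T T'))"

definition torsion_pair ::
  "('o, 'm, 'k, 'z) lin_cat_scheme \<Rightarrow> 'o set \<Rightarrow> 'o set \<Rightarrow> 'o set \<Rightarrow> bool" where
  "torsion_pair C A T F \<longleftrightarrow> T \<subseteq> A \<and> F \<subseteq> A \<and>
     (\<forall>X \<in> T. \<forall>Y \<in> A. isomorphic C X Y \<longrightarrow> Y \<in> T) \<and>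
     (\<forall>X \<in> F. \<forall>Y \<in> A. isomorphic C X Y \<longrightarrow> Y \<in> F) \<and>
     (\<forall>X \<in> T. \<forall>Y \<in> F. hom_zero C X Y) \<and>
     (\<forall>X \<in> A. \<exists>f g. short_exact C A f g \<and> Dom C f \<in> T \<and> Cod C f = X \<and> Cod C g \<in> F)"


section \<open>Triangulated categories\<close>

text \<open>
  The shift is a strict automorphism. A triple \<open>(f, g, h)\<close> in \<open>Tri\<close> is a distinguished
  triangle \<open>X \<rightarrow> Y \<rightarrow> Z \<rightarrow> X[1]\<close>.
\<close>

record ('o, 'm, 'k) tri_cat = "('o, 'm, 'k) lin_cat" +
  Sh :: "'o \<Rightarrow> 'o"
  ShA :: "'m \<Rightarrow> 'm"
  Tri :: "('m \<times> 'm \<times> 'm) set"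

definition candidate_triangle ::
  "('o, 'm, 'k, 'z) lin_cat_scheme \<Rightarrow> ('o \<Rightarrow> 'o) \<Rightarrow> 'm \<times> 'm \<times> 'm \<Rightarrow> bool" where
  "candidate_triangle C sh = (\<lambda>(f, g, h).
     f \<in> Arr C \<and> g \<in> Arr C \<and> h \<in> Arr C \<and>
     Cod C f = Dom C g \<and> Cod C g = Dom C h \<and> Cod C h = sh (Dom C f))"

definition triangle_iso ::
  "('o, 'm, 'k, 'z) lin_cat_scheme \<Rightarrow> ('m \<Rightarrow> 'm) \<Rightarrow> 'm \<times> 'm \<times> 'm \<Rightarrow> 'm \<times> 'm \<times> 'm \<Rightarrow> bool" where
  "triangle_iso C shA = (\<lambda>(f, g, h) (f', g', h').
     \<exists>a \<in> hom C (Dom C f) (Dom C f'). \<exists>b \<in> hom C (Dom C g) (Dom C g').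
     \<exists>c \<in> hom C (Dom C h) (Dom C h').
        is_iso C a \<and> is_iso C b \<and> is_iso C c \<and>
        b \<cdot>\<^bsub>C\<^esub> f = f' \<cdot>\<^bsub>C\<^esub> a \<and> c \<cdot>\<^bsub>C\<^esub> g = g' \<cdot>\<^bsub>C\<^esub> b \<and> shA a \<cdot>\<^bsub>C\<^esub> h = h' \<cdot>\<^bsub>C\<^esub> c)"

locale triangulated_category = additive_linear_category C
  for C :: "('o, 'm, 'k::field, 'z) tri_cat_scheme" (structure) +
  assumes shift_obj: "bij_betw (Sh C) (Obj C) (Obj C)"
    and shift_arr: "bij_betw (ShA C) (Arr C) (Arr C)"
    and shift_hom: "f \<in> hom C X Y \<Longrightarrow> ShA C f \<in> hom C (Sh C X) (Sh C Y)"
    and shift_ide: "X \<in> Obj C \<Longrightarrow> ShA C (Ide C X) = Ide C (Sh C X)"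
    and shift_comp: "\<lbrakk>f \<in> hom C X Y; g \<in> hom C Y Z\<rbrakk> \<Longrightarrow> ShA C (g \<cdot> f) = ShA C g \<cdot> ShA C f"
    and shift_add: "\<lbrakk>f \<in> hom C X Y; g \<in> hom C X Y\<rbrakk> \<Longrightarrow> ShA C (f \<oplus> g) = ShA C f \<oplus> ShA C g"
    and shift_scale: "f \<in> hom C X Y \<Longrightarrow> ShA C (r \<odot> f) = r \<odot> ShA C f"
    and tri_candidate: "t \<in> Tri C \<Longrightarrow> candidate_triangle C (Sh C) t"
    and tri_iso: "\<lbrakk>t \<in> Tri C; candidate_triangle C (Sh C) t'; triangle_iso C (ShA C) t t'\<rbrakk>
                    \<Longrightarrow> t' \<in> Tri C"
    and TR1_ide: "\<lbrakk>X \<in> Obj C; zero_obj C Z\<rbrakk> \<Longrightarrow> (Ide C X, Null C X Z, Null C Z (Sh C X)) \<in> Tri C"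
    and TR1_cone: "f \<in> Arr C \<Longrightarrow> \<exists>g h. (f, g, h) \<in> Tri C"
    and TR2: "candidate_triangle C (Sh C) (f, g, h)
                \<Longrightarrow> (f, g, h) \<in> Tri C \<longleftrightarrow> (g, h, (-1) \<odot> ShA C f) \<in> Tri C"
    and TR3: "\<lbrakk>(f, g, h) \<in> Tri C; (f', g', h') \<in> Tri C;
               a \<in> hom C (Dom C f) (Dom C f'); b \<in> hom C (Dom C g) (Dom C g'); b \<cdot> f = f' \<cdot> a\<rbrakk>
                \<Longrightarrow> \<exists>c \<in> hom C (Dom C h) (Dom C h'). c \<cdot> g = g' \<cdot> b \<and> ShA C a \<cdot> h = h' \<cdot> c"
    and TR4: "\<lbrakk>f \<in> hom C X Y; g \<in> hom C Y Z;
               (f, p1, d1) \<in> Tri C; (g \<cdot> f, p2, d2) \<in> Tri C; (g, p3, d3) \<in> Tri C\<rbrakk>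
                \<Longrightarrow> \<exists>a b. (a, b, ShA C p1 \<cdot> d3) \<in> Tri C \<and>
                      a \<cdot> p1 = p2 \<cdot> g \<and> d2 \<cdot> a = d1 \<and> b \<cdot> p2 = p3 \<and> d3 \<cdot> b = ShA C f \<cdot> d2"

definition thick_subcategory :: "('o, 'm, 'k, 'z) tri_cat_scheme \<Rightarrow> 'o set \<Rightarrow> bool" where
  "thick_subcategory D V \<longleftrightarrow> V \<subseteq> Obj D \<and>
     (\<exists>Z \<in> V. zero_obj D Z) \<and>
     (\<forall>X \<in> Obj D. Sh D X \<in> V \<longleftrightarrow> X \<in> V) \<and>
     (\<forall>f g h. (f, g, h) \<in> Tri D \<and> Dom D f \<in> V \<and> Cod D f \<in> V \<longrightarrow> Cod D g \<in> V) \<and>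
     (\<forall>X Y B. B \<in> V \<and> is_biproduct D X Y B \<longrightarrow> X \<in> V)"

definition thick :: "('o, 'm, 'k, 'z) tri_cat_scheme \<Rightarrow> 'o set \<Rightarrow> 'o set" where
  "thick D A = \<Inter>{V. thick_subcategory D V \<and> A \<subseteq> V}"

inductive_set ext_closure :: "('o, 'm, 'k, 'z) tri_cat_scheme \<Rightarrow> 'o set \<Rightarrow> 'o set"
  for D A where
  base: "X \<in> A \<Longrightarrow> X \<in> ext_closure D A"
| zero: "zero_obj D X \<Longrightarrow> X \<in> ext_closure D A"
| iso: "\<lbrakk>X \<in> ext_closure D A; isomorphic D X Y\<rbrakk> \<Longrightarrow> Y \<in> ext_closure D A"
| ext: "\<lbrakk>(f, g, h) \<in> Tri D; Dom D f \<in> ext_closure D A; Cod D g \<in> ext_closure D A\<rbrakk>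
          \<Longrightarrow> Cod D f \<in> ext_closure D A"


section \<open>Hearts and tilting\<close>

definition right_perp :: "('o, 'm, 'k, 'z) lin_cat_scheme \<Rightarrow> 'o set \<Rightarrow> 'o set" where
  "right_perp C A = {Y \<in> Obj C. \<forall>X \<in> A. hom_zero C X Y}"

text \<open>
  A t-structure is given by its aisle \<open>P\<close>, so that \<open>P\<close> and \<open>right_perp D P\<close> play the roles
  of degrees \<open>\<le> 0\<close> and \<open>\<ge> 1\<close>.
\<close>

definition t_structure :: "('o, 'm, 'k, 'z) tri_cat_scheme \<Rightarrow> 'o set \<Rightarrow> bool" where
  "t_structure D P \<longleftrightarrow> P \<subseteq> Obj D \<and>
     (\<forall>X \<in> P. \<forall>Y. isomorphic D X Y \<longrightarrow> Y \<in> P) \<and>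
     (\<forall>X \<in> P. Sh D X \<in> P) \<and>
     (\<forall>X \<in> Obj D. \<exists>f g h. (f, g, h) \<in> Tri D \<and>
        Dom D f \<in> P \<and> Cod D f = X \<and> Cod D g \<in> right_perp D P)"

definition bounded_t_structure :: "('o, 'm, 'k, 'z) tri_cat_scheme \<Rightarrow> 'o set \<Rightarrow> bool" where
  "bounded_t_structure D P \<longleftrightarrow> t_structure D P \<and>
     (\<forall>X \<in> Obj D. (\<exists>m. (Sh D ^^ m) X \<in> P) \<and> (\<exists>n. X \<in> (Sh D ^^ n) ` right_perp D P))"

definition is_heart :: "('o, 'm, 'k, 'z) tri_cat_scheme \<Rightarrow> 'o set \<Rightarrow> bool" where
  "is_heart D H \<longleftrightarrow> (\<exists>P. bounded_t_structure D P \<and> H = P \<inter> Sh D ` right_perp D P)"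

definition finite_heart :: "('o, 'm, 'k, 'z) tri_cat_scheme \<Rightarrow> 'o set \<Rightarrow> bool" where
  "finite_heart D H \<longleftrightarrow> is_heart D H \<and> finite_length D H \<and> finitely_many_simples D H"

text \<open>For objects of a heart, \<open>Ext\<^sup>1(X, Y) = Hom(X, Y[1])\<close>.\<close>

definition ext1_zero :: "('o, 'm, 'k, 'z) tri_cat_scheme \<Rightarrow> 'o \<Rightarrow> 'o \<Rightarrow> bool" where
  "ext1_zero D X Y \<longleftrightarrow> hom_zero D X (Sh D Y)"

definition rigid_heart :: "('o, 'm, 'k, 'z) tri_cat_scheme \<Rightarrow> 'o set \<Rightarrow> bool" where
  "rigid_heart D H \<longleftrightarrow> (\<forall>T \<in> Sim D H. ext1_zero D T T)"

definition forward_tilt :: "('o, 'm, 'k, 'z) tri_cat_scheme \<Rightarrow> 'o set \<Rightarrow> 'o set \<Rightarrow> 'o set" where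
  "forward_tilt D T F = {M \<in> Obj D. \<exists>f g h. (f, g, h) \<in> Tri D \<and>
     Dom D f \<in> Sh D ` F \<and> Cod D f = M \<and> Cod D g \<in> T}"

text \<open>In a torsion pair the torsion class is determined by the torsion-free class.\<close>

definition torsion_class :: "('o, 'm, 'k, 'z) lin_cat_scheme \<Rightarrow> 'o set \<Rightarrow> 'o set \<Rightarrow> 'o set" where
  "torsion_class C A F = {X \<in> A. \<forall>Y \<in> F. hom_zero C X Y}"

definition simple_forward_tilt :: "('o, 'm, 'k, 'z) tri_cat_scheme \<Rightarrow> 'o set \<Rightarrow> 'o \<Rightarrow> 'o set" where
  "simple_forward_tilt D H S =
     forward_tilt D (torsion_class D H (ext_closure D {S})) (ext_closure D {S})"

definition simple_forward_tilting ::
  "('o, 'm, 'k, 'z) tri_cat_scheme \<Rightarrow> 'o set \<Rightarrow> 'o \<Rightarrow> 'o set \<Rightarrow> bool" where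
  "simple_forward_tilting D H S H' \<longleftrightarrow> is_heart D H \<and> S \<in> Sim D H \<and>
     (\<exists>T. torsion_pair D H T (ext_closure D {S}) \<and> H' = forward_tilt D T (ext_closure D {S})) \<and>
     is_heart D H'"


section \<open>Verdier quotients\<close>

text \<open>
  The quotient \<open>D/V\<close> has the objects of \<open>D\<close>; its morphisms \<open>X \<rightarrow> Y\<close> are equivalence classes of
  roofs \<open>(s, f)\<close>, that is \<open>X \<leftarrow> Z \<rightarrow> Y\<close> with the cone of \<open>s : Z \<rightarrow> X\<close> in \<open>V\<close>. A class is stored
  together with its source and target.
\<close>

definition inverted :: "('o, 'm, 'k, 'z) tri_cat_scheme \<Rightarrow> 'o set \<Rightarrow> 'm set" where
  "inverted D V = {s. \<exists>g h. (s, g, h) \<in> Tri D \<and> Cod D g \<in> V}"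

definition roofs :: "('o, 'm, 'k, 'z) tri_cat_scheme \<Rightarrow> 'o set \<Rightarrow> ('m \<times> 'm) set" where
  "roofs D V = {(s, f). s \<in> inverted D V \<and> f \<in> Arr D \<and> Dom D s = Dom D f}"

definition roof_equiv ::
  "('o, 'm, 'k, 'z) tri_cat_scheme \<Rightarrow> 'o set \<Rightarrow> 'm \<times> 'm \<Rightarrow> 'm \<times> 'm \<Rightarrow> bool" where
  "roof_equiv D V = (\<lambda>(s, f) (t, g). \<exists>W. \<exists>u \<in> hom D W (Dom D s). \<exists>v \<in> hom D W (Dom D t).
     s \<cdot>\<^bsub>D\<^esub> u = t \<cdot>\<^bsub>D\<^esub> v \<and> s \<cdot>\<^bsub>D\<^esub> u \<in> inverted D V \<and> f \<cdot>\<^bsub>D\<^esub> u = g \<cdot>\<^bsub>D\<^esub> v)"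

type_synonym ('o, 'm) roof_class = "'o \<times> 'o \<times> ('m \<times> 'm) set"

definition roof_class ::
  "('o, 'm, 'k, 'z) tri_cat_scheme \<Rightarrow> 'o set \<Rightarrow> 'm \<Rightarrow> 'm \<Rightarrow> ('o, 'm) roof_class" where
  "roof_class D V s f = (Cod D s, Cod D f,
     {(t, g) \<in> roofs D V. Cod D t = Cod D s \<and> Cod D g = Cod D f \<and> roof_equiv D V (t, g) (s, f)})"

abbreviation reps :: "('o, 'm) roof_class \<Rightarrow> ('m \<times> 'm) set" where
  "reps c \<equiv> snd (snd c)"

definition verdier_mor :: "('o, 'm, 'k, 'z) tri_cat_scheme \<Rightarrow> 'o set \<Rightarrow> 'm \<Rightarrow> ('o, 'm) roof_class" where
  "verdier_mor D V f = roof_class D V (Ide D (Dom D f)) f"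

definition verdier_obj :: "('o, 'm, 'k, 'z) tri_cat_scheme \<Rightarrow> 'o set \<Rightarrow> 'o \<Rightarrow> 'o" where
  "verdier_obj D V X = X"

text \<open>
  Operations on classes collect the results for all representatives, so no choice is made:
  \<open>(t, g)\<close> after \<open>(s, f)\<close> is \<open>(s t', g f')\<close> for any completion \<open>f t' = t f'\<close> with \<open>t'\<close> inverted;
  sums are formed after passing to a common denominator.
\<close>

definition verdier_lin_cat ::
  "('o, 'm, 'k, 'z) tri_cat_scheme \<Rightarrow> 'o set \<Rightarrow> ('o, ('o, 'm) roof_class, 'k) lin_cat" where
  "verdier_lin_cat D V = \<lparr>
     Obj = Obj D,
     Arr = {roof_class D V s f | s f. (s, f) \<in> roofs D V},
     Dom = (\<lambda>c. fst c),
     Cod = (\<lambda>c. fst (snd c)),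
     Ide = (\<lambda>X. verdier_mor D V (Ide D X)),
     Comp = (\<lambda>d c. (fst c, fst (snd d),
       \<Union>{reps (roof_class D V (s \<cdot>\<^bsub>D\<^esub> t') (g \<cdot>\<^bsub>D\<^esub> f')) | s f t g t' f'.
           (s, f) \<in> reps c \<and> (t, g) \<in> reps d \<and> (t', f') \<in> roofs D V \<and>
           Cod D t' = Dom D f \<and> Cod D f' = Dom D t \<and> f \<cdot>\<^bsub>D\<^esub> t' = t \<cdot>\<^bsub>D\<^esub> f'})),
     Null = (\<lambda>X Y. verdier_mor D V (Null D X Y)),
     Add = (\<lambda>c d. (fst c, fst (snd c),
       \<Union>{reps (roof_class D V s (f \<oplus>\<^bsub>D\<^esub> g)) | s f g. (s, f) \<in> reps c \<and> (s, g) \<in> reps d})),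
     Scale = (\<lambda>a c. (fst c, fst (snd c),
       \<Union>{reps (roof_class D V s (a \<odot>\<^bsub>D\<^esub> f)) | s f. (s, f) \<in> reps c})) \<rparr>"

definition verdier_shift ::
  "('o, 'm, 'k, 'z) tri_cat_scheme \<Rightarrow> ('o, 'm) roof_class \<Rightarrow> ('o, 'm) roof_class" where
  "verdier_shift D c = (Sh D (fst c), Sh D (fst (snd c)), map_prod (ShA D) (ShA D) ` reps c)"

text \<open>Distinguished triangles of \<open>D/V\<close> are those isomorphic to images of distinguished triangles.\<close>

definition verdier_quotient ::
  "('o, 'm, 'k, 'z) tri_cat_scheme \<Rightarrow> 'o set \<Rightarrow> ('o, ('o, 'm) roof_class, 'k) tri_cat" where
  "verdier_quotient D V = lin_cat.extend (verdier_lin_cat D V)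
     (tri_cat.fields (Sh D) (verdier_shift D)
       {t. candidate_triangle (verdier_lin_cat D V) (Sh D) t \<and>
           (\<exists>(f, g, h) \<in> Tri D. triangle_iso (verdier_lin_cat D V) (verdier_shift D)
              (verdier_mor D V f, verdier_mor D V g, verdier_mor D V h) t)})"

definition verdier_image :: "('o, 'm, 'k, 'z) tri_cat_scheme \<Rightarrow> 'o set \<Rightarrow> 'o set \<Rightarrow> 'o set" where
  "verdier_image D V A = {Y \<in> Obj (verdier_quotient D V).
     \<exists>X \<in> A. isomorphic (verdier_quotient D V) (verdier_obj D V X) Y}"

end

theory Submission
  imports Defs
begin

text \<open>
  Write \<open>V\<close> for the thick subcategory generated by \<open>K\<close> and \<open>Q\<close> for the Verdier quotient \<open>D/V\<close>. Every object of \<open>D\<close>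
  is an iterated extension of shifts of simple objects of the heart, and such a filtration can be sorted
  by degree: a neighbouring pair \<open>T[m]\<close>, \<open>U[n]\<close> in the wrong order is exchanged, or it cancels when the connecting
  map is an isomorphism (\<open>word_sort\<close>). Sorted filtrations exhibit all truncations, and sorting never creates new
  factors. Consequently \<open>V\<close> consists of the objects that are iterated extensions of shifts of the simple objects
  of \<open>K\<close>; the one point that is not formal is closure under direct summands (\<open>retract_last_letter\<close>).

  A map \<open>X \<rightarrow> Y\<close> in \<open>Q\<close> is a roof \<open>X \<leftarrow> Z \<rightarrow> Y\<close> whose left leg has its cone in \<open>V\<close>, so \<open>Z\<close> is an extension of \<open>X\<close>
  by an object of \<open>V\<close>. If \<open>X\<close> has cohomology in degrees \<open>\<le> 0\<close> only, then all factors of \<open>Z\<close> in positive degrees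
  come from \<open>V\<close>, and they can be cut off without changing the class of the roof (\<open>roof_word\<close>). This is the engine
  of the whole argument. It shows that the image of the aisle is the aisle of a bounded t-structure on \<open>Q\<close>, whose
  heart is the image of the heart \<open>H\<close> (\<open>quotient_heart\<close>). It also shows that, up to isomorphism of the source, a map
  between objects of the quotient heart comes from a map in \<open>H\<close> (\<open>map_from_heart\<close>). Hence the simple objects of
  \<open>H\<close> outside \<open>K\<close> stay simple, those in \<open>K\<close> become zero, and the quotient heart has finite length with finitely
  many simple objects.

  The hypothesis \<open>Ext\<^sup>1(K, S) = 0\<close> enters in comparing the tilts. It makes the maps from objects of \<open>H\<close> to
  \<open>S\<close> vanish in \<open>Q\<close> exactly when they vanish in \<open>D\<close>, so torsion classes correspond. Together with the rigidity of
  \<open>S\<close> it gives \<open>Ext\<^sup>1(S, S) = 0\<close> in \<open>Q\<close> (\<open>rigid_Q\<close>), so the extension closure of \<open>S\<close> in \<open>Q\<close> consists of direct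
  sums and lifts to \<open>D\<close>. Finally it allows one to lift the connecting maps \<open>T \<rightarrow> F[2]\<close> of the triangles
  \<open>F[1] \<rightarrow> M \<rightarrow> T\<close> that make up the tilted heart (\<open>tilt_image\<close>).

  That both tilts are hearts is the general theorem on tilting at a torsion pair (\<open>forward_tilt_is_heart\<close>), applied
  to \<open>D\<close> and to \<open>Q\<close>. For this, \<open>Q\<close> is shown to be a triangulated category (\<open>triangulated_Q\<close>), and hearts of bounded
  t-structures are shown to be abelian, with short exact sequences given by triangles (\<open>abelian_heart\<close>,
  \<open>short_exact_triangle\<close>).
\<close>


section \<open>Computing in linear categories\<close>

text \<open>
  Hom sets are not types, so every equation between maps holds under side conditions. These are phrased
  with \<open>Arr\<close>, \<open>Dom\<close> and \<open>Cod\<close> instead of membership in a hom set: they are then determined by the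
  terms in the equation, and the simplifier can discharge them while it brackets composites to the right.
\<close>

context linear_category
begin

abbreviation neg :: "'m \<Rightarrow> 'm" where "neg f \<equiv> (-1) \<odot> f"

lemma in_hom: "f \<in> hom C X Y \<longleftrightarrow> f \<in> Arr C \<and> Dom C f = X \<and> Cod C f = Y"
  by (auto simp: hom_def)

lemma arr_in_hom: "f \<in> Arr C \<Longrightarrow> f \<in> hom C (Dom C f) (Cod C f)"
  by (simp add: in_hom)

lemma hom_obj: assumes "f \<in> hom C X Y" shows "X \<in> Obj C" "Y \<in> Obj C"
  using assms dom_obj cod_obj by (auto simp: in_hom)

declare dom_obj[simp] cod_obj[simp]

lemma ide_arr [simp]:
  "X \<in> Obj C \<Longrightarrow> Ide C X \<in> Arr C" "X \<in> Obj C \<Longrightarrow> Dom C (Ide C X) = X"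
  "X \<in> Obj C \<Longrightarrow> Cod C (Ide C X) = X"
  using ide_hom[of X] by (auto simp: in_hom)

lemma null_arr [simp]:
  "X \<in> Obj C \<Longrightarrow> Y \<in> Obj C \<Longrightarrow> Null C X Y \<in> Arr C"
  "X \<in> Obj C \<Longrightarrow> Y \<in> Obj C \<Longrightarrow> Dom C (Null C X Y) = X"
  "X \<in> Obj C \<Longrightarrow> Y \<in> Obj C \<Longrightarrow> Cod C (Null C X Y) = Y"
  using null_hom[of X Y] by (auto simp: in_hom)

lemma comp_arr [simp]:
  assumes "f \<in> Arr C" "g \<in> Arr C" "Cod C f = Dom C g"
  shows "g \<cdot> f \<in> Arr C" "Dom C (g \<cdot> f) = Dom C f" "Cod C (g \<cdot> f) = Cod C g"
  using comp_hom[of f "Dom C f" "Dom C g" g "Cod C g"] assms by (auto simp: in_hom)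

lemma add_arr [simp]:
  assumes "f \<in> Arr C" "g \<in> Arr C" "Dom C f = Dom C g" "Cod C f = Cod C g"
  shows "f \<oplus> g \<in> Arr C" "Dom C (f \<oplus> g) = Dom C g" "Cod C (f \<oplus> g) = Cod C g"
  using add_hom[of f "Dom C g" "Cod C g" g] assms by (auto simp: in_hom)

lemma scale_arr [simp]:
  assumes "f \<in> Arr C"
  shows "a \<odot> f \<in> Arr C" "Dom C (a \<odot> f) = Dom C f" "Cod C (a \<odot> f) = Cod C f"
  using scale_hom[of f "Dom C f" "Cod C f" a] assms by (auto simp: in_hom)

lemma comp_assoc' [simp]:
  assumes "f \<in> Arr C" "g \<in> Arr C" "h \<in> Arr C" "Cod C f = Dom C g" "Cod C g = Dom C h"
  shows "(h \<cdot> g) \<cdot> f = h \<cdot> (g \<cdot> f)"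
  by (rule comp_assoc[of f "Dom C f" "Dom C g" g "Dom C h" h "Cod C h"])
    (use assms in \<open>auto simp: in_hom\<close>)

lemma comp_ide' [simp]: "f \<in> Arr C \<Longrightarrow> Dom C f = X \<Longrightarrow> f \<cdot> Ide C X = f"
  by (rule comp_ide[of f X "Cod C f"]) (auto simp: in_hom)

lemma ide_comp' [simp]: "f \<in> Arr C \<Longrightarrow> Cod C f = Y \<Longrightarrow> Ide C Y \<cdot> f = f"
  by (rule ide_comp[of f "Dom C f" Y]) (auto simp: in_hom)

lemma add_null' [simp]: "f \<in> Arr C \<Longrightarrow> Dom C f = X \<Longrightarrow> Cod C f = Y \<Longrightarrow> f \<oplus> Null C X Y = f"
  by (rule add_null) (auto simp: in_hom)

lemma add_commute':
  assumes "f \<in> Arr C" "g \<in> Arr C" "Dom C f = Dom C g" "Cod C f = Cod C g"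
  shows "f \<oplus> g = g \<oplus> f"
  by (rule add_commute[of f "Dom C g" "Cod C g" g]) (use assms in \<open>auto simp: in_hom\<close>)

lemma null_add' [simp]:
  assumes "f \<in> Arr C" "Dom C f = X" "Cod C f = Y" shows "Null C X Y \<oplus> f = f"
proof -
  have "Null C X Y \<oplus> f = f \<oplus> Null C X Y" by (rule add_commute') (use assms in auto)
  then show ?thesis using assms by simp
qed

lemma add_assoc' [simp]:
  assumes "f \<in> Arr C" "g \<in> Arr C" "h \<in> Arr C" "Dom C f = Dom C h" "Cod C f = Cod C h"
    "Dom C g = Dom C h" "Cod C g = Cod C h"
  shows "(f \<oplus> g) \<oplus> h = f \<oplus> (g \<oplus> h)"
  by (rule add_assoc[of f "Dom C h" "Cod C h" g h]) (use assms in \<open>auto simp: in_hom\<close>)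

lemma add_neg' [simp]: "f \<in> Arr C \<Longrightarrow> f \<oplus> neg f = Null C (Dom C f) (Cod C f)"
  by (rule add_neg) (auto simp: in_hom)

lemma neg_add' [simp]: assumes "f \<in> Arr C" shows "neg f \<oplus> f = Null C (Dom C f) (Cod C f)"
  using add_commute'[of "neg f" f] assms by simp

lemma scale_one' [simp]: "f \<in> Arr C \<Longrightarrow> 1 \<odot> f = f"
  by (rule scale_one) (auto simp: in_hom)

lemma scale_scale' [simp]: "f \<in> Arr C \<Longrightarrow> a \<odot> b \<odot> f = (a * b) \<odot> f"
  by (rule scale_scale) (auto simp: in_hom)

lemma scale_add':
  assumes "f \<in> Arr C" "g \<in> Arr C" "Dom C f = Dom C g" "Cod C f = Cod C g"
  shows "a \<odot> (f \<oplus> g) = a \<odot> f \<oplus> a \<odot> g"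
  by (rule scale_add_right[of f "Dom C g" "Cod C g" g]) (use assms in \<open>auto simp: in_hom\<close>)

lemma add_comp':
  assumes "f \<in> Arr C" "g \<in> Arr C" "h \<in> Arr C" "Cod C f = Dom C h" "Dom C g = Dom C h" "Cod C g = Cod C h"
  shows "(g \<oplus> h) \<cdot> f = (g \<cdot> f) \<oplus> (h \<cdot> f)"
  by (rule comp_add_left[of f "Dom C f" "Dom C h" g "Cod C h"]) (use assms in \<open>auto simp: in_hom\<close>)

lemma comp_add':
  assumes "f \<in> Arr C" "g \<in> Arr C" "h \<in> Arr C" "Cod C f = Dom C h" "Dom C f = Dom C g" "Cod C g = Dom C h"
  shows "h \<cdot> (f \<oplus> g) = (h \<cdot> f) \<oplus> (h \<cdot> g)"
  by (rule comp_add_right[of f "Dom C f" "Dom C h" g h "Cod C h"]) (use assms in \<open>auto simp: in_hom\<close>)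

lemma scale_comp' [simp]:
  assumes "f \<in> Arr C" "g \<in> Arr C" "Cod C f = Dom C g"
  shows "(a \<odot> g) \<cdot> f = a \<odot> (g \<cdot> f)"
  by (rule comp_scale_left[of f "Dom C f" "Dom C g" g "Cod C g"]) (use assms in \<open>auto simp: in_hom\<close>)

lemma comp_scale' [simp]:
  assumes "f \<in> Arr C" "g \<in> Arr C" "Cod C f = Dom C g"
  shows "g \<cdot> (a \<odot> f) = a \<odot> (g \<cdot> f)"
  by (rule comp_scale_right[of f "Dom C f" "Dom C g" g "Cod C g"]) (use assms in \<open>auto simp: in_hom\<close>)

lemma add_neg_cancel:
  assumes "f \<in> Arr C" "g \<in> Arr C" "Dom C f = Dom C g" "Cod C f = Cod C g"
  shows "(f \<oplus> g) \<oplus> neg g = f" "f \<oplus> (neg f \<oplus> g) = g" "neg f \<oplus> (f \<oplus> g) = g"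
proof -
  show "(f \<oplus> g) \<oplus> neg g = f" using assms by simp
  have "f \<oplus> (neg f \<oplus> g) = (f \<oplus> neg f) \<oplus> g" using assms by (simp del: add_neg')
  then show "f \<oplus> (neg f \<oplus> g) = g" using assms by simp
  have "neg f \<oplus> (f \<oplus> g) = (neg f \<oplus> f) \<oplus> g" using assms by (simp del: neg_add')
  then show "neg f \<oplus> (f \<oplus> g) = g" using assms by simp
qed

lemma diff_null_iff:
  assumes "f \<in> Arr C" "g \<in> Arr C" "Dom C f = Dom C g" "Cod C f = Cod C g"
  shows "f \<oplus> neg g = Null C (Dom C g) (Cod C g) \<longleftrightarrow> f = g"
proof
  assume e: "f \<oplus> neg g = Null C (Dom C g) (Cod C g)"
  have "f = f \<oplus> (neg g \<oplus> g)" using assms by simp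
  also have "\<dots> = (f \<oplus> neg g) \<oplus> g" using assms by (simp del: neg_add')
  also have "\<dots> = g" using assms by (simp add: e del: add_assoc')
  finally show "f = g" .
qed (use assms in auto)

lemma double_null:
  assumes "f \<in> Arr C" "f \<oplus> f = f" shows "f = Null C (Dom C f) (Cod C f)"
  using add_neg_cancel(1)[of f f] add_neg'[of f] assms by simp

lemma null_comp [simp]:
  assumes "f \<in> Arr C" "Cod C f = Y" "Z \<in> Obj C" shows "Null C Y Z \<cdot> f = Null C (Dom C f) Z"
proof -
  have Y: "Y \<in> Obj C" using assms by auto
  have "(Null C Y Z \<oplus> Null C Y Z) \<cdot> f = (Null C Y Z \<cdot> f) \<oplus> (Null C Y Z \<cdot> f)"
    by (rule add_comp') (use assms Y in auto)
  then show ?thesis using double_null[of "Null C Y Z \<cdot> f"] assms Y by simp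
qed

lemma comp_null [simp]:
  assumes "f \<in> Arr C" "Dom C f = Y" "X \<in> Obj C" shows "f \<cdot> Null C X Y = Null C X (Cod C f)"
proof -
  have Y: "Y \<in> Obj C" using assms by auto
  have "f \<cdot> (Null C X Y \<oplus> Null C X Y) = (f \<cdot> Null C X Y) \<oplus> (f \<cdot> Null C X Y)"
    by (rule comp_add') (use assms Y in auto)
  then show ?thesis using double_null[of "f \<cdot> Null C X Y"] assms Y by simp
qed

lemma scale_null [simp]:
  assumes "X \<in> Obj C" "Y \<in> Obj C" shows "a \<odot> Null C X Y = Null C X Y"
proof -
  have "a \<odot> (Null C X Y \<oplus> Null C X Y) = a \<odot> Null C X Y \<oplus> a \<odot> Null C X Y"
    by (rule scale_add') (use assms in auto)
  then show ?thesis using double_null[of "a \<odot> Null C X Y"] assms by simp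
qed

lemma neg_eq_null [simp]:
  assumes "f \<in> Arr C" "X \<in> Obj C" "Y \<in> Obj C" shows "neg f = Null C X Y \<longleftrightarrow> f = Null C X Y"
proof
  assume "neg f = Null C X Y"
  then have "neg (neg f) = neg (Null C X Y)" by simp
  then show "f = Null C X Y" using assms by simp
qed (use assms in auto)

lemma neg_neg_eq: "f \<in> Arr C \<Longrightarrow> neg f = g \<Longrightarrow> f = neg g" by auto

subsection \<open>Isomorphisms and zero objects\<close>

lemma is_isoI:
  assumes "f \<in> hom C X Y" "g \<in> hom C Y X" "g \<cdot> f = Ide C X" "f \<cdot> g = Ide C Y"
  shows "is_iso C f"
  using assms by (auto simp: is_iso_def in_hom)

lemma is_isoE:
  assumes "is_iso C f"
  obtains g where "f \<in> Arr C" "g \<in> Arr C" "Dom C g = Cod C f" "Cod C g = Dom C f" "g \<cdot> f = Ide C (Dom C f)" "f \<cdot> g = Ide C (Cod C f)"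
    "is_iso C g"
  using assms by (fastforce simp: is_iso_def in_hom)

lemma is_iso_arr: "is_iso C f \<Longrightarrow> f \<in> Arr C" by (simp add: is_iso_def)

lemma is_iso_ide [simp]: "X \<in> Obj C \<Longrightarrow> is_iso C (Ide C X)"
  by (rule is_isoI[of _ X X "Ide C X"]) (auto simp: in_hom)

text \<open>
  Composites are bracketed to the right, so an equation \<open>a b = c\<close> cannot be used for rewriting inside
  \<open>a (b x)\<close>; this is the form in which it applies there.
\<close>

lemma comp_cancel:
  assumes "a \<cdot> b = c" "a \<in> Arr C" "b \<in> Arr C" "x \<in> Arr C" "Cod C x = Dom C b" "Cod C b = Dom C a"
  shows "a \<cdot> (b \<cdot> x) = c \<cdot> x"
  using assms comp_assoc'[of x b a] by simp

lemma is_iso_comp: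
  assumes "is_iso C f" "is_iso C g" "Cod C f = Dom C g" shows "is_iso C (g \<cdot> f)"
proof -
  obtain f' where f: "f \<in> Arr C" "f' \<in> Arr C" "Dom C f' = Cod C f" "Cod C f' = Dom C f" "f' \<cdot> f = Ide C (Dom C f)" "f \<cdot> f' = Ide C (Cod C f)"
    using is_isoE[OF assms(1)] by metis
  obtain g' where g: "g \<in> Arr C" "g' \<in> Arr C" "Dom C g' = Cod C g" "Cod C g' = Dom C g" "g' \<cdot> g = Ide C (Dom C g)" "g \<cdot> g' = Ide C (Cod C g)"
    using is_isoE[OF assms(2)] by metis
  show ?thesis
  proof (rule is_isoI[of _ "Dom C f" "Cod C g" "f' \<cdot> g'"])
    show "(f' \<cdot> g') \<cdot> (g \<cdot> f) = Ide C (Dom C f)"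
      using f g assms comp_cancel[OF g(5), of f] by simp
    show "(g \<cdot> f) \<cdot> (f' \<cdot> g') = Ide C (Cod C g)"
      using f g assms comp_cancel[OF f(6), of g'] by simp
  qed (use f g assms in \<open>auto simp: in_hom\<close>)
qed

text \<open>Evaluating \<open>g f h\<close> in two ways shows that the two one-sided inverses agree.\<close>

lemma iso_of_inverses:
  assumes f: "f \<in> Arr C" and g: "g \<in> hom C (Cod C f) (Dom C f)" "g \<cdot> f = Ide C (Dom C f)"
    and h: "h \<in> hom C (Cod C f) (Dom C f)" "f \<cdot> h = Ide C (Cod C f)"
  shows "is_iso C f"
proof -
  have "g = g \<cdot> (f \<cdot> h)" using g h f by (simp add: in_hom)
  also have "\<dots> = (g \<cdot> f) \<cdot> h" using g(1) h(1) f by (simp add: in_hom)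
  also have "\<dots> = h" using g h by (simp add: in_hom)
  finally show ?thesis using is_isoI[of f "Dom C f" "Cod C f" g] assms by (simp add: in_hom)
qed

lemma is_iso_left_cancel:
  assumes "is_iso C (g \<cdot> f)" "is_iso C g" "f \<in> Arr C" "Cod C f = Dom C g" shows "is_iso C f"
proof -
  obtain g' where g: "g \<in> Arr C" "g' \<in> Arr C" "Dom C g' = Cod C g" "Cod C g' = Dom C g" "g' \<cdot> g = Ide C (Dom C g)" "g \<cdot> g' = Ide C (Cod C g)" "is_iso C g'"
    using is_isoE[OF assms(2)] by metis
  have "is_iso C (g' \<cdot> (g \<cdot> f))" by (rule is_iso_comp) (use assms g in auto)
  then show ?thesis using comp_cancel[OF g(5), of f] assms g by simp
qed

lemma is_iso_neg: assumes "is_iso C f" shows "is_iso C (neg f)"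
proof -
  obtain g where f: "f \<in> Arr C" "g \<in> Arr C" "Dom C g = Cod C f" "Cod C g = Dom C f" "g \<cdot> f = Ide C (Dom C f)" "f \<cdot> g = Ide C (Cod C f)"
    using is_isoE[OF assms] by metis
  show ?thesis
    by (rule is_isoI[of _ "Dom C f" "Cod C f" "neg g"]) (use f in \<open>auto simp: in_hom\<close>)
qed

lemma isomorphicI: "is_iso C f \<Longrightarrow> Dom C f = X \<Longrightarrow> Cod C f = Y \<Longrightarrow> isomorphic C X Y"
  unfolding isomorphic_def using is_iso_arr in_hom by blast

lemma isomorphicE:
  assumes "isomorphic C X Y"
  obtains f g where "f \<in> Arr C" "Dom C f = X" "Cod C f = Y" "g \<in> Arr C" "Dom C g = Y" "Cod C g = X"
    "g \<cdot> f = Ide C X" "f \<cdot> g = Ide C Y" "is_iso C f" "is_iso C g" "X \<in> Obj C" "Y \<in> Obj C"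
proof -
  obtain f where f: "f \<in> hom C X Y" "is_iso C f" using assms by (auto simp: isomorphic_def)
  obtain g where "f \<in> Arr C" "g \<in> Arr C" "Dom C g = Cod C f" "Cod C g = Dom C f" "g \<cdot> f = Ide C (Dom C f)" "f \<cdot> g = Ide C (Cod C f)"
    "is_iso C g" using is_isoE[OF f(2)] by metis
  with that[of f g] f show thesis by (auto simp: in_hom)
qed

lemma isomorphic_obj: "isomorphic C X Y \<Longrightarrow> X \<in> Obj C \<and> Y \<in> Obj C"
  by (elim isomorphicE) blast

lemma isomorphic_refl: "X \<in> Obj C \<Longrightarrow> isomorphic C X X"
  using isomorphicI[of "Ide C X" X X] by simp

lemma isomorphic_sym: "isomorphic C X Y \<Longrightarrow> isomorphic C Y X"
  by (elim isomorphicE) (auto intro: isomorphicI)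

lemma isomorphic_trans: assumes "isomorphic C X Y" "isomorphic C Y Z" shows "isomorphic C X Z"
proof -
  obtain f where "is_iso C f" "Dom C f = X" "Cod C f = Y" using isomorphicE[OF assms(1)] by metis
  moreover obtain g where "is_iso C g" "Dom C g = Y" "Cod C g = Z" using isomorphicE[OF assms(2)] by metis
  ultimately show ?thesis using isomorphicI[OF is_iso_comp[of f g]] is_iso_arr by simp
qed

lemma zero_obj_Obj: "zero_obj C Z \<Longrightarrow> Z \<in> Obj C" by (simp add: zero_obj_def)

lemma zero_from:
  assumes "zero_obj C Z" "f \<in> Arr C" "Dom C f = Z" shows "f = Null C Z (Cod C f)"
proof -
  have "f = f \<cdot> Ide C Z" using assms by simp
  also have "\<dots> = f \<cdot> Null C Z Z" using assms(1) by (simp add: zero_obj_def)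
  also have "\<dots> = Null C Z (Cod C f)" using assms zero_obj_Obj by simp
  finally show ?thesis .
qed

lemma zero_to:
  assumes "zero_obj C Z" "f \<in> Arr C" "Cod C f = Z" shows "f = Null C (Dom C f) Z"
proof -
  have "f = Ide C Z \<cdot> f" using assms by simp
  also have "\<dots> = Null C Z Z \<cdot> f" using assms(1) by (simp add: zero_obj_def)
  also have "\<dots> = Null C (Dom C f) Z" using assms zero_obj_Obj by simp
  finally show ?thesis .
qed

lemma zero_isomorphic: assumes "zero_obj C X" "zero_obj C Y" shows "isomorphic C X Y"
proof (rule isomorphicI)
  have o: "X \<in> Obj C" "Y \<in> Obj C" using assms zero_obj_Obj by auto
  show "is_iso C (Null C X Y)"
    by (rule is_isoI[of _ X Y "Null C Y X"]) (use assms o in \<open>auto simp: in_hom zero_obj_def\<close>)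
qed (use assms zero_obj_Obj in auto)

lemma zero_obj_iso: assumes "zero_obj C X" "isomorphic C X Y" shows "zero_obj C Y"
proof -
  obtain f g where f: "f \<in> Arr C" "Dom C f = X" "Cod C f = Y" "g \<in> Arr C" "Dom C g = Y" "Cod C g = X"
    "f \<cdot> g = Ide C Y" "Y \<in> Obj C" using isomorphicE[OF assms(2)] by metis
  have "f \<cdot> g = Null C Y Y" using zero_from[OF assms(1) f(1,2)] f assms by simp
  then show ?thesis using f by (simp add: zero_obj_def)
qed

lemma hom_zeroI:
  assumes "X \<in> Obj C" "Y \<in> Obj C"
    "\<And>f. f \<in> Arr C \<Longrightarrow> Dom C f = X \<Longrightarrow> Cod C f = Y \<Longrightarrow> f = Null C X Y"
  shows "hom_zero C X Y"
  using assms null_hom by (auto simp: hom_zero_def in_hom)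

lemma hom_zeroD:
  assumes "hom_zero C X Y" "f \<in> Arr C" "Dom C f = X" "Cod C f = Y" shows "f = Null C X Y"
  using assms by (auto simp: hom_zero_def hom_def)

lemma hom_zero_obj: assumes "hom_zero C X Y" shows "X \<in> Obj C" "Y \<in> Obj C"
proof -
  have "Null C X Y \<in> hom C X Y" using assms by (simp add: hom_zero_def)
  then show "X \<in> Obj C" "Y \<in> Obj C" by (rule hom_obj)+
qed

lemma hom_zero_from_zero: "zero_obj C X \<Longrightarrow> Y \<in> Obj C \<Longrightarrow> hom_zero C X Y"
  by (rule hom_zeroI) (auto simp: zero_obj_Obj dest: zero_from)

lemma hom_zero_to_zero: "zero_obj C Y \<Longrightarrow> X \<in> Obj C \<Longrightarrow> hom_zero C X Y"
  by (rule hom_zeroI) (auto simp: zero_obj_Obj dest: zero_to)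

lemma hom_zero_self: "hom_zero C X X \<Longrightarrow> zero_obj C X"
  using hom_zeroD[of X X "Ide C X"] hom_zero_obj[of X X] by (auto simp: zero_obj_def)

definition retract :: "'o \<Rightarrow> 'o \<Rightarrow> bool" where
  "retract X B \<longleftrightarrow> (\<exists>i r. i \<in> Arr C \<and> r \<in> Arr C \<and> Dom C i = X \<and> Cod C i = B \<and> Dom C r = B \<and> Cod C r = X \<and>
     r \<cdot> i = Ide C X)"

lemma retractE:
  assumes "retract X B"
  obtains i r where "i \<in> Arr C" "r \<in> Arr C" "Dom C i = X" "Cod C i = B" "Dom C r = B" "Cod C r = X"
     "r \<cdot> i = Ide C X" "X \<in> Obj C" "B \<in> Obj C"
proof -
  obtain i r where ir: "i \<in> Arr C" "r \<in> Arr C" "Dom C i = X" "Cod C i = B" "Dom C r = B" "Cod C r = X"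
     "r \<cdot> i = Ide C X" using assms by (auto simp: retract_def)
  then show thesis using that[OF ir] dom_obj[OF ir(1)] cod_obj[OF ir(1)] by simp
qed

lemma retract_of_iso: "isomorphic C X Y \<Longrightarrow> retract X Y"
  by (elim isomorphicE) (auto simp: retract_def)

lemma hom_zero_retract_left:
  assumes "retract X B" "hom_zero C B Y" shows "hom_zero C X Y"
proof (rule hom_zeroI)
  obtain i r where ir: "i \<in> Arr C" "r \<in> Arr C" "Dom C i = X" "Cod C i = B" "Dom C r = B" "Cod C r = X"
     "r \<cdot> i = Ide C X" "X \<in> Obj C" "B \<in> Obj C" using retractE[OF assms(1)] by metis
  show "X \<in> Obj C" "Y \<in> Obj C" using ir hom_zero_obj[OF assms(2)] by auto
  fix f assume f: "f \<in> Arr C" "Dom C f = X" "Cod C f = Y"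
  have "f = f \<cdot> (r \<cdot> i)" using f ir by simp
  also have "\<dots> = (f \<cdot> r) \<cdot> i" using f ir(1-6) by simp
  also have "f \<cdot> r = Null C B Y" by (rule hom_zeroD[OF assms(2)]) (use f ir in auto)
  also have "Null C B Y \<cdot> i = Null C X Y" using ir hom_zero_obj[OF assms(2)] by simp
  finally show "f = Null C X Y" .
qed

lemma hom_zero_retract_right:
  assumes "retract X B" "hom_zero C Y B" shows "hom_zero C Y X"
proof (rule hom_zeroI)
  obtain i r where ir: "i \<in> Arr C" "r \<in> Arr C" "Dom C i = X" "Cod C i = B" "Dom C r = B" "Cod C r = X"
     "r \<cdot> i = Ide C X" "X \<in> Obj C" "B \<in> Obj C" using retractE[OF assms(1)] by metis
  show "X \<in> Obj C" "Y \<in> Obj C" using ir hom_zero_obj[OF assms(2)] by auto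
  fix f assume f: "f \<in> Arr C" "Dom C f = Y" "Cod C f = X"
  have "f = (r \<cdot> i) \<cdot> f" using f ir by simp
  also have "\<dots> = r \<cdot> (i \<cdot> f)" using f ir(1-6) by simp
  also have "i \<cdot> f = Null C Y B" by (rule hom_zeroD[OF assms(2)]) (use f ir in auto)
  also have "r \<cdot> Null C Y B = Null C Y X" using ir hom_zero_obj[OF assms(2)] by simp
  finally show "f = Null C Y X" .
qed

lemma hom_zero_iso:
  assumes "isomorphic C X X'" "isomorphic C Y Y'" "hom_zero C X Y" shows "hom_zero C X' Y'"
  by (meson assms hom_zero_retract_left hom_zero_retract_right isomorphic_sym retract_of_iso)

lemma biproductE:
  assumes "is_biproduct C X Y B"
  obtains i j p q where "i \<in> Arr C" "Dom C i = X" "Cod C i = B" "j \<in> Arr C" "Dom C j = Y" "Cod C j = B"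
    "p \<in> Arr C" "Dom C p = B" "Cod C p = X" "q \<in> Arr C" "Dom C q = B" "Cod C q = Y"
    "p \<cdot> i = Ide C X" "q \<cdot> j = Ide C Y" "p \<cdot> j = Null C Y X" "q \<cdot> i = Null C X Y" "i \<cdot> p \<oplus> j \<cdot> q = Ide C B"
proof -
  obtain i j p q where "i \<in> hom C X B" "j \<in> hom C Y B" "p \<in> hom C B X" "q \<in> hom C B Y"
    "p \<cdot> i = Ide C X" "q \<cdot> j = Ide C Y" "p \<cdot> j = Null C Y X" "q \<cdot> i = Null C X Y" "i \<cdot> p \<oplus> j \<cdot> q = Ide C B"
    using assms unfolding is_biproduct_def by blast
  then show thesis using that[of i j p q] by (simp add: in_hom)
qed

end


section \<open>Pretriangulated categories\<close>

text \<open>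
  Triangulated categories without the octahedral axiom. The Verdier quotient is first recognised as one of
  these: its octahedra are obtained by moving octahedra along isomorphisms of triangles, and that such
  isomorphisms exist is a consequence (the five lemma) of the other axioms.
\<close>

locale pretriangulated_category = additive_linear_category C
  for C :: "('o, 'm, 'k::field, 'z) tri_cat_scheme" (structure) +
  assumes shift_obj: "bij_betw (Sh C) (Obj C) (Obj C)"
    and shift_arr: "bij_betw (ShA C) (Arr C) (Arr C)"
    and shift_hom: "f \<in> hom C X Y \<Longrightarrow> ShA C f \<in> hom C (Sh C X) (Sh C Y)"
    and shift_ide: "X \<in> Obj C \<Longrightarrow> ShA C (Ide C X) = Ide C (Sh C X)"
    and shift_comp: "\<lbrakk>f \<in> hom C X Y; g \<in> hom C Y Z\<rbrakk> \<Longrightarrow> ShA C (g \<cdot> f) = ShA C g \<cdot> ShA C f"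
    and shift_add: "\<lbrakk>f \<in> hom C X Y; g \<in> hom C X Y\<rbrakk> \<Longrightarrow> ShA C (f \<oplus> g) = ShA C f \<oplus> ShA C g"
    and shift_scale: "f \<in> hom C X Y \<Longrightarrow> ShA C (r \<odot> f) = r \<odot> ShA C f"
    and tri_candidate: "t \<in> Tri C \<Longrightarrow> candidate_triangle C (Sh C) t"
    and tri_iso: "\<lbrakk>t \<in> Tri C; candidate_triangle C (Sh C) t'; triangle_iso C (ShA C) t t'\<rbrakk>
                    \<Longrightarrow> t' \<in> Tri C"
    and TR1_ide: "\<lbrakk>X \<in> Obj C; zero_obj C Z\<rbrakk> \<Longrightarrow> (Ide C X, Null C X Z, Null C Z (Sh C X)) \<in> Tri C"
    and TR1_cone: "f \<in> Arr C \<Longrightarrow> \<exists>g h. (f, g, h) \<in> Tri C"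
    and TR2: "candidate_triangle C (Sh C) (f, g, h)
                \<Longrightarrow> (f, g, h) \<in> Tri C \<longleftrightarrow> (g, h, (-1) \<odot> ShA C f) \<in> Tri C"
    and TR3: "\<lbrakk>(f, g, h) \<in> Tri C; (f', g', h') \<in> Tri C;
               a \<in> hom C (Dom C f) (Dom C f'); b \<in> hom C (Dom C g) (Dom C g'); b \<cdot> f = f' \<cdot> a\<rbrakk>
                \<Longrightarrow> \<exists>c \<in> hom C (Dom C h) (Dom C h'). c \<cdot> g = g' \<cdot> b \<and> ShA C a \<cdot> h = h' \<cdot> c"
begin

lemma sh_obj [simp]: "X \<in> Obj C \<Longrightarrow> Sh C X \<in> Obj C"
  using shift_obj by (auto simp: bij_betw_def)

lemma sha_arr [simp]:
  assumes "f \<in> Arr C"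
  shows "ShA C f \<in> Arr C" "Dom C (ShA C f) = Sh C (Dom C f)" "Cod C (ShA C f) = Sh C (Cod C f)"
  using shift_hom[OF arr_in_hom[OF assms]] by (auto simp: in_hom)

lemma sha_comp [simp]:
  assumes "f \<in> Arr C" "g \<in> Arr C" "Cod C f = Dom C g" shows "ShA C (g \<cdot> f) = ShA C g \<cdot> ShA C f"
  by (rule shift_comp[of f "Dom C f" "Dom C g" g "Cod C g"]) (use assms in \<open>auto simp: in_hom\<close>)

lemma sha_add [simp]:
  assumes "f \<in> Arr C" "g \<in> Arr C" "Dom C f = Dom C g" "Cod C f = Cod C g"
  shows "ShA C (f \<oplus> g) = ShA C f \<oplus> ShA C g"
  by (rule shift_add[of f "Dom C g" "Cod C g" g]) (use assms in \<open>auto simp: in_hom\<close>)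

lemma sha_scale [simp]: "f \<in> Arr C \<Longrightarrow> ShA C (r \<odot> f) = r \<odot> ShA C f"
  by (rule shift_scale[OF arr_in_hom])

declare shift_ide [simp]

lemma sha_null [simp]:
  assumes "X \<in> Obj C" "Y \<in> Obj C" shows "ShA C (Null C X Y) = Null C (Sh C X) (Sh C Y)"
proof -
  have "ShA C (Null C X Y \<oplus> Null C X Y) = ShA C (Null C X Y) \<oplus> ShA C (Null C X Y)"
    using assms by (intro sha_add) auto
  then show ?thesis using double_null[of "ShA C (Null C X Y)"] assms by simp
qed

lemma sha_inj: "ShA C f = ShA C g \<Longrightarrow> f \<in> Arr C \<Longrightarrow> g \<in> Arr C \<Longrightarrow> f = g"
  using shift_arr by (auto simp: bij_betw_def inj_on_def)

lemma sh_inj: "Sh C X = Sh C Y \<Longrightarrow> X \<in> Obj C \<Longrightarrow> Y \<in> Obj C \<Longrightarrow> X = Y"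
  using shift_obj by (auto simp: bij_betw_def inj_on_def)

lemma sh_surj: assumes "Y \<in> Obj C" obtains X where "X \<in> Obj C" "Y = Sh C X"
  using assms shift_obj unfolding bij_betw_def by (metis imageE)

lemma sha_surj:
  assumes "f \<in> Arr C" "Dom C f = Sh C X" "Cod C f = Sh C Y" "X \<in> Obj C" "Y \<in> Obj C"
  obtains g where "g \<in> Arr C" "Dom C g = X" "Cod C g = Y" "f = ShA C g"
proof -
  obtain g where g: "g \<in> Arr C" "f = ShA C g" using assms(1) shift_arr unfolding bij_betw_def by (metis imageE)
  then have "Dom C g = X" "Cod C g = Y" using assms by (auto intro: sh_inj)
  with g that show thesis by blast
qed

lemma sha_is_iso: assumes "is_iso C f" shows "is_iso C (ShA C f)"
proof -
  obtain g where f: "f \<in> Arr C" "g \<in> Arr C" "Dom C g = Cod C f" "Cod C g = Dom C f" "g \<cdot> f = Ide C (Dom C f)" "f \<cdot> g = Ide C (Cod C f)"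
    using is_isoE[OF assms] by metis
  show ?thesis
    by (rule is_isoI[of _ "Sh C (Dom C f)" "Sh C (Cod C f)" "ShA C g"]) (use f in \<open>auto simp: in_hom simp flip: sha_comp\<close>)
qed

lemma sha_is_iso_iff: assumes "f \<in> Arr C" shows "is_iso C (ShA C f) \<longleftrightarrow> is_iso C f"
proof
  assume "is_iso C (ShA C f)"
  then obtain g where g: "g \<in> Arr C" "Dom C g = Sh C (Cod C f)" "Cod C g = Sh C (Dom C f)"
    "g \<cdot> ShA C f = Ide C (Sh C (Dom C f))" "ShA C f \<cdot> g = Ide C (Sh C (Cod C f))"
    using is_isoE[of "ShA C f"] assms by (metis sha_arr(2,3))
  obtain g' where g': "g' \<in> Arr C" "Dom C g' = Cod C f" "Cod C g' = Dom C f" "g = ShA C g'"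
    using sha_surj[OF g(1-3)] assms by auto
  have "g' \<cdot> f = Ide C (Dom C f)" by (rule sha_inj) (use g g' assms in auto)
  moreover have "f \<cdot> g' = Ide C (Cod C f)" by (rule sha_inj) (use g g' assms in auto)
  ultimately show "is_iso C f" using is_isoI[of f "Dom C f" "Cod C f" g'] g' assms by (simp add: in_hom)
qed (rule sha_is_iso)

lemma zero_obj_sh: "zero_obj C X \<Longrightarrow> zero_obj C (Sh C X)"
  using shift_ide[of X] by (simp add: zero_obj_def flip: shift_ide)

lemma zero_obj_sh_iff: assumes "X \<in> Obj C" shows "zero_obj C (Sh C X) \<longleftrightarrow> zero_obj C X"
proof
  assume "zero_obj C (Sh C X)"
  then show "zero_obj C X" using sha_inj[of "Ide C X" "Null C X X"] assms by (simp add: zero_obj_def)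
qed (rule zero_obj_sh)

lemma isomorphic_sh: "isomorphic C X Y \<Longrightarrow> isomorphic C (Sh C X) (Sh C Y)"
  unfolding isomorphic_def using sha_is_iso shift_hom by blast

lemma isomorphic_sh_iff: assumes "X \<in> Obj C" "Y \<in> Obj C"
  shows "isomorphic C (Sh C X) (Sh C Y) \<longleftrightarrow> isomorphic C X Y"
proof
  assume "isomorphic C (Sh C X) (Sh C Y)"
  then obtain f where f: "f \<in> Arr C" "Dom C f = Sh C X" "Cod C f = Sh C Y" "is_iso C f"
    by (metis isomorphicE)
  obtain g where "g \<in> Arr C" "Dom C g = X" "Cod C g = Y" "f = ShA C g" using sha_surj[OF f(1-3) assms] .
  then show "isomorphic C X Y" using f sha_is_iso_iff isomorphicI by blast
qed (rule isomorphic_sh)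

lemma hom_zero_sh: assumes "X \<in> Obj C" "Y \<in> Obj C"
  shows "hom_zero C (Sh C X) (Sh C Y) \<longleftrightarrow> hom_zero C X Y"
proof
  assume z: "hom_zero C (Sh C X) (Sh C Y)"
  show "hom_zero C X Y"
  proof (rule hom_zeroI)
    fix f assume f: "f \<in> Arr C" "Dom C f = X" "Cod C f = Y"
    show "f = Null C X Y"
      by (rule sha_inj) (use hom_zeroD[OF z, of "ShA C f"] f assms in auto)
  qed (use assms in auto)
next
  assume z: "hom_zero C X Y"
  show "hom_zero C (Sh C X) (Sh C Y)"
  proof (rule hom_zeroI)
    fix f assume f: "f \<in> Arr C" "Dom C f = Sh C X" "Cod C f = Sh C Y"
    obtain g where g: "g \<in> Arr C" "Dom C g = X" "Cod C g = Y" "f = ShA C g" using sha_surj[OF f assms] .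
    then show "f = Null C (Sh C X) (Sh C Y)" using hom_zeroD[OF z, of g] assms by simp
  qed (use assms in auto)
qed

subsection \<open>Exactness of triangles\<close>

lemma triD:
  assumes "(f, g, h) \<in> Tri C"
  shows "f \<in> Arr C" "g \<in> Arr C" "h \<in> Arr C" "Cod C f = Dom C g" "Cod C g = Dom C h" "Cod C h = Sh C (Dom C f)"
  using tri_candidate[OF assms] by (auto simp: candidate_triangle_def)

lemma tri_rotI: "(f, g, h) \<in> Tri C \<Longrightarrow> (g, h, neg (ShA C f)) \<in> Tri C"
  using TR2 tri_candidate by blast

lemma tri_rot_back:
  assumes "(g, h, k) \<in> Tri C"
  obtains f where "(f, g, h) \<in> Tri C" "k = neg (ShA C f)"
proof -
  note t = triD[OF assms]
  obtain X where X: "X \<in> Obj C" "Cod C h = Sh C X" using sh_surj[of "Cod C h"] t by auto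
  obtain f where f: "f \<in> Arr C" "Dom C f = X" "Cod C f = Dom C g" "neg k = ShA C f"
    by (rule sha_surj[of "neg k" X "Dom C g"]) (use t X in auto)
  have k: "k = neg (ShA C f)" using f t by (metis neg_neg_eq)
  have "candidate_triangle C (Sh C) (f, g, h)" using t f X by (simp add: candidate_triangle_def)
  then have "(f, g, h) \<in> Tri C" using TR2[of f g h] assms k by simp
  then show thesis using that k by blast
qed

text \<open>The degenerate triangle on \<open>0 \<rightarrow> W\<close>, obtained by rotating that of the identity backwards.\<close>

lemma tri_from_zero:
  assumes "W \<in> Obj C" "zero_obj C Z" shows "(Null C Z W, Ide C W, Null C W (Sh C Z)) \<in> Tri C"
proof -
  have z: "zero_obj C (Sh C Z)" "Z \<in> Obj C" using assms zero_obj_sh zero_obj_Obj by auto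
  have "(Ide C W, Null C W (Sh C Z), Null C (Sh C Z) (Sh C W)) \<in> Tri C"
    using TR1_ide[OF assms(1) z(1)] .
  moreover have "candidate_triangle C (Sh C) (Null C Z W, Ide C W, Null C W (Sh C Z))"
    using assms z by (simp add: candidate_triangle_def)
  ultimately show ?thesis using TR2[of "Null C Z W" "Ide C W" "Null C W (Sh C Z)"] assms z by simp
qed

text \<open>
  The map \<open>(1, f)\<close> from the triangle \<open>X \<rightarrow> X \<rightarrow> 0\<close> makes \<open>g f\<close> factor through a zero object.
\<close>

lemma tri_comp_zero:
  assumes "(f, g, h) \<in> Tri C" shows "g \<cdot> f = Null C (Dom C f) (Cod C g)"
proof -
  note t = triD[OF assms]
  obtain Z where Z: "zero_obj C Z" using ex_zero by blast
  have T: "(Ide C (Dom C f), Null C (Dom C f) Z, Null C Z (Sh C (Dom C f))) \<in> Tri C"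
    using TR1_ide[OF _ Z] t by simp
  have "Z \<in> Obj C" using Z zero_obj_Obj by auto
  then obtain c where c: "c \<in> hom C Z (Dom C h)" "c \<cdot> Null C (Dom C f) Z = g \<cdot> f"
    using TR3[OF T assms, of "Ide C (Dom C f)" f] t by (auto simp: in_hom)
  then show ?thesis using t by (simp add: in_hom flip: c(2))
qed

lemma tri_comp_zero2: "(f, g, h) \<in> Tri C \<Longrightarrow> h \<cdot> g = Null C (Dom C g) (Cod C h)"
  using tri_comp_zero[OF tri_rotI] by blast

lemma tri_comp_zero3:
  assumes "(f, g, h) \<in> Tri C" shows "ShA C f \<cdot> h = Null C (Dom C h) (Sh C (Cod C f))"
proof -
  note t = triD[OF assms]
  have "neg (ShA C f) \<cdot> h = Null C (Dom C h) (Sh C (Cod C f))"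
    using tri_comp_zero2[OF tri_rotI[OF assms]] t by simp
  then show ?thesis using t by simp
qed

lemma TR3_arr:
  assumes "(f, g, h) \<in> Tri C" "(f', g', h') \<in> Tri C"
    "a \<in> Arr C" "Dom C a = Dom C f" "Cod C a = Dom C f'" "b \<in> Arr C" "Dom C b = Dom C g" "Cod C b = Dom C g'"
    "b \<cdot> f = f' \<cdot> a"
  obtains c where "c \<in> Arr C" "Dom C c = Dom C h" "Cod C c = Dom C h'" "c \<cdot> g = g' \<cdot> b" "ShA C a \<cdot> h = h' \<cdot> c"
proof -
  have "a \<in> hom C (Dom C f) (Dom C f')" "b \<in> hom C (Dom C g) (Dom C g')" using assms by (simp_all add: in_hom)
  from TR3[OF assms(1,2) this assms(9)] obtain c where "c \<in> hom C (Dom C h) (Dom C h')"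
    "c \<cdot> g = g' \<cdot> b" "ShA C a \<cdot> h = h' \<cdot> c" by blast
  then show thesis using that[of c] by (simp add: in_hom)
qed

text \<open>
  Since \<open>u f = 0\<close>, the pair \<open>(0, u)\<close> maps the triangle to \<open>0 \<rightarrow> W \<rightarrow> W\<close>; the third component of such a
  morphism is the factorisation. It is not unique in general.
\<close>

lemma weak_coker:
  assumes "(f, g, h) \<in> Tri C" "u \<in> Arr C" "Dom C u = Dom C g" "u \<cdot> f = Null C (Dom C f) (Cod C u)"
  obtains v where "v \<in> Arr C" "Dom C v = Dom C h" "Cod C v = Cod C u" "v \<cdot> g = u"
proof -
  note t = triD[OF assms(1)]
  obtain Z where Z: "zero_obj C Z" using ex_zero by blast
  have Z': "Z \<in> Obj C" using Z zero_obj_Obj by auto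
  have T: "(Null C Z (Cod C u), Ide C (Cod C u), Null C (Cod C u) (Sh C Z)) \<in> Tri C"
    using tri_from_zero[OF _ Z] assms by simp
  have o: "Dom C f \<in> Obj C" "Cod C u \<in> Obj C" using t assms by auto
  obtain c where c: "c \<in> Arr C" "Dom C c = Dom C h" "Cod C c = Dom C (Null C (Cod C u) (Sh C Z))" "c \<cdot> g = Ide C (Cod C u) \<cdot> u"
    by (rule TR3_arr[OF assms(1) T, of "Null C (Dom C f) Z" u]) (use t assms(2-4) Z' o in auto)
  show thesis by (rule that[of c]) (use c o Z' assms(2) in auto)
qed

text \<open>
  Dually, \<open>u\<close> extends to a morphism of rotated triangles from \<open>W \<rightarrow> 0 \<rightarrow> W[1]\<close>, whose third component is the
  shift of the factorisation.
\<close>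

lemma weak_ker:
  assumes "(f, g, h) \<in> Tri C" "u \<in> Arr C" "Cod C u = Dom C g" "g \<cdot> u = Null C (Dom C u) (Cod C g)"
  obtains v where "v \<in> Arr C" "Dom C v = Dom C u" "Cod C v = Dom C f" "f \<cdot> v = u"
proof -
  note t = triD[OF assms(1)]
  let ?W = "Dom C u"
  obtain Z where Z: "zero_obj C Z" using ex_zero by blast
  have Z': "Z \<in> Obj C" using Z zero_obj_Obj by auto
  have W: "?W \<in> Obj C" using assms by simp
  have T: "(Null C ?W Z, Null C Z (Sh C ?W), neg (ShA C (Ide C ?W))) \<in> Tri C"
    using tri_rotI[OF TR1_ide[OF W Z]] .
  have Dh: "Dom C h \<in> Obj C" using t by simp
  obtain c where c: "c \<in> Arr C" "Dom C c = Dom C (neg (ShA C (Ide C ?W)))" "Cod C c = Dom C (neg (ShA C f))"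
      "ShA C u \<cdot> neg (ShA C (Ide C ?W)) = neg (ShA C f) \<cdot> c"
    by (rule TR3_arr[OF T tri_rotI[OF assms(1)], of u "Null C Z (Dom C h)"]) (use t assms(2-4) Z' W Dh in auto)
  have cc: "c \<in> Arr C" "Dom C c = Sh C ?W" "Cod C c = Sh C (Dom C f)" using c W t by auto
  obtain v where v: "v \<in> Arr C" "Dom C v = ?W" "Cod C v = Dom C f" "c = ShA C v"
    using sha_surj[OF cc] t W by auto
  have "neg (ShA C u) = neg (ShA C f \<cdot> c)" using c(4) cc t assms(2-4) W by simp
  then have "neg (neg (ShA C u)) = neg (neg (ShA C f \<cdot> c))" by simp
  then have "ShA C u = ShA C (f \<cdot> v)" using cc v t assms by simp
  then have "f \<cdot> v = u" using sha_inj[of u "f \<cdot> v"] v t assms by simp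
  then show thesis using that v by blast
qed

lemma weak_ker_shift:
  assumes "(f, g, h) \<in> Tri C" "u \<in> Arr C" "Cod C u = Cod C h" "ShA C f \<cdot> u = Null C (Dom C u) (Sh C (Cod C f))"
  obtains v where "v \<in> Arr C" "Dom C v = Dom C u" "Cod C v = Dom C h" "h \<cdot> v = u"
proof -
  note t = triD[OF assms(1)]
  show thesis
    by (rule weak_ker[OF tri_rotI[OF tri_rotI[OF assms(1)]], of u]) (use that t assms in auto)
qed

text \<open>
  Write \<open>e = 1 + n\<close>. From \<open>n g = 0\<close> the map \<open>n\<close> factors through \<open>h\<close>, and \<open>h n = 0\<close>; hence \<open>n\<^sup>2 = 0\<close> and
  \<open>1 - n\<close> is inverse to \<open>e\<close>.
\<close>

lemma iso_of_unipotent: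
  assumes T: "(f, g, h) \<in> Tri C" and e: "e \<in> Arr C" "Dom C e = Dom C h" "Cod C e = Dom C h"
    "e \<cdot> g = g" "h \<cdot> e = h"
  shows "is_iso C e"
proof -
  note t = triD[OF T]
  let ?Z = "Dom C h"
  have Z: "?Z \<in> Obj C" using t by simp
  define n where "n = e \<oplus> neg (Ide C ?Z)"
  have n: "n \<in> Arr C" "Dom C n = ?Z" "Cod C n = ?Z" using e Z by (auto simp: n_def)
  have "n \<cdot> g = Null C (Dom C g) ?Z"
    unfolding n_def using e t Z by (subst add_comp') auto
  then obtain k where k: "k \<in> Arr C" "Dom C k = Cod C h" "Cod C k = ?Z" "k \<cdot> h = n"
    using weak_coker[OF tri_rotI[OF T], of n] n t by auto
  have hn: "h \<cdot> n = Null C ?Z (Cod C h)"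
    unfolding n_def using e t Z by (subst comp_add') auto
  have "k \<cdot> (h \<cdot> e) = n \<cdot> e" by (rule comp_cancel[OF k(4)]) (use k(1-3) e t in auto)
  then have ne: "n \<cdot> e = n" using e k(4) by simp
  have "k \<cdot> (h \<cdot> n) = n \<cdot> n" by (rule comp_cancel[OF k(4)]) (use k(1-3) n t in auto)
  then have nn: "n \<cdot> n = Null C ?Z ?Z" using hn k(1-3) t Z by simp
  have e2: "e = n \<oplus> Ide C ?Z" unfolding n_def using e Z by simp
  have en: "e \<cdot> n = n" by (subst e2, subst add_comp') (use n nn Z in auto)
  have x: "e \<oplus> neg n = Ide C ?Z"
    unfolding n_def using e Z by (simp add: scale_add' add_neg_cancel)
  show ?thesis
  proof (rule is_isoI[of _ ?Z ?Z "Ide C ?Z \<oplus> neg n"])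
    show "(Ide C ?Z \<oplus> neg n) \<cdot> e = Ide C ?Z"
      using x by (subst add_comp') (use e n ne Z in auto)
    show "e \<cdot> (Ide C ?Z \<oplus> neg n) = Ide C ?Z"
      using x by (subst comp_add') (use e n en Z in auto)
  qed (use e n Z in \<open>auto simp: in_hom\<close>)
qed

text \<open>
  With both other components invertible, inverses extend to a morphism of triangles in the
  opposite direction. Both composites with that morphism are the identity on the first two vertices, so
  they are unipotent on the third one.
\<close>

lemma five_lemma:
  assumes T: "(f, g, h) \<in> Tri C" and T': "(f', g', h') \<in> Tri C"
    and a: "a \<in> hom C (Dom C f) (Dom C f')" "is_iso C a"
    and b: "b \<in> hom C (Dom C g) (Dom C g')" "is_iso C b"
    and c: "c \<in> hom C (Dom C h) (Dom C h')"
    and "b \<cdot> f = f' \<cdot> a" "c \<cdot> g = g' \<cdot> b" "ShA C a \<cdot> h = h' \<cdot> c"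
  shows "is_iso C c"
proof -
  note t = triD[OF T] triD[OF T']
  note sq = assms(8-10)
  have ab: "a \<in> Arr C" "Dom C a = Dom C f" "Cod C a = Dom C f'" "b \<in> Arr C" "Dom C b = Dom C g" "Cod C b = Dom C g'"
    using a b by (auto simp: in_hom)
  have cc: "c \<in> Arr C" "Dom C c = Dom C h" "Cod C c = Dom C h'" using c by (auto simp: in_hom)
  obtain a' where a': "a' \<in> Arr C" "Dom C a' = Dom C f'" "Cod C a' = Dom C f" "a' \<cdot> a = Ide C (Dom C f)" "a \<cdot> a' = Ide C (Dom C f')"
    using is_isoE[OF a(2)] ab by metis
  obtain b' where b': "b' \<in> Arr C" "Dom C b' = Dom C g'" "Cod C b' = Dom C g" "b' \<cdot> b = Ide C (Dom C g)" "b \<cdot> b' = Ide C (Dom C g')"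
    using is_isoE[OF b(2)] ab by metis
  have "b' \<cdot> f' = b' \<cdot> (f' \<cdot> (a \<cdot> a'))" using a' t by simp
  also have "\<dots> = b' \<cdot> ((f' \<cdot> a) \<cdot> a')" using a'(1-3) ab t by simp
  also have "\<dots> = b' \<cdot> (b \<cdot> (f \<cdot> a'))" unfolding sq(1)[symmetric] using a'(1-3) b'(1-3) ab t by simp
  also have "\<dots> = f \<cdot> a'" using comp_cancel[OF b'(4), of "f \<cdot> a'"] a' b' ab t by simp
  finally have s: "b' \<cdot> f' = f \<cdot> a'" .
  obtain c' where c': "c' \<in> Arr C" "Dom C c' = Dom C h'" "Cod C c' = Dom C h" "c' \<cdot> g' = g \<cdot> b'" "ShA C a' \<cdot> h' = h \<cdot> c'"
    by (rule TR3_arr[OF T' T, of a' b']) (use a' b' s in auto)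
  have 1: "is_iso C (c' \<cdot> c)"
  proof (rule iso_of_unipotent[OF T])
    show "(c' \<cdot> c) \<cdot> g = g"
    proof -
      have "(c' \<cdot> c) \<cdot> g = c' \<cdot> (g' \<cdot> b)" using sq c' cc t by simp
      also have "\<dots> = (g \<cdot> b') \<cdot> b" by (rule comp_cancel[OF c'(4)]) (use ab c' t in auto)
      finally show ?thesis using b' ab t by simp
    qed
    show "h \<cdot> (c' \<cdot> c) = h"
    proof -
      have "h \<cdot> (c' \<cdot> c) = (ShA C a' \<cdot> h') \<cdot> c" by (rule comp_cancel[OF c'(5)[symmetric]]) (use c' cc t in auto)
      also have "\<dots> = ShA C a' \<cdot> (ShA C a \<cdot> h)" using sq a' ab cc t by simp
      also have "\<dots> = ShA C (Ide C (Dom C f)) \<cdot> h"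
        by (rule comp_cancel) (use a' ab t in \<open>auto simp flip: sha_comp\<close>)
      finally show ?thesis using t by simp
    qed
  qed (use c' cc in auto)
  have 2: "is_iso C (c \<cdot> c')"
  proof (rule iso_of_unipotent[OF T'])
    show "(c \<cdot> c') \<cdot> g' = g'"
    proof -
      have "(c \<cdot> c') \<cdot> g' = c \<cdot> (g \<cdot> b')" using c' cc t by simp
      also have "\<dots> = (g' \<cdot> b) \<cdot> b'" by (rule comp_cancel[OF sq(2)]) (use b' ab cc t in auto)
      finally show ?thesis using b' ab t by simp
    qed
    show "h' \<cdot> (c \<cdot> c') = h'"
    proof -
      have "h' \<cdot> (c \<cdot> c') = (ShA C a \<cdot> h) \<cdot> c'" by (rule comp_cancel[OF sq(3)[symmetric]]) (use c' cc t in auto)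
      also have "\<dots> = ShA C a \<cdot> (ShA C a' \<cdot> h')" using c' ab t by simp
      also have "\<dots> = ShA C (Ide C (Dom C f')) \<cdot> h'"
        by (rule comp_cancel) (use a' ab t in \<open>auto simp flip: sha_comp\<close>)
      finally show ?thesis using t by simp
    qed
  qed (use c' cc in auto)
  obtain p where p: "p \<in> Arr C" "Dom C p = Dom C h" "Cod C p = Dom C h" "p \<cdot> (c' \<cdot> c) = Ide C (Dom C h)"
    using is_isoE[OF 1] c' cc by (metis comp_arr(2,3))
  obtain q where q: "q \<in> Arr C" "Dom C q = Dom C h'" "Cod C q = Dom C h'" "(c \<cdot> c') \<cdot> q = Ide C (Dom C h')"
    using is_isoE[OF 2] c' cc by (metis comp_arr(2,3))
  show ?thesis
    by (rule iso_of_inverses[of c "p \<cdot> c'" "c' \<cdot> q"]) (use p q c' cc t in \<open>auto simp: in_hom\<close>)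
qed

text \<open>Any completion to a morphism of triangles is invertible by the five lemma.\<close>

lemma tri_iso_extend:
  assumes T: "(f, g, h) \<in> Tri C" and T': "(f', g', h') \<in> Tri C"
    and a: "a \<in> hom C (Dom C f) (Dom C f')" "is_iso C a"
    and b: "b \<in> hom C (Dom C g) (Dom C g')" "is_iso C b" and "b \<cdot> f = f' \<cdot> a"
  obtains c where "c \<in> Arr C" "Dom C c = Dom C h" "Cod C c = Dom C h'" "is_iso C c" "c \<cdot> g = g' \<cdot> b" "ShA C a \<cdot> h = h' \<cdot> c"
proof -
  obtain c where c: "c \<in> hom C (Dom C h) (Dom C h')" "c \<cdot> g = g' \<cdot> b" "ShA C a \<cdot> h = h' \<cdot> c"
    using TR3[OF T T' a(1) b(1) assms(7)] by blast
  have "is_iso C c" by (rule five_lemma[OF T T' a b c(1) assms(7) c(2,3)])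
  with c that show thesis by (auto simp: in_hom)
qed

lemma tri_cong:
  assumes T: "(f, g, h) \<in> Tri C" and "is_iso C a" "is_iso C b" "is_iso C c"
    "Dom C a = Dom C f" "Dom C b = Dom C g" "Dom C c = Dom C h"
    "f' \<in> hom C (Cod C a) (Cod C b)" "g' \<in> hom C (Cod C b) (Cod C c)" "h' \<in> hom C (Cod C c) (Sh C (Cod C a))"
    "b \<cdot> f = f' \<cdot> a" "c \<cdot> g = g' \<cdot> b" "ShA C a \<cdot> h = h' \<cdot> c"
  shows "(f', g', h') \<in> Tri C"
proof (rule tri_iso[OF T])
  show "candidate_triangle C (Sh C) (f', g', h')" using assms by (auto simp: candidate_triangle_def in_hom)
  show "triangle_iso C (ShA C) (f, g, h) (f', g', h')"
    unfolding triangle_iso_def prod.case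
    by (rule bexI[of _ a], rule bexI[of _ b], rule bexI[of _ c]) (use assms is_iso_arr in \<open>auto simp: in_hom\<close>)
qed

section \<open>Triangles seen from their vertices\<close>

text \<open>
  Orthogonality arguments about t-structures only use which objects are the vertices of a triangle. The
  relation below forgets the maps, so that long exact sequences and octahedra become rules about objects.
\<close>

definition tri :: "'o \<Rightarrow> 'o \<Rightarrow> 'o \<Rightarrow> bool" where
  "tri X Y Z \<longleftrightarrow> (\<exists>f g h. (f, g, h) \<in> Tri C \<and> Dom C f = X \<and> Cod C f = Y \<and> Cod C g = Z)"

lemma triI: "(f, g, h) \<in> Tri C \<Longrightarrow> tri (Dom C f) (Cod C f) (Cod C g)"
  by (auto simp: tri_def)

lemma triE:
  assumes "tri X Y Z"
  obtains f g h where "(f, g, h) \<in> Tri C" "f \<in> Arr C" "g \<in> Arr C" "h \<in> Arr C"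
    "Dom C f = X" "Cod C f = Y" "Dom C g = Y" "Cod C g = Z" "Dom C h = Z" "Cod C h = Sh C X"
    "X \<in> Obj C" "Y \<in> Obj C" "Z \<in> Obj C"
proof -
  obtain f g h where T: "(f, g, h) \<in> Tri C" "Dom C f = X" "Cod C f = Y" "Cod C g = Z" using assms by (auto simp: tri_def)
  note t = triD[OF T(1)]
  show thesis by (rule that[OF T(1)]) (use t T in auto)
qed

lemma tri_obj: assumes "tri X Y Z" shows "X \<in> Obj C" "Y \<in> Obj C" "Z \<in> Obj C"
  using assms by (meson triE)+

lemma tri_rot: "tri X Y Z \<Longrightarrow> tri Y Z (Sh C X)"
  by (elim triE) (use tri_rotI triI in fastforce)

lemma tri_unrot: assumes "tri Y Z (Sh C X)" "X \<in> Obj C" shows "tri X Y Z"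
proof -
  obtain g h k where T: "(g, h, k) \<in> Tri C" "Dom C g = Y" "Cod C g = Z" "Cod C h = Sh C X" using assms by (auto simp: tri_def)
  obtain f where f: "(f, g, h) \<in> Tri C" using tri_rot_back[OF T(1)] .
  note t = triD[OF f]
  have "Dom C f = X" using t T assms by (auto intro: sh_inj)
  then show ?thesis using triI[OF f] T t by auto
qed

lemma tri_unrot_ex: assumes "tri Y Z W" obtains X where "X \<in> Obj C" "W = Sh C X" "tri X Y Z"
  by (metis assms sh_surj tri_obj(3) tri_unrot)

lemma tri_sh: assumes "X \<in> Obj C" "Y \<in> Obj C" "Z \<in> Obj C"
  shows "tri (Sh C X) (Sh C Y) (Sh C Z) \<longleftrightarrow> tri X Y Z"
  by (metis assms tri_rot tri_unrot)

lemma tri_zero_right: assumes "X \<in> Obj C" "zero_obj C Z" shows "tri X X Z"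
  using triI[OF TR1_ide[OF assms]] assms zero_obj_Obj by simp

lemma tri_zero_left: assumes "X \<in> Obj C" "zero_obj C Z" shows "tri Z X X"
  using triI[OF tri_from_zero[OF assms]] assms zero_obj_Obj by simp

lemma tri_iso_obj:
  assumes "tri X Y Z" "isomorphic C X X'" "isomorphic C Y Y'" "isomorphic C Z Z'" shows "tri X' Y' Z'"
proof -
  obtain f g h where T: "(f, g, h) \<in> Tri C" "f \<in> Arr C" "g \<in> Arr C" "h \<in> Arr C"
    "Dom C f = X" "Cod C f = Y" "Dom C g = Y" "Cod C g = Z" "Dom C h = Z" "Cod C h = Sh C X"
    using triE[OF assms(1)] by metis
  obtain a a' where a: "a \<in> Arr C" "Dom C a = X" "Cod C a = X'" "a' \<in> Arr C" "Dom C a' = X'" "Cod C a' = X"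
    "a' \<cdot> a = Ide C X" "a \<cdot> a' = Ide C X'" "is_iso C a" using isomorphicE[OF assms(2)] by metis
  obtain b b' where b: "b \<in> Arr C" "Dom C b = Y" "Cod C b = Y'" "b' \<in> Arr C" "Dom C b' = Y'" "Cod C b' = Y"
    "b' \<cdot> b = Ide C Y" "b \<cdot> b' = Ide C Y'" "is_iso C b" using isomorphicE[OF assms(3)] by metis
  obtain c c' where c: "c \<in> Arr C" "Dom C c = Z" "Cod C c = Z'" "c' \<in> Arr C" "Dom C c' = Z'" "Cod C c' = Z"
    "c' \<cdot> c = Ide C Z" "c \<cdot> c' = Ide C Z'" "is_iso C c" using isomorphicE[OF assms(4)] by metis
  have "(b \<cdot> (f \<cdot> a'), c \<cdot> (g \<cdot> b'), ShA C a \<cdot> (h \<cdot> c')) \<in> Tri C"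
    by (rule tri_cong[OF T(1) a(9) b(9) c(9)]) (use T a b c in \<open>auto simp: in_hom\<close>)
  from triI[OF this] show ?thesis using T a b c by simp
qed

lemma tri_iso_mid: assumes "tri X Y Z" "isomorphic C Y Y'" shows "tri X Y' Z"
  using tri_iso_obj[OF assms(1) _ assms(2)] isomorphic_refl tri_obj[OF assms(1)] by blast

lemma hom_zero_mid:
  assumes T: "tri X Y Z" and "hom_zero C W X" "hom_zero C W Z" shows "hom_zero C W Y"
proof -
  obtain f g h where t: "(f, g, h) \<in> Tri C" "f \<in> Arr C" "g \<in> Arr C" "h \<in> Arr C"
    "Dom C f = X" "Cod C f = Y" "Dom C g = Y" "Cod C g = Z" "Dom C h = Z" using triE[OF T] by metis
  show ?thesis
  proof (rule hom_zeroI)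
    show "W \<in> Obj C" "Y \<in> Obj C" using tri_obj[OF T] hom_zero_obj[OF assms(2)] by auto
    fix u assume u: "u \<in> Arr C" "Dom C u = W" "Cod C u = Y"
    have "g \<cdot> u = Null C W Z" by (rule hom_zeroD[OF assms(3)]) (use t u in auto)
    then obtain v where v: "v \<in> Arr C" "Dom C v = W" "Cod C v = X" "f \<cdot> v = u"
      using weak_ker[OF t(1), of u] t u by auto
    have "v = Null C W X" by (rule hom_zeroD[OF assms(2)]) (use v in auto)
    then show "u = Null C W Y" using v t tri_obj[OF T] hom_zero_obj[OF assms(2)] by auto
  qed
qed

lemma hom_zero_mid':
  assumes T: "tri X Y Z" and "hom_zero C X W" "hom_zero C Z W" shows "hom_zero C Y W"
proof -
  obtain f g h where t: "(f, g, h) \<in> Tri C" "f \<in> Arr C" "g \<in> Arr C" "h \<in> Arr C"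
    "Dom C f = X" "Cod C f = Y" "Dom C g = Y" "Cod C g = Z" "Dom C h = Z" using triE[OF T] by metis
  show ?thesis
  proof (rule hom_zeroI)
    show "W \<in> Obj C" "Y \<in> Obj C" using tri_obj[OF T] hom_zero_obj[OF assms(2)] by auto
    fix u assume u: "u \<in> Arr C" "Dom C u = Y" "Cod C u = W"
    have "u \<cdot> f = Null C X W" by (rule hom_zeroD[OF assms(2)]) (use t u in auto)
    then obtain v where v: "v \<in> Arr C" "Dom C v = Z" "Cod C v = W" "v \<cdot> g = u"
      using weak_coker[OF t(1), of u] t u by auto
    have "v = Null C Z W" by (rule hom_zeroD[OF assms(3)]) (use v in auto)
    then show "u = Null C Y W" using v t tri_obj[OF T] hom_zero_obj[OF assms(2)] by auto
  qed
qed

text \<open>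
  A zero connecting map lets the identity of the third vertex lift to a section \<open>s\<close> of \<open>g\<close>. The idempotent
  \<open>1 - s g\<close> is killed by \<open>g\<close> and factors as \<open>f p\<close>; since \<open>f\<close> is a monomorphism here, \<open>(f, s)\<close> and \<open>(p, g)\<close> form
  a biproduct, and the cone of \<open>s\<close> is identified with the first vertex through \<open>p\<close>.
\<close>

lemma tri_split_morphisms:
  assumes T: "(f, g, h) \<in> Tri C" and h0: "h = Null C (Dom C h) (Cod C h)"
  obtains s p where "s \<in> Arr C" "p \<in> Arr C" "Dom C s = Dom C h" "Cod C s = Dom C g" "Dom C p = Dom C g" "Cod C p = Dom C f"
    "g \<cdot> s = Ide C (Dom C h)" "p \<cdot> f = Ide C (Dom C f)" "p \<cdot> s = Null C (Dom C h) (Dom C f)"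
    "f \<cdot> p = Ide C (Dom C g) \<oplus> neg (s \<cdot> g)" "(s, p, Null C (Dom C f) (Sh C (Dom C h))) \<in> Tri C"
proof -
  note t = triD[OF T]
  let ?X = "Dom C f" let ?Y = "Dom C g" let ?Z = "Dom C h"
  have o: "?X \<in> Obj C" "?Y \<in> Obj C" "?Z \<in> Obj C" using t by auto
  have "h \<cdot> Ide C ?Z = Null C ?Z (Cod C h)" using t h0 by simp
  then obtain s where s: "s \<in> Arr C" "Dom C s = ?Z" "Cod C s = ?Y" "g \<cdot> s = Ide C ?Z"
    using weak_ker[OF tri_rotI[OF T], of "Ide C ?Z"] t o by auto
  define e where "e = Ide C ?Y \<oplus> neg (s \<cdot> g)"
  have e: "e \<in> Arr C" "Dom C e = ?Y" "Cod C e = ?Y" using s t o by (auto simp: e_def)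
  have "g \<cdot> e = g \<oplus> neg (g \<cdot> (s \<cdot> g))" unfolding e_def by (subst comp_add') (use s t o in auto)
  then have "g \<cdot> e = Null C ?Y (Cod C g)" using comp_cancel[OF s(4), of g] s t o by simp
  then obtain p where p: "p \<in> Arr C" "Dom C p = ?Y" "Cod C p = ?X" "f \<cdot> p = e"
    using weak_ker[OF T, of e] t e by auto
  have mono: "x = Null C (Dom C x) ?X" if x: "x \<in> Arr C" "Cod C x = ?X" "f \<cdot> x = Null C (Dom C x) ?Y" for x
  proof -
    have "ShA C f \<cdot> ShA C x = Null C (Sh C (Dom C x)) (Sh C (Cod C f))"
      using x t o sha_comp[of x f] by simp
    then obtain y where y: "y \<in> Arr C" "Dom C y = Sh C (Dom C x)" "Cod C y = ?Z" "h \<cdot> y = ShA C x"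
      using weak_ker_shift[OF T, of "ShA C x"] x t o by auto
    have "ShA C x = Null C (Sh C (Dom C x)) (Sh C ?X)" using y t x o by (subst y(4)[symmetric], subst h0) simp
    then show ?thesis using sha_inj[of x "Null C (Dom C x) ?X"] x o by simp
  qed
  have pf: "p \<cdot> f = Ide C ?X"
  proof -
    have "f \<cdot> (p \<cdot> f \<oplus> neg (Ide C ?X)) = f \<cdot> (p \<cdot> f) \<oplus> neg f" by (subst comp_add') (use p t o in auto)
    also have "f \<cdot> (p \<cdot> f) = e \<cdot> f" by (rule comp_cancel[OF p(4)]) (use p t o in auto)
    also have "e \<cdot> f = f \<oplus> neg (s \<cdot> (g \<cdot> f))" unfolding e_def by (subst add_comp') (use s t o in auto)
    also have "\<dots> = f" using tri_comp_zero[OF T] s t o by simp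
    finally have "f \<cdot> (p \<cdot> f \<oplus> neg (Ide C ?X)) = Null C ?X ?Y" using t by simp
    then have "p \<cdot> f \<oplus> neg (Ide C ?X) = Null C ?X ?X" using mono[of "p \<cdot> f \<oplus> neg (Ide C ?X)"] p t o by simp
    then show ?thesis using diff_null_iff[of "p \<cdot> f" "Ide C ?X"] p t o by simp
  qed
  have ps: "p \<cdot> s = Null C ?Z ?X"
  proof -
    have "f \<cdot> (p \<cdot> s) = e \<cdot> s" by (rule comp_cancel[OF p(4)]) (use p s t o in auto)
    also have "e \<cdot> s = s \<oplus> neg (s \<cdot> (g \<cdot> s))" unfolding e_def by (subst add_comp') (use s t o in auto)
    also have "\<dots> = Null C ?Z ?Y" using s t o by simp
    finally show ?thesis using mono[of "p \<cdot> s"] p s t o by simp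
  qed
  obtain q k where K: "(s, q, k) \<in> Tri C" using TR1_cone[OF s(1)] by blast
  note tk = triD[OF K]
  have k0: "k = Null C (Dom C k) (Sh C ?Z)"
  proof -
    have "ShA C g \<cdot> (ShA C s \<cdot> k) = Ide C (Sh C ?Z) \<cdot> k"
      by (rule comp_cancel) (use s t tk o in \<open>auto simp flip: sha_comp\<close>)
    then show ?thesis using tri_comp_zero3[OF K] s t tk o by simp
  qed
  obtain c where c: "c \<in> Arr C" "Dom C c = Dom C k" "Cod C c = ?X" "c \<cdot> q = p"
    using weak_coker[OF K, of p] p s tk ps by auto
  have q: "q \<in> Arr C" "Dom C q = ?Y" "Cod C q = Dom C k" using tk s by auto
  have qfp: "q \<cdot> (f \<cdot> p) = q"
  proof -
    have "q \<cdot> e = q \<oplus> neg (q \<cdot> (s \<cdot> g))" unfolding e_def by (subst comp_add') (use s t o q in auto)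
    also have "q \<cdot> (s \<cdot> g) = Null C ?Z (Cod C q) \<cdot> g"
      by (rule comp_cancel) (use tri_comp_zero[OF K] q s t in auto)
    finally show ?thesis using p q t s o tk(3) by simp
  qed
  have 1: "c \<cdot> (q \<cdot> f) = Ide C ?X" using comp_cancel[OF c(4), of f] c q t pf by simp
  have 2: "(q \<cdot> f) \<cdot> c = Ide C (Dom C k)"
  proof -
    let ?d = "(q \<cdot> f) \<cdot> c \<oplus> neg (Ide C (Dom C k))"
    have d: "?d \<in> Arr C" "Dom C ?d = Dom C k" "Cod C ?d = Dom C k" using q t c tk by auto
    have "?d \<cdot> q = ((q \<cdot> f) \<cdot> c) \<cdot> q \<oplus> neg q" by (subst add_comp') (use q t c tk in auto)
    also have "((q \<cdot> f) \<cdot> c) \<cdot> q = q" using q t c tk qfp by simp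
    finally have "?d \<cdot> q = Null C (Dom C q) (Cod C q)" using q by simp
    then obtain m where m: "m \<in> Arr C" "Dom C m = Cod C k" "Cod C m = Dom C k" "m \<cdot> k = ?d"
      using weak_coker[OF tri_rotI[OF K], of ?d] d q tk by auto
    have "?d = Null C (Dom C k) (Dom C k)" using m tk s o by (subst m(4)[symmetric], subst k0) simp
    then show ?thesis using diff_null_iff[of "(q \<cdot> f) \<cdot> c" "Ide C (Dom C k)"] q t c tk by simp
  qed
  have ic: "is_iso C c" by (rule is_isoI[of c "Dom C k" ?X "q \<cdot> f"]) (use 1 2 q t c tk in \<open>auto simp: in_hom\<close>)
  have "(s, p, Null C ?X (Sh C ?Z)) \<in> Tri C"
    by (rule tri_cong[OF K, of "Ide C ?Z" "Ide C ?Y" c])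
      (use ic s p c tk o q k0 in \<open>auto simp: in_hom\<close>)
  then show thesis using that[of s p] s p pf ps e_def by simp
qed

lemma tri_swap:
  assumes "(f, g, h) \<in> Tri C" "h = Null C (Dom C h) (Cod C h)" shows "tri (Cod C g) (Cod C f) (Dom C f)"
proof -
  obtain s p where s: "s \<in> Arr C" "p \<in> Arr C" "Dom C s = Dom C h" "Cod C s = Dom C g" "Dom C p = Dom C g" "Cod C p = Dom C f"
    "(s, p, Null C (Dom C f) (Sh C (Dom C h))) \<in> Tri C"
    using tri_split_morphisms[OF assms] by metis
  show ?thesis using triI[OF s(7)] s triD[OF assms(1)] by simp
qed

lemma tri_split_biproduct:
  assumes "(f, g, h) \<in> Tri C" "h = Null C (Dom C h) (Cod C h)"
  shows "is_biproduct C (Dom C f) (Cod C g) (Cod C f)"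
proof -
  note t = triD[OF assms(1)]
  obtain s p where s: "s \<in> Arr C" "p \<in> Arr C" "Dom C s = Dom C h" "Cod C s = Dom C g" "Dom C p = Dom C g" "Cod C p = Dom C f"
    "g \<cdot> s = Ide C (Dom C h)" "p \<cdot> f = Ide C (Dom C f)" "p \<cdot> s = Null C (Dom C h) (Dom C f)"
    "f \<cdot> p = Ide C (Dom C g) \<oplus> neg (s \<cdot> g)"
    using tri_split_morphisms[OF assms] by metis
  show ?thesis unfolding is_biproduct_def
    by (rule bexI[of _ f], rule bexI[of _ s], rule bexI[of _ p], rule bexI[of _ g])
      (use s t tri_comp_zero[OF assms(1)] in \<open>auto simp: in_hom\<close>)
qed

lemma tri_split_retract:
  assumes "(f, g, h) \<in> Tri C" "h = Null C (Dom C h) (Cod C h)"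
  shows "retract (Dom C f) (Cod C f)" "retract (Cod C g) (Cod C f)"
proof -
  note t = triD[OF assms(1)]
  obtain s p where s: "s \<in> Arr C" "p \<in> Arr C" "Dom C s = Dom C h" "Cod C s = Dom C g" "Dom C p = Dom C g" "Cod C p = Dom C f"
    "g \<cdot> s = Ide C (Dom C h)" "p \<cdot> f = Ide C (Dom C f)"
    using tri_split_morphisms[OF assms] by metis
  show "retract (Dom C f) (Cod C f)" unfolding retract_def
    by (rule exI[of _ f], rule exI[of _ p]) (use s t in auto)
  show "retract (Cod C g) (Cod C f)" unfolding retract_def
    by (rule exI[of _ s], rule exI[of _ g]) (use s t in auto)
qed

lemma iso_of_zero_cone:
  assumes T: "(f, g, h) \<in> Tri C" and z: "zero_obj C (Cod C g)" shows "is_iso C f"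
proof -
  note t = triD[OF T]
  let ?I = "Ide C (Dom C f)"
  have I: "(?I, Null C (Dom C f) (Cod C g), Null C (Cod C g) (Sh C (Dom C f))) \<in> Tri C"
    by (rule TR1_ide) (use t z in auto)
  have "g = Null C (Dom C g) (Cod C g)" using zero_to[OF z, of g] t by simp
  then have "g \<cdot> Ide C (Dom C g) = Null C (Dom C g) (Cod C g)" using t by simp
  then obtain r where r: "r \<in> Arr C" "Dom C r = Dom C g" "Cod C r = Dom C f" "f \<cdot> r = Ide C (Dom C g)"
    using weak_ker[OF T, of "Ide C (Dom C g)"] t by auto
  have h0: "h = Null C (Dom C h) (Cod C h)" using zero_from[OF z, of h] t by simp
  obtain p where p: "p \<in> Arr C" "Dom C p = Dom C g" "Cod C p = Dom C f" "p \<cdot> f = Ide C (Dom C f)"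
    using tri_split_morphisms[OF T h0] by metis
  show ?thesis by (rule iso_of_inverses[of f p r]) (use p r t in \<open>auto simp: in_hom\<close>)
qed

lemma tri_iso_of_zero_right: assumes "tri X Y Z" "zero_obj C Z" shows "isomorphic C X Y"
  by (rule triE[OF assms(1)]) (use iso_of_zero_cone assms(2) isomorphicI in blast)

lemma tri_iso_of_zero_left: assumes "tri X Y Z" "zero_obj C X" shows "isomorphic C Y Z"
  using tri_iso_of_zero_right[OF tri_rot[OF assms(1)]] zero_obj_sh assms by blast

text \<open>
  The compositions \<open>h g\<close> and \<open>f[1] h\<close> vanish, so \<open>g = 0\<close> and \<open>f = 0\<close>; the identity of the middle vertex then
  factors through \<open>f = 0\<close>.
\<close>

lemma zero_of_iso_connecting:
  assumes T: "(f, g, h) \<in> Tri C" and i: "is_iso C h" shows "zero_obj C (Cod C f)"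
proof -
  note t = triD[OF T]
  obtain k where k: "k \<in> Arr C" "Dom C k = Cod C h" "Cod C k = Dom C h" "k \<cdot> h = Ide C (Dom C h)" "h \<cdot> k = Ide C (Cod C h)"
    using is_isoE[OF i] by metis
  have "k \<cdot> (h \<cdot> g) = Ide C (Dom C h) \<cdot> g" by (rule comp_cancel[OF k(4)]) (use k t in auto)
  then have g0: "g = Null C (Dom C g) (Cod C g)" using tri_comp_zero2[OF T] k t by simp
  have "ShA C f \<cdot> h = Null C (Dom C h) (Sh C (Cod C f))" by (rule tri_comp_zero3[OF T])
  then have "ShA C f \<cdot> (h \<cdot> k) = Null C (Dom C h) (Sh C (Cod C f)) \<cdot> k"
    by (rule comp_cancel) (use k t in auto)
  then have "ShA C f = ShA C (Null C (Dom C f) (Dom C g))" using k t by simp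
  then have f0: "f = Null C (Dom C f) (Dom C g)" using sha_inj[of f "Null C (Dom C f) (Dom C g)"] t by simp
  have "g \<cdot> Ide C (Dom C g) = Null C (Dom C g) (Cod C g)" using g0 t by simp
  then obtain r where r: "r \<in> Arr C" "Dom C r = Dom C g" "Cod C r = Dom C f" "f \<cdot> r = Ide C (Dom C g)"
    using weak_ker[OF T, of "Ide C (Dom C g)"] t by auto
  have "f \<cdot> r = Null C (Dom C g) (Dom C g)" by (subst f0) (use r t in simp)
  then show ?thesis using r t by (simp add: zero_obj_def)
qed

lemma zero_of_iso_first:
  assumes T: "(f, g, h) \<in> Tri C" and i: "is_iso C f" shows "zero_obj C (Cod C g)"
proof -
  have "is_iso C (neg (ShA C f))" by (rule is_iso_neg[OF sha_is_iso[OF i]])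
  from zero_of_iso_connecting[OF tri_rotI[OF T] this] show ?thesis .
qed

lemma retract_biproduct:
  assumes "is_biproduct C X Y B" shows "retract X B" "retract Y B"
proof -
  obtain i j p q where *: "i \<in> Arr C" "Dom C i = X" "Cod C i = B" "j \<in> Arr C" "Dom C j = Y" "Cod C j = B"
    "p \<in> Arr C" "Dom C p = B" "Cod C p = X" "q \<in> Arr C" "Dom C q = B" "Cod C q = Y"
    "p \<cdot> i = Ide C X" "q \<cdot> j = Ide C Y" using biproductE[OF assms] by metis
  show "retract X B" unfolding retract_def by (rule exI[of _ i], rule exI[of _ p]) (use * in auto)
  show "retract Y B" unfolding retract_def by (rule exI[of _ j], rule exI[of _ q]) (use * in auto)
qed

lemma cone_ex: assumes "f \<in> Arr C"
  obtains g h where "(f, g, h) \<in> Tri C" "tri (Dom C f) (Cod C f) (Cod C g)"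
  using TR1_cone[OF assms] triI by blast

lemma fibre_ex: assumes "g \<in> Arr C"
  obtains f h where "(f, g, h) \<in> Tri C" "tri (Dom C f) (Dom C g) (Cod C g)"
proof -
  obtain h k where "(g, h, k) \<in> Tri C" using TR1_cone[OF assms] by blast
  then obtain f where f: "(f, g, h) \<in> Tri C" using tri_rot_back by metis
  then show thesis using that[OF f] triI[OF f] triD[OF f] by simp
qed

end

sublocale triangulated_category \<subseteq> pretriangulated_category
  by unfold_locales (fact shift_obj shift_arr shift_hom shift_ide shift_comp shift_add shift_scale
      tri_candidate tri_iso TR1_ide TR1_cone TR2 TR3)+

context triangulated_category
begin

text \<open>
  The axiom does not state the endpoints of \<open>a\<close> and \<open>b\<close>; they follow from the triangle in which the two
  maps occur and from the commutative squares.
\<close>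

lemma TR4_arr:
  assumes fg: "f \<in> Arr C" "g \<in> Arr C" "Cod C f = Dom C g"
    and T: "(f, p1, d1) \<in> Tri C" "(g \<cdot> f, p2, d2) \<in> Tri C" "(g, p3, d3) \<in> Tri C"
  obtains a b where "a \<in> Arr C" "Dom C a = Cod C p1" "Cod C a = Cod C p2" "b \<in> Arr C" "Dom C b = Cod C p2" "Cod C b = Cod C p3"
    "(a, b, ShA C p1 \<cdot> d3) \<in> Tri C" "a \<cdot> p1 = p2 \<cdot> g" "d2 \<cdot> a = d1" "b \<cdot> p2 = p3" "d3 \<cdot> b = ShA C f \<cdot> d2"
proof -
  note t1 = triD[OF T(1)] and t2 = triD[OF T(2)] and t3 = triD[OF T(3)]
  have fg': "f \<in> hom C (Dom C f) (Dom C g)" "g \<in> hom C (Dom C g) (Cod C g)" using fg by (simp_all add: in_hom)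
  obtain a b where ab: "(a, b, ShA C p1 \<cdot> d3) \<in> Tri C" "a \<cdot> p1 = p2 \<cdot> g" "d2 \<cdot> a = d1" "b \<cdot> p2 = p3" "d3 \<cdot> b = ShA C f \<cdot> d2"
    using TR4[OF fg' T] by blast
  note t = triD[OF ab(1)]
  have "Dom C p1 = Dom C g" using t1(4) fg(3) by simp
  then have d3: "Dom C (ShA C p1 \<cdot> d3) = Cod C p3" "Cod C (ShA C p1 \<cdot> d3) = Sh C (Cod C p1)"
    using t1(2) t3(3,5,6) by simp_all
  have a: "Dom C a = Cod C p1" by (rule sh_inj) (use t(1,6) d3(2) t1(2) in auto)
  have b: "Cod C b = Cod C p3" using t(5) d3(1) by simp
  have "Cod C (a \<cdot> p1) = Cod C a" using t(1) t1(2) a by simp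
  moreover have "Dom C p2 = Cod C g" using t2(4) fg by simp
  then have "Cod C (p2 \<cdot> g) = Cod C p2" using t2(2) fg(2) by simp
  ultimately have "Cod C a = Cod C p2" using ab(2) by simp
  then show thesis using that[of a b] t a b ab by simp
qed

text \<open>
  On vertices, the octahedral axiom says that an iterated extension can be bracketed in either way. This is
  one direction and the next lemma the other one.
\<close>

lemma octahedral:
  assumes "tri A B C'" "tri B E F" obtains G where "tri A E G" "tri C' G F"
proof -
  obtain f p1 d1 where 1: "(f, p1, d1) \<in> Tri C" "Dom C f = A" "Cod C f = B" "Cod C p1 = C'" using assms(1) by (auto simp: tri_def)
  obtain g p3 d3 where 2: "(g, p3, d3) \<in> Tri C" "Dom C g = B" "Cod C g = E" "Cod C p3 = F" using assms(2) by (auto simp: tri_def)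
  have fg: "f \<in> Arr C" "g \<in> Arr C" "Cod C f = Dom C g" using triD[OF 1(1)] triD[OF 2(1)] 1 2 by auto
  obtain p2 d2 where 3: "(g \<cdot> f, p2, d2) \<in> Tri C" using TR1_cone[of "g \<cdot> f"] fg by auto
  obtain a b where ab: "Dom C a = Cod C p1" "Cod C a = Cod C p2" "Cod C b = Cod C p3" "(a, b, ShA C p1 \<cdot> d3) \<in> Tri C"
    by (rule TR4_arr[OF fg 1(1) 3 2(1)])
  show thesis using that triI[OF 3] triI[OF ab(4)] ab(1-3) fg 1 2 by simp
qed

lemma octahedral':
  assumes "tri A X Y" "tri Y1 Y X2" obtains X1 where "tri X1 X X2" "tri A X1 Y1"
proof -
  have "tri X Y (Sh C A)" "tri Y X2 (Sh C Y1)" using assms tri_rot by auto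
  then obtain G where G: "tri X X2 G" "tri (Sh C A) G (Sh C Y1)" using octahedral by metis
  obtain X1 where X1: "X1 \<in> Obj C" "G = Sh C X1" using sh_surj tri_obj(3)[OF G(1)] by metis
  have "tri X1 X X2" by (rule tri_unrot) (use G X1 in auto)
  moreover have "tri A X1 Y1" using tri_sh[of A X1 Y1] G(2) X1 tri_obj(1)[OF assms(1)] tri_obj(1)[OF assms(2)] by simp
  ultimately show thesis using that by blast
qed

end


section \<open>Bounded t-structures and their hearts\<close>

context linear_category
begin

lemma biproduct_obj: "is_biproduct C X Y B \<Longrightarrow> B \<in> Obj C"
  by (elim biproductE) (use cod_obj in blast)

lemma hom_zero_biproduct_left:
  assumes "is_biproduct C X Y B" "hom_zero C X W" "hom_zero C Y W" shows "hom_zero C B W"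
proof -
  obtain i j p q where *: "i \<in> Arr C" "Dom C i = X" "Cod C i = B" "j \<in> Arr C" "Dom C j = Y" "Cod C j = B"
    "p \<in> Arr C" "Dom C p = B" "Cod C p = X" "q \<in> Arr C" "Dom C q = B" "Cod C q = Y"
    "i \<cdot> p \<oplus> j \<cdot> q = Ide C B" using biproductE[OF assms(1)] by metis
  note o = hom_zero_obj[OF assms(2)] hom_zero_obj[OF assms(3)] biproduct_obj[OF assms(1)]
  show ?thesis
  proof (rule hom_zeroI)
    fix f assume f: "f \<in> Arr C" "Dom C f = B" "Cod C f = W"
    have 1: "f \<cdot> i = Null C X W" by (rule hom_zeroD[OF assms(2)]) (use f *(1-3) in auto)
    have 2: "f \<cdot> j = Null C Y W" by (rule hom_zeroD[OF assms(3)]) (use f *(4-6) in auto)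
    have 3: "f \<cdot> (i \<cdot> p) = Null C X W \<cdot> p" by (rule comp_cancel[OF 1]) (use f *(1-9) in auto)
    have 4: "f \<cdot> (j \<cdot> q) = Null C Y W \<cdot> q" by (rule comp_cancel[OF 2]) (use f *(1-12) in auto)
    have "f = f \<cdot> (i \<cdot> p \<oplus> j \<cdot> q)" using f *(13) by simp
    also have "\<dots> = f \<cdot> (i \<cdot> p) \<oplus> f \<cdot> (j \<cdot> q)" by (rule comp_add') (use f *(1-12) in auto)
    also have "\<dots> = Null C B W" unfolding 3 4 using *(7-12) o by simp
    finally show "f = Null C B W" .
  qed (use * o in auto)
qed

lemma hom_zero_biproduct_right:
  assumes "is_biproduct C X Y B" "hom_zero C W X" "hom_zero C W Y" shows "hom_zero C W B"
proof -
  obtain i j p q where *: "i \<in> Arr C" "Dom C i = X" "Cod C i = B" "j \<in> Arr C" "Dom C j = Y" "Cod C j = B"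
    "p \<in> Arr C" "Dom C p = B" "Cod C p = X" "q \<in> Arr C" "Dom C q = B" "Cod C q = Y"
    "i \<cdot> p \<oplus> j \<cdot> q = Ide C B" using biproductE[OF assms(1)] by metis
  note o = hom_zero_obj[OF assms(2)] hom_zero_obj[OF assms(3)] biproduct_obj[OF assms(1)]
  show ?thesis
  proof (rule hom_zeroI)
    fix f assume f: "f \<in> Arr C" "Dom C f = W" "Cod C f = B"
    have 1: "p \<cdot> f = Null C W X" by (rule hom_zeroD[OF assms(2)]) (use f *(1-9) in auto)
    have 2: "q \<cdot> f = Null C W Y" by (rule hom_zeroD[OF assms(3)]) (use f *(1-12) in auto)
    have "f = (i \<cdot> p \<oplus> j \<cdot> q) \<cdot> f" using f *(13) by simp
    also have "\<dots> = i \<cdot> (p \<cdot> f) \<oplus> j \<cdot> (q \<cdot> f)" by (subst add_comp') (use f *(1-12) in auto)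
    also have "\<dots> = Null C W B" unfolding 1 2 using *(1-6) o by simp
    finally show "f = Null C W B" .
  qed (use * o in auto)
qed

lemma mono_inI:
  assumes "arr_in C A f"
    "\<And>U g h. U \<in> A \<Longrightarrow> g \<in> hom C U (Dom C f) \<Longrightarrow> h \<in> hom C U (Dom C f) \<Longrightarrow> f \<cdot> g = f \<cdot> h \<Longrightarrow> g = h"
  shows "mono_in C A f" using assms by (simp add: mono_in_def)

lemma mono_inD:
  assumes "mono_in C A f" "g \<in> Arr C" "h \<in> Arr C" "Dom C g = Dom C h" "Cod C g = Dom C f" "Cod C h = Dom C f"
    "Dom C h \<in> A" "f \<cdot> g = f \<cdot> h"
  shows "g = h" using assms by (auto simp: mono_in_def in_hom)

lemma kernel_mono: assumes "is_kernel C A k f" shows "mono_in C A k"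
proof (rule mono_inI)
  show a: "arr_in C A k" using assms by (simp add: is_kernel_def)
  have k: "arr_in C A f" "Cod C k = Dom C f" "f \<cdot> k = Null C (Dom C k) (Cod C f)" using assms by (auto simp: is_kernel_def)
  fix U g h assume U: "U \<in> A" and g: "g \<in> hom C U (Dom C k)" and h: "h \<in> hom C U (Dom C k)" and e: "k \<cdot> g = k \<cdot> h"
  have "k \<cdot> g \<in> hom C U (Dom C f)" using a g k by (auto simp: in_hom arr_in_def)
  moreover have "f \<cdot> (k \<cdot> g) = Null C (Dom C k) (Cod C f) \<cdot> g" by (rule comp_cancel[OF k(3)]) (use a g k in \<open>auto simp: in_hom arr_in_def\<close>)
  then have "f \<cdot> (k \<cdot> g) = Null C U (Cod C f)" using g k by (auto simp: in_hom arr_in_def)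
  ultimately have "\<exists>!v. v \<in> hom C U (Dom C k) \<and> k \<cdot> v = k \<cdot> g" using assms U unfolding is_kernel_def by blast
  then show "g = h" using g h e by metis
qed

lemma Sim_mono:
  assumes "T \<in> Sim C A" "mono_in C A f" "Cod C f = T" shows "zero_obj C (Dom C f) \<or> is_iso C f"
  using assms by (simp add: Sim_def)

lemma kernel_zero:
  assumes "is_kernel C A k f" "k = Null C (Dom C k) (Cod C k)" shows "zero_obj C (Dom C k)"
proof -
  have k: "k \<in> Arr C" "Dom C k \<in> A" using assms by (auto simp: is_kernel_def arr_in_def)
  have "Ide C (Dom C k) = Null C (Dom C k) (Dom C k)"
    by (rule mono_inD[OF kernel_mono[OF assms(1)]]) (use k assms(2) in auto)
  then show ?thesis using k by (simp add: zero_obj_def)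
qed

lemma cokernel_zero:
  assumes "is_cokernel C A p f" "p = Null C (Dom C p) (Cod C p)" shows "zero_obj C (Cod C p)"
proof -
  have k: "p \<in> Arr C" "Cod C p \<in> A" "Dom C p = Cod C f" "p \<cdot> f = Null C (Dom C f) (Cod C p)"
    using assms by (auto simp: is_cokernel_def arr_in_def)
  have "p \<in> hom C (Cod C f) (Cod C p)" using k by (simp add: in_hom)
  then have "\<exists>!h. h \<in> hom C (Cod C p) (Cod C p) \<and> h \<cdot> p = p"
    using assms(1) k unfolding is_cokernel_def by blast
  moreover have "Ide C (Cod C p) \<in> hom C (Cod C p) (Cod C p) \<and> Ide C (Cod C p) \<cdot> p = p" using k by (simp add: in_hom)
  moreover have "Null C (Cod C p) (Cod C p) \<in> hom C (Cod C p) (Cod C p) \<and> Null C (Cod C p) (Cod C p) \<cdot> p = p"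
    using k(1) assms(2) by (simp add: in_hom)
  ultimately have "Ide C (Cod C p) = Null C (Cod C p) (Cod C p)" by blast
  then show ?thesis using k by (simp add: zero_obj_def)
qed

text \<open>A monomorphism into \<open>T'\<close> becomes one into \<open>T\<close> after composition with the isomorphism.\<close>

lemma Sim_iso:
  assumes T: "T \<in> Sim C A" and T': "T' \<in> A" and i: "isomorphic C T T'" shows "T' \<in> Sim C A"
  unfolding Sim_def mem_Collect_eq
proof (intro conjI allI impI T')
  obtain a b where ab: "b \<in> Arr C" "Dom C b = T'" "Cod C b = T" "is_iso C b" "a \<in> Arr C" "Dom C a = T" "Cod C a = T'" "a \<cdot> b = Ide C T'"
    using isomorphicE[OF i] by metis
  show "\<not> zero_obj C T'" using T zero_obj_iso isomorphic_sym[OF i] by (auto simp: Sim_def)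
  fix f assume "mono_in C A f \<and> Cod C f = T'"
  then have m: "mono_in C A f" and f: "f \<in> Arr C" "Dom C f \<in> A" "Cod C f = T'" by (auto simp: mono_in_def arr_in_def)
  have bf: "b \<cdot> f \<in> Arr C" "Dom C (b \<cdot> f) = Dom C f" "Cod C (b \<cdot> f) = T" using ab f by auto
  have "mono_in C A (b \<cdot> f)"
  proof (rule mono_inI)
    show "arr_in C A (b \<cdot> f)" using bf f T by (simp add: arr_in_def Sim_def)
    fix U g h assume U: "U \<in> A" and g: "g \<in> hom C U (Dom C (b \<cdot> f))" and h: "h \<in> hom C U (Dom C (b \<cdot> f))"
      and e: "(b \<cdot> f) \<cdot> g = (b \<cdot> f) \<cdot> h"
    have gh: "g \<in> Arr C" "h \<in> Arr C" "Dom C g = U" "Dom C h = U" "Cod C g = Dom C f" "Cod C h = Dom C f" using g h bf by (auto simp: in_hom)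
    have "a \<cdot> (b \<cdot> (f \<cdot> g)) = Ide C T' \<cdot> (f \<cdot> g)" by (rule comp_cancel[OF ab(8)]) (use ab f gh in auto)
    then have 1: "a \<cdot> (b \<cdot> (f \<cdot> g)) = f \<cdot> g" using f gh by simp
    have "a \<cdot> (b \<cdot> (f \<cdot> h)) = Ide C T' \<cdot> (f \<cdot> h)" by (rule comp_cancel[OF ab(8)]) (use ab f gh in auto)
    then have 2: "a \<cdot> (b \<cdot> (f \<cdot> h)) = f \<cdot> h" using f gh by simp
    have "b \<cdot> (f \<cdot> g) = b \<cdot> (f \<cdot> h)" using e ab(1-3) f gh by simp
    then have "f \<cdot> g = f \<cdot> h" using 1 2 by metis
    then show "g = h" by (rule mono_inD[OF m gh(1,2), rotated -1]) (use gh U in auto)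
  qed
  from Sim_mono[OF T this bf(3)] have "zero_obj C (Dom C f) \<or> is_iso C (b \<cdot> f)" unfolding bf(2) .
  then show "zero_obj C (Dom C f) \<or> is_iso C f" using is_iso_left_cancel[of b f] ab f by blast
qed

end

context pretriangulated_category
begin

text \<open>
  The obstruction to cancelling \<open>f\<close> is a map \<open>U[1] \<rightarrow> Z\<close> into the third vertex; inside a heart there is none.
\<close>

lemma tri_cancel_left:
  assumes T: "(f, g, h) \<in> Tri C" and z: "hom_zero C (Sh C U) (Cod C g)"
    and x: "x \<in> Arr C" "Dom C x = U" "Cod C x = Dom C f" and y: "y \<in> Arr C" "Dom C y = U" "Cod C y = Dom C f"
    and e: "f \<cdot> x = f \<cdot> y"
  shows "x = y"
proof -
  note t = triD[OF T]
  have U: "U \<in> Obj C" using x by auto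
  define d where "d = x \<oplus> neg y"
  have d: "d \<in> Arr C" "Dom C d = U" "Cod C d = Dom C f" using x y by (auto simp: d_def)
  have "f \<cdot> d = f \<cdot> x \<oplus> neg (f \<cdot> y)" unfolding d_def by (subst comp_add') (use x y t in auto)
  then have fd: "f \<cdot> d = Null C U (Cod C f)" using y t U e by simp
  have "ShA C f \<cdot> ShA C d = Null C (Dom C (ShA C d)) (Sh C (Cod C f))"
    using fd d t U by (simp flip: sha_comp)
  then obtain v where v: "v \<in> Arr C" "Dom C v = Dom C (ShA C d)" "Cod C v = Dom C h" "h \<cdot> v = ShA C d"
    by (rule weak_ker_shift[OF T, of "ShA C d", rotated 2]) (use d t in auto)
  have "v = Null C (Sh C U) (Cod C g)" by (rule hom_zeroD[OF z]) (use v d t in auto)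
  then have "ShA C d = ShA C (Null C U (Dom C f))" using v(4) t U by simp
  then have "d = Null C U (Dom C f)" by (rule sha_inj) (use d t U in auto)
  then show ?thesis using diff_null_iff[of x y] x y by (simp add: d_def)
qed

lemma tri_cancel_right:
  assumes T: "(f, g, h) \<in> Tri C" and z: "hom_zero C (Sh C (Dom C f)) W"
    and x: "x \<in> Arr C" "Dom C x = Cod C g" "Cod C x = W" and y: "y \<in> Arr C" "Dom C y = Cod C g" "Cod C y = W"
    and e: "x \<cdot> g = y \<cdot> g"
  shows "x = y"
proof -
  note t = triD[OF T]
  have U: "W \<in> Obj C" using x by auto
  define d where "d = x \<oplus> neg y"
  have d: "d \<in> Arr C" "Dom C d = Dom C h" "Cod C d = W" using x y t by (auto simp: d_def)
  have "d \<cdot> g = x \<cdot> g \<oplus> neg (y \<cdot> g)" unfolding d_def by (subst add_comp') (use x y t in auto)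
  then have "d \<cdot> g = Null C (Dom C g) (Cod C d)" using y t U e d by simp
  then obtain v where v: "v \<in> Arr C" "Dom C v = Dom C (neg (ShA C f))" "Cod C v = Cod C d" "v \<cdot> h = d"
    by (rule weak_coker[OF tri_rotI[OF T], of d, rotated 2]) (use d t in auto)
  have "v = Null C (Sh C (Dom C f)) W" by (rule hom_zeroD[OF z]) (use v d t in auto)
  then have "d = Null C (Dom C h) W" using v(4) t U by simp
  then show ?thesis using diff_null_iff[of x y] x y t by (simp add: d_def)
qed

text \<open>
  Rotating puts the zero map into the place of the connecting map, and the triangle splits.
\<close>

lemma retract_of_zero_second:
  assumes "tri A X B" "hom_zero C X B" shows "retract B (Sh C A)"
proof -
  obtain f g h where t: "(f, g, h) \<in> Tri C" "f \<in> Arr C" "g \<in> Arr C" "h \<in> Arr C"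
    "Dom C f = A" "Cod C f = X" "Dom C g = X" "Cod C g = B" "Dom C h = B" "Cod C h = Sh C A" using triE[OF assms(1)] by metis
  have "g = Null C X B" by (rule hom_zeroD[OF assms(2)]) (use t in auto)
  then have "neg (ShA C g) = Null C (Sh C X) (Sh C B)" using tri_obj[OF assms(1)] by simp
  then have "neg (ShA C g) = Null C (Dom C (neg (ShA C g))) (Cod C (neg (ShA C g)))" using tri_obj[OF assms(1)] t by simp
  from tri_split_retract(1)[OF tri_rotI[OF tri_rotI[OF t(1)]] this] show ?thesis using t by simp
qed

lemma retract_of_zero_first:
  assumes "tri A X B" "hom_zero C A X" shows "retract X B" "retract (Sh C A) B"
proof -
  obtain f g h where t: "(f, g, h) \<in> Tri C" "f \<in> Arr C" "g \<in> Arr C" "h \<in> Arr C"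
    "Dom C f = A" "Cod C f = X" "Dom C g = X" "Cod C g = B" "Dom C h = B" "Cod C h = Sh C A" using triE[OF assms(1)] by metis
  have "f = Null C A X" by (rule hom_zeroD[OF assms(2)]) (use t in auto)
  then have "neg (ShA C f) = Null C (Dom C (neg (ShA C f))) (Cod C (neg (ShA C f)))" using tri_obj[OF assms(1)] t by simp
  from tri_split_retract[OF tri_rotI[OF t(1)] this] show "retract X B" "retract (Sh C A) B" using t by simp_all
qed

end

locale bounded_t = triangulated_category C for C :: "('o, 'm, 'k::field, 'z) tri_cat_scheme" (structure) +
  fixes P :: "'o set"
  assumes bts: "bounded_t_structure C P"
begin

text \<open>
  With cohomological grading, the aisle \<open>P\<close> consists of the objects in degrees \<open>\<le> 0\<close>, \<open>R\<close> of those in degrees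
  \<open>\<ge> 1\<close>, and \<open>N\<close> of those in degrees \<open>\<ge> 0\<close>.
\<close>

definition R :: "'o set" where "R = right_perp C P"
definition N :: "'o set" where "N = Sh C ` R"
definition H :: "'o set" where "H = P \<inter> N"

lemma P_obj: "X \<in> P \<Longrightarrow> X \<in> Obj C" using bts by (auto simp: bounded_t_structure_def t_structure_def)
lemma P_iso: "X \<in> P \<Longrightarrow> isomorphic C X Y \<Longrightarrow> Y \<in> P" using bts by (auto simp: bounded_t_structure_def t_structure_def)
lemma P_sh: "X \<in> P \<Longrightarrow> Sh C X \<in> P" using bts by (auto simp: bounded_t_structure_def t_structure_def)

lemma trunc: assumes "X \<in> Obj C" obtains A B where "tri A X B" "A \<in> P" "B \<in> R"
  using bts assms unfolding bounded_t_structure_def t_structure_def R_def tri_def by blast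

lemma R_iff: "Y \<in> R \<longleftrightarrow> Y \<in> Obj C \<and> (\<forall>X\<in>P. hom_zero C X Y)" by (simp add: R_def right_perp_def)
lemma R_obj: "Y \<in> R \<Longrightarrow> Y \<in> Obj C" by (simp add: R_iff)
lemma PR: "X \<in> P \<Longrightarrow> Y \<in> R \<Longrightarrow> hom_zero C X Y" by (simp add: R_iff)

text \<open>
  In the truncation triangle \<open>A \<rightarrow> X \<rightarrow> B\<close> the second map is zero, so \<open>B\<close> is a retract of \<open>A[1]\<close>. But there are no
  maps from the aisle to \<open>B\<close>, hence \<open>B = 0\<close>.
\<close>

lemma P_left_perp: assumes X: "X \<in> Obj C" and "\<And>Y. Y \<in> R \<Longrightarrow> hom_zero C X Y" shows "X \<in> P"
proof -
  obtain A B where AB: "tri A X B" "A \<in> P" "B \<in> R" using trunc[OF X] .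
  have "retract B (Sh C A)" by (rule retract_of_zero_second[OF AB(1) assms(2)[OF AB(3)]])
  then have "hom_zero C B B" using hom_zero_retract_left PR P_sh AB by blast
  then have "isomorphic C A X" using tri_iso_of_zero_right[OF AB(1)] hom_zero_self by blast
  then show ?thesis using P_iso AB by blast
qed

lemma P_retract: "retract X B \<Longrightarrow> B \<in> P \<Longrightarrow> X \<in> P"
  by (rule P_left_perp) (auto elim: retractE intro: hom_zero_retract_left PR)

lemma R_retract: "retract X B \<Longrightarrow> B \<in> R \<Longrightarrow> X \<in> R"
  by (auto simp: R_iff elim: retractE intro: hom_zero_retract_right)

lemma P_ext: "tri X Y Z \<Longrightarrow> X \<in> P \<Longrightarrow> Z \<in> P \<Longrightarrow> Y \<in> P"
  by (rule P_left_perp) (auto dest: tri_obj intro: hom_zero_mid' PR)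

lemma R_ext: "tri X Y Z \<Longrightarrow> X \<in> R \<Longrightarrow> Z \<in> R \<Longrightarrow> Y \<in> R"
  by (auto simp: R_iff dest: tri_obj intro: hom_zero_mid)

lemma R_unsh: assumes "Sh C Y \<in> R" "Y \<in> Obj C" shows "Y \<in> R"
  using assms P_sh P_obj hom_zero_sh unfolding R_iff by blast

lemma Sh_N_iff: "Y \<in> Obj C \<Longrightarrow> Sh C Y \<in> N \<longleftrightarrow> Y \<in> R"
  using sh_inj R_obj by (auto simp: N_def)

lemma N_iff: "Y \<in> N \<longleftrightarrow> Y \<in> Obj C \<and> (\<forall>X\<in>P. hom_zero C (Sh C X) Y)"
proof
  assume "Y \<in> N"
  then obtain Z where Z: "Z \<in> R" "Y = Sh C Z" by (auto simp: N_def)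
  then show "Y \<in> Obj C \<and> (\<forall>X\<in>P. hom_zero C (Sh C X) Y)" using PR R_obj P_obj hom_zero_sh by auto
next
  assume Y: "Y \<in> Obj C \<and> (\<forall>X\<in>P. hom_zero C (Sh C X) Y)"
  obtain Z where Z: "Z \<in> Obj C" "Y = Sh C Z" using Y sh_surj by blast
  then have "Z \<in> R" using Y P_obj hom_zero_sh by (auto simp: R_iff)
  then show "Y \<in> N" using Z by (auto simp: N_def)
qed

lemma N_obj: "Y \<in> N \<Longrightarrow> Y \<in> Obj C" by (simp add: N_iff)
lemma PN: "X \<in> P \<Longrightarrow> Y \<in> N \<Longrightarrow> hom_zero C (Sh C X) Y" by (simp add: N_iff)
lemma R_N: "X \<in> R \<Longrightarrow> X \<in> N" using R_obj PR P_sh by (auto simp: N_iff)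
lemma N_retract: "retract X B \<Longrightarrow> B \<in> N \<Longrightarrow> X \<in> N"
  by (auto simp: N_iff elim: retractE intro: hom_zero_retract_right)
lemma N_ext: "tri X Y Z \<Longrightarrow> X \<in> N \<Longrightarrow> Z \<in> N \<Longrightarrow> Y \<in> N"
  by (auto simp: N_iff dest: tri_obj intro: hom_zero_mid)
lemma N_iso: "X \<in> N \<Longrightarrow> isomorphic C X Y \<Longrightarrow> Y \<in> N"
  using N_retract isomorphic_sym retract_of_iso by blast

lemma P_zero: "zero_obj C Z \<Longrightarrow> Z \<in> P"
  by (rule P_left_perp) (auto simp: zero_obj_Obj R_obj intro: hom_zero_from_zero)
lemma R_zero: "zero_obj C Z \<Longrightarrow> Z \<in> R"
  by (auto simp: R_iff zero_obj_Obj P_obj intro: hom_zero_to_zero)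

lemma P_cone: "tri X Y Z \<Longrightarrow> X \<in> P \<Longrightarrow> Y \<in> P \<Longrightarrow> Z \<in> P"
  using P_ext[OF tri_rot] P_sh by blast

lemma R_fibre: assumes "tri X Y Z" "Y \<in> R" "Z \<in> N" shows "X \<in> R"
proof -
  obtain Z' where Z: "Z' \<in> Obj C" "Z = Sh C Z'" "tri Z' X Y" using tri_unrot_ex[OF assms(1)] .
  then show ?thesis using R_ext assms Sh_N_iff by blast
qed

lemma N_fibre: assumes "tri X Y Z" "Y \<in> N" "Z \<in> N" shows "X \<in> N"
proof -
  obtain Z' where Z: "Z' \<in> Obj C" "Z = Sh C Z'" "tri Z' X Y" using tri_unrot_ex[OF assms(1)] .
  then show ?thesis using N_ext assms Sh_N_iff R_N by blast
qed

lemma H_P: "X \<in> H \<Longrightarrow> X \<in> P" and H_N: "X \<in> H \<Longrightarrow> X \<in> N" and H_obj: "X \<in> H \<Longrightarrow> X \<in> Obj C"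
  by (auto simp: H_def N_obj)
lemma H_I: "X \<in> P \<Longrightarrow> X \<in> N \<Longrightarrow> X \<in> H" by (simp add: H_def)
lemma H_iso: "X \<in> H \<Longrightarrow> isomorphic C X Y \<Longrightarrow> Y \<in> H" using P_iso N_iso by (auto simp: H_def)
lemma H_zero: "zero_obj C Z \<Longrightarrow> Z \<in> H" using P_zero R_zero R_N by (auto simp: H_def)
lemma H_ext: "tri X Y Z \<Longrightarrow> X \<in> H \<Longrightarrow> Z \<in> H \<Longrightarrow> Y \<in> H" using P_ext N_ext by (auto simp: H_def)
lemma H_retract: "retract X B \<Longrightarrow> B \<in> H \<Longrightarrow> X \<in> H" using P_retract N_retract by (auto simp: H_def)
lemma HH: "X \<in> H \<Longrightarrow> Y \<in> H \<Longrightarrow> hom_zero C (Sh C X) Y" using PN H_P H_N by blast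

text \<open>The truncation that splits off the cohomology in degree zero of an object of the aisle.\<close>

lemma trunc_P: assumes "X \<in> P" obtains A B where "tri (Sh C A) X B" "A \<in> P" "B \<in> H"
proof -
  obtain X' where X': "X' \<in> Obj C" "X = Sh C X'" using sh_surj P_obj assms by metis
  obtain A B where AB: "tri A X' B" "A \<in> P" "B \<in> R" using trunc[OF X'(1)] .
  have T: "tri (Sh C A) X (Sh C B)" using AB X' tri_sh tri_obj[OF AB(1)] by simp
  have "Sh C B \<in> N" using AB by (simp add: N_def)
  moreover have "Sh C B \<in> P" using P_cone[OF T] AB P_sh assms by blast
  ultimately show thesis using that T AB H_I by blast
qed

subsection \<open>The heart is abelian\<close>

text \<open>
  Exactness of the triangle gives the factorisations. They are unique because there are no maps \<open>U[1] \<rightarrow> V\<close>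
  between objects of the heart.
\<close>

lemma heart_short_exact:
  assumes T: "(f, g, h) \<in> Tri C" and H: "Dom C f \<in> H" "Cod C f \<in> H" "Cod C g \<in> H"
  shows "short_exact C H f g"
proof -
  note t = triD[OF T]
  have k: "is_kernel C H f g"
    unfolding is_kernel_def
  proof (intro conjI ballI impI)
    show "arr_in C H f" "arr_in C H g" using t H by (auto simp: arr_in_def)
    show "Cod C f = Dom C g" "g \<cdot> f = Null C (Dom C f) (Cod C g)" using t tri_comp_zero[OF T] by auto
    fix U u assume U: "U \<in> H" and u: "u \<in> hom C U (Dom C g)" and z: "g \<cdot> u = Null C U (Cod C g)"
    have u': "u \<in> Arr C" "Dom C u = U" "Cod C u = Dom C g" using u by (auto simp: in_hom)
    obtain v where v: "v \<in> Arr C" "Dom C v = Dom C u" "Cod C v = Dom C f" "f \<cdot> v = u"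
      by (rule weak_ker[OF T, of u]) (use u' z in auto)
    show "\<exists>!h. h \<in> hom C U (Dom C f) \<and> f \<cdot> h = u"
    proof (rule ex1I[of _ v])
      show "v \<in> hom C U (Dom C f) \<and> f \<cdot> v = u" using v u' by (simp add: in_hom)
      fix w assume w: "w \<in> hom C U (Dom C f) \<and> f \<cdot> w = u"
      show "w = v" by (rule tri_cancel_left[OF T, of U]) (use w v u' HH[OF U H(3)] in \<open>auto simp: in_hom\<close>)
    qed
  qed
  have c: "is_cokernel C H g f"
    unfolding is_cokernel_def
  proof (intro conjI ballI impI)
    show "arr_in C H f" "arr_in C H g" using t H by (auto simp: arr_in_def)
    show "Dom C g = Cod C f" "g \<cdot> f = Null C (Dom C f) (Cod C g)" using t tri_comp_zero[OF T] by auto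
    fix U u assume U: "U \<in> H" and u: "u \<in> hom C (Cod C f) U" and z: "u \<cdot> f = Null C (Dom C f) U"
    have u': "u \<in> Arr C" "Dom C u = Dom C g" "Cod C u = U" using u t by (auto simp: in_hom)
    obtain v where v: "v \<in> Arr C" "Dom C v = Dom C h" "Cod C v = Cod C u" "v \<cdot> g = u"
      by (rule weak_coker[OF T, of u]) (use u' z in auto)
    show "\<exists>!h. h \<in> hom C (Cod C g) U \<and> h \<cdot> g = u"
    proof (rule ex1I[of _ v])
      show "v \<in> hom C (Cod C g) U \<and> v \<cdot> g = u" using v u' t by (simp add: in_hom)
      fix w assume w: "w \<in> hom C (Cod C g) U \<and> w \<cdot> g = u"
      show "w = v" by (rule tri_cancel_right[OF T, of U]) (use w v u' t HH[OF H(1) U] in \<open>auto simp: in_hom\<close>)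
    qed
  qed
  show ?thesis using k c by (simp add: short_exact_def)
qed

text \<open>
  The cone of a map in the heart has cohomology in two degrees only: its truncations are the shifted
  kernel and the cokernel.
\<close>

lemma heart_cone:
  assumes T: "(f, c, d) \<in> Tri C" and fH: "arr_in C H f"
  obtains A B k p where "tri (Sh C A) (Cod C c) B" "is_kernel C H k f" "Dom C k = A" "is_cokernel C H p f" "Cod C p = B"
proof -
  note t = triD[OF T]
  have XY: "Dom C f \<in> H" "Cod C f \<in> H" using fH by (auto simp: arr_in_def)
  have T': "tri (Dom C f) (Cod C f) (Cod C c)" using triI[OF T] .
  obtain A B where AB: "tri (Sh C A) (Cod C c) B" "A \<in> P" "B \<in> H"
    using trunc_P[OF P_cone[OF T']] XY H_P by metis
  have AO: "A \<in> Obj C" using AB P_obj by auto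
  obtain i q r where iq: "(i, q, r) \<in> Tri C" "i \<in> Arr C" "q \<in> Arr C" "r \<in> Arr C" "Dom C i = Sh C A" "Cod C i = Cod C c"
    "Dom C q = Cod C c" "Cod C q = B" "Dom C r = B" using triE[OF AB(1)] by metis
  \<comment> \<open>As an object between \<open>B[-1]\<close> and the cone, \<open>A[1]\<close> receives no maps from degrees \<open>\<le> -2\<close>.\<close>
  have AN: "A \<in> N" unfolding N_iff
  proof (intro conjI ballI)
    fix W assume W: "W \<in> P"
    obtain B0 where B0: "B0 \<in> Obj C" "B = Sh C B0" "tri B0 (Sh C A) (Cod C c)" using tri_unrot_ex[OF AB(1)] .
    have "B0 \<in> R" using AB H_N Sh_N_iff B0 by blast
    then have 1: "hom_zero C (Sh C (Sh C W)) B0" using PR P_sh W by blast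
    have "hom_zero C (Sh C (Sh C W)) (Sh C (Dom C f))"
      using hom_zero_sh PN[OF W] XY H_N H_obj P_obj[OF W] by simp
    then have "hom_zero C (Sh C (Sh C W)) (Cod C c)"
      using hom_zero_mid[OF tri_rot[OF T']] PN[OF P_sh[OF W]] XY H_N by blast
    then have "hom_zero C (Sh C (Sh C W)) (Sh C A)" using hom_zero_mid[OF B0(3) 1] by blast
    then show "hom_zero C (Sh C W) A" using hom_zero_sh AO P_obj[OF W] by simp
  qed (rule AO)
  have AH: "A \<in> H" using AN AB H_I by blast
  obtain k where k: "k \<in> Arr C" "Dom C k = A" "Cod C k = Dom C f" "d \<cdot> i = ShA C k"
    by (rule sha_surj[of "d \<cdot> i" A "Dom C f"]) (use iq t AO in auto)
  have dT: "(d, neg (ShA C f), neg (ShA C c)) \<in> Tri C" using tri_rotI[OF tri_rotI[OF T]] .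
  have cd0: "d \<cdot> c = Null C (Dom C c) (Cod C d)" using tri_comp_zero2[OF T] .
  have ker: "is_kernel C H k f"
    unfolding is_kernel_def
  proof (intro conjI ballI impI)
    show "arr_in C H k" "arr_in C H f" using k AH fH by (auto simp: arr_in_def)
    show "Cod C k = Dom C f" by fact
    have "ShA C f \<cdot> (d \<cdot> i) = Null C (Dom C d) (Sh C (Cod C f)) \<cdot> i"
      by (rule comp_cancel[OF tri_comp_zero3[OF T]]) (use iq t in auto)
    then have "ShA C (f \<cdot> k) = ShA C (Null C A (Cod C f))" using k t iq AO by simp
    then show "f \<cdot> k = Null C (Dom C k) (Cod C f)" using sha_inj[of "f \<cdot> k" "Null C A (Cod C f)"] k t AO by simp
    fix U u assume U: "U \<in> H" and u: "u \<in> hom C U (Dom C f)" and z: "f \<cdot> u = Null C U (Cod C f)"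
    have u': "u \<in> Arr C" "Dom C u = U" "Cod C u = Dom C f" using u by (auto simp: in_hom)
    have UO: "U \<in> Obj C" using U H_obj by auto
    have fu: "ShA C f \<cdot> ShA C u = Null C (Dom C (ShA C u)) (Sh C (Cod C f))"
      using z u' t UO by (simp flip: sha_comp)
    obtain v where v: "v \<in> Arr C" "Dom C v = Dom C (ShA C u)" "Cod C v = Dom C d" "d \<cdot> v = ShA C u"
      by (rule weak_ker_shift[OF T, of "ShA C u"]) (use fu u' t in auto)
    have "q \<cdot> v = Null C (Sh C U) B" by (rule hom_zeroD[OF HH[OF U AB(3)]]) (use iq v u' t in auto)
    then obtain w where w: "w \<in> Arr C" "Dom C w = Dom C v" "Cod C w = Dom C i" "i \<cdot> w = v"
      using weak_ker[OF iq(1), of v] iq v u' t by auto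
    obtain w0 where w0: "w0 \<in> Arr C" "Dom C w0 = U" "Cod C w0 = A" "w = ShA C w0"
      by (rule sha_surj[of w U A]) (use w v u' iq AO UO in auto)
    have "d \<cdot> (i \<cdot> w) = ShA C k \<cdot> w" by (rule comp_cancel[OF k(4)]) (use w iq t in auto)
    then have "ShA C (k \<cdot> w0) = ShA C u" using w(4) v(4) k(1-3) w0 by simp
    then have ku: "k \<cdot> w0 = u" using sha_inj[of "k \<cdot> w0" u] k w0 u' by simp
    show "\<exists>!h. h \<in> hom C U (Dom C k) \<and> k \<cdot> h = u"
    proof (rule ex1I[of _ w0])
      show "w0 \<in> hom C U (Dom C k) \<and> k \<cdot> w0 = u" using w0 k ku by (simp add: in_hom)
      fix x assume x: "x \<in> hom C U (Dom C k) \<and> k \<cdot> x = u"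
      have x': "x \<in> Arr C" "Dom C x = U" "Cod C x = A" using x k by (auto simp: in_hom)
      have "d \<cdot> (i \<cdot> ShA C x) = ShA C k \<cdot> ShA C x" by (rule comp_cancel[OF k(4)]) (use x' iq t in auto)
      moreover have "d \<cdot> (i \<cdot> ShA C w0) = ShA C k \<cdot> ShA C w0" by (rule comp_cancel[OF k(4)]) (use w0 iq t in auto)
      moreover have "ShA C k \<cdot> ShA C x = ShA C k \<cdot> ShA C w0" using x ku k(1-3) w0 x' by (simp flip: sha_comp)
      ultimately have e: "d \<cdot> (i \<cdot> ShA C x) = d \<cdot> (i \<cdot> ShA C w0)" by simp
      have z1: "hom_zero C (Sh C (Sh C U)) (Sh C (Cod C f))"
        using HH[OF U XY(2)] hom_zero_sh[of "Sh C U" "Cod C f"] UO t by simp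
      have e2: "i \<cdot> ShA C x = i \<cdot> ShA C w0"
        by (rule tri_cancel_left[OF dT, of "Sh C U"]) (use z1 e x' w0 iq t in auto)
      have z2: "hom_zero C (Sh C (Sh C U)) B" using PN P_sh H_P U AB(3) H_N by blast
      have "ShA C x = ShA C w0"
        by (rule tri_cancel_left[OF iq(1), of "Sh C U"]) (use z2 e2 x' w0 iq t in auto)
      then show "x = w0" using sha_inj x' w0 by blast
    qed
  qed
  have coker: "is_cokernel C H (q \<cdot> c) f"
    unfolding is_cokernel_def
  proof (intro conjI ballI impI)
    have qc: "q \<cdot> c \<in> Arr C" "Dom C (q \<cdot> c) = Cod C f" "Cod C (q \<cdot> c) = B" using iq t by auto
    show "arr_in C H f" "arr_in C H (q \<cdot> c)" using qc AB fH by (auto simp: arr_in_def)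
    show "Dom C (q \<cdot> c) = Cod C f" by fact
    show "(q \<cdot> c) \<cdot> f = Null C (Dom C f) (Cod C (q \<cdot> c))" using tri_comp_zero[OF T] iq t by simp
    fix U u assume U: "U \<in> H" and u: "u \<in> hom C (Cod C f) U" and z: "u \<cdot> f = Null C (Dom C f) U"
    have u': "u \<in> Arr C" "Dom C u = Dom C c" "Cod C u = U" using u t by (auto simp: in_hom)
    have UO: "U \<in> Obj C" using U H_obj by auto
    obtain v where v: "v \<in> Arr C" "Dom C v = Dom C d" "Cod C v = Cod C u" "v \<cdot> c = u"
      by (rule weak_coker[OF T, of u]) (use u' z in auto)
    have "v \<cdot> i = Null C (Sh C A) U" by (rule hom_zeroD[OF PN[OF AB(2) H_N[OF U]]]) (use iq v u' t in auto)
    then obtain w where w: "w \<in> Arr C" "Dom C w = Dom C r" "Cod C w = Cod C v" "w \<cdot> q = v"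
      using weak_coker[OF iq(1), of v] iq v u' t by auto
    have wq: "w \<cdot> (q \<cdot> c) = u" using comp_cancel[OF w(4), of c] w iq t v by simp
    show "\<exists>!h. h \<in> hom C (Cod C (q \<cdot> c)) U \<and> h \<cdot> (q \<cdot> c) = u"
    proof (rule ex1I[of _ w])
      show "w \<in> hom C (Cod C (q \<cdot> c)) U \<and> w \<cdot> (q \<cdot> c) = u" using w iq wq v u' qc by (simp add: in_hom)
      fix x assume x: "x \<in> hom C (Cod C (q \<cdot> c)) U \<and> x \<cdot> (q \<cdot> c) = u"
      have x': "x \<in> Arr C" "Dom C x = B" "Cod C x = U" using x qc by (auto simp: in_hom)
      have e: "(x \<cdot> q) \<cdot> c = (w \<cdot> q) \<cdot> c" using x wq x' w(1-3) iq t by simp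
      have "x \<cdot> q = w \<cdot> q"
        by (rule tri_cancel_right[OF T HH[OF XY(1) U]]) (use e x' w(1-3) v u' iq t in auto)
      then show "x = w"
        by - (rule tri_cancel_right[OF iq(1), of U], use x' w(1-3) v(1-3) u' iq t PN[OF P_sh[OF AB(2)] H_N[OF U]] in auto)
    qed
  qed
  have "Cod C (q \<cdot> c) = B" using iq t by simp
  then show thesis using that[OF AB(1) ker k(2) coker] by simp
qed

text \<open>
  The kernel of a monomorphism vanishes, which leaves only the cokernel in the cone.
\<close>

lemma heart_mono_cone:
  assumes "mono_in C H f" "(f, c, d) \<in> Tri C" shows "Cod C c \<in> H"
proof -
  have f: "arr_in C H f" using assms by (simp add: mono_in_def)
  obtain A B k p where AB: "tri (Sh C A) (Cod C c) B" "is_kernel C H k f" "Dom C k = A" "is_cokernel C H p f" "Cod C p = B"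
    by (rule heart_cone[OF assms(2) f])
  have k: "k \<in> Arr C" "A \<in> H" "f \<cdot> k = Null C A (Cod C f)" "Cod C k = Dom C f" "f \<in> Arr C"
    using AB(2,3) f by (auto simp: is_kernel_def arr_in_def)
  have "k = Null C A (Dom C f)" by (rule mono_inD[OF assms(1)]) (use k AB(3) H_obj in auto)
  then have "zero_obj C A" using kernel_zero[OF AB(2)] AB(3) k by simp
  then have "isomorphic C (Cod C c) B" using tri_iso_of_zero_left[OF AB(1)] zero_obj_sh by blast
  moreover have "B \<in> H" using AB(4,5) by (auto simp: is_cokernel_def arr_in_def)
  ultimately show ?thesis using H_iso isomorphic_sym by blast
qed

text \<open>
  Dually, a vanishing cokernel leaves only the shifted kernel in the cone, so the fibre lies in the heart.
\<close>

lemma heart_coker_zero_fibre: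
  assumes T: "(k', f, c) \<in> Tri C" and f: "arr_in C H f" and z: "\<And>p. is_cokernel C H p f \<Longrightarrow> zero_obj C (Cod C p)"
  shows "Dom C k' \<in> H"
proof -
  obtain A B k p where AB: "tri (Sh C A) (Cod C c) B" "is_kernel C H k f" "Dom C k = A" "is_cokernel C H p f" "Cod C p = B"
    by (rule heart_cone[OF tri_rotI[OF T] f])
  have "isomorphic C (Sh C A) (Cod C c)" using tri_iso_of_zero_right[OF AB(1)] z AB by blast
  moreover have A: "A \<in> H" using AB(2,3) by (auto simp: is_kernel_def arr_in_def)
  moreover have "Cod C c = Sh C (Dom C k')" "Dom C k' \<in> Obj C" using triD[OF T] by auto
  ultimately have "isomorphic C A (Dom C k')" using isomorphic_sh_iff H_obj by simp
  then show ?thesis using H_iso A by blast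
qed

lemma heart_epi_fibre:
  assumes f: "epi_in C H f" and T: "(k', f, c) \<in> Tri C" shows "Dom C k' \<in> H"
proof (rule heart_coker_zero_fibre[OF T])
  show fi: "arr_in C H f" using f by (simp add: epi_in_def)
  fix p assume p: "is_cokernel C H p f"
  have p': "p \<in> hom C (Cod C f) (Cod C p)" "Cod C p \<in> H" "p \<cdot> f = Null C (Dom C f) (Cod C p)"
    using p by (auto simp: is_cokernel_def arr_in_def in_hom)
  have o: "Cod C p \<in> Obj C" "f \<in> Arr C" using p' fi H_obj by (auto simp: arr_in_def)
  have n: "Null C (Cod C f) (Cod C p) \<in> hom C (Cod C f) (Cod C p)" using o by (simp add: in_hom)
  have "Null C (Cod C f) (Cod C p) \<cdot> f = Null C (Dom C f) (Cod C p)" using o by simp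
  then have "p = Null C (Cod C f) (Cod C p)" using f p' n unfolding epi_in_def by metis
  then show "zero_obj C (Cod C p)" using cokernel_zero[OF p] p' by (simp add: in_hom)
qed

text \<open>
  Kernels and cokernels come from the truncations of a cone. A monomorphism has its cone in the heart and is
  therefore the kernel of its cokernel; an epimorphism has its fibre in the heart and is the cokernel of its
  kernel.
\<close>

theorem abelian_heart: "abelian_on C H"
  unfolding abelian_on_def
proof (intro conjI ballI allI impI)
  show "H \<subseteq> Obj C" using H_obj by auto
  show "\<exists>Z\<in>H. zero_obj C Z" using ex_zero H_zero by blast
next
  fix X Y assume XY: "X \<in> H" "Y \<in> H"
  obtain B where B: "is_biproduct C X Y B" using ex_biproduct XY H_obj by blast
  have "B \<in> P" by (rule P_left_perp) (use B XY hom_zero_biproduct_left biproduct_obj PR H_P in auto)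
  moreover have "B \<in> N" using B XY hom_zero_biproduct_right biproduct_obj PN H_N unfolding N_iff by blast
  ultimately show "\<exists>B\<in>H. is_biproduct C X Y B" using B H_I by blast
next
  fix f assume f: "arr_in C H f"
  then obtain c d where T: "(f, c, d) \<in> Tri C" using TR1_cone unfolding arr_in_def by blast
  show "\<exists>k. is_kernel C H k f" "\<exists>c. is_cokernel C H c f" using heart_cone[OF T f] by metis+
next
  fix f assume f: "mono_in C H f"
  then have fi: "f \<in> Arr C" "Dom C f \<in> H" "Cod C f \<in> H" by (auto simp: arr_in_def mono_in_def)
  then obtain c d where T: "(f, c, d) \<in> Tri C" using TR1_cone by blast
  show "\<exists>g. is_kernel C H f g" using heart_short_exact[OF T fi(2,3) heart_mono_cone[OF f T]]
    by (auto simp: short_exact_def)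
next
  fix f assume f: "epi_in C H f"
  then have fi: "f \<in> Arr C" "Dom C f \<in> H" "Cod C f \<in> H" by (auto simp: arr_in_def epi_in_def)
  then obtain k c where T: "(k, f, c) \<in> Tri C" using fibre_ex by metis
  show "\<exists>g. is_cokernel C H f g" using heart_short_exact[OF T heart_epi_fibre[OF f T]] fi triD[OF T]
    by (auto simp: short_exact_def)
qed

text \<open>
  The cone of the monomorphism \<open>f\<close> lies in the heart and is a cokernel of \<open>f\<close>. So is \<open>g\<close>, and the unique
  isomorphism between the two cokernels carries the triangle of the cone to one on \<open>f\<close> and \<open>g\<close>.
\<close>

lemma short_exact_triangle:
  assumes "short_exact C H f g" obtains h where "(f, g, h) \<in> Tri C"
proof -
  have k: "is_kernel C H f g" and c: "is_cokernel C H g f" using assms by (auto simp: short_exact_def)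
  have fg: "f \<in> Arr C" "g \<in> Arr C" "Dom C f \<in> H" "Cod C f \<in> H" "Dom C g = Cod C f" "Cod C g \<in> H" "g \<cdot> f = Null C (Dom C f) (Cod C g)"
    using c by (auto simp: is_cokernel_def arr_in_def)
  obtain g' h where T: "(f, g', h) \<in> Tri C" using TR1_cone fg by blast
  note t = triD[OF T]
  have CH: "Cod C g' \<in> H" using heart_mono_cone[OF kernel_mono[OF k] T] .
  have c': "is_cokernel C H g' f" using heart_short_exact[OF T fg(3,4) CH] by (simp add: short_exact_def)
  have univ: "\<exists>!w. w \<in> hom C (Cod C p) (Cod C q) \<and> w \<cdot> p = q" if "is_cokernel C H p f" "is_cokernel C H q f" for p q
  proof -
    have q: "Cod C q \<in> H" "q \<in> hom C (Cod C f) (Cod C q)" "q \<cdot> f = Null C (Dom C f) (Cod C q)"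
      using that(2) by (auto simp: is_cokernel_def arr_in_def in_hom)
    show ?thesis using that(1) q unfolding is_cokernel_def by blast
  qed
  obtain w where w: "w \<in> hom C (Cod C g') (Cod C g)" "w \<cdot> g' = g" using univ[OF c' c] by blast
  obtain v where v: "v \<in> hom C (Cod C g) (Cod C g')" "v \<cdot> g = g'" using univ[OF c c'] by blast
  have wv: "w \<in> Arr C" "v \<in> Arr C" "Dom C w = Cod C g'" "Cod C w = Cod C g" "Dom C v = Cod C g" "Cod C v = Cod C g'"
    using w v by (auto simp: in_hom)
  have "(v \<cdot> w) \<cdot> g' = g'" using wv t w v by simp
  moreover have "v \<cdot> w \<in> hom C (Cod C g') (Cod C g')" "Ide C (Cod C g') \<in> hom C (Cod C g') (Cod C g')" using wv t by (auto simp: in_hom)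
  moreover have "Ide C (Cod C g') \<cdot> g' = g'" using t by simp
  ultimately have vw: "v \<cdot> w = Ide C (Cod C g')" using univ[OF c' c'] by blast
  have "(w \<cdot> v) \<cdot> g = g" using wv fg w v by simp
  moreover have "w \<cdot> v \<in> hom C (Cod C g) (Cod C g)" "Ide C (Cod C g) \<in> hom C (Cod C g) (Cod C g)" using wv fg by (auto simp: in_hom)
  moreover have "Ide C (Cod C g) \<cdot> g = g" using fg by simp
  ultimately have wv1: "w \<cdot> v = Ide C (Cod C g)" using univ[OF c c] by blast
  have iw: "is_iso C w" by (rule is_isoI[OF w(1) v(1) vw wv1])
  have "(f, g, h \<cdot> v) \<in> Tri C"
    by (rule tri_cong[OF T, of "Ide C (Dom C f)" "Ide C (Cod C f)" w])
      (use iw fg t wv w vw in \<open>auto simp: in_hom\<close>)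
  then show thesis using that by blast
qed

lemma short_exact_tri: "short_exact C H f g \<Longrightarrow> tri (Dom C f) (Cod C f) (Cod C g)"
  by (elim short_exact_triangle) (rule triI)

subsection \<open>Simple objects\<close>

lemma Sim_H: "T \<in> Sim C H \<Longrightarrow> T \<in> H" and Sim_nonzero: "T \<in> Sim C H \<Longrightarrow> \<not> zero_obj C T"
  by (auto simp: Sim_def)

text \<open>
  The map \<open>u\<close> factors through the kernel of its cokernel, a subobject of \<open>T\<close>. As \<open>u\<close> is nonzero this subobject is
  all of \<open>T\<close>, so the cokernel is zero.
\<close>

lemma epi_to_simple:
  assumes T: "T \<in> Sim C H" and u: "u \<in> Arr C" "Dom C u \<in> H" "Cod C u = T" "u \<noteq> Null C (Dom C u) T"
    and tri: "(k, u, h) \<in> Tri C"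
  shows "Dom C k \<in> H"
proof (rule heart_coker_zero_fibre[OF tri])
  show ui: "arr_in C H u" using u Sim_H[OF T] by (simp add: arr_in_def)
  fix p assume p: "is_cokernel C H p u"
  have p': "p \<in> Arr C" "Dom C p = T" "Cod C p \<in> H" "arr_in C H p" "p \<cdot> u = Null C (Dom C u) (Cod C p)"
    using p u by (auto simp: is_cokernel_def arr_in_def)
  obtain m where m: "is_kernel C H m p" using abelian_heart p' unfolding abelian_on_def by blast
  have m': "m \<in> Arr C" "Cod C m = T" "Dom C m \<in> H" "p \<cdot> m = Null C (Dom C m) (Cod C p)" using m p' by (auto simp: is_kernel_def arr_in_def)
  have o: "T \<in> Obj C" "Cod C p \<in> Obj C" "Dom C m \<in> Obj C" using p' m' by auto
  have "u \<in> hom C (Dom C u) (Dom C p)" using u p' by (simp add: in_hom)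
  then obtain v where v: "v \<in> hom C (Dom C u) (Dom C m)" "m \<cdot> v = u" using m u(2) p'(5) unfolding is_kernel_def by blast
  have "\<not> zero_obj C (Dom C m)"
  proof
    assume "zero_obj C (Dom C m)"
    then have "m = Null C (Dom C m) T" using zero_from m' by blast
    then have "m \<cdot> v = Null C (Dom C u) T" using v(1) o by (metis in_hom null_comp)
    then show False using v u by simp
  qed
  then have "is_iso C m" using Sim_mono[OF T kernel_mono[OF m]] m' by blast
  then obtain n where n: "n \<in> Arr C" "Dom C n = T" "Cod C n = Dom C m" "m \<cdot> n = Ide C T"
    using is_isoE m' by metis
  have "p \<cdot> (m \<cdot> n) = Null C (Dom C m) (Cod C p) \<cdot> n" by (rule comp_cancel[OF m'(4)]) (use p' m' n in auto)
  then have "p = Null C (Dom C p) (Cod C p)" using n p' o by simp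
  then show "zero_obj C (Cod C p)" using cokernel_zero[OF p] by blast
qed

text \<open>
  The kernel of \<open>u\<close> is a subobject of \<open>T\<close>, and it cannot be all of \<open>T\<close>.
\<close>

lemma mono_from_simple:
  assumes T: "T \<in> Sim C H" and u: "u \<in> Arr C" "Dom C u = T" "Cod C u \<in> H" "u \<noteq> Null C T (Cod C u)"
    and tri: "(u, c, d) \<in> Tri C"
  shows "Cod C c \<in> H"
proof -
  have ui: "arr_in C H u" using u Sim_H[OF T] by (simp add: arr_in_def)
  obtain A B k p where AB: "tri (Sh C A) (Cod C c) B" "is_kernel C H k u" "Dom C k = A" "is_cokernel C H p u" "Cod C p = B"
    by (rule heart_cone[OF tri ui])
  have k': "k \<in> Arr C" "Cod C k = T" "A \<in> H" "u \<cdot> k = Null C A (Cod C u)" using AB u by (auto simp: is_kernel_def arr_in_def)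
  have "\<not> is_iso C k"
  proof
    assume "is_iso C k"
    then obtain n where n: "n \<in> Arr C" "Dom C n = T" "Cod C n = A" "k \<cdot> n = Ide C T" using is_isoE k' AB(3) by metis
    have "u \<cdot> (k \<cdot> n) = Null C A (Cod C u) \<cdot> n" by (rule comp_cancel[OF k'(4)]) (use k' n u AB(3) in auto)
    then show False using n u by simp
  qed
  then have "zero_obj C A" using Sim_mono[OF T kernel_mono[OF AB(2)]] k' AB(3) by blast
  then have "isomorphic C (Cod C c) B" using tri_iso_of_zero_left[OF AB(1)] zero_obj_sh by blast
  moreover have "B \<in> H" using AB(4,5) by (auto simp: is_cokernel_def arr_in_def)
  ultimately show ?thesis using H_iso isomorphic_sym by blast
qed

text \<open>
  The cone lies both in the heart and, as the shift of the kernel, in the shifted heart; so it is zero.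
\<close>

lemma schur:
  assumes T: "T \<in> Sim C H" and T': "T' \<in> Sim C H"
    and u: "u \<in> Arr C" "Dom C u = T" "Cod C u = T'" "u \<noteq> Null C T T'"
  shows "is_iso C u"
proof -
  obtain k c where F: "(k, u, c) \<in> Tri C" using fibre_ex[OF u(1)] by metis
  have R: "(u, c, neg (ShA C k)) \<in> Tri C" using tri_rotI[OF F] .
  have "Dom C k \<in> H" by (rule epi_to_simple[OF T' _ _ _ _ F]) (use u T Sim_H in auto)
  moreover have "Cod C c \<in> H" by (rule mono_from_simple[OF T _ _ _ _ R]) (use u T' Sim_H in auto)
  moreover have "Cod C c = Sh C (Dom C k)" using triD[OF F] by simp
  ultimately have "hom_zero C (Cod C c) (Cod C c)" using HH[of "Dom C k" "Cod C c"] by simp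
  then show ?thesis using iso_of_zero_cone[OF R] hom_zero_self by blast
qed

text \<open>
  A nonzero monomorphism to \<open>T\<close> has its fibre in the heart by assumption. The fibre is its kernel, hence zero, and
  the map is an isomorphism.
\<close>

lemma simpleI:
  assumes T: "T \<in> H" "\<not> zero_obj C T"
    and epi: "\<And>u k h. u \<in> Arr C \<Longrightarrow> Dom C u \<in> H \<Longrightarrow> Cod C u = T \<Longrightarrow> u \<noteq> Null C (Dom C u) T \<Longrightarrow> (k, u, h) \<in> Tri C
      \<Longrightarrow> Dom C k \<in> H"
  shows "T \<in> Sim C H"
  unfolding Sim_def mem_Collect_eq
proof (intro conjI allI impI T)
  fix f assume "mono_in C H f \<and> Cod C f = T"
  then have m: "mono_in C H f" and f: "f \<in> Arr C" "Dom C f \<in> H" "Cod C f = T" by (auto simp: mono_in_def arr_in_def)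
  show "zero_obj C (Dom C f) \<or> is_iso C f"
  proof (cases "f = Null C (Dom C f) T")
    case True
    have "Ide C (Dom C f) = Null C (Dom C f) (Dom C f)"
      by (rule mono_inD[OF m]) (use f True in auto)
    then show ?thesis using f by (simp add: zero_obj_def)
  next
    case False
    obtain k h where F: "(k, f, h) \<in> Tri C" using fibre_ex[OF f(1)] by metis
    note t = triD[OF F]
    have K: "Dom C k \<in> H" by (rule epi[OF f False F])
    have se: "is_kernel C H k f" using heart_short_exact[OF F K] f T t by (simp add: short_exact_def)
    have "k = Null C (Dom C k) (Cod C k)"
      by (rule mono_inD[OF m]) (use t K tri_comp_zero[OF F] in auto)
    then have "zero_obj C (Dom C k)" using kernel_zero[OF se] by blast
    then have "is_iso C f" using iso_of_zero_cone[OF tri_rotI[OF F]] zero_obj_sh t by simp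
    then show ?thesis by blast
  qed
qed

end


section \<open>Iterated extensions\<close>

context pretriangulated_category
begin

text \<open>
  Integral shifts. Negative ones use an inverse of the shift that is meaningful on objects of the category
  only, since \<open>Sh\<close> is bijective there and arbitrary elsewhere.
\<close>

definition shz :: "int \<Rightarrow> 'o \<Rightarrow> 'o" where
  "shz n X = (if 0 \<le> n then (Sh C ^^ nat n) X else (inv_into (Obj C) (Sh C) ^^ nat (- n)) X)"

lemma shz_0 [simp]: "shz 0 X = X" by (simp add: shz_def)

lemma unsh: assumes "X \<in> Obj C" shows "inv_into (Obj C) (Sh C) X \<in> Obj C" "Sh C (inv_into (Obj C) (Sh C) X) = X"
proof -
  have X: "X \<in> Sh C ` Obj C" using assms shift_obj by (simp add: bij_betw_def)
  show "inv_into (Obj C) (Sh C) X \<in> Obj C" by (rule inv_into_into[OF X])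
  show "Sh C (inv_into (Obj C) (Sh C) X) = X" by (rule f_inv_into_f[OF X])
qed

lemma unsh_funpow: "X \<in> Obj C \<Longrightarrow> (inv_into (Obj C) (Sh C) ^^ k) X \<in> Obj C"
  by (induction k) (auto intro: unsh)

lemma sh_funpow: "X \<in> Obj C \<Longrightarrow> (Sh C ^^ k) X \<in> Obj C"
  by (induction k) auto

lemma shz_obj [simp]: "X \<in> Obj C \<Longrightarrow> shz n X \<in> Obj C"
  by (simp add: shz_def unsh_funpow sh_funpow)

lemma shz_of_nat: "shz (int n) X = (Sh C ^^ n) X" by (simp add: shz_def)

lemma Sh_shz: assumes "X \<in> Obj C" shows "Sh C (shz n X) = shz (n + 1) X"
proof (cases "0 \<le> n")
  case True
  then have "nat (n + 1) = Suc (nat n)" by simp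
  then show ?thesis using True by (simp add: shz_def)
next
  case False
  then have k: "nat (- n) = Suc (nat (- (n + 1)))" by simp
  have "Sh C (shz n X) = (inv_into (Obj C) (Sh C) ^^ nat (- (n + 1))) X"
    using False k unsh(2)[OF unsh_funpow[OF assms]] by (simp add: shz_def)
  also have "\<dots> = shz (n + 1) X" using False by (cases "n = -1") (auto simp: shz_def)
  finally show ?thesis .
qed

lemma shz_ind:
  assumes "P (0::int)" "\<And>n. P n \<longleftrightarrow> P (n + 1)" shows "P n"
  by (induction n rule: int_induct[of _ 0]) (use assms assms(2)[of "_ - 1"] in \<open>auto simp: algebra_simps\<close>)

lemma shz_shz: assumes "X \<in> Obj C" shows "shz m (shz n X) = shz (m + n) X"
proof (induction m rule: shz_ind)
  case (2 m)
  have a: "shz m (shz n X) \<in> Obj C" "shz (m + n) X \<in> Obj C" using assms by auto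
  have "shz (m + 1) (shz n X) = Sh C (shz m (shz n X))" "shz (m + 1 + n) X = Sh C (shz (m + n) X)"
    using Sh_shz[of "shz n X" m] Sh_shz[of X "m + n"] assms by (auto simp: algebra_simps)
  then show ?case using sh_inj[OF _ a] by auto
qed simp

lemma shz_1: "X \<in> Obj C \<Longrightarrow> shz 1 X = Sh C X" using Sh_shz[of X 0] by simp

lemma hom_zero_shz: assumes "X \<in> Obj C" "Y \<in> Obj C" shows "hom_zero C (shz n X) (shz n Y) \<longleftrightarrow> hom_zero C X Y"
  by (induction n rule: shz_ind) (use assms hom_zero_sh[of "shz _ X" "shz _ Y"] in \<open>auto simp: Sh_shz\<close>)

lemma isomorphic_shz: assumes "X \<in> Obj C" "Y \<in> Obj C" shows "isomorphic C (shz n X) (shz n Y) \<longleftrightarrow> isomorphic C X Y"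
  by (induction n rule: shz_ind) (use assms isomorphic_sh_iff[of "shz _ X" "shz _ Y"] in \<open>auto simp: Sh_shz\<close>)

lemma tri_shz: assumes "X \<in> Obj C" "Y \<in> Obj C" "Z \<in> Obj C" shows "tri (shz n X) (shz n Y) (shz n Z) \<longleftrightarrow> tri X Y Z"
  by (induction n rule: shz_ind) (use assms tri_sh[of "shz _ X" "shz _ Y" "shz _ Z"] in \<open>auto simp: Sh_shz\<close>)

lemma zero_obj_shz: assumes "X \<in> Obj C" shows "zero_obj C (shz n X) \<longleftrightarrow> zero_obj C X"
  by (induction n rule: shz_ind) (use assms zero_obj_sh_iff[of "shz _ X"] in \<open>auto simp: Sh_shz\<close>)

text \<open>
  Iterated extensions, recorded by the list of their successive quotients from the bottom upwards. The order
  matters: the manipulations of words below exchange neighbouring entries.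
\<close>

inductive filt :: "'o list \<Rightarrow> 'o \<Rightarrow> bool" where
  filt_Nil: "zero_obj C X \<Longrightarrow> filt [] X"
| filt_Cons: "tri A X Y \<Longrightarrow> filt L Y \<Longrightarrow> filt (A # L) X"

inductive_cases filt_NilE: "filt [] X"
inductive_cases filt_ConsE: "filt (A # L) X"

lemma filt_obj: "filt L X \<Longrightarrow> X \<in> Obj C"
  by (induction rule: filt.induct) (auto simp: zero_obj_Obj dest: tri_obj)

lemma filt_iso: assumes "filt L X" "isomorphic C X Y" shows "filt L Y"
proof (cases L)
  case Nil
  then show ?thesis using assms zero_obj_iso filt_Nil by (auto elim!: filt_NilE)
next
  case (Cons A M)
  then obtain Z where Z: "tri A X Z" "filt M Z" using assms by (auto elim: filt_ConsE)
  then show ?thesis using filt_Cons[OF tri_iso_mid[OF Z(1) assms(2)] Z(2)] Cons by simp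
qed

lemma filt_single: assumes "X \<in> Obj C" shows "filt [X] X"
proof -
  obtain Z where Z: "zero_obj C Z" using ex_zero by blast
  show ?thesis by (rule filt_Cons[OF tri_zero_right[OF assms Z] filt_Nil[OF Z]])
qed

lemma filt_singleD: "filt [A] X \<Longrightarrow> isomorphic C A X"
  by (elim filt_ConsE filt_NilE) (rule tri_iso_of_zero_right)

lemma filt_hom_left: "filt L X \<Longrightarrow> Y \<in> Obj C \<Longrightarrow> (\<And>A. A \<in> set L \<Longrightarrow> hom_zero C A Y) \<Longrightarrow> hom_zero C X Y"
  by (induction rule: filt.induct) (auto intro: hom_zero_from_zero hom_zero_mid')

lemma filt_hom_right: "filt L X \<Longrightarrow> Y \<in> Obj C \<Longrightarrow> (\<And>A. A \<in> set L \<Longrightarrow> hom_zero C Y A) \<Longrightarrow> hom_zero C Y X"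
  by (induction rule: filt.induct) (auto intro: hom_zero_to_zero hom_zero_mid)

lemma filt_closed:
  assumes "filt L X" "set L \<subseteq> A" "\<And>Z. zero_obj C Z \<Longrightarrow> Z \<in> A" "\<And>X Y Z. tri X Y Z \<Longrightarrow> X \<in> A \<Longrightarrow> Z \<in> A \<Longrightarrow> Y \<in> A"
  shows "X \<in> A"
  using assms(1,2) by (induction rule: filt.induct) (use assms(3,4) in auto)

lemma filt_shz: "filt L X \<Longrightarrow> filt (map (shz n) L) (shz n X)"
proof (induction rule: filt.induct)
  case (filt_Nil X)
  then show ?case using zero_obj_shz zero_obj_Obj filt.filt_Nil by simp
next
  case (filt_Cons A X Y L)
  have "tri (shz n A) (shz n X) (shz n Y)" using tri_shz tri_obj[OF filt_Cons(1)] filt_Cons(1) by simp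
  then show ?case using filt_Cons filt.filt_Cons by simp
qed

end

context triangulated_category
begin

text \<open>
  Splicing two filtrations is the associativity of extensions, that is, the octahedral axiom.
\<close>

lemma filt_append:
  assumes "tri X1 X X2" "filt L1 X1" "filt L2 X2" shows "filt (L1 @ L2) X"
  using assms(2,1)
proof (induction arbitrary: X rule: filt.induct)
  case (filt_Nil X1)
  then show ?case using assms(3) filt_iso tri_iso_of_zero_left isomorphic_sym by fastforce
next
  case (filt_Cons A X1 Y1 L)
  obtain G where G: "tri A X G" "tri Y1 G X2" using octahedral[OF filt_Cons(1) filt_Cons(4)] .
  then show ?case using filt_Cons(3)[OF G(2)] filt.filt_Cons by simp
qed

lemma filt_appendE:
  assumes "filt (L1 @ L2) X" obtains X1 X2 where "tri X1 X X2" "filt L1 X1" "filt L2 X2"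
  using assms
proof (induction L1 arbitrary: X thesis)
  case Nil
  obtain Z where "zero_obj C Z" using ex_zero by blast
  then show ?case using Nil filt.filt_Nil tri_zero_left filt_obj by fastforce
next
  case (Cons A L1)
  obtain Y where Y: "tri A X Y" "filt (L1 @ L2) Y" using Cons.prems(2) by (auto elim: filt_ConsE)
  obtain Y1 X2 where Y1: "tri Y1 Y X2" "filt L1 Y1" "filt L2 X2" using Cons.IH[OF _ Y(2)] by blast
  obtain X1 where "tri X1 X X2" "tri A X1 Y1" using octahedral'[OF Y(1) Y1(1)] .
  then show ?case using Cons.prems(1) Y1 filt.filt_Cons by blast
qed

text \<open>
  The octahedral axiom re-brackets iterated extensions, so one generator can be added at a time.
\<close>

lemma ext_closure_filt: assumes "A \<subseteq> Obj C" shows "X \<in> ext_closure C A \<longleftrightarrow> (\<exists>L. set L \<subseteq> A \<and> filt L X)"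
proof
  assume "X \<in> ext_closure C A"
  then show "\<exists>L. set L \<subseteq> A \<and> filt L X"
  proof (induction rule: ext_closure.induct)
    case (base X)
    then show ?case using assms filt_single by (intro exI[of _ "[X]"]) auto
  next
    case (zero X)
    then show ?case using filt.filt_Nil by (intro exI[of _ "[]"]) auto
  next
    case (iso X Y)
    then show ?case using filt_iso by blast
  next
    case (ext f g h)
    then obtain L1 L2 where "set L1 \<subseteq> A" "filt L1 (Dom C f)" "set L2 \<subseteq> A" "filt L2 (Cod C g)" by blast
    then show ?case using filt_append[OF triI[OF ext(1)]] by (intro exI[of _ "L1 @ L2"]) auto
  qed
next
  assume "\<exists>L. set L \<subseteq> A \<and> filt L X"
  then obtain L where "filt L X" "set L \<subseteq> A" by blast
  then show "X \<in> ext_closure C A"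
  proof (induction rule: filt.induct)
    case (filt_Nil X)
    show ?case by (rule ext_closure.zero) (rule filt_Nil)
  next
    case (filt_Cons B X Y L)
    obtain f g h where "(f, g, h) \<in> Tri C" "Dom C f = B" "Cod C f = X" "Cod C g = Y"
      using filt_Cons(1) by (auto simp: tri_def)
    then show ?case using ext_closure.ext[of f g h C A] ext_closure.base[of B A C] filt_Cons by auto
  qed
qed

end

section \<open>Tilting a heart at a torsion pair\<close>

context bounded_t
begin

lemma is_heart_H: "is_heart C H"
  using bts by (auto simp: is_heart_def H_def N_def R_def)

text \<open>
  The aisle of the tilted t-structure consists of the objects of \<open>P\<close> without maps to \<open>F\<close>. To truncate \<open>X\<close> with
  respect to it, one removes from the old truncation of \<open>X\<close> the torsion-free quotient of its cohomology in
  degree \<open>0\<close>; what is removed has the form \<open>F * R\<close>, where the new aisle has no maps to \<open>F\<close> or to \<open>R\<close>.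
\<close>

theorem forward_tilt_is_heart:
  assumes tp: "torsion_pair C H T F" shows "is_heart C (forward_tilt C T F)"
proof -
  have TH: "T \<subseteq> H" and FH: "F \<subseteq> H" and TF: "\<And>X Y. X \<in> T \<Longrightarrow> Y \<in> F \<Longrightarrow> hom_zero C X Y"
    and Tiso: "\<And>X Y. X \<in> T \<Longrightarrow> isomorphic C X Y \<Longrightarrow> Y \<in> T" and Fiso: "\<And>X Y. X \<in> F \<Longrightarrow> isomorphic C X Y \<Longrightarrow> Y \<in> F"
    using tp H_iso unfolding torsion_pair_def by blast+
  have dec: "\<exists>A B. tri A X B \<and> A \<in> T \<and> B \<in> F" if X: "X \<in> H" for X
  proof -
    obtain f g where "short_exact C H f g" "Dom C f \<in> T" "Cod C f = X" "Cod C g \<in> F"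
      using tp X unfolding torsion_pair_def by blast
    then show ?thesis using short_exact_tri by blast
  qed
  define P' where "P' = {X \<in> P. \<forall>Y\<in>F. hom_zero C X Y}"
  define R' where "R' = right_perp C P'"
  have P'P: "P' \<subseteq> P" by (auto simp: P'_def)
  have R'iff: "Y \<in> R' \<longleftrightarrow> Y \<in> Obj C \<and> (\<forall>X\<in>P'. hom_zero C X Y)" for Y by (simp add: R'_def right_perp_def)
  have ShP: "Sh C X \<in> P'" if "X \<in> P" for X using that P_sh PN H_N FH by (auto simp: P'_def)
  have RR': "R \<subseteq> R'" using P'P PR R_obj unfolding R'iff subset_iff by blast
  have T_P': "T \<subseteq> P'" using TH TF H_P by (auto simp: P'_def)
  have F_R': "F \<subseteq> R'" using FH H_obj by (auto simp: R'iff P'_def)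
  have P'ext: "Y \<in> P'" if "tri X Y Z" "X \<in> P'" "Z \<in> P'" for X Y Z
    using that P_ext[OF that(1)] hom_zero_mid'[OF that(1)] by (auto simp: P'_def)
  have R'ext: "Y \<in> R'" if "tri X Y Z" "X \<in> R'" "Z \<in> R'" for X Y Z
    using that tri_obj[OF that(1)] hom_zero_mid[OF that(1)] by (auto simp: R'iff)
  have P'iso: "Y \<in> P'" if "X \<in> P'" "isomorphic C X Y" for X Y
    using that P_iso hom_zero_retract_left[OF retract_of_iso[OF isomorphic_sym[OF that(2)]]] by (auto simp: P'_def)
  have truncP: "\<exists>E B. tri E X B \<and> E \<in> P' \<and> B \<in> F" if X: "X \<in> P" for X
  proof -
    obtain A1 A0 where A: "tri (Sh C A1) X A0" "A1 \<in> P" "A0 \<in> H" using trunc_P[OF X] .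
    obtain T0 F0 where T0: "tri T0 A0 F0" "T0 \<in> T" "F0 \<in> F" using dec[OF A(3)] by blast
    obtain E where E: "tri E X F0" "tri (Sh C A1) E T0" using octahedral'[OF A(1) T0(1)] .
    then have "E \<in> P'" using P'ext ShP A T0 T_P' by blast
    then show ?thesis using E T0 by blast
  qed
  have ts: "t_structure C P'"
    unfolding t_structure_def
  proof (intro conjI ballI allI impI)
    show "P' \<subseteq> Obj C" using P'P P_obj by auto
    show "\<And>X Y. X \<in> P' \<Longrightarrow> isomorphic C X Y \<Longrightarrow> Y \<in> P'" by (rule P'iso)
    show "\<And>X. X \<in> P' \<Longrightarrow> Sh C X \<in> P'" using ShP P'P by blast
    fix X assume X: "X \<in> Obj C"
    obtain A B where AB: "tri A X B" "A \<in> P" "B \<in> R" using trunc[OF X] .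
    obtain E F0 where E: "tri E A F0" "E \<in> P'" "F0 \<in> F" using truncP[OF AB(2)] by blast
    obtain G where G: "tri E X G" "tri F0 G B" using octahedral[OF E(1) AB(1)] .
    have "G \<in> R'" using R'ext[OF G(2)] E F_R' AB RR' by blast
    moreover obtain f g h where "(f, g, h) \<in> Tri C" "Dom C f = E" "Cod C f = X" "Cod C g = G"
      using G(1) by (auto simp: tri_def)
    ultimately show "\<exists>f g h. (f, g, h) \<in> Tri C \<and> Dom C f \<in> P' \<and> Cod C f = X \<and> Cod C g \<in> right_perp C P'"
      using E(2) unfolding R'_def by blast
  qed
  have "bounded_t_structure C P'"
    unfolding bounded_t_structure_def
  proof (intro conjI ballI ts)
    fix X assume X: "X \<in> Obj C"
    obtain m where "(Sh C ^^ m) X \<in> P" using bts X by (auto simp: bounded_t_structure_def)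
    then have "(Sh C ^^ Suc m) X \<in> P'" using ShP by simp
    then show "\<exists>m. (Sh C ^^ m) X \<in> P'" by blast
    obtain n where "X \<in> (Sh C ^^ n) ` R" using bts X unfolding bounded_t_structure_def R_def by blast
    then show "\<exists>n. X \<in> (Sh C ^^ n) ` right_perp C P'" using RR' unfolding R'_def by blast
  qed
  moreover have "forward_tilt C T F = P' \<inter> Sh C ` right_perp C P'"
  proof (intro set_eqI iffI)
    fix M assume "M \<in> forward_tilt C T F"
    then obtain f g h where fg: "(f, g, h) \<in> Tri C" "Dom C f \<in> Sh C ` F" "Cod C f = M" "Cod C g \<in> T"
      unfolding forward_tilt_def by blast
    then obtain F0 T0 where FT: "tri (Sh C F0) M T0" "F0 \<in> F" "T0 \<in> T" using triI[OF fg(1)] by auto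
    have "M \<in> P'" using P'ext[OF FT(1)] ShP FT FH H_P T_P' by blast
    moreover obtain M' where M': "M' \<in> Obj C" "M = Sh C M'" using sh_surj tri_obj(2)[OF FT(1)] by metis
    obtain T1 where T1: "T1 \<in> Obj C" "T0 = Sh C T1" using sh_surj tri_obj(3)[OF FT(1)] by metis
    have t: "tri F0 M' T1" using FT(1) M' T1 tri_sh[of F0 M' T1] FT FH H_obj by auto
    have "T1 \<in> R" using FT T1 TH H_N Sh_N_iff by blast
    then have "M' \<in> R'" using R'ext[OF t] FT F_R' RR' by blast
    ultimately show "M \<in> P' \<inter> Sh C ` right_perp C P'" using M' by (auto simp: R'_def)
  next
    fix M assume "M \<in> P' \<inter> Sh C ` right_perp C P'"
    then obtain M' where M: "M \<in> P'" "M' \<in> R'" "M = Sh C M'" by (auto simp: R'_def)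
    obtain A B where AB: "tri (Sh C A) M B" "A \<in> P" "B \<in> H" using trunc_P M P'P by blast
    \<comment> \<open>The torsion-free quotient of \<open>B\<close> would receive a nonzero map from \<open>M\<close>.\<close>
    have "B \<in> T"
    proof -
      obtain T0 F0 where T0: "tri T0 B F0" "T0 \<in> T" "F0 \<in> F" using dec[OF AB(3)] by blast
      have "hom_zero C M F0" using M T0 by (auto simp: P'_def)
      moreover have "hom_zero C (Sh C (Sh C A)) F0" using PN P_sh AB T0 FH H_N by blast
      ultimately have "hom_zero C B F0" using hom_zero_mid'[OF tri_rot[OF AB(1)]] by blast
      then have "retract F0 (Sh C T0)" using retract_of_zero_second[OF T0(1)] by blast
      moreover have "hom_zero C (Sh C T0) F0" using HH T0 TH FH by blast
      ultimately have "zero_obj C F0" using hom_zero_retract_left hom_zero_self by blast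
      then show ?thesis using tri_iso_of_zero_right[OF T0(1)] Tiso T0 by blast
    qed
    \<comment> \<open>The tilted truncation of \<open>A\<close> has no part in the new aisle, so \<open>A\<close> is a retract of an object of \<open>F\<close>.\<close>
    moreover have "A \<in> F"
    proof -
      have Mo: "M' \<in> Obj C" using M by (simp add: R'iff)
      obtain B' where B': "B' \<in> Obj C" "B = Sh C B'" using sh_surj H_obj AB by metis
      have t: "tri A M' B'" using AB M B' tri_sh[of A M' B'] P_obj Mo by auto
      obtain B2 where B2: "B2 \<in> Obj C" "B' = Sh C B2" "tri B2 A M'" using tri_unrot_ex[OF t] .
      have "B' \<in> R" using AB B' H_N Sh_N_iff by blast
      then have B2R: "B2 \<in> R" using B2 R_unsh by blast
      obtain E F0 where E: "tri E A F0" "E \<in> P'" "F0 \<in> F" using truncP[OF AB(2)] by blast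
      have "hom_zero C E M'" using E M by (simp add: R'iff)
      then have "hom_zero C E A" using hom_zero_mid[OF B2(3) PR] B2R E P'P by blast
      then have r: "retract A F0" using retract_of_zero_first(1)[OF E(1)] by blast
      then have AH: "A \<in> H" using H_retract E FH by blast
      obtain T1 F1 where T1: "tri T1 A F1" "T1 \<in> T" "F1 \<in> F" using dec[OF AH] by blast
      have "hom_zero C T1 A" using hom_zero_retract_right[OF r] TF T1 E by blast
      then have "retract (Sh C T1) F1" using retract_of_zero_first(2)[OF T1(1)] by blast
      moreover have "hom_zero C (Sh C T1) F1" using HH T1 TH FH by blast
      ultimately have "zero_obj C (Sh C T1)" using hom_zero_retract_right hom_zero_self by blast
      then have "zero_obj C T1" using zero_obj_sh_iff tri_obj(1)[OF T1(1)] by blast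
      then show ?thesis using tri_iso_of_zero_left[OF T1(1)] Fiso T1 isomorphic_sym by blast
    qed
    ultimately show "M \<in> forward_tilt C T F"
      using AB(1) tri_obj(2)[OF AB(1)] unfolding forward_tilt_def tri_def by blast
  qed
  ultimately show ?thesis unfolding is_heart_def by blast
qed

lemma filt_H: "filt L X \<Longrightarrow> set L \<subseteq> H \<Longrightarrow> X \<in> H"
  by (rule filt_closed) (auto intro: H_zero H_ext)

lemma filt_comp_series: "filt L X \<Longrightarrow> set L \<subseteq> Sim C H \<Longrightarrow> \<exists>Ts. comp_series C H X Ts"
proof (induction L arbitrary: X rule: rev_induct)
  case Nil
  then show ?case using comp_series.Nil[of X H C] H_zero by (auto elim!: filt_NilE)
next
  case (snoc T L)
  obtain X1 X2 where X: "tri X1 X X2" "filt L X1" "filt [T] X2" using filt_appendE[OF snoc.prems(1)] .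
  obtain Ts where Ts: "comp_series C H X1 Ts" using snoc X by auto
  have T: "T \<in> Sim C H" using snoc by auto
  have "isomorphic C T X2" using X filt_singleD by blast
  then have X2: "X2 \<in> Sim C H" using Sim_iso[OF T] Sim_H[OF T] H_iso by blast
  have "X1 \<in> H" using filt_H[OF X(2)] snoc.prems(2) Sim_H by auto
  moreover have "X \<in> H" using H_ext[OF X(1)] X2 Sim_H calculation by blast
  moreover obtain f g h where f: "(f, g, h) \<in> Tri C" "Dom C f = X1" "Cod C f = X" "Cod C g = X2" using X by (auto simp: tri_def)
  ultimately have "short_exact C H f g" using heart_short_exact[OF f(1)] X2 Sim_H by auto
  from comp_series.Cons[OF this, of Ts] show ?case using Ts f X2 by auto
qed

end

section \<open>Hearts of finite length\<close>

locale length_heart = bounded_t C P for C :: "('o, 'm, 'k::field, 'z) tri_cat_scheme" (structure) and P +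
  assumes finite_length: "finite_length C H"
begin

lemma comp_series_filt: "comp_series C H X Ts \<Longrightarrow> filt (rev Ts) X"
proof (induction rule: comp_series.induct)
  case (Nil X)
  then show ?case by (simp add: filt_Nil)
next
  case (Cons f g Ts)
  have "Cod C g \<in> Obj C" using Cons(3) Sim_H H_obj by blast
  then show ?case using filt_append[OF short_exact_tri[OF Cons(1)] Cons(4) filt_single] by simp
qed

lemma comp_series_Sim: "comp_series C H X Ts \<Longrightarrow> set Ts \<subseteq> Sim C H"
  by (induction rule: comp_series.induct) auto

lemma H_filtE: assumes "X \<in> H" obtains L where "set L \<subseteq> Sim C H" "filt L X"
proof -
  obtain Ts where "comp_series C H X Ts" using finite_length assms by (auto simp: finite_length_def)
  then show thesis using that[of "rev Ts"] comp_series_filt comp_series_Sim by auto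
qed

text \<open>
  Climbing up the filtration: a new bottom factor \<open>U\<close> either joins the torsion part, or
  it is a copy of \<open>S\<close> that splits off the torsion part and can be moved to the torsion-free quotient.
\<close>

lemma torsion_decomposition:
  assumes S: "S \<in> Sim C H" and X: "filt L X" "set L \<subseteq> Sim C H"
  shows "\<exists>A B M. tri A X B \<and> A \<in> H \<and> hom_zero C A S \<and> set M \<subseteq> {S} \<and> filt M B"
  using X
proof (induction rule: filt.induct)
  case (filt_Nil X)
  have "X \<in> Obj C" using filt_Nil zero_obj_Obj by blast
  then have "tri X X X" "hom_zero C X S" "filt [] X"
    using filt_Nil tri_zero_right hom_zero_from_zero filt.filt_Nil S Sim_H H_obj by auto
  then show ?case using H_zero filt_Nil by (intro exI[of _ X] exI[of _ "[]"]) auto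
next
  case (filt_Cons U X Y L)
  have So: "S \<in> Obj C" using S Sim_H H_obj by blast
  have U: "U \<in> Sim C H" using filt_Cons by auto
  obtain A B M where A: "tri A Y B" "A \<in> H" "hom_zero C A S" "set M \<subseteq> {S}" "filt M B" using filt_Cons by auto
  obtain E where E: "tri E X B" "tri U E A" using octahedral'[OF filt_Cons(1) A(1)] .
  have EH: "E \<in> H" using H_ext[OF E(2)] U Sim_H A by blast
  show ?case
  proof (cases "hom_zero C E S")
    case True
    then show ?thesis using E EH A by blast
  next
    case False
    then obtain e where e: "e \<in> Arr C" "Dom C e = E" "Cod C e = S" "e \<noteq> Null C E S"
      using hom_zeroI[of E S] So EH H_obj by blast
    obtain j p d where T: "(j, p, d) \<in> Tri C" "j \<in> Arr C" "p \<in> Arr C" "d \<in> Arr C"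
      "Dom C j = U" "Cod C j = E" "Dom C p = E" "Cod C p = A" "Dom C d = A" "Cod C d = Sh C U" "U \<in> Obj C" "E \<in> Obj C" "A \<in> Obj C"
      using triE[OF E(2)] by metis
    have ej: "e \<cdot> j \<in> Arr C" "Dom C (e \<cdot> j) = U" "Cod C (e \<cdot> j) = S" using e T by auto
    have "e \<cdot> j \<noteq> Null C U S"
    proof
      assume "e \<cdot> j = Null C U S"
      then obtain v where v: "v \<in> Arr C" "Dom C v = A" "Cod C v = S" "v \<cdot> p = e"
        using weak_coker[OF T(1), of e] e T by auto
      have "v = Null C A S" by (rule hom_zeroD[OF A(3)]) (use v in auto)
      then show False using v e T So by auto
    qed
    then have iso: "is_iso C (e \<cdot> j)" using schur[OF U S ej] by blast
    then obtain n where n: "n \<in> Arr C" "Dom C n = S" "Cod C n = U" "n \<cdot> (e \<cdot> j) = Ide C U"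
      using is_isoE ej by metis
    have "ShA C (n \<cdot> e) \<cdot> (ShA C j \<cdot> d) = ShA C (Ide C U) \<cdot> d"
      by (rule comp_cancel) (use n e T in \<open>auto simp flip: sha_comp\<close>)
    then have "d = Null C (Dom C d) (Cod C d)" using tri_comp_zero3[OF T(1)] n e T by simp
    then have sw: "tri A E U" using tri_swap[OF T(1)] T by simp
    obtain G where G: "tri A X G" "tri U G B" using octahedral[OF sw E(1)] .
    have "isomorphic C U S" using iso ej isomorphicI by blast
    then have "tri S G B" using tri_iso_obj[OF G(2)] isomorphic_refl tri_obj[OF G(2)] by blast
    then have "filt (S # M) G" using A filt.filt_Cons by blast
    then show ?thesis using G A by (intro exI[of _ A] exI[of _ G] exI[of _ "S # M"]) auto
  qed
qed

lemma torsion_class_iff: assumes "S \<in> Sim C H"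
  shows "X \<in> torsion_class C H (ext_closure C {S}) \<longleftrightarrow> X \<in> H \<and> hom_zero C X S"
proof -
  have So: "{S} \<subseteq> Obj C" using assms Sim_H H_obj by blast
  have "hom_zero C X Y" if "X \<in> H" "hom_zero C X S" "Y \<in> ext_closure C {S}" for Y
  proof -
    obtain L where "set L \<subseteq> {S}" "filt L Y" using \<open>Y \<in> ext_closure C {S}\<close> ext_closure_filt[OF So] by blast
    then show ?thesis using that by (intro filt_hom_right[of L Y X] H_obj) auto
  qed
  then show ?thesis using ext_closure.base[of S "{S}" C] unfolding torsion_class_def by blast
qed

text \<open>
  Since \<open>S\<close> generates the torsion-free class, the torsion class is cut out by the maps to \<open>S\<close> alone.
\<close>

theorem simple_torsion_pair:
  assumes S: "S \<in> Sim C H"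
  shows "torsion_pair C H (torsion_class C H (ext_closure C {S})) (ext_closure C {S})"
    (is "torsion_pair C H ?T ?F")
proof -
  have So: "{S} \<subseteq> Obj C" using assms Sim_H H_obj by blast
  have FH: "?F \<subseteq> H"
  proof
    fix Y assume "Y \<in> ?F"
    then obtain L where "set L \<subseteq> {S}" "filt L Y" using ext_closure_filt[OF So] by blast
    then show "Y \<in> H" using filt_H[of L Y] S Sim_H by blast
  qed
  show ?thesis unfolding torsion_pair_def
  proof (intro conjI ballI impI)
    show "?T \<subseteq> H" by (auto simp: torsion_class_def)
    show "?F \<subseteq> H" by fact
    show "Y \<in> ?T" if "X \<in> ?T" "Y \<in> H" "isomorphic C X Y" for X Y
    proof -
      have "hom_zero C X S" using that torsion_class_iff[OF S] by blast
      then have "hom_zero C Y S" using hom_zero_iso[OF that(3) isomorphic_refl] So by blast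
      then show ?thesis using that torsion_class_iff[OF S] by blast
    qed
    show "Y \<in> ?F" if "X \<in> ?F" "Y \<in> H" "isomorphic C X Y" for X Y
      by (rule ext_closure.iso[OF that(1,3)])
    show "hom_zero C X Y" if "X \<in> ?T" "Y \<in> ?F" for X Y using that by (simp add: torsion_class_def)
    fix X assume X: "X \<in> H"
    obtain L where L: "set L \<subseteq> Sim C H" "filt L X" using H_filtE[OF X] .
    obtain A B M where A: "tri A X B" "A \<in> H" "hom_zero C A S" "set M \<subseteq> {S}" "filt M B"
      using torsion_decomposition[OF S L(2,1)] by blast
    have B: "B \<in> ?F" using A ext_closure_filt[OF So] by blast
    obtain f g h where f: "(f, g, h) \<in> Tri C" "Dom C f = A" "Cod C f = X" "Cod C g = B" using A by (auto simp: tri_def)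
    have "short_exact C H f g" using heart_short_exact[OF f(1)] f A B FH X by auto
    then show "\<exists>f g. short_exact C H f g \<and> Dom C f \<in> ?T \<and> Cod C f = X \<and> Cod C g \<in> ?F"
      using f A B torsion_class_iff[OF S] by blast
  qed
qed

theorem simple_tilting:
  assumes S: "S \<in> Sim C H" shows "simple_forward_tilting C H S (simple_forward_tilt C H S)"
  unfolding simple_forward_tilting_def simple_forward_tilt_def
  using S is_heart_H simple_torsion_pair[OF S] forward_tilt_is_heart[OF simple_torsion_pair[OF S]] by blast

section \<open>Words in shifted simple objects\<close>

text \<open>
  A word lists letters \<open>(n, T)\<close> of degree \<open>n\<close>, standing for \<open>T[n]\<close>, whose iterated extension is the given object. Words
  take the place of cohomology functors and their long exact sequences: once a word is sorted by decreasing
  degree, cutting it gives the truncations of the object, and sorting never creates letters. So the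
  cohomology of an extension is controlled by the letters of its two ends.
\<close>

definition word :: "(int \<times> 'o) list \<Rightarrow> 'o \<Rightarrow> bool" where
  "word w X \<longleftrightarrow> filt (map (\<lambda>(n, T). shz n T) w) X"

lemma word_Nil: "word [] X \<longleftrightarrow> zero_obj C X"
  by (auto simp: word_def intro: filt_Nil elim: filt_NilE)

lemma word_Cons: "word ((n, T) # w) X \<longleftrightarrow> (\<exists>Y. tri (shz n T) X Y \<and> word w Y)"
  by (auto simp: word_def intro: filt_Cons elim: filt_ConsE)

lemma word_obj: "word w X \<Longrightarrow> X \<in> Obj C"
  by (simp add: word_def filt_obj)

lemma word_iso: "word w X \<Longrightarrow> isomorphic C X Y \<Longrightarrow> word w Y"
  using filt_iso by (auto simp: word_def)

lemma word_append: "tri X1 X X2 \<Longrightarrow> word w1 X1 \<Longrightarrow> word w2 X2 \<Longrightarrow> word (w1 @ w2) X"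
  using filt_append by (simp add: word_def)

lemma word_appendE: assumes "word (w1 @ w2) X" obtains X1 X2 where "tri X1 X X2" "word w1 X1" "word w2 X2"
  using filt_appendE assms unfolding word_def map_append by metis

lemma word_shz: assumes "word w X" "snd ` set w \<subseteq> Obj C" shows "word (map (\<lambda>(n, T). (n + k, T)) w) (shz k X)"
proof -
  have e: "map (shz k) (map (\<lambda>(n, T). shz n T) w) = map (\<lambda>(n, T). shz n T) (map (\<lambda>(n, T). (n + k, T)) w)"
    using assms(2) by (auto simp: shz_shz add.commute)
  show ?thesis using filt_shz[of "map (\<lambda>(n, T). shz n T) w" X k] assms(1) unfolding e word_def by blast
qed

lemma word_single: assumes "T \<in> Obj C" shows "word [(n, T)] (shz n T)"
  using filt_single assms by (simp add: word_def)

lemma shz_P: "T \<in> P \<Longrightarrow> shz (int n) T \<in> P"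
  unfolding shz_of_nat by (induction n) (auto intro: P_sh)

lemma shz_N: "T \<in> N \<Longrightarrow> n \<le> 0 \<Longrightarrow> shz n T \<in> N"
proof -
  assume T: "T \<in> N"
  have "shz (- int k) T \<in> N" for k
  proof (induction k)
    case (Suc k)
    have o: "shz (- int (Suc k)) T \<in> Obj C" using N_obj[OF T] by simp
    have "Sh C (shz (- int (Suc k)) T) = shz (- int k) T" using Sh_shz[of T "- int (Suc k)"] N_obj[OF T] by simp
    then have "shz (- int (Suc k)) T \<in> R" using Sh_N_iff[OF o] Suc by simp
    then show ?case by (rule R_N)
  qed (use T in auto)
  from this[of "nat (- n)"] show "n \<le> 0 \<Longrightarrow> shz n T \<in> N" by simp
qed

lemma shz_P': "T \<in> P \<Longrightarrow> 0 \<le> n \<Longrightarrow> shz n T \<in> P" using shz_P[of T "nat n"] by simp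

lemma shz_R: assumes "T \<in> N" "n < 0" shows "shz n T \<in> R"
proof -
  have "Sh C (shz n T) \<in> N" using Sh_shz N_obj shz_N[of T "n + 1"] assms by simp
  then show ?thesis using Sh_N_iff N_obj assms by simp
qed

lemma letters_hom_zero: assumes "T \<in> H" "T' \<in> H" "n < m" shows "hom_zero C (shz m T) (shz n T')"
proof -
  have o: "T \<in> Obj C" "T' \<in> Obj C" using assms H_obj by auto
  have "hom_zero C (Sh C (shz (m - n - 1) T)) T'" using PN shz_P' H_P H_N assms by simp
  then have "hom_zero C (shz (m - n) T) (shz 0 T')" using Sh_shz o by simp
  then have "hom_zero C (shz n (shz (m - n) T)) (shz n T')" using hom_zero_shz o by simp
  then show ?thesis using shz_shz o by simp
qed

text \<open>
  Schur's lemma in each degree, by induction on the shift in both directions.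
\<close>

lemma schur_shz:
  assumes T: "T \<in> Sim C H" and T': "T' \<in> Sim C H"
  shows "u \<in> Arr C \<Longrightarrow> Dom C u = shz n T \<Longrightarrow> Cod C u = shz n T' \<Longrightarrow> u \<noteq> Null C (shz n T) (shz n T') \<Longrightarrow> is_iso C u"
proof (induction n arbitrary: u rule: int_induct[of _ 0])
  have o: "T \<in> Obj C" "T' \<in> Obj C" using assms Sim_H H_obj by auto
  case base
  then show ?case using schur[OF T T'] by simp
next
  have o: "T \<in> Obj C" "T' \<in> Obj C" using assms Sim_H H_obj by auto
  case (step1 n)
  obtain v where v: "v \<in> Arr C" "Dom C v = shz n T" "Cod C v = shz n T'" "u = ShA C v"
    by (rule sha_surj[of u "shz n T" "shz n T'"]) (use step1 o Sh_shz in auto)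
  have "v \<noteq> Null C (shz n T) (shz n T')" using step1.prems(4) v o by (auto simp: Sh_shz)
  then show ?case using step1.IH v sha_is_iso by blast
next
  have o: "T \<in> Obj C" "T' \<in> Obj C" using assms Sim_H H_obj by auto
  case (step2 n)
  have s: "Sh C (shz (n - 1) T) = shz n T" "Sh C (shz (n - 1) T') = shz n T'" using Sh_shz o by auto
  have "ShA C u \<noteq> ShA C (Null C (shz (n - 1) T) (shz (n - 1) T'))"
    using step2.prems sha_inj o by (metis null_arr(1) shz_obj)
  then have "is_iso C (ShA C u)" using step2.IH[of "ShA C u"] step2.prems s o by simp
  then show ?case using sha_is_iso_iff step2.prems by blast
qed

text \<open>
  The connecting map between letters of increasing degree is zero or an isomorphism: such letters
  can be exchanged, or they cancel.
\<close>

lemma letters_swap: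
  assumes T: "T \<in> Sim C H" and U: "U \<in> Sim C H" and X: "tri (shz n T) X (shz m U)" and "n < m"
  shows "zero_obj C X \<or> tri (shz m U) X (shz n T)"
proof -
  have o: "T \<in> Obj C" "U \<in> Obj C" using assms Sim_H H_obj by auto
  obtain f g h where t: "(f, g, h) \<in> Tri C" "h \<in> Arr C" "Dom C f = shz n T" "Cod C f = X" "Cod C g = shz m U"
    "Dom C h = shz m U" "Cod C h = Sh C (shz n T)" using triE[OF X] by metis
  show ?thesis
  proof (cases "h = Null C (Dom C h) (Cod C h)")
    case True
    then show ?thesis using tri_swap[OF t(1)] t by simp
  next
    case False
    have c: "Cod C h = shz (n + 1) T" using t Sh_shz o by simp
    have "\<not> n + 1 < m" using False letters_hom_zero[of U T "n + 1" m] hom_zeroD t c Sim_H T U by metis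
    then have "m = n + 1" using assms by simp
    then have "is_iso C h" using schur_shz[OF U T, of h m] t c False by simp
    then show ?thesis using zero_of_iso_connecting[OF t(1)] t by simp
  qed
qed

abbreviation sorted_word :: "(int \<times> 'o) list \<Rightarrow> bool" where
  "sorted_word \<equiv> sorted_wrt (\<lambda>a b. fst b \<le> fst a)"

text \<open>
  Bubble sort: a letter is moved to the right past all letters of larger degree, unless it cancels against one of
  them.
\<close>

lemma word_insert:
  assumes "word ((n, T) # w) X" "sorted_word w" "T \<in> Sim C H" "snd ` set w \<subseteq> Sim C H"
  shows "\<exists>v. sorted_word v \<and> set v \<subseteq> insert (n, T) (set w) \<and> word v X"
  using assms
proof (induction w arbitrary: X)
  case Nil
  then show ?case by (intro exI[of _ "[(n, T)]"]) auto
next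
  case (Cons a w)
  obtain m U where a: "a = (m, U)" by (cases a)
  show ?case
  proof (cases "m \<le> n")
    case True
    then show ?thesis using Cons.prems a by (intro exI[of _ "(n, T) # a # w"]) auto
  next
    case False
    have U: "U \<in> Sim C H" using Cons.prems a by auto
    have "word ([(n, T), (m, U)] @ w) X" using Cons.prems a by simp
    then obtain X1 X2 where X: "tri X1 X X2" "word [(n, T), (m, U)] X1" "word w X2" using word_appendE by blast
    obtain Y where Y: "tri (shz n T) X1 Y" "word [(m, U)] Y" using X(2) unfolding word_Cons by blast
    have "isomorphic C (shz m U) Y" using Y(2) filt_singleD by (simp add: word_def)
    then have "tri (shz n T) X1 (shz m U)" using tri_iso_obj[OF Y(1)] isomorphic_refl isomorphic_sym tri_obj[OF Y(1)] by blast
    then have "zero_obj C X1 \<or> tri (shz m U) X1 (shz n T)" using letters_swap[OF Cons.prems(3) U] False by simp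
    then consider "zero_obj C X1" | "tri (shz m U) X1 (shz n T)" by blast
    then show ?thesis
    proof cases
      case 1
      then have "word w X" using tri_iso_of_zero_left[OF X(1)] X(3) word_iso isomorphic_sym by blast
      then show ?thesis using Cons.prems by auto
    next
      case 2
      have "T \<in> Obj C" using Cons.prems Sim_H H_obj by blast
      then have "word [(m, U), (n, T)] X1" using 2 word_single[of T n] unfolding word_Cons by blast
      then have "word ((m, U) # (n, T) # w) X" using word_append[OF X(1) _ X(3)] by fastforce
      then obtain Z where Z: "tri (shz m U) X Z" "word ((n, T) # w) Z" unfolding word_Cons[of m] by blast
      obtain v where v: "sorted_word v" "set v \<subseteq> insert (n, T) (set w)" "word v Z"
        using Cons.IH[OF Z(2)] Cons.prems by auto
      have "word ((m, U) # v) X" using Z v unfolding word_Cons by blast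
      moreover have "sorted_word ((m, U) # v)" using v Cons.prems a False by (auto dest: subsetD)
      ultimately show ?thesis using v a by (intro exI[of _ "(m, U) # v"]) auto
    qed
  qed
qed

lemma word_sort:
  assumes "word w X" "snd ` set w \<subseteq> Sim C H"
  shows "\<exists>v. sorted_word v \<and> set v \<subseteq> set w \<and> word v X"
  using assms
proof (induction w arbitrary: X)
  case Nil
  then show ?case by auto
next
  case (Cons a w)
  obtain n T where a: "a = (n, T)" by (cases a)
  obtain Y where Y: "tri (shz n T) X Y" "word w Y" using Cons.prems(1) unfolding a word_Cons by blast
  obtain v where v: "sorted_word v" "set v \<subseteq> set w" "word v Y" using Cons.IH[OF Y(2)] Cons.prems by auto
  have "word ((n, T) # v) X" using Y v unfolding word_Cons by blast
  moreover have "T \<in> Sim C H" "snd ` set v \<subseteq> Sim C H" using Cons.prems a v by auto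
  ultimately obtain u where "sorted_word u" "set u \<subseteq> insert (n, T) (set v)" "word u X"
    using word_insert[OF _ v(1)] by blast
  then show ?case using a v by (intro exI[of _ u]) auto
qed

lemma sorted_word_cut:
  assumes "sorted_word w"
  obtains w1 w2 where "w = w1 @ w2" "\<forall>a\<in>set w1. k \<le> fst a" "\<forall>a\<in>set w2. fst a < k" "sorted_word w1" "sorted_word w2"
proof
  let ?w1 = "takeWhile (\<lambda>a. k \<le> fst a) w" and ?w2 = "dropWhile (\<lambda>a. k \<le> fst a) w"
  show "w = ?w1 @ ?w2" by simp
  show "\<forall>a\<in>set ?w1. k \<le> fst a" by (auto dest: set_takeWhileD)
  have "sorted_word (?w1 @ ?w2)" using assms by simp
  then show s: "sorted_word ?w1" "sorted_word ?w2" by (auto simp only: sorted_wrt_append)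
  show "\<forall>a\<in>set ?w2. fst a < k"
  proof (cases ?w2)
    case Nil
    then show ?thesis by (simp only: list.set ball_empty)
  next
    case (Cons b u)
    have "\<not> k \<le> fst b" using Cons hd_dropWhile[of "\<lambda>a. k \<le> fst a" w] by auto
    moreover have "sorted_word (b # u)" using s(2) Cons by simp
    ultimately show ?thesis unfolding Cons by auto
  qed
qed

text \<open>Sorting a word by degree and cutting it at \<open>k\<close> truncates the object, without using new letters.\<close>

lemma word_trunc:
  assumes "word w X" "snd ` set w \<subseteq> Sim C H"
  obtains w1 w2 X1 X2 where "tri X1 X X2" "word w1 X1" "word w2 X2" "set w1 \<subseteq> set w" "set w2 \<subseteq> set w"
    "\<forall>a\<in>set w1. k \<le> fst a" "\<forall>a\<in>set w2. fst a < k" "sorted_word w1" "sorted_word w2"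
proof -
  obtain v where v: "sorted_word v" "set v \<subseteq> set w" "word v X" using word_sort[OF assms] by blast
  obtain w1 w2 where w: "v = w1 @ w2" "\<forall>a\<in>set w1. k \<le> fst a" "\<forall>a\<in>set w2. fst a < k" "sorted_word w1" "sorted_word w2"
    using sorted_word_cut[OF v(1)] .
  obtain X1 X2 where "tri X1 X X2" "word w1 X1" "word w2 X2" using word_appendE v(3) w(1) by blast
  then show thesis using that w v by auto
qed

lemma word_hom_left:
  "word w X \<Longrightarrow> Y \<in> Obj C \<Longrightarrow> (\<And>n T. (n, T) \<in> set w \<Longrightarrow> hom_zero C (shz n T) Y) \<Longrightarrow> hom_zero C X Y"
  unfolding word_def by (rule filt_hom_left) auto

lemma word_hom_right:
  "word w X \<Longrightarrow> Y \<in> Obj C \<Longrightarrow> (\<And>n T. (n, T) \<in> set w \<Longrightarrow> hom_zero C Y (shz n T)) \<Longrightarrow> hom_zero C Y X"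
  unfolding word_def by (rule filt_hom_right) auto

lemma word_P: assumes "word w X" "snd ` set w \<subseteq> Sim C H" "\<forall>a\<in>set w. 0 \<le> fst a" shows "X \<in> P"
  using assms(1) unfolding word_def
  by (rule filt_closed) (use assms Sim_H H_P in \<open>force intro: P_zero P_ext shz_P'\<close>)+

lemma word_R: assumes "word w X" "snd ` set w \<subseteq> Sim C H" "\<forall>a\<in>set w. fst a < 0" shows "X \<in> R"
  using assms(1) unfolding word_def
  by (rule filt_closed) (use assms Sim_H H_N in \<open>force intro: R_zero R_ext shz_R\<close>)+

lemma word_H: assumes "word w X" "snd ` set w \<subseteq> Sim C H" "\<forall>a\<in>set w. fst a = 0" shows "X \<in> H"
  using assms(1) unfolding word_def
  by (rule filt_closed) (use assms Sim_H in \<open>force intro: H_zero H_ext\<close>)+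

lemma H_word: assumes "X \<in> H" obtains w where "word w X" "snd ` set w \<subseteq> Sim C H" "\<forall>a\<in>set w. fst a = 0"
proof -
  obtain L where L: "set L \<subseteq> Sim C H" "filt L X" using H_filtE[OF assms] .
  have "map (\<lambda>(n, T). shz n T) (map (Pair 0) L) = L" by (simp add: comp_def)
  then have "word (map (Pair 0) L) X" using L by (simp add: word_def)
  moreover have "snd ` set (map (Pair 0) L) \<subseteq> Sim C H" using L by force
  ultimately show thesis using that[of "map (Pair 0) L"] by auto
qed

text \<open>
  Induction on the number of degrees in which \<open>X\<close> lives: the cohomology in degree \<open>0\<close> is split off at the top.
\<close>

lemma P_word_aux:
  "X \<in> P \<Longrightarrow> shz (- int n) X \<in> R \<Longrightarrow> \<exists>w. word w X \<and> snd ` set w \<subseteq> Sim C H"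
proof (induction n arbitrary: X)
  case 0
  then have "hom_zero C X X" using PR by simp
  then show ?case using hom_zero_self word_Nil by (intro exI[of _ "[]"]) auto
next
  case (Suc n)
  obtain A B where AB: "tri (Sh C A) X B" "A \<in> P" "B \<in> H" using trunc_P[OF Suc.prems(1)] .
  have o: "A \<in> Obj C" "X \<in> Obj C" "B \<in> Obj C" using AB P_obj H_obj Suc by auto
  let ?k = "- int (Suc n)"
  have "tri (shz ?k (Sh C A)) (shz ?k X) (shz ?k B)" using tri_shz AB o by simp
  moreover have "shz ?k (Sh C A) = shz (- int n) A" using shz_shz[of A ?k 1] shz_1 o by simp
  ultimately have "shz (- int n) A \<in> R" using R_fibre Suc.prems(2) shz_N[of B ?k] H_N AB by simp
  then obtain w where w: "word w A" "snd ` set w \<subseteq> Sim C H" using Suc.IH AB by blast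
  have "snd ` set w \<subseteq> Obj C" using w(2) Sim_H H_obj by blast
  then have "word (map (\<lambda>(n, T). (n + 1, T)) w) (Sh C A)" using word_shz[OF w(1), of 1] shz_1 o by simp
  moreover obtain v where v: "word v B" "snd ` set v \<subseteq> Sim C H" using H_word AB by metis
  ultimately have "word (map (\<lambda>(n, T). (n + 1, T)) w @ v) X" using word_append AB by blast
  moreover have "snd ` set (map (\<lambda>(n, T). (n + 1, T)) w @ v) \<subseteq> Sim C H" using w v by force
  ultimately show ?case by blast
qed

lemma word_ex: assumes X: "X \<in> Obj C" obtains w where "word w X" "snd ` set w \<subseteq> Sim C H"
proof -
  obtain m where "(Sh C ^^ m) X \<in> P" using bts X by (auto simp: bounded_t_structure_def)
  then have P: "shz (int m) X \<in> P" by (simp add: shz_of_nat)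
  obtain n Y where Y: "Y \<in> R" "X = shz (int n) Y" using bts X by (auto simp: bounded_t_structure_def R_def shz_of_nat)
  have "shz (- int (n + m)) (shz (int m) X) = Y" using Y shz_shz R_obj by simp
  then obtain w where w: "word w (shz (int m) X)" "snd ` set w \<subseteq> Sim C H" using P_word_aux[OF P, of "n + m"] Y by auto
  have "snd ` set w \<subseteq> Obj C" using w(2) Sim_H H_obj by blast
  then have "word (map (\<lambda>(n, T). (n + - int m, T)) w) (shz (- int m) (shz (int m) X))" using word_shz[OF w(1), of "- int m"] by simp
  moreover have "shz (- int m) (shz (int m) X) = X" using shz_shz X by simp
  moreover have "snd ` set (map (\<lambda>(n, T). (n + - int m, T)) w) \<subseteq> Sim C H" using w by force
  ultimately show thesis using that by metis
qed

text \<open>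
  The part of negative shift of a sorted word is a truncation in \<open>R\<close>, which vanishes for objects of the aisle.
\<close>

lemma P_word:
  assumes "X \<in> P" obtains w where "word w X" "snd ` set w \<subseteq> Sim C H" "\<forall>a\<in>set w. 0 \<le> fst a"
proof -
  obtain v where v: "word v X" "snd ` set v \<subseteq> Sim C H" using word_ex[OF P_obj[OF assms]] .
  obtain w1 w2 X1 X2 where w: "tri X1 X X2" "word w1 X1" "word w2 X2" "set w1 \<subseteq> set v" "set w2 \<subseteq> set v"
    "\<forall>a\<in>set w1. 0 \<le> fst a" "\<forall>a\<in>set w2. fst a < 0" using word_trunc[OF v, of 0] by metis
  have s: "snd ` set w1 \<subseteq> Sim C H" "snd ` set w2 \<subseteq> Sim C H" using v w by auto
  have X1: "X1 \<in> P" using word_P[OF w(2) s(1)] w by blast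
  have X2: "X2 \<in> R" using word_R[OF w(3) s(2)] w by blast
  have "retract X2 (Sh C X1)" using retract_of_zero_second[OF w(1) PR[OF assms X2]] .
  then have "zero_obj C X2" using hom_zero_retract_left[OF _ PR[OF P_sh[OF X1] X2]] hom_zero_self by blast
  then have "word w1 X" using tri_iso_of_zero_right[OF w(1)] word_iso w by blast
  then show thesis using that s w by blast
qed

end


section \<open>Thick subcategories\<close>

context pretriangulated_category
begin

lemma retract_unsh: assumes "retract (Sh C X) (Sh C B)" "X \<in> Obj C" "B \<in> Obj C" shows "retract X B"
proof -
  obtain i r where ir: "i \<in> Arr C" "r \<in> Arr C" "Dom C i = Sh C X" "Cod C i = Sh C B" "Dom C r = Sh C B" "Cod C r = Sh C X"
     "r \<cdot> i = Ide C (Sh C X)" using retractE[OF assms(1)] by metis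
  obtain i' where i': "i' \<in> Arr C" "Dom C i' = X" "Cod C i' = B" "i = ShA C i'" using sha_surj[OF ir(1,3,4) assms(2,3)] .
  obtain r' where r': "r' \<in> Arr C" "Dom C r' = B" "Cod C r' = X" "r = ShA C r'" using sha_surj[OF ir(2,5,6) assms(3,2)] .
  have "r' \<cdot> i' = Ide C X" by (rule sha_inj) (use i' r' ir(7) assms in auto)
  then show ?thesis using i' r' unfolding retract_def by blast
qed

text \<open>
  The retraction and its section are morphisms over \<open>Z\<close> between \<open>X\<close> and \<open>B\<close>, so they lift to the fibres. The
  lifted composite need not be the identity, but by the five lemma it is an isomorphism.
\<close>

lemma fibre_retract:
  assumes T: "tri X' X Z" and "retract X B" obtains B' where "tri B' B Z" "retract X' B'"
proof -
  obtain f g h where t: "(f, g, h) \<in> Tri C" "f \<in> Arr C" "g \<in> Arr C" "h \<in> Arr C"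
    "Dom C f = X'" "Cod C f = X" "Dom C g = X" "Cod C g = Z" "Dom C h = Z" "Cod C h = Sh C X'" "X' \<in> Obj C" "X \<in> Obj C" "Z \<in> Obj C"
    using triE[OF T] by metis
  obtain i r where ir: "i \<in> Arr C" "r \<in> Arr C" "Dom C i = X" "Cod C i = B" "Dom C r = B" "Cod C r = X"
     "r \<cdot> i = Ide C X" using retractE[OF assms(2)] by metis
  have gr: "g \<cdot> r \<in> Arr C" "Dom C (g \<cdot> r) = B" "Cod C (g \<cdot> r) = Z" using t ir by auto
  obtain f' h' where F: "(f', g \<cdot> r, h') \<in> Tri C" using fibre_ex[OF gr(1)] by metis
  note t' = triD[OF F]
  have h': "Dom C h' = Z" using t'(5) gr by simp
  have R: "(g, h, neg (ShA C f)) \<in> Tri C" and R': "(g \<cdot> r, h', neg (ShA C f')) \<in> Tri C"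
    using tri_rotI[OF t(1)] tri_rotI[OF F] by auto
  have e1: "Ide C Z \<cdot> g = (g \<cdot> r) \<cdot> i" using t ir by simp
  have e2: "Ide C Z \<cdot> (g \<cdot> r) = g \<cdot> r" using gr by simp
  have s: "Dom C (neg (ShA C f)) = Sh C X'" "Dom C (neg (ShA C f')) = Sh C (Dom C f')" using t t' by auto
  obtain c where c: "c \<in> Arr C" "Dom C c = Sh C X'" "Cod C c = Sh C (Dom C f')" "c \<cdot> h = h' \<cdot> Ide C Z"
    "ShA C i \<cdot> neg (ShA C f) = neg (ShA C f') \<cdot> c"
    by (rule TR3_arr[OF R R' ir(1) _ _ _ _ _ e1]) (use t ir gr h' s in auto)
  obtain d where d: "d \<in> Arr C" "Dom C d = Sh C (Dom C f')" "Cod C d = Sh C X'" "d \<cdot> h' = h \<cdot> Ide C Z"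
    "ShA C r \<cdot> neg (ShA C f') = neg (ShA C f) \<cdot> d"
    by (rule TR3_arr[OF R' R ir(2) _ _ _ _ _ e2]) (use t ir gr h' s in auto)
  have "is_iso C (d \<cdot> c)"
  proof (rule five_lemma[OF R R, of "Ide C X" "Ide C Z"])
    show "(d \<cdot> c) \<cdot> h = h \<cdot> Ide C Z" using c d t t' h' by simp
    have "ShA C r \<cdot> (ShA C i \<cdot> neg (ShA C f)) = ShA C r \<cdot> (neg (ShA C f') \<cdot> c)" using c by simp
    also have "\<dots> = (neg (ShA C f) \<cdot> d) \<cdot> c"
      by (rule comp_cancel[OF d(5)]) (use c d ir t t' gr in auto)
    finally have x: "ShA C r \<cdot> (ShA C i \<cdot> neg (ShA C f)) = (neg (ShA C f) \<cdot> d) \<cdot> c" .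
    have "ShA C r \<cdot> (ShA C i \<cdot> neg (ShA C f)) = ShA C (Ide C X) \<cdot> neg (ShA C f)"
      by (rule comp_cancel) (use ir t in \<open>auto simp flip: sha_comp\<close>)
    then show "ShA C (Ide C X) \<cdot> neg (ShA C f) = neg (ShA C f) \<cdot> (d \<cdot> c)" using x c(1-3) d(1-3) t by simp
  qed (use t c d in \<open>auto simp: in_hom\<close>)
  then obtain e where e: "e \<in> Arr C" "Dom C e = Sh C X'" "Cod C e = Sh C X'" "e \<cdot> (d \<cdot> c) = Ide C (Sh C X')"
    using is_isoE[of "d \<cdot> c"] c d by (metis comp_arr(2,3))
  have "retract (Sh C X') (Sh C (Dom C f'))" unfolding retract_def
    by (rule exI[of _ c], rule exI[of _ "e \<cdot> d"]) (use c(1-3) d(1-3) e in auto)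
  then have "retract X' (Dom C f')" using retract_unsh t t' by simp
  moreover have "tri (Dom C f') B Z" using triI[OF F] t'(4) gr by simp
  ultimately show thesis using that by blast
qed

end

locale thick_in = pretriangulated_category C for C :: "('o, 'm, 'k::field, 'z) tri_cat_scheme" (structure) +
  fixes V :: "'o set"
  assumes thick_V: "thick_subcategory C V"
begin

lemma V_obj: "X \<in> V \<Longrightarrow> X \<in> Obj C" using thick_V by (auto simp: thick_subcategory_def)

lemma V_sh: "X \<in> Obj C \<Longrightarrow> Sh C X \<in> V \<longleftrightarrow> X \<in> V" using thick_V by (auto simp: thick_subcategory_def)

lemma V_cone: "tri X Y Z \<Longrightarrow> X \<in> V \<Longrightarrow> Y \<in> V \<Longrightarrow> Z \<in> V"
  using thick_V unfolding thick_subcategory_def tri_def by blast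

lemma V_mid: assumes "tri X Y Z" "X \<in> V" "Z \<in> V" shows "Y \<in> V"
proof -
  obtain Z' where "Z' \<in> Obj C" "Z = Sh C Z'" "tri Z' X Y" using tri_unrot_ex[OF assms(1)] .
  then show ?thesis using V_cone V_sh assms by blast
qed

lemma V_fibre: "tri X Y Z \<Longrightarrow> Y \<in> V \<Longrightarrow> Z \<in> V \<Longrightarrow> X \<in> V"
  using V_cone[OF tri_rot] V_sh tri_obj by blast

lemma V_zero: assumes "zero_obj C X" shows "X \<in> V"
proof -
  obtain Z where "Z \<in> V" "zero_obj C Z" using thick_V by (auto simp: thick_subcategory_def)
  then show ?thesis using V_cone[OF tri_zero_right[OF _ assms]] V_obj by blast
qed

lemma V_iso: assumes "X \<in> V" "isomorphic C X Y" shows "Y \<in> V"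
proof -
  obtain Z where Z: "zero_obj C Z" using ex_zero by blast
  have "tri X Y Z" using tri_iso_mid[OF tri_zero_right[OF V_obj[OF assms(1)] Z] assms(2)] .
  then show ?thesis using V_mid assms V_zero Z by blast
qed

lemma V_biproduct: "B \<in> V \<Longrightarrow> is_biproduct C X Y B \<Longrightarrow> X \<in> V"
  using thick_V unfolding thick_subcategory_def by blast

lemma V_filt: "filt L X \<Longrightarrow> set L \<subseteq> V \<Longrightarrow> X \<in> V"
  by (rule filt_closed) (auto intro: V_zero V_mid)

lemma V_shz: "X \<in> Obj C \<Longrightarrow> shz n X \<in> V \<longleftrightarrow> X \<in> V"
  by (induction n rule: shz_ind) (use V_sh[of "shz _ X"] in \<open>auto simp: Sh_shz\<close>)

end

section \<open>The thick subcategory generated by simple objects\<close>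

text \<open>
  The set \<open>SK\<close> consists of the simple objects of the Serre subcategory that generates the kernel of the quotient.
\<close>

locale thick_simples = length_heart C P for C :: "('o, 'm, 'k::field, 'z) tri_cat_scheme" (structure) and P +
  fixes SK :: "'o set"
  assumes SK_Sim: "SK \<subseteq> Sim C H"
    and SK_iso: "T \<in> SK \<Longrightarrow> isomorphic C T T' \<Longrightarrow> T' \<in> SK"
begin

lemma SK_obj: "T \<in> SK \<Longrightarrow> T \<in> Obj C" using SK_Sim Sim_H H_obj by blast

text \<open>
  In the language of words: the objects whose cohomology objects have all their composition factors in \<open>SK\<close>.
\<close>

definition W :: "'o set" where "W = {X. \<exists>w. snd ` set w \<subseteq> SK \<and> word w X}"

lemma W_I: "word w X \<Longrightarrow> snd ` set w \<subseteq> SK \<Longrightarrow> X \<in> W" by (auto simp: W_def)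

lemma W_obj: "X \<in> W \<Longrightarrow> X \<in> Obj C" by (auto simp: W_def word_obj)

lemma W_zero: "zero_obj C X \<Longrightarrow> X \<in> W" using W_I[of "[]"] word_Nil by auto

lemma W_ext: assumes "tri X Y Z" "X \<in> W" "Z \<in> W" shows "Y \<in> W"
proof -
  obtain w1 w2 where "word w1 X" "snd ` set w1 \<subseteq> SK" "word w2 Z" "snd ` set w2 \<subseteq> SK" using assms by (auto simp: W_def)
  then show ?thesis using W_I[OF word_append[OF assms(1)]] by (simp add: image_Un)
qed

lemma W_shz: assumes "X \<in> W" shows "shz k X \<in> W"
proof -
  obtain w where w: "word w X" "snd ` set w \<subseteq> SK" using assms by (auto simp: W_def)
  have "word (map (\<lambda>(n, T). (n + k, T)) w) (shz k X)" using word_shz[OF w(1)] w(2) SK_obj by blast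
  moreover have "snd ` set (map (\<lambda>(n, T). (n + k, T)) w) \<subseteq> SK" using w(2) by force
  ultimately show ?thesis by (rule W_I)
qed

lemma W_sh_iff: assumes "X \<in> Obj C" shows "Sh C X \<in> W \<longleftrightarrow> X \<in> W"
proof
  assume "Sh C X \<in> W"
  then have "shz (-1) (Sh C X) \<in> W" by (rule W_shz)
  moreover have "shz (-1) (Sh C X) = X" using shz_shz[OF assms, of "-1" 1] shz_1[OF assms] by simp
  ultimately show "X \<in> W" by simp
qed (use W_shz[of X 1] shz_1[OF assms] in auto)

lemma W_cone: "tri X Y Z \<Longrightarrow> X \<in> W \<Longrightarrow> Y \<in> W \<Longrightarrow> Z \<in> W"
  using W_ext[OF tri_rot] W_sh_iff tri_obj by blast

text \<open>
  In distinct degrees this is the orthogonality of the t-structure, in equal degrees Schur's lemma: an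
  isomorphism \<open>U \<cong> T\<close> would put \<open>T\<close> into \<open>SK\<close>.
\<close>

lemma SK_hom_zero:
  assumes "U \<in> SK" "T \<in> Sim C H" "T \<notin> SK" "n \<le> m" shows "hom_zero C (shz m U) (shz n T)" and "n = m \<Longrightarrow> hom_zero C (shz n T) (shz m U)"
proof -
  have U: "U \<in> Sim C H" using assms SK_Sim by blast
  have o: "U \<in> Obj C" "T \<in> Obj C" using U assms Sim_H H_obj by auto
  show "hom_zero C (shz m U) (shz n T)"
  proof (cases "n = m")
    case True
    show ?thesis
    proof (rule hom_zeroI)
      fix f assume f: "f \<in> Arr C" "Dom C f = shz m U" "Cod C f = shz n T"
      show "f = Null C (shz m U) (shz n T)"
      proof (rule ccontr)
        assume "f \<noteq> Null C (shz m U) (shz n T)"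
        then have "is_iso C f" using schur_shz[OF U assms(2), of f n] f True by simp
        then have "isomorphic C (shz n U) (shz n T)" using isomorphicI f True by blast
        then have "isomorphic C U T" using isomorphic_shz o by blast
        then show False using SK_iso assms by blast
      qed
    qed (use o in auto)
  next
    case False
    then show ?thesis using letters_hom_zero[of U T n m] U assms Sim_H by auto
  qed
  show "hom_zero C (shz n T) (shz m U)" if nm: "n = m"
  proof (rule hom_zeroI)
    fix f assume f: "f \<in> Arr C" "Dom C f = shz n T" "Cod C f = shz m U"
    show "f = Null C (shz n T) (shz m U)"
    proof (rule ccontr)
      assume "f \<noteq> Null C (shz n T) (shz m U)"
      then have "is_iso C f" using schur_shz[OF assms(2) U, of f n] f nm by simp
      then have "isomorphic C (shz n T) (shz n U)" using isomorphicI f nm by blast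
      then have "isomorphic C T U" using isomorphic_shz o by blast
      then show False using SK_iso assms isomorphic_sym by blast
    qed
  qed (use o in auto)
qed

text \<open>
  The last letter \<open>T[n]\<close> of a sorted word receives a nonzero map. A retract of an object of
  \<open>W\<close> only involves the letters of degree at least \<open>n\<close>, which map to zero in \<open>T[n]\<close> unless
  \<open>T\<close> is one of the generators.
\<close>

lemma retract_last_letter:
  assumes X: "word (w @ [(n, T)]) X" "sorted_word (w @ [(n, T)])" "snd ` set (w @ [(n, T)]) \<subseteq> Sim C H"
    and r: "retract X B" and B: "B \<in> W"
  shows "T \<in> SK"
proof (rule ccontr)
  assume TK: "T \<notin> SK"
  have T: "T \<in> Sim C H" using X by simp
  have To: "T \<in> Obj C" using T Sim_H H_obj by blast
  have ge: "n \<le> m \<and> U \<in> Sim C H" if "(m, U) \<in> set (w @ [(n, T)])" for m U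
    using X(2,3) that by (auto simp: sorted_wrt_append)
  obtain v where v: "word v B" "snd ` set v \<subseteq> SK" using B by (auto simp: W_def)
  have vs: "snd ` set v \<subseteq> Sim C H" using v SK_Sim by blast
  obtain v1 v2 B1 B2 where B12: "tri B1 B B2" "word v1 B1" "word v2 B2" "set v1 \<subseteq> set v" "set v2 \<subseteq> set v"
    "\<forall>a\<in>set v1. n \<le> fst a" "\<forall>a\<in>set v2. fst a < n" using word_trunc[OF v(1) vs, of n] by metis
  have "hom_zero C X B2"
  proof (rule word_hom_right[OF B12(3) word_obj[OF X(1)]])
    fix k U assume k: "(k, U) \<in> set v2"
    then have "k < n" "(k, U) \<in> set v" using B12 by auto
    then have kU: "k < n" "U \<in> Sim C H" using vs by force+
    show "hom_zero C X (shz k U)"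
    proof (rule word_hom_left[OF X(1)])
      show "shz k U \<in> Obj C" using kU Sim_H H_obj by simp
      fix m U' assume "(m, U') \<in> set (w @ [(n, T)])"
      then show "hom_zero C (shz m U') (shz k U)" using ge kU letters_hom_zero Sim_H by (meson order.strict_trans2)
    qed
  qed
  obtain j p q where J: "(j, p, q) \<in> Tri C" "j \<in> Arr C" "p \<in> Arr C" "Dom C j = B1" "Cod C j = B" "Dom C p = B" "Cod C p = B2"
    using triE[OF B12(1)] by metis
  obtain i r where ir: "i \<in> Arr C" "r \<in> Arr C" "Dom C i = X" "Cod C i = B" "Dom C r = B" "Cod C r = X"
     "r \<cdot> i = Ide C X" using retractE[OF r] by metis
  have "p \<cdot> i = Null C X B2" by (rule hom_zeroD[OF \<open>hom_zero C X B2\<close>]) (use J ir in auto)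
  then obtain i' where i': "i' \<in> Arr C" "Dom C i' = X" "Cod C i' = B1" "j \<cdot> i' = i"
    using weak_ker[OF J(1), of i] J ir by auto
  have "retract X B1" unfolding retract_def
    by (rule exI[of _ i'], rule exI[of _ "r \<cdot> j"]) (use i' ir J in auto)
  moreover have "hom_zero C B1 (shz n T)"
  proof (rule word_hom_left[OF B12(2)])
    show "shz n T \<in> Obj C" using To by simp
    fix m U assume "(m, U) \<in> set v1"
    then have "n \<le> m" "(m, U) \<in> set v" using B12 by auto
    then have "n \<le> m" "U \<in> SK" using v by force+
    then show "hom_zero C (shz m U) (shz n T)" using SK_hom_zero(1) T TK by blast
  qed
  ultimately have z: "hom_zero C X (shz n T)" using hom_zero_retract_left by blast
  obtain X' Z where Z: "tri X' X Z" "word w X'" "word [(n, T)] Z" using word_appendE[OF X(1)] .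
  have iso: "isomorphic C (shz n T) Z" using Z(3) filt_singleD by (simp add: word_def)
  have "hom_zero C X Z" using hom_zero_iso[OF isomorphic_refl iso z] word_obj[OF X(1)] by blast
  then have rZ: "retract Z (Sh C X')" using retract_of_zero_second[OF Z(1)] by blast
  have "hom_zero C (shz 1 X') (shz n T)"
  proof (rule word_hom_left[OF word_shz[OF Z(2)]])
    show "snd ` set w \<subseteq> Obj C" using X(3) Sim_H H_obj by auto
    show "shz n T \<in> Obj C" using To by simp
    fix m U assume "(m, U) \<in> set (map (\<lambda>(n, T). (n + 1, T)) w)"
    then have "(m - 1, U) \<in> set w" by auto
    then have "n < m" "U \<in> H" using ge[of "m - 1" U] Sim_H by auto
    then show "hom_zero C (shz m U) (shz n T)" using letters_hom_zero T Sim_H by blast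
  qed
  then have "hom_zero C (Sh C X') (shz n T)" using shz_1 tri_obj(1)[OF Z(1)] by simp
  then have "hom_zero C (Sh C X') Z" using hom_zero_iso[OF isomorphic_refl iso] tri_obj(1)[OF Z(1)] by simp
  then have "zero_obj C Z" using rZ hom_zero_retract_left hom_zero_self by blast
  then have "zero_obj C (shz n T)" using zero_obj_iso isomorphic_sym iso by blast
  then show False using zero_obj_shz To T Sim_nonzero by blast
qed

text \<open>
  The letters of \<open>X\<close> are removed one at a time from the top: each is a generator by the previous lemma, and what
  remains is again a retract of an object of \<open>W\<close>.
\<close>

lemma word_retract_W:
  "word w X \<Longrightarrow> sorted_word w \<Longrightarrow> snd ` set w \<subseteq> Sim C H \<Longrightarrow> retract X B \<Longrightarrow> B \<in> W \<Longrightarrow> X \<in> W"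
proof (induction w arbitrary: X B rule: rev_induct)
  case Nil
  then show ?case using word_Nil W_zero by blast
next
  case (snoc a w)
  obtain n T where a: "a = (n, T)" by (cases a)
  have T: "T \<in> SK" using retract_last_letter snoc.prems unfolding a by blast
  obtain X' Z where Z: "tri X' X Z" "word w X'" "word [(n, T)] Z" using word_appendE snoc.prems(1) unfolding a by blast
  have ZW: "Z \<in> W" using W_I[OF Z(3)] T by simp
  obtain B' where B': "tri B' B Z" "retract X' B'" using fibre_retract[OF Z(1) snoc.prems(4)] .
  have "Sh C B' \<in> W" using W_cone[OF tri_rot[OF tri_rot[OF B'(1)]]] W_cone[OF tri_rot[OF B'(1)]] snoc.prems(5) ZW by blast
  then have "B' \<in> W" using W_sh_iff tri_obj(1)[OF B'(1)] by blast
  moreover have "sorted_word w" "snd ` set w \<subseteq> Sim C H" using snoc.prems by (auto simp: sorted_wrt_append)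
  ultimately have "X' \<in> W" using snoc.IH Z(2) B'(2) by blast
  then show ?case using W_ext[OF Z(1)] ZW by blast
qed

lemma W_retract: assumes "retract X B" "B \<in> W" shows "X \<in> W"
proof -
  have "X \<in> Obj C" using assms(1) by (rule retractE)
  then obtain v where v: "word v X" "snd ` set v \<subseteq> Sim C H" by (rule word_ex)
  then obtain w where "sorted_word w" "set w \<subseteq> set v" "word w X" using word_sort by blast
  then show ?thesis using word_retract_W[of w X B] assms v by blast
qed

lemma W_simple: assumes "T \<in> Sim C H" "T \<in> W" shows "T \<in> SK"
proof -
  have T: "T \<in> Obj C" using assms W_obj by blast
  have "retract T T" using retract_of_iso isomorphic_refl T by blast
  then show ?thesis using retract_last_letter[of "[]" 0 T T T] word_single[OF T, of 0] assms by simp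
qed

lemma thick_W: "thick_subcategory C W"
  unfolding thick_subcategory_def
proof (intro conjI allI ballI impI)
  show "W \<subseteq> Obj C" using W_obj by blast
  show "\<exists>Z\<in>W. zero_obj C Z" using ex_zero W_zero by blast
  show "Sh C X \<in> W \<longleftrightarrow> X \<in> W" if "X \<in> Obj C" for X using W_sh_iff that .
  show "Cod C g \<in> W" if *: "(f, g, h) \<in> Tri C \<and> Dom C f \<in> W \<and> Cod C f \<in> W" for f g h
    by (rule W_cone[OF triI]) (use * in auto)
  show "X \<in> W" if "B \<in> W \<and> is_biproduct C X Y B" for X Y B
    using W_retract retract_biproduct(1) that by blast
qed

text \<open>
  Closure of \<open>W\<close> under summands gives one inclusion. The other one holds because a word is an iterated extension
  of shifts of generators.
\<close>

theorem thick_eq_W: assumes "SK \<subseteq> K" "K \<subseteq> W" shows "thick C K = W"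
proof
  show "thick C K \<subseteq> W" using thick_W assms by (auto simp: thick_def)
  show "W \<subseteq> thick C K"
    unfolding thick_def
  proof (intro subsetI InterI)
    fix X V assume X: "X \<in> W" and V: "V \<in> {V. thick_subcategory C V \<and> K \<subseteq> V}"
    interpret V: thick_in C V using V by unfold_locales auto
    obtain w where w: "word w X" "snd ` set w \<subseteq> SK" using X by (auto simp: W_def)
    show "X \<in> V"
    proof (rule V.V_filt)
      show "filt (map (\<lambda>(n, T). shz n T) w) X" using w by (simp add: word_def)
      have "shz n T \<in> V" if nT: "(n, T) \<in> set w" for n T
      proof -
        have "T \<in> SK" using w nT by force
        then show ?thesis using V.V_shz SK_obj assms V by blast
      qed
      then show "set (map (\<lambda>(n, T). shz n T) w) \<subseteq> V" by auto
    qed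
  qed
qed

end


section \<open>The calculus of roofs\<close>

text \<open>
  A map of the quotient is a class of roofs \<open>X \<leftarrow> Z \<rightarrow> Y\<close> whose left leg is inverted. Everything follows
  from three closure properties of the inverted maps: they can be composed and cancelled, pulled back along
  arbitrary maps, and they turn an equality \<open>t f = t g\<close> into an equality \<open>f u = g u\<close>.
\<close>

locale verdier = triangulated_category C for C :: "('o, 'm, 'k::field, 'z) tri_cat_scheme" (structure) +
  fixes V :: "'o set"
  assumes thick: "thick_subcategory C V"

sublocale verdier \<subseteq> thick_in C V
  by unfold_locales (rule thick)

context verdier
begin

abbreviation I :: "'m set" where "I \<equiv> inverted C V"

lemma I_arr [simp]: "s \<in> I \<Longrightarrow> s \<in> Arr C"
  by (auto simp: inverted_def dest: triD)

lemma I_cone: assumes "s \<in> I" "(s, g, h) \<in> Tri C" shows "Cod C g \<in> V"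
proof -
  obtain g' h' where T: "(s, g', h') \<in> Tri C" "Cod C g' \<in> V" using assms by (auto simp: inverted_def)
  note t = triD[OF T(1)] triD[OF assms(2)]
  have i: "Ide C (Dom C s) \<in> hom C (Dom C s) (Dom C s)" "Ide C (Dom C g') \<in> hom C (Dom C g') (Dom C g)" 
    "is_iso C (Ide C (Dom C s))" "is_iso C (Ide C (Dom C g'))" "Ide C (Dom C g') \<cdot> s = s \<cdot> Ide C (Dom C s)"
    using t(1,2,4,10) by (simp_all add: in_hom)
  obtain c where c: "c \<in> Arr C" "Dom C c = Dom C h'" "Cod C c = Dom C h" "is_iso C c"
    using tri_iso_extend[OF T(1) assms(2) i(1,3,2,4,5)] by blast
  then have "isomorphic C (Cod C g') (Cod C g)" using isomorphicI t by simp
  then show ?thesis using V_iso T by blast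
qed

lemma I_I: "(s, g, h) \<in> Tri C \<Longrightarrow> Cod C g \<in> V \<Longrightarrow> s \<in> I"
  by (auto simp: inverted_def)

lemma I_iso: assumes "is_iso C s" shows "s \<in> I"
proof -
  obtain g h where T: "(s, g, h) \<in> Tri C" using TR1_cone is_iso_arr assms by blast
  show ?thesis using I_I[OF T] V_zero zero_of_iso_first[OF T assms] by blast
qed

lemma I_ide [simp]: "X \<in> Obj C \<Longrightarrow> Ide C X \<in> I" by (rule I_iso) simp

text \<open>
  The octahedron on \<open>s\<close> and \<open>t\<close> relates their cones to that of \<open>t s\<close>, so closure properties of \<open>V\<close> become ones of the inverted maps.
\<close>

lemma cones_ex:
  assumes "s \<in> Arr C" "t \<in> Arr C" "Cod C s = Dom C t"
  obtains A B E where "tri A B E" "s \<in> I \<longleftrightarrow> A \<in> V" "t \<cdot> s \<in> I \<longleftrightarrow> B \<in> V" "t \<in> I \<longleftrightarrow> E \<in> V"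
proof -
  obtain p1 d1 where 1: "(s, p1, d1) \<in> Tri C" using TR1_cone assms by blast
  obtain p2 d2 where 2: "(t \<cdot> s, p2, d2) \<in> Tri C" using TR1_cone[of "t \<cdot> s"] assms by auto
  obtain p3 d3 where 3: "(t, p3, d3) \<in> Tri C" using TR1_cone assms by blast
  obtain a b where ab: "Dom C a = Cod C p1" "Cod C a = Cod C p2" "Cod C b = Cod C p3" "(a, b, ShA C p1 \<cdot> d3) \<in> Tri C"
    by (rule TR4_arr[OF assms 1 2 3])
  have *: "s \<in> I \<longleftrightarrow> Cod C p1 \<in> V" "t \<cdot> s \<in> I \<longleftrightarrow> Cod C p2 \<in> V" "t \<in> I \<longleftrightarrow> Cod C p3 \<in> V"
    using I_cone[OF _ 1] I_I[OF 1] I_cone[OF _ 2] I_I[OF 2] I_cone[OF _ 3] I_I[OF 3] by blast+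
  show thesis using that[OF _ *] triI[OF ab(4)] ab(1-3) by simp
qed

lemma I_comp [simp]: "s \<in> I \<Longrightarrow> t \<in> I \<Longrightarrow> Cod C s = Dom C t \<Longrightarrow> t \<cdot> s \<in> I"
  by (rule cones_ex[of s t]) (auto intro: V_mid)

lemma I_right: "t \<cdot> s \<in> I \<Longrightarrow> t \<in> I \<Longrightarrow> s \<in> Arr C \<Longrightarrow> Cod C s = Dom C t \<Longrightarrow> s \<in> I"
  by (rule cones_ex[of s t]) (auto intro: V_fibre)

lemma I_neg: assumes "s \<in> I" shows "neg s \<in> I"
proof -
  have "neg (Ide C (Cod C s)) \<in> I" by (rule I_iso[OF is_iso_neg]) (use assms in simp)
  then have "neg (Ide C (Cod C s)) \<cdot> s \<in> I" using assms by (intro I_comp) auto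
  then show ?thesis using assms by simp
qed

lemma I_sh: assumes "s \<in> Arr C" shows "ShA C s \<in> I \<longleftrightarrow> s \<in> I"
proof -
  obtain g h where T: "(s, g, h) \<in> Tri C" using TR1_cone assms by blast
  have T': "(neg (ShA C s), neg (ShA C g), neg (ShA C h)) \<in> Tri C" using tri_rotI[OF tri_rotI[OF tri_rotI[OF T]]] .
  have c: "Cod C (neg (ShA C g)) = Sh C (Cod C g)" "Cod C g \<in> Obj C" using triD[OF T] by auto
  have "s \<in> I \<longleftrightarrow> Cod C g \<in> V" using I_cone[OF _ T] I_I[OF T] by blast
  moreover have "neg (ShA C s) \<in> I \<longleftrightarrow> Sh C (Cod C g) \<in> V" using I_cone[OF _ T'] I_I[OF T'] c(1) by metis
  moreover have "neg (ShA C s) \<in> I \<longleftrightarrow> ShA C s \<in> I" using I_neg[of "ShA C s"] I_neg[of "neg (ShA C s)"] assms by auto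
  ultimately show ?thesis using V_sh c by simp
qed

text \<open>
  Take for \<open>t'\<close> the fibre of \<open>g f\<close>, where \<open>g\<close> is the map from the target of \<open>t\<close> to its cone: \<open>t\<close> and \<open>t'\<close> then have
  the same cone, and \<open>f t'\<close> lifts along \<open>t\<close> because \<open>g\<close> kills it.
\<close>

lemma ore:
  assumes f: "f \<in> Arr C" and t: "t \<in> I" "Cod C f = Cod C t"
  obtains t' f' where "t' \<in> I" "Cod C t' = Dom C f" "f' \<in> Arr C" "Dom C f' = Dom C t'" "Cod C f' = Dom C t" "f \<cdot> t' = t \<cdot> f'"
proof -
  obtain g h where T: "(t, g, h) \<in> Tri C" using TR1_cone t by force
  note tt = triD[OF T]
  have gf: "g \<cdot> f \<in> Arr C" "Dom C (g \<cdot> f) = Dom C f" "Cod C (g \<cdot> f) = Cod C g" using f t tt by auto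
  obtain t' k where T': "(t', g \<cdot> f, k) \<in> Tri C" using fibre_ex[OF gf(1)] by metis
  note t' = triD[OF T']
  have 1: "t' \<in> I" using I_I[OF T'] gf I_cone[OF t(1) T] by simp
  have ct: "Cod C t' = Dom C f" using t'(4) gf by simp
  have ft: "f \<cdot> t' \<in> Arr C" "Dom C (f \<cdot> t') = Dom C t'" "Cod C (f \<cdot> t') = Dom C g" using f ct t' t tt by auto
  have "g \<cdot> (f \<cdot> t') = (g \<cdot> f) \<cdot> t'" using f ct t' t tt by simp
  also have "\<dots> = Null C (Dom C t') (Cod C (g \<cdot> f))" by (rule tri_comp_zero[OF T'])
  finally have "g \<cdot> (f \<cdot> t') = Null C (Dom C (f \<cdot> t')) (Cod C g)" using ft gf by simp
  then obtain f' where "f' \<in> Arr C" "Dom C f' = Dom C (f \<cdot> t')" "Cod C f' = Dom C t" "t \<cdot> f' = f \<cdot> t'"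
    by (rule weak_ker[OF T ft(1,3)])
  then show thesis using that[of t' f'] 1 ct ft by simp
qed

text \<open>
  The difference of \<open>f\<close> and \<open>g\<close> factors through the fibre \<open>k\<close> of \<open>t\<close>, whose source lies in \<open>V\<close>; the fibre of that
  factor is inverted and equalizes \<open>f\<close> and \<open>g\<close>.
\<close>

lemma equalize:
  assumes t: "t \<in> I" and f: "f \<in> Arr C" "g \<in> Arr C" "Dom C f = Dom C g" "Cod C f = Dom C t" "Cod C g = Dom C t"
    and e: "t \<cdot> f = t \<cdot> g"
  obtains u where "u \<in> I" "Cod C u = Dom C g" "f \<cdot> u = g \<cdot> u"
proof -
  define d where "d = f \<oplus> neg g"
  have d: "d \<in> Arr C" "Dom C d = Dom C g" "Cod C d = Dom C t" using f by (auto simp: d_def)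
  obtain p q where T: "(t, p, q) \<in> Tri C" using TR1_cone t by force
  then obtain k r where K: "(k, t, p) \<in> Tri C" using fibre_ex[of t] t triD[OF T] tri_rot_back by metis
  note kk = triD[OF K] and tt = triD[OF T]
  have "t \<cdot> d = t \<cdot> f \<oplus> neg (t \<cdot> g)" unfolding d_def by (subst comp_add') (use f t in auto)
  then have "t \<cdot> d = Null C (Dom C d) (Cod C t)" using e f d t by simp
  then obtain m where m: "m \<in> Arr C" "Dom C m = Dom C d" "Cod C m = Dom C k" "k \<cdot> m = d"
    using weak_ker[OF K d(1)] d by auto
  obtain u r where U: "(u, m, r) \<in> Tri C" using fibre_ex[OF m(1)] by metis
  note uu = triD[OF U]
  have "Sh C (Dom C k) \<in> V" using I_cone[OF t T] kk by simp
  then have "Dom C k \<in> V" using V_sh kk by simp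
  then have uI: "u \<in> I" using I_I[OF U] m by simp
  have "d \<cdot> u = k \<cdot> (m \<cdot> u)" using m kk uu by (metis comp_assoc')
  also have "\<dots> = Null C (Dom C u) (Dom C t)" using tri_comp_zero[OF U] m(1-3) kk uu d by simp
  finally have "d \<cdot> u = Null C (Dom C u) (Dom C t)" .
  moreover have "d \<cdot> u = f \<cdot> u \<oplus> neg (g \<cdot> u)"
    unfolding d_def by (subst add_comp') (use f uu m d in auto)
  ultimately have "f \<cdot> u = g \<cdot> u" using diff_null_iff[of "f \<cdot> u" "g \<cdot> u"] f uu m d by simp
  then show thesis using that[of u] uI uu m d by simp
qed

definition roof :: "'m \<Rightarrow> 'm \<Rightarrow> bool" where
  "roof s f \<longleftrightarrow> s \<in> I \<and> f \<in> Arr C \<and> Dom C f = Dom C s"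

lemma roofD: "roof s f \<Longrightarrow> s \<in> I" "roof s f \<Longrightarrow> f \<in> Arr C" "roof s f \<Longrightarrow> Dom C f = Dom C s"
  by (auto simp: roof_def)

lemma roofs_iff: "(s, f) \<in> roofs C V \<longleftrightarrow> roof s f"
  by (auto simp: roofs_def roof_def)

text \<open>
  The equivalence of roofs in terms of \<open>Arr\<close>, \<open>Dom\<close> and \<open>Cod\<close>.
\<close>

definition req :: "'m \<Rightarrow> 'm \<Rightarrow> 'm \<Rightarrow> 'm \<Rightarrow> bool" where
  "req s f t g \<longleftrightarrow> (\<exists>u v. u \<in> Arr C \<and> v \<in> Arr C \<and> Dom C u = Dom C v \<and> Cod C u = Dom C s \<and> Cod C v = Dom C t \<and>
     s \<cdot> u = t \<cdot> v \<and> s \<cdot> u \<in> I \<and> f \<cdot> u = g \<cdot> v)"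

lemma reqE:
  assumes "req s f t g"
  obtains u v where "u \<in> Arr C" "v \<in> Arr C" "Dom C u = Dom C v" "Cod C u = Dom C s" "Cod C v = Dom C t"
     "s \<cdot> u = t \<cdot> v" "s \<cdot> u \<in> I" "f \<cdot> u = g \<cdot> v"
  using assms unfolding req_def by blast

lemma reqI:
  assumes "u \<in> Arr C" "v \<in> Arr C" "Dom C u = Dom C v" "Cod C u = Dom C s" "Cod C v = Dom C t"
     "s \<cdot> u = t \<cdot> v" "s \<cdot> u \<in> I" "f \<cdot> u = g \<cdot> v"
  shows "req s f t g"
  using assms unfolding req_def by blast

lemma roof_equiv_iff: "roof_equiv C V (s, f) (t, g) \<longleftrightarrow> req s f t g"
proof
  assume "roof_equiv C V (s, f) (t, g)"
  then obtain W u v where "u \<in> hom C W (Dom C s)" "v \<in> hom C W (Dom C t)"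
    "s \<cdot> u = t \<cdot> v \<and> s \<cdot> u \<in> I \<and> f \<cdot> u = g \<cdot> v" unfolding roof_equiv_def by blast
  then show "req s f t g" unfolding in_hom req_def by metis
next
  assume "req s f t g"
  then obtain u v where u: "u \<in> Arr C" "v \<in> Arr C" "Dom C u = Dom C v" "Cod C u = Dom C s" "Cod C v = Dom C t"
     "s \<cdot> u = t \<cdot> v" "s \<cdot> u \<in> I" "f \<cdot> u = g \<cdot> v" by (rule reqE)
  then have "u \<in> hom C (Dom C v) (Dom C s)" "v \<in> hom C (Dom C v) (Dom C t)" by (simp_all add: in_hom)
  then show "roof_equiv C V (s, f) (t, g)" using u unfolding roof_equiv_def by blast
qed

lemma req_refl: "roof s f \<Longrightarrow> req s f s f"
  by (rule reqI[of "Ide C (Dom C s)" "Ide C (Dom C s)"]) (auto simp: roof_def)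

lemma req_sym: "req s f t g \<Longrightarrow> req t g s f"
  by (elim reqE) (rule reqI, auto)

lemma req_trans:
  assumes st: "req s f t g" and tr: "req t g r h" and "roof s f" "roof t g" "roof r h"
  shows "req s f r h"
proof -
  note R = assms(3-5)[unfolded roof_def]
  obtain u v where u: "u \<in> Arr C" "v \<in> Arr C" "Dom C u = Dom C v" "Cod C u = Dom C s" "Cod C v = Dom C t"
     "s \<cdot> u = t \<cdot> v" "s \<cdot> u \<in> I" "f \<cdot> u = g \<cdot> v" using reqE[OF st] .
  obtain u' v' where u': "u' \<in> Arr C" "v' \<in> Arr C" "Dom C u' = Dom C v'" "Cod C u' = Dom C t" "Cod C v' = Dom C r"
     "t \<cdot> u' = r \<cdot> v'" "t \<cdot> u' \<in> I" "g \<cdot> u' = h \<cdot> v'" using reqE[OF tr] .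
  have uI: "u \<in> I" "v \<in> I" "u' \<in> I" using I_right[of s u] I_right[of t v] I_right[of t u'] u u' R by auto
  obtain x y where xy: "x \<in> I" "Cod C x = Dom C v" "y \<in> Arr C" "Dom C y = Dom C x" "Cod C y = Dom C u'" "v \<cdot> x = u' \<cdot> y"
    by (rule ore[OF u(2) uI(3)]) (use u u' in auto)
  show ?thesis
  proof (rule reqI[of "u \<cdot> x" "v' \<cdot> y"])
    have "s \<cdot> (u \<cdot> x) = (t \<cdot> v) \<cdot> x" by (rule comp_cancel[OF u(6)]) (use u(1-5) xy R in auto)
    also have "\<dots> = t \<cdot> (u' \<cdot> y)" using u(1-5) xy R by simp
    also have "\<dots> = (r \<cdot> v') \<cdot> y" by (rule comp_cancel[OF u'(6)]) (use u'(1-5) xy R in auto)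
    finally show "s \<cdot> (u \<cdot> x) = r \<cdot> (v' \<cdot> y)" using u'(1-5) xy R by simp
    have "f \<cdot> (u \<cdot> x) = (g \<cdot> v) \<cdot> x" by (rule comp_cancel[OF u(8)]) (use u(1-5) xy R in auto)
    also have "\<dots> = g \<cdot> (u' \<cdot> y)" using u(1-5) xy R by simp
    also have "\<dots> = (h \<cdot> v') \<cdot> y" by (rule comp_cancel[OF u'(8)]) (use u'(1-5) xy R in auto)
    finally show "f \<cdot> (u \<cdot> x) = h \<cdot> (v' \<cdot> y)" using u'(1-5) xy R by simp
    show "s \<cdot> (u \<cdot> x) \<in> I" using uI u(3,4) xy R by simp
  qed (use u(1-5) u'(1-5) xy in auto)
qed

abbreviation rc :: "'m \<Rightarrow> 'm \<Rightarrow> ('o, 'm) roof_class" where "rc s f \<equiv> roof_class C V s f"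

lemma rc_reps: "(t, g) \<in> reps (rc s f) \<longleftrightarrow> roof t g \<and> Cod C t = Cod C s \<and> Cod C g = Cod C f \<and> req t g s f"
  by (simp add: roof_class_def roofs_iff roof_equiv_iff)

lemma rc_eq_iff:
  assumes "roof s f" "roof t g"
  shows "rc s f = rc t g \<longleftrightarrow> Cod C s = Cod C t \<and> Cod C f = Cod C g \<and> req s f t g"
proof
  assume e: "rc s f = rc t g"
  have "(s, f) \<in> reps (rc s f)" using assms req_refl rc_reps by blast
  then have "(s, f) \<in> reps (rc t g)" using e by simp
  then show "Cod C s = Cod C t \<and> Cod C f = Cod C g \<and> req s f t g" by (simp add: rc_reps)
next
  assume e: "Cod C s = Cod C t \<and> Cod C f = Cod C g \<and> req s f t g"
  have "req x y s f \<longleftrightarrow> req x y t g" if "roof x y" for x y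
    using req_trans[of x y s f t g] req_trans[of x y t g s f] req_sym assms that e by blast
  then show "rc s f = rc t g" using e unfolding roof_class_def by (auto simp: roofs_iff roof_equiv_iff)
qed

lemma reps_iff: "roof s f \<Longrightarrow> (t, g) \<in> reps (rc s f) \<longleftrightarrow> roof t g \<and> rc t g = rc s f"
  using rc_reps rc_eq_iff by blast

lemma rc_refine:
  assumes "roof s f" "u \<in> Arr C" "Cod C u = Dom C s" "s \<cdot> u \<in> I"
  shows "roof (s \<cdot> u) (f \<cdot> u)" "rc (s \<cdot> u) (f \<cdot> u) = rc s f"
proof -
  note R = assms(1)[unfolded roof_def]
  show 1: "roof (s \<cdot> u) (f \<cdot> u)" using assms R by (simp add: roof_def)
  have "req (s \<cdot> u) (f \<cdot> u) s f"
    by (rule reqI[of "Ide C (Dom C u)" u]) (use assms R in auto)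
  then show "rc (s \<cdot> u) (f \<cdot> u) = rc s f" using rc_eq_iff[OF 1 assms(1)] assms R by simp
qed

text \<open>
  Over a fixed denominator, two roofs are equivalent only if their numerators agree after an inverted map; the
  two comparison maps in the definition are made equal by \<open>equalize\<close>.
\<close>

lemma rc_same_denominator:
  assumes "rc s f = rc s g" "roof s f" "roof s g"
  obtains w where "w \<in> I" "Cod C w = Dom C s" "f \<cdot> w = g \<cdot> w"
proof -
  note R = assms(2-3)[unfolded roof_def]
  obtain u v where u: "u \<in> Arr C" "v \<in> Arr C" "Dom C u = Dom C v" "Cod C u = Dom C s" "Cod C v = Dom C s"
     "s \<cdot> u = s \<cdot> v" "s \<cdot> u \<in> I" "f \<cdot> u = g \<cdot> v"
    using rc_eq_iff[OF assms(2,3)] assms(1) reqE[of s f s g] by blast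
  have uI: "u \<in> I" using I_right[of s u] u R by auto
  obtain z where z: "z \<in> I" "Cod C z = Dom C v" "u \<cdot> z = v \<cdot> z"
    by (rule equalize[of s u v]) (use u R in auto)
  have "f \<cdot> (u \<cdot> z) = (g \<cdot> v) \<cdot> z" by (rule comp_cancel[OF u(8)]) (use u(1-5) z R in auto)
  then have "f \<cdot> (u \<cdot> z) = g \<cdot> (u \<cdot> z)" using u(1-5) z R by simp
  moreover have "u \<cdot> z \<in> I" "Cod C (u \<cdot> z) = Dom C s" using uI z(1,2) u(1-5) by simp_all
  ultimately show thesis using that by blast
qed

text \<open>
  The Ore condition refines both completions to a common one, on which they agree up to an arrow that
  can be equalized because \<open>t\<close> is inverted.
\<close>

lemma comp_unique:
  assumes s: "roof s f" and t: "roof t g" and c: "Cod C f = Cod C t"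
    and 1: "x \<in> Arr C" "y \<in> Arr C" "Dom C x = Dom C y" "Cod C x = Dom C s" "Cod C y = Dom C t" "s \<cdot> x \<in> I" "f \<cdot> x = t \<cdot> y"
    and 2: "x' \<in> Arr C" "y' \<in> Arr C" "Dom C x' = Dom C y'" "Cod C x' = Dom C s" "Cod C y' = Dom C t" "s \<cdot> x' \<in> I" "f \<cdot> x' = t \<cdot> y'"
  shows "rc (s \<cdot> x) (g \<cdot> y) = rc (s \<cdot> x') (g \<cdot> y')"
proof -
  note R = s[unfolded roof_def] t[unfolded roof_def]
  have xI: "x \<in> I" "x' \<in> I" using I_right[of s x] I_right[of s x'] 1 2 R by auto
  obtain p q where pq: "p \<in> I" "Cod C p = Dom C x" "q \<in> Arr C" "Dom C q = Dom C p" "Cod C q = Dom C x'" "x \<cdot> p = x' \<cdot> q"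
    by (rule ore[OF 1(1) xI(2)]) (use 1 2 in auto)
  have "t \<cdot> (y \<cdot> p) = (f \<cdot> x) \<cdot> p" by (rule comp_cancel[OF 1(7)[symmetric]]) (use 1(1-5) pq R in auto)
  also have "\<dots> = f \<cdot> (x' \<cdot> q)" using 1(1-5) pq R by simp
  also have "\<dots> = (t \<cdot> y') \<cdot> q" by (rule comp_cancel[OF 2(7)]) (use 2(1-5) pq R in auto)
  finally have "t \<cdot> (y \<cdot> p) = t \<cdot> (y' \<cdot> q)" using 2(1-5) pq R by simp
  then obtain z where z: "z \<in> I" "Cod C z = Dom C (y' \<cdot> q)" "(y \<cdot> p) \<cdot> z = (y' \<cdot> q) \<cdot> z"
    by (rule equalize[of t "y \<cdot> p" "y' \<cdot> q", rotated -2]) (use 1(1-5) 2(1-5) pq R in auto)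
  have zz: "Cod C z = Dom C p" using z(2) 2(1-5) pq by simp
  have y: "y \<cdot> (p \<cdot> z) = y' \<cdot> (q \<cdot> z)" using z 1(1-5) 2(1-5) pq zz by simp
  have r: "roof (s \<cdot> x) (g \<cdot> y)" "roof (s \<cdot> x') (g \<cdot> y')" using 1 2 R by (auto simp: roof_def)
  have "req (s \<cdot> x) (g \<cdot> y) (s \<cdot> x') (g \<cdot> y')"
  proof (rule reqI[of "p \<cdot> z" "q \<cdot> z"])
    have "x \<cdot> (p \<cdot> z) = (x' \<cdot> q) \<cdot> z" by (rule comp_cancel[OF pq(6)]) (use 1(1-5) pq(1-5) z zz in auto)
    then have "x \<cdot> (p \<cdot> z) = x' \<cdot> (q \<cdot> z)" using 2(1-5) pq(1-5) z(1) zz by simp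
    then show "(s \<cdot> x) \<cdot> (p \<cdot> z) = (s \<cdot> x') \<cdot> (q \<cdot> z)" using 1(1-5) 2(1-5) pq(1-5) z(1) zz R by simp
    show "(g \<cdot> y) \<cdot> (p \<cdot> z) = (g \<cdot> y') \<cdot> (q \<cdot> z)" using y 1(1-5) 2(1-5) pq(1-5) z(1) zz R by simp
    show "(s \<cdot> x) \<cdot> (p \<cdot> z) \<in> I" using xI pq(1,2) z(1) zz R 1(3,4) by simp
  qed (use 1(1-5) 2(1-5) pq(1-5) z(1) zz R in auto)
  then show ?thesis using rc_eq_iff[OF r] 1(1-5) 2(1-5) R by simp
qed

section \<open>The Verdier quotient is linear\<close>

abbreviation Q :: "('o, ('o, 'm) roof_class, 'k) tri_cat" where "Q \<equiv> verdier_quotient C V"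
abbreviation Q_comp :: "('o, 'm) roof_class \<Rightarrow> ('o, 'm) roof_class \<Rightarrow> ('o, 'm) roof_class" (infixl "\<bullet>" 70)
  where "d \<bullet> c \<equiv> d \<cdot>\<^bsub>Q\<^esub> c"
abbreviation L :: "'m \<Rightarrow> ('o, 'm) roof_class" where "L \<equiv> verdier_mor C V"

lemmas Q_defs = verdier_quotient_def verdier_lin_cat_def lin_cat.defs tri_cat.defs

lemma Q_Obj [simp]: "Obj Q = Obj C" by (simp add: Q_defs)
lemma Q_Sh [simp]: "Sh Q = Sh C" by (simp add: Q_defs)
lemma Q_ShA: "ShA Q = verdier_shift C" by (simp add: Q_defs)
lemma Q_Arr: "Arr Q = {rc s f | s f. roof s f}" by (simp add: Q_defs roofs_iff)
lemma Q_Dom [simp]: "Dom Q (rc s f) = Cod C s" by (simp add: Q_defs roof_class_def)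
lemma Q_Cod [simp]: "Cod Q (rc s f) = Cod C f" by (simp add: Q_defs roof_class_def)
lemma Q_Ide: "Ide Q X = L (Ide C X)" by (simp add: Q_defs)
lemma Q_Null: "Null Q X Y = L (Null C X Y)" by (simp add: Q_defs)

lemma rc_Arr [simp]: "roof s f \<Longrightarrow> rc s f \<in> Arr Q" by (auto simp: Q_Arr)

lemma Q_ArrE: assumes "c \<in> Arr Q" obtains s f where "c = rc s f" "roof s f" "s \<in> I" "f \<in> Arr C" "Dom C f = Dom C s"
  "Dom Q c = Cod C s" "Cod Q c = Cod C f"
  using assms by (auto simp: Q_Arr roof_def)

lemma rc_eqI_reps:
  assumes "fst c = Cod C s" "fst (snd c) = Cod C f" "\<And>t g. (t, g) \<in> reps c \<longleftrightarrow> (t, g) \<in> reps (rc s f)"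
  shows "c = rc s f"
proof (rule prod_eqI)
  show "fst c = fst (rc s f)" using assms by (simp add: roof_class_def)
  show "snd c = snd (rc s f)"
  proof (rule prod_eqI)
    show "fst (snd c) = fst (snd (rc s f))" using assms by (simp add: roof_class_def)
    show "snd (snd c) = snd (snd (rc s f))" using assms(3) by auto
  qed
qed

lemma rc_fst: "fst (rc s f) = Cod C s" "fst (snd (rc s f)) = Cod C f" by (auto simp: roof_class_def)

text \<open>
  The composite of classes is a union over all representatives and completions. It is a single class because
  any two choices can be compared with a completion of a common refinement.
\<close>

lemma Q_Comp:
  assumes s: "roof s f" and t: "roof t g" and c: "Cod C f = Cod C t"
    and x: "x \<in> Arr C" "y \<in> Arr C" "Dom C x = Dom C y" "Cod C x = Dom C s" "Cod C y = Dom C t" "s \<cdot> x \<in> I" "f \<cdot> x = t \<cdot> y"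
  shows "rc t g \<bullet> rc s f = rc (s \<cdot> x) (g \<cdot> y)"
proof -
  note R = s[unfolded roof_def] t[unfolded roof_def]
  have r: "roof (s \<cdot> x) (g \<cdot> y)" using x R by (auto simp: roof_def)
  have wd: "rc (s1 \<cdot> x1) (g1 \<cdot> y1) = rc (s \<cdot> x) (g \<cdot> y)"
    if H: "roof s1 f1" "rc s1 f1 = rc s f" "roof t1 g1" "rc t1 g1 = rc t g" "roof x1 y1" "Cod C x1 = Dom C f1" "Cod C y1 = Dom C t1"
      "f1 \<cdot> x1 = t1 \<cdot> y1" for s1 f1 t1 g1 x1 y1
  proof -
    note R1 = H(1,3,5)[unfolded roof_def]
    have c1: "Cod C s1 = Cod C s" "Cod C f1 = Cod C f" "Cod C t1 = Cod C t" "Cod C g1 = Cod C g"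
      using H s t rc_eq_iff by blast+
    obtain u v where u: "u \<in> Arr C" "v \<in> Arr C" "Dom C u = Dom C v" "Cod C u = Dom C s1" "Cod C v = Dom C s"
      "s1 \<cdot> u = s \<cdot> v" "s1 \<cdot> u \<in> I" "f1 \<cdot> u = f \<cdot> v" using rc_eq_iff[OF H(1) s] H(2) reqE[of s1 f1 s f] by blast
    obtain p q where p: "p \<in> Arr C" "q \<in> Arr C" "Dom C p = Dom C q" "Cod C p = Dom C t1" "Cod C q = Dom C t"
      "t1 \<cdot> p = t \<cdot> q" "t1 \<cdot> p \<in> I" "g1 \<cdot> p = g \<cdot> q" using rc_eq_iff[OF H(3) t] H(4) reqE[of t1 g1 t g] by blast
    have fv: "f \<cdot> v \<in> Arr C" "Dom C (f \<cdot> v) = Dom C v" "Cod C (f \<cdot> v) = Cod C t" using u R c by auto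
    have tq: "t \<cdot> q \<in> I" "Cod C (t \<cdot> q) = Cod C t" "Dom C (t \<cdot> q) = Dom C q" using p R by auto
    obtain m n where mn: "m \<in> I" "Cod C m = Dom C v" "n \<in> Arr C" "Dom C n = Dom C m" "Cod C n = Dom C q"
      "(f \<cdot> v) \<cdot> m = (t \<cdot> q) \<cdot> n"
      using ore[OF fv(1) tq(1)] fv tq by metis
    have sv: "s \<cdot> v \<in> I" using u by simp
    have "(s \<cdot> v) \<cdot> m \<in> I" by (rule I_comp) (use sv mn u R in auto)
    then have svm: "s \<cdot> (v \<cdot> m) \<in> I" using mn u R by simp
    have A: "rc (s \<cdot> x) (g \<cdot> y) = rc (s \<cdot> (v \<cdot> m)) (g \<cdot> (q \<cdot> n))"
      by (rule comp_unique[OF s t c x]) (use mn u(1-5) p(1-5) R svm in auto)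
    have e1: "s1 \<cdot> (u \<cdot> m) = s \<cdot> (v \<cdot> m)"
      using comp_cancel[OF u(6), of m] mn(1-5) u(1-5) R R1 by simp
    have e2: "g1 \<cdot> (p \<cdot> n) = g \<cdot> (q \<cdot> n)"
      using comp_cancel[OF p(8), of n] mn(1-5) p(1-5) R R1 by simp
    have e3: "f1 \<cdot> (u \<cdot> m) = (f \<cdot> v) \<cdot> m" by (rule comp_cancel[OF u(8)]) (use mn(1-5) u(1-5) R1 in auto)
    have e4: "t1 \<cdot> (p \<cdot> n) = (t \<cdot> q) \<cdot> n" by (rule comp_cancel[OF p(6)]) (use mn(1-5) p(1-5) R1 in auto)
    have "rc (s1 \<cdot> x1) (g1 \<cdot> y1) = rc (s1 \<cdot> (u \<cdot> m)) (g1 \<cdot> (p \<cdot> n))"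
      by (rule comp_unique[OF H(1,3)]) (use H(5-8) c1 c R1 mn u(1-5) p(1-5) svm e1 e3 e4 in auto)
    then show ?thesis using A e1 e2 by simp
  qed
  show ?thesis
  proof (rule rc_eqI_reps)
    show "fst (rc t g \<bullet> rc s f) = Cod C (s \<cdot> x)" using x R by (simp add: Q_defs rc_fst)
    show "fst (snd (rc t g \<bullet> rc s f)) = Cod C (g \<cdot> y)" using x R by (simp add: Q_defs rc_fst)
    fix a b
    have "(a, b) \<in> reps (rc t g \<bullet> rc s f) \<longleftrightarrow> (\<exists>s1 f1 t1 g1 x1 y1. (a, b) \<in> reps (rc (s1 \<cdot> x1) (g1 \<cdot> y1)) \<and>
        (s1, f1) \<in> reps (rc s f) \<and> (t1, g1) \<in> reps (rc t g) \<and> (x1, y1) \<in> roofs C V \<and>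
        Cod C x1 = Dom C f1 \<and> Cod C y1 = Dom C t1 \<and> f1 \<cdot> x1 = t1 \<cdot> y1)"
      by (simp add: Q_defs) blast
    also have "\<dots> \<longleftrightarrow> (\<exists>s1 f1 t1 g1 x1 y1. (a, b) \<in> reps (rc (s1 \<cdot> x1) (g1 \<cdot> y1)) \<and>
        roof s1 f1 \<and> rc s1 f1 = rc s f \<and> roof t1 g1 \<and> rc t1 g1 = rc t g \<and> roof x1 y1 \<and>
        Cod C x1 = Dom C f1 \<and> Cod C y1 = Dom C t1 \<and> f1 \<cdot> x1 = t1 \<cdot> y1)"
      unfolding reps_iff[OF s] reps_iff[OF t] roofs_iff by (simp only: conj_assoc)
    also have "\<dots> \<longleftrightarrow> (a, b) \<in> reps (rc (s \<cdot> x) (g \<cdot> y))"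
    proof
      assume "\<exists>s1 f1 t1 g1 x1 y1. (a, b) \<in> reps (rc (s1 \<cdot> x1) (g1 \<cdot> y1)) \<and>
        roof s1 f1 \<and> rc s1 f1 = rc s f \<and> roof t1 g1 \<and> rc t1 g1 = rc t g \<and> roof x1 y1 \<and>
        Cod C x1 = Dom C f1 \<and> Cod C y1 = Dom C t1 \<and> f1 \<cdot> x1 = t1 \<cdot> y1"
      then show "(a, b) \<in> reps (rc (s \<cdot> x) (g \<cdot> y))" using wd by (elim exE conjE) simp
    next
      assume "(a, b) \<in> reps (rc (s \<cdot> x) (g \<cdot> y))"
      moreover have "roof x y" using I_right[of s x] x R by (simp add: roof_def)
      ultimately show "\<exists>s1 f1 t1 g1 x1 y1. (a, b) \<in> reps (rc (s1 \<cdot> x1) (g1 \<cdot> y1)) \<and>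
        roof s1 f1 \<and> rc s1 f1 = rc s f \<and> roof t1 g1 \<and> rc t1 g1 = rc t g \<and> roof x1 y1 \<and>
        Cod C x1 = Dom C f1 \<and> Cod C y1 = Dom C t1 \<and> f1 \<cdot> x1 = t1 \<cdot> y1"
        using s t x(4,5,7) R by metis
    qed
    finally show "(a, b) \<in> reps (rc t g \<bullet> rc s f) \<longleftrightarrow> (a, b) \<in> reps (rc (s \<cdot> x) (g \<cdot> y))" .
  qed
qed

text \<open>
  With a numerator that already factors through the denominator of the next map no completion is needed. By the
  following lemma, every map can be put into this form, which makes composition of classes computable.
\<close>

lemma comp_rc:
  assumes "roof t g" "s \<in> I" "k \<in> Arr C" "Dom C k = Dom C s" "Cod C k = Dom C t"
  shows "rc t g \<bullet> rc s (t \<cdot> k) = rc s (g \<cdot> k)"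
proof -
  have "rc t g \<bullet> rc s (t \<cdot> k) = rc (s \<cdot> Ide C (Dom C s)) (g \<cdot> k)"
    by (rule Q_Comp) (use assms in \<open>auto simp: roof_def\<close>)
  then show ?thesis using assms by simp
qed

lemma rep_through:
  assumes "c \<in> Arr Q" "t \<in> I" "Cod Q c = Cod C t"
  obtains s k where "c = rc s (t \<cdot> k)" "s \<in> I" "k \<in> Arr C" "Dom C k = Dom C s" "Cod C k = Dom C t" "Cod C s = Dom Q c"
proof -
  obtain s f where c: "c = rc s f" "roof s f" "s \<in> I" "f \<in> Arr C" "Dom C f = Dom C s" "Dom Q c = Cod C s" "Cod Q c = Cod C f" using Q_ArrE[OF assms(1)] .
  obtain u k where u: "u \<in> I" "Cod C u = Dom C f" "k \<in> Arr C" "Dom C k = Dom C u" "Cod C k = Dom C t" "f \<cdot> u = t \<cdot> k"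
    by (rule ore[of f t]) (use c assms in auto)
  have "rc (s \<cdot> u) (f \<cdot> u) = rc s f" by (rule rc_refine(2)[OF c(2)]) (use u c in auto)
  then show thesis using that[of "s \<cdot> u" k] u c by simp
qed

lemma common_denominator:
  assumes "c \<in> Arr Q" "d \<in> Arr Q" "Dom Q c = Dom Q d"
  obtains s f g where "c = rc s f" "d = rc s g" "roof s f" "roof s g" "s \<in> I" "f \<in> Arr C" "g \<in> Arr C" "Dom C f = Dom C s" "Dom C g = Dom C s"
    "Dom Q c = Cod C s" "Dom Q d = Cod C s" "Cod Q c = Cod C f" "Cod Q d = Cod C g"
proof -
  obtain s f where c: "c = rc s f" "roof s f" "s \<in> I" "f \<in> Arr C" "Dom C f = Dom C s" "Dom Q c = Cod C s" "Cod Q c = Cod C f" using Q_ArrE[OF assms(1)] .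
  obtain t g where d: "d = rc t g" "roof t g" "t \<in> I" "g \<in> Arr C" "Dom C g = Dom C t" "Dom Q d = Cod C t" "Cod Q d = Cod C g" using Q_ArrE[OF assms(2)] .
  obtain u k where u: "u \<in> I" "Cod C u = Dom C s" "k \<in> Arr C" "Dom C k = Dom C u" "Cod C k = Dom C t" "s \<cdot> u = t \<cdot> k"
    by (rule ore[of s t]) (use c d assms in auto)
  have su: "s \<cdot> u \<in> I" using u(1,2) c by simp
  have 1: "roof (s \<cdot> u) (f \<cdot> u)" "rc (s \<cdot> u) (f \<cdot> u) = rc s f"
    using rc_refine[OF c(2), of u] u su by auto
  have tk: "t \<cdot> k \<in> I" using su u(6) by simp
  have 2: "roof (t \<cdot> k) (g \<cdot> k)" "rc (t \<cdot> k) (g \<cdot> k) = rc t g"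
    using rc_refine[OF d(2), of k] u(3,5) tk by auto
  have st: "Cod C t = Cod C s" using assms(3) c d by simp
  have arr: "s \<cdot> u \<in> Arr C" "f \<cdot> u \<in> Arr C" "g \<cdot> k \<in> Arr C" "Dom C (f \<cdot> u) = Dom C (s \<cdot> u)" "Dom C (g \<cdot> k) = Dom C (s \<cdot> u)"
    "Cod C (s \<cdot> u) = Cod C s" "Cod C (f \<cdot> u) = Cod C f" "Cod C (g \<cdot> k) = Cod C g"
    using u(1-5) c d by simp_all
  have 3: "roof (s \<cdot> u) (g \<cdot> k)" "rc (s \<cdot> u) (g \<cdot> k) = d" using 2 d(1) unfolding u(6) by simp_all
  show thesis
    by (rule that[of "s \<cdot> u" "f \<cdot> u" "g \<cdot> k"]) (use 1 3 su arr c(1,6,7) d(1,6,7) st in simp_all)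
qed

lemma Q_Scale:
  assumes s: "roof s f" shows "Scale Q a (rc s f) = rc s (a \<odot> f)"
proof -
  note R = s[unfolded roof_def]
  have wd: "rc s1 (a \<odot> f1) = rc s (a \<odot> f)" if H: "roof s1 f1" "rc s1 f1 = rc s f" for s1 f1
  proof -
    note R1 = H(1)[unfolded roof_def]
    obtain u v where u: "u \<in> Arr C" "v \<in> Arr C" "Dom C u = Dom C v" "Cod C u = Dom C s1" "Cod C v = Dom C s"
      "s1 \<cdot> u = s \<cdot> v" "s1 \<cdot> u \<in> I" "f1 \<cdot> u = f \<cdot> v" using rc_eq_iff[OF H(1) s] H(2) reqE[of s1 f1 s f] by blast
    have "req s1 (a \<odot> f1) s (a \<odot> f)" by (rule reqI[of u v]) (use u R R1 in auto)
    then show ?thesis using rc_eq_iff[of s1 "a \<odot> f1" s "a \<odot> f"] H s rc_eq_iff[OF H(1) s] R R1 by (simp add: roof_def)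
  qed
  show ?thesis
  proof (rule rc_eqI_reps)
    show "fst (Scale Q a (rc s f)) = Cod C s" by (simp add: Q_defs rc_fst)
    show "fst (snd (Scale Q a (rc s f))) = Cod C (a \<odot> f)" using R by (simp add: Q_defs rc_fst)
    fix x y
    have "(x, y) \<in> reps (Scale Q a (rc s f)) \<longleftrightarrow> (\<exists>s1 f1. (x, y) \<in> reps (rc s1 (a \<odot> f1)) \<and> (s1, f1) \<in> reps (rc s f))"
      by (simp add: Q_defs) blast
    also have "\<dots> \<longleftrightarrow> (x, y) \<in> reps (rc s (a \<odot> f))" unfolding reps_iff[OF s] using wd s by metis
    finally show "(x, y) \<in> reps (Scale Q a (rc s f)) \<longleftrightarrow> (x, y) \<in> reps (rc s (a \<odot> f))" .
  qed
qed

lemma Q_Add: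
  assumes s: "roof s f" "roof s g" "Cod C f = Cod C g" shows "Add Q (rc s f) (rc s g) = rc s (f \<oplus> g)"
proof -
  note R = s(1,2)[unfolded roof_def]
  have r: "roof s (f \<oplus> g)" using R s(3) by (simp add: roof_def)
  have wd: "rc s1 (f1 \<oplus> g1) = rc s (f \<oplus> g)" if H: "roof s1 f1" "rc s1 f1 = rc s f" "roof s1 g1" "rc s1 g1 = rc s g" for s1 f1 g1
  proof -
    note R1 = H(1,3)[unfolded roof_def]
    have c1: "Cod C s1 = Cod C s" "Cod C f1 = Cod C f" "Cod C g1 = Cod C g" using H s rc_eq_iff by blast+
    obtain u v where u: "u \<in> Arr C" "v \<in> Arr C" "Dom C u = Dom C v" "Cod C u = Dom C s1" "Cod C v = Dom C s"
      "s1 \<cdot> u = s \<cdot> v" "s1 \<cdot> u \<in> I" "f1 \<cdot> u = f \<cdot> v" using rc_eq_iff[OF H(1) s(1)] H(2) reqE[of s1 f1 s f] by blast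
    have svI: "s \<cdot> v \<in> I" using u by simp
    have A: "roof (s1 \<cdot> u) (g1 \<cdot> u)" "rc (s1 \<cdot> u) (g1 \<cdot> u) = rc s1 g1"
      using rc_refine[OF H(3), of u] u by auto
    have B: "roof (s \<cdot> v) (g \<cdot> v)" "rc (s \<cdot> v) (g \<cdot> v) = rc s g"
      using rc_refine[OF s(2), of v] u svI by auto
    obtain w where w: "w \<in> I" "Cod C w = Dom C (s \<cdot> v)" "(g1 \<cdot> u) \<cdot> w = (g \<cdot> v) \<cdot> w"
      by (rule rc_same_denominator[of "s \<cdot> v" "g1 \<cdot> u" "g \<cdot> v"]) (use A B H u(6) in auto)
    have w2: "Cod C w = Dom C v" using w u(1-5) R by simp
    have fw: "(f1 \<cdot> u) \<cdot> w = (f \<cdot> v) \<cdot> w" using u(8) by simp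
    have r1: "roof s1 (f1 \<oplus> g1)" using R1 c1 s(3) by (simp add: roof_def)
    have "(s \<cdot> v) \<cdot> w \<in> I" by (rule I_comp) (use svI w in auto)
    moreover have "(s1 \<cdot> u) \<cdot> w = (s \<cdot> v) \<cdot> w" using u(6) by simp
    ultimately have "req s1 (f1 \<oplus> g1) s (f \<oplus> g)"
    proof (intro reqI[of "u \<cdot> w" "v \<cdot> w"])
      have "(f1 \<oplus> g1) \<cdot> (u \<cdot> w) = f1 \<cdot> (u \<cdot> w) \<oplus> g1 \<cdot> (u \<cdot> w)"
        by (rule add_comp') (use w(1) w2 u(1-5) R1 c1 s(3) in auto)
      also have "\<dots> = f \<cdot> (v \<cdot> w) \<oplus> g \<cdot> (v \<cdot> w)" using fw w(1,3) w2 u(1-5) R R1 by simp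
      also have "\<dots> = (f \<oplus> g) \<cdot> (v \<cdot> w)"
        by (rule add_comp'[symmetric]) (use w(1) w2 u(1-5) R s(3) in auto)
      finally show "(f1 \<oplus> g1) \<cdot> (u \<cdot> w) = (f \<oplus> g) \<cdot> (v \<cdot> w)" .
    qed (use w(1) w2 u(1-5) R R1 in auto)
    then show ?thesis using rc_eq_iff[OF r1 r] c1 R R1 s(3) by simp
  qed
  show ?thesis
  proof (rule rc_eqI_reps)
    show "fst (Add Q (rc s f) (rc s g)) = Cod C s" by (simp add: Q_defs rc_fst)
    show "fst (snd (Add Q (rc s f) (rc s g))) = Cod C (f \<oplus> g)" using R s(3) by (simp add: Q_defs rc_fst)
    fix x y
    have "(x, y) \<in> reps (Add Q (rc s f) (rc s g)) \<longleftrightarrow>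
      (\<exists>s1 f1 g1. (x, y) \<in> reps (rc s1 (f1 \<oplus> g1)) \<and> (s1, f1) \<in> reps (rc s f) \<and> (s1, g1) \<in> reps (rc s g))"
      by (simp add: Q_defs) blast
    also have "\<dots> \<longleftrightarrow> (x, y) \<in> reps (rc s (f \<oplus> g))" unfolding reps_iff[OF s(1)] reps_iff[OF s(2)] using wd s by metis
    finally show "(x, y) \<in> reps (Add Q (rc s f) (rc s g)) \<longleftrightarrow> (x, y) \<in> reps (rc s (f \<oplus> g))" .
  qed
qed

lemma L_rc: "f \<in> Arr C \<Longrightarrow> L f = rc (Ide C (Dom C f)) f" by (simp add: verdier_mor_def)

lemma L_roof: "f \<in> Arr C \<Longrightarrow> roof (Ide C (Dom C f)) f" by (simp add: roof_def)

lemma L_denominator: assumes "f \<in> Arr C" "s \<in> I" "Cod C s = Dom C f" shows "L f = rc s (f \<cdot> s)" "roof s (f \<cdot> s)"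
proof -
  have "rc (Ide C (Dom C f) \<cdot> s) (f \<cdot> s) = rc (Ide C (Dom C f)) f"
    by (rule rc_refine(2)[OF L_roof]) (use assms in auto)
  then show "L f = rc s (f \<cdot> s)" using assms L_rc by simp
  show "roof s (f \<cdot> s)" using assms by (simp add: roof_def)
qed

lemma L_arr [simp]: "f \<in> Arr C \<Longrightarrow> L f \<in> Arr Q" "f \<in> Arr C \<Longrightarrow> Dom Q (L f) = Dom C f" "f \<in> Arr C \<Longrightarrow> Cod Q (L f) = Cod C f"
  using L_roof by (auto simp: L_rc)

lemma Q_Null_rc: assumes "Y \<in> Obj C" "s \<in> I" shows "Null Q (Cod C s) Y = rc s (Null C (Dom C s) Y)"
  using L_denominator[of "Null C (Cod C s) Y" s] assms by (simp add: Q_Null)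

lemma L_after: assumes "roof s f" "g \<in> Arr C" "Cod C f = Dom C g" shows "L g \<bullet> rc s f = rc s (g \<cdot> f)"
proof -
  note R = assms(1)[unfolded roof_def]
  have "rc (Ide C (Dom C g)) g \<bullet> rc s (Ide C (Dom C g) \<cdot> f) = rc s (g \<cdot> f)"
    by (rule comp_rc) (use assms R L_roof in auto)
  then show ?thesis using assms R by (simp add: L_rc)
qed

lemma Q_hom: "c \<in> hom Q X Y \<longleftrightarrow> c \<in> Arr Q \<and> Dom Q c = X \<and> Cod Q c = Y" by (auto simp: hom_def)

text \<open>
  Each axiom is reduced to the same one for numerators: sums after passing to a common denominator, composites
  after choosing representatives that factor through the next denominator.
\<close>

lemma linear_Q: "linear_category Q"
proof
  show "f \<in> Arr Q \<Longrightarrow> Dom Q f \<in> Obj Q" "f \<in> Arr Q \<Longrightarrow> Cod Q f \<in> Obj Q" for f by (auto elim!: Q_ArrE)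
  show "X \<in> Obj Q \<Longrightarrow> Ide Q X \<in> hom Q X X" for X by (simp add: Q_hom Q_Ide)
  show "X \<in> Obj Q \<Longrightarrow> Y \<in> Obj Q \<Longrightarrow> Null Q X Y \<in> hom Q X Y" for X Y by (simp add: Q_hom Q_Null)
next
  fix f X Y g Z assume f: "f \<in> hom Q X Y" and g: "g \<in> hom Q Y Z"
  obtain t g0 where g': "g = rc t g0" "roof t g0" "t \<in> I" "g0 \<in> Arr C" "Dom C g0 = Dom C t" "Dom Q g = Cod C t" "Cod Q g = Cod C g0"
    using Q_ArrE g unfolding Q_hom by blast
  obtain s k where f': "f = rc s (t \<cdot> k)" "s \<in> I" "k \<in> Arr C" "Dom C k = Dom C s" "Cod C k = Dom C t" "Cod C s = Dom Q f"
    by (rule rep_through[of f t]) (use f g g' in \<open>auto simp: Q_hom\<close>)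
  have e: "g \<bullet> f = rc s (g0 \<cdot> k)" unfolding f' g' by (rule comp_rc) (use f' g' in auto)
  have "roof s (g0 \<cdot> k)" using f'(2-5) g'(3-5) by (simp add: roof_def)
  then show "g \<bullet> f \<in> hom Q X Z" unfolding e using f g f'(2-6) g'(3-5,7) by (simp add: Q_hom)
  fix a
  show "Scale Q a g \<bullet> f = Scale Q a (g \<bullet> f)"
  proof -
    have "rc t (a \<odot> g0) \<bullet> rc s (t \<cdot> k) = rc s ((a \<odot> g0) \<cdot> k)" by (rule comp_rc) (use f' g' in \<open>auto simp: roof_def\<close>)
    then show ?thesis unfolding e using Q_Scale[OF g'(2)] Q_Scale[of s "g0 \<cdot> k"] f'(1-5) g' by (simp add: roof_def)
  qed
  show "g \<bullet> Scale Q a f = Scale Q a (g \<bullet> f)"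
  proof -
    have "rc t g0 \<bullet> rc s (t \<cdot> (a \<odot> k)) = rc s (g0 \<cdot> (a \<odot> k))" by (rule comp_rc) (use f' g' in auto)
    then show ?thesis unfolding e using Q_Scale[of s "t \<cdot> k"] Q_Scale[of s "g0 \<cdot> k"] f'(1-5) g' by (simp add: roof_def)
  qed
  fix h W assume h: "h \<in> hom Q Z W"
  obtain r h0 where h': "h = rc r h0" "roof r h0" "r \<in> I" "h0 \<in> Arr C" "Dom C h0 = Dom C r" "Dom Q h = Cod C r" "Cod Q h = Cod C h0"
    using Q_ArrE h unfolding Q_hom by blast
  obtain t l where g2: "g = rc t (r \<cdot> l)" "t \<in> I" "l \<in> Arr C" "Dom C l = Dom C t" "Cod C l = Dom C r" "Cod C t = Dom Q g"
    by (rule rep_through[of g r]) (use h g h' in \<open>auto simp: Q_hom\<close>)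
  obtain s k where f2: "f = rc s (t \<cdot> k)" "s \<in> I" "k \<in> Arr C" "Dom C k = Dom C s" "Cod C k = Dom C t" "Cod C s = Dom Q f"
    by (rule rep_through[of f t]) (use f g g2(2,6) in \<open>auto simp: Q_hom\<close>)
  have hg: "h \<bullet> g = rc t (h0 \<cdot> l)" unfolding h' g2 by (rule comp_rc) (use h' g2 in auto)
  have gf: "g \<bullet> f = rc s ((r \<cdot> l) \<cdot> k)" unfolding f2 g2(1) by (rule comp_rc) (use h' f2 g2 in \<open>auto simp: roof_def\<close>)
  have "(h \<bullet> g) \<bullet> f = rc s ((h0 \<cdot> l) \<cdot> k)" unfolding hg f2(1) by (rule comp_rc) (use h' f2 g2 in \<open>auto simp: roof_def\<close>)
  also have "\<dots> = rc s (h0 \<cdot> (l \<cdot> k))" using h' f2(2-5) g2(2-5) by simp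
  also have "\<dots> = rc r h0 \<bullet> rc s (r \<cdot> (l \<cdot> k))" by (rule comp_rc[symmetric]) (use h' f2(2-5) g2(2-5) in auto)
  also have "\<dots> = h \<bullet> (g \<bullet> f)" unfolding gf h'(1) using h'(3) f2(2-5) g2(2-5) by simp
  finally show "(h \<bullet> g) \<bullet> f = h \<bullet> (g \<bullet> f)" .
next
  fix f X Y a b assume f: "f \<in> hom Q X Y"
  obtain s f0 where f': "f = rc s f0" "roof s f0" "s \<in> I" "f0 \<in> Arr C" "Dom C f0 = Dom C s" "Dom Q f = Cod C s" "Cod Q f = Cod C f0"
    using Q_ArrE f unfolding Q_hom by blast
  have XY: "X = Cod C s" "Y = Cod C f0" "X \<in> Obj C" "Y \<in> Obj C" using f f' by (auto simp: Q_hom)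
  have "L (Ide C X) = rc s (Ide C X \<cdot> s)" by (rule L_denominator(1)) (use f'(3) XY in auto)
  then have "Ide Q X = rc s (s \<cdot> Ide C (Dom C s))" using f'(3) XY(1,3) by (simp add: Q_Ide)
  moreover have "rc s f0 \<bullet> rc s (s \<cdot> Ide C (Dom C s)) = rc s (f0 \<cdot> Ide C (Dom C s))"
    by (rule comp_rc) (use f'(2-5) in auto)
  ultimately show "f \<bullet> Ide Q X = f" using f'(1,4,5) by simp
  have "L (Ide C Y) \<bullet> rc s f0 = rc s (Ide C Y \<cdot> f0)" by (rule L_after) (use f'(2,4) XY in auto)
  then show "Ide Q Y \<bullet> f = f" using f'(1,4) XY(2) by (simp add: Q_Ide)
  show "Scale Q a f \<in> hom Q X Y" using Q_Scale[OF f'(2)] f' XY by (simp add: Q_hom roof_def)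
  have nr: "roof s (Null C (Dom C s) Y)" "Null Q X Y = rc s (Null C (Dom C s) Y)"
    using Q_Null_rc[of Y s] f' XY by (simp_all add: roof_def)
  show "Add Q f (Null Q X Y) = f" unfolding nr(2) f'(1) using Q_Add[OF f'(2) nr(1)] f' XY by simp
  have sr: "roof s (a \<odot> f0)" for a using f' by (simp add: roof_def)
  show "Add Q f (Scale Q (-1) f) = Null Q X Y" unfolding f'(1) Q_Scale[OF f'(2)] nr(2) using Q_Add[OF f'(2) sr] f' XY by simp
  show "Scale Q 1 f = f" unfolding f'(1) Q_Scale[OF f'(2)] using f' by simp
  show "Scale Q a (Scale Q b f) = Scale Q (a * b) f" unfolding f'(1) Q_Scale[OF f'(2)] Q_Scale[OF sr] using f' by simp
  have "(a + b) \<odot> f0 = (a \<odot> f0) \<oplus> (b \<odot> f0)" by (rule scale_add_left[OF arr_in_hom]) (use f' in simp)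
  then show "Scale Q (a + b) f = Add Q (Scale Q a f) (Scale Q b f)"
    unfolding f'(1) Q_Scale[OF f'(2)] using Q_Add[OF sr sr, of a b] f' by simp
next
  fix f X Y g assume f: "f \<in> hom Q X Y" and g: "g \<in> hom Q X Y"
  obtain s f0 g0 where fg: "f = rc s f0" "g = rc s g0" "roof s f0" "roof s g0" "s \<in> I" "f0 \<in> Arr C" "g0 \<in> Arr C" "Dom C f0 = Dom C s" "Dom C g0 = Dom C s"
    "Dom Q f = Cod C s" "Dom Q g = Cod C s" "Cod Q f = Cod C f0" "Cod Q g = Cod C g0"
    by (rule common_denominator[of f g]) (use f g in \<open>auto simp: Q_hom\<close>)
  have c: "Cod C f0 = Cod C g0" using f g fg by (simp add: Q_hom)
  have e: "Add Q f g = rc s (f0 \<oplus> g0)" unfolding fg using Q_Add[OF fg(3,4) c] .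
  have r: "roof s (f0 \<oplus> g0)" using fg c by (simp add: roof_def)
  show "Add Q f g \<in> hom Q X Y" unfolding e using r f g fg c by (simp add: Q_hom)
  show "Add Q f g = Add Q g f" unfolding e unfolding fg Q_Add[OF fg(4,3) c[symmetric]] using add_commute'[of f0 g0] fg c by simp
  show "Scale Q a (Add Q f g) = Add Q (Scale Q a f) (Scale Q a g)" for a
  proof -
    have "roof s (a \<odot> f0)" "roof s (a \<odot> g0)" using fg by (auto simp: roof_def)
    from Q_Add[OF this] show ?thesis unfolding e Q_Scale[OF r] unfolding fg Q_Scale[OF fg(3)] Q_Scale[OF fg(4)]
      using scale_add'[of f0 g0 a] fg c by simp
  qed
  show "Add Q (Add Q f g) h = Add Q f (Add Q g h)" if h: "h \<in> hom Q X Y" for h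
  proof -
    have fgh: "Add Q f g \<in> Arr Q" "Dom Q (Add Q f g) = X" unfolding e using r fg f by (auto simp: Q_hom)
    obtain t h0 where h': "h = rc t h0" "roof t h0" "t \<in> I" "h0 \<in> Arr C" "Dom C h0 = Dom C t" "Dom Q h = Cod C t" "Cod Q h = Cod C h0"
      using Q_ArrE h unfolding Q_hom by blast
    obtain u k where u: "u \<in> I" "Cod C u = Dom C s" "k \<in> Arr C" "Dom C k = Dom C u" "Cod C k = Dom C t" "s \<cdot> u = t \<cdot> k"
      by (rule ore[of s t]) (use fg h' f h in \<open>auto simp: Q_hom\<close>)
    have su: "s \<cdot> u \<in> I" using u(1,2) fg by simp
    have tk: "t \<cdot> k \<in> I" using u(6) su by simp
    have 1: "rc s f0 = rc (s \<cdot> u) (f0 \<cdot> u)" "roof (s \<cdot> u) (f0 \<cdot> u)" using rc_refine[OF fg(3), of u] u su by auto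
    have 2: "rc s g0 = rc (s \<cdot> u) (g0 \<cdot> u)" "roof (s \<cdot> u) (g0 \<cdot> u)" using rc_refine[OF fg(4), of u] u su by auto
    have "rc t h0 = rc (t \<cdot> k) (h0 \<cdot> k)" "roof (t \<cdot> k) (h0 \<cdot> k)" using rc_refine[OF h'(2), of k] u(1-5) tk by auto
    then have 3: "rc t h0 = rc (s \<cdot> u) (h0 \<cdot> k)" "roof (s \<cdot> u) (h0 \<cdot> k)" using u(6) by simp_all
    have arr: "f0 \<cdot> u \<in> Arr C" "g0 \<cdot> u \<in> Arr C" "h0 \<cdot> k \<in> Arr C" "Dom C (f0 \<cdot> u) = Dom C (s \<cdot> u)" "Dom C (g0 \<cdot> u) = Dom C (s \<cdot> u)"
      "Dom C (h0 \<cdot> k) = Dom C (s \<cdot> u)" "Cod C (f0 \<cdot> u) = Y" "Cod C (g0 \<cdot> u) = Y" "Cod C (h0 \<cdot> k) = Y"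
      using u(1-5) fg h' f g h by (auto simp: Q_hom)
    have r1: "roof (s \<cdot> u) (f0 \<cdot> u \<oplus> g0 \<cdot> u)" "roof (s \<cdot> u) (g0 \<cdot> u \<oplus> h0 \<cdot> k)" using arr su by (auto simp: roof_def)
    have x1: "Add Q f g = rc (s \<cdot> u) (f0 \<cdot> u \<oplus> g0 \<cdot> u)" unfolding fg 1 2 by (rule Q_Add) (use 1 2 arr in auto)
    have x2: "Add Q g h = rc (s \<cdot> u) (g0 \<cdot> u \<oplus> h0 \<cdot> k)" unfolding fg h' 2 3 by (rule Q_Add) (use 2 3 arr in auto)
    have "Add Q (Add Q f g) h = rc (s \<cdot> u) ((f0 \<cdot> u \<oplus> g0 \<cdot> u) \<oplus> h0 \<cdot> k)" unfolding x1 h'(1) 3 by (rule Q_Add) (use r1 3 arr in auto)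
    moreover have "Add Q f (Add Q g h) = rc (s \<cdot> u) (f0 \<cdot> u \<oplus> (g0 \<cdot> u \<oplus> h0 \<cdot> k))" unfolding x2 fg(1) 1 by (rule Q_Add) (use r1 1 arr in auto)
    ultimately show ?thesis using add_assoc'[of "f0 \<cdot> u" "g0 \<cdot> u" "h0 \<cdot> k"] arr by metis
  qed
  show "h \<bullet> Add Q f g = Add Q (h \<bullet> f) (h \<bullet> g)" if h: "h \<in> hom Q Y Z" for h Z
  proof -
    obtain t h0 where h': "h = rc t h0" "roof t h0" "t \<in> I" "h0 \<in> Arr C" "Dom C h0 = Dom C t" "Dom Q h = Cod C t" "Cod Q h = Cod C h0"
      using Q_ArrE h unfolding Q_hom by blast
    have ct: "Cod C f0 = Cod C t" "Cod C g0 = Cod C t" using f g h fg h' by (auto simp: Q_hom)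
    obtain u k where u: "u \<in> I" "Cod C u = Dom C f0" "k \<in> Arr C" "Dom C k = Dom C u" "Cod C k = Dom C t" "f0 \<cdot> u = t \<cdot> k"
      by (rule ore[of f0 t]) (use fg h' ct in auto)
    have gu: "g0 \<cdot> u \<in> Arr C" "Dom C (g0 \<cdot> u) = Dom C u" "Cod C (g0 \<cdot> u) = Cod C t" using u fg ct by auto
    obtain v l where v: "v \<in> I" "Cod C v = Dom C (g0 \<cdot> u)" "l \<in> Arr C" "Dom C l = Dom C v" "Cod C l = Dom C t" "(g0 \<cdot> u) \<cdot> v = t \<cdot> l"
      by (rule ore[OF gu(1) h'(3) gu(3)])
    have cv: "Cod C v = Dom C u" using v gu by simp
    let ?s = "s \<cdot> (u \<cdot> v)"
    have uv: "u \<cdot> v \<in> Arr C" "Cod C (u \<cdot> v) = Dom C s" "?s \<in> I" "Dom C (u \<cdot> v) = Dom C v" "Dom C ?s = Dom C v" using u v cv fg by auto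
    have "f0 \<cdot> (u \<cdot> v) = (t \<cdot> k) \<cdot> v" by (rule comp_cancel[OF u(6)]) (use u(1-5) v(1) cv fg in auto)
    then have e1: "f0 \<cdot> (u \<cdot> v) = t \<cdot> (k \<cdot> v)" using u(1-5) v(1) cv h' by simp
    have e2: "g0 \<cdot> (u \<cdot> v) = t \<cdot> l" using u(1-5) v(1,6) cv fg by simp
    have 1: "rc s f0 = rc ?s (t \<cdot> (k \<cdot> v))" "roof ?s (t \<cdot> (k \<cdot> v))" using rc_refine[OF fg(3) uv(1-3)] e1 by auto
    have 2: "rc s g0 = rc ?s (t \<cdot> l)" "roof ?s (t \<cdot> l)" using rc_refine[OF fg(4) uv(1-3)] e2 by auto
    have kv: "k \<cdot> v \<in> Arr C" "Dom C (k \<cdot> v) = Dom C v" "Cod C (k \<cdot> v) = Dom C t" using u(1-5) v(1) cv by auto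
    have "Add Q f g = rc ?s (t \<cdot> (k \<cdot> v) \<oplus> t \<cdot> l)" unfolding fg 1 2 by (rule Q_Add[OF 1(2) 2(2)]) (use kv v h' in auto)
    also have "\<dots> = rc ?s (t \<cdot> (k \<cdot> v \<oplus> l))" using comp_add'[of "k \<cdot> v" l t] kv v(3-5) h' by simp
    finally have s1: "h \<bullet> Add Q f g = rc ?s (h0 \<cdot> (k \<cdot> v \<oplus> l))"
      using comp_rc[OF h'(2) uv(3), of "k \<cdot> v \<oplus> l"] kv v(3-5) h' uv by simp
    have s2: "h \<bullet> f = rc ?s (h0 \<cdot> (k \<cdot> v))" unfolding fg(1) 1(1) h'(1) by (rule comp_rc[OF h'(2) uv(3)]) (use kv uv in auto)
    have s3: "h \<bullet> g = rc ?s (h0 \<cdot> l)" unfolding fg(2) 2(1) h'(1) by (rule comp_rc[OF h'(2) uv(3)]) (use v uv in auto)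
    have "Add Q (h \<bullet> f) (h \<bullet> g) = rc ?s (h0 \<cdot> (k \<cdot> v) \<oplus> h0 \<cdot> l)" unfolding s2 s3
      by (rule Q_Add) (use kv v(3-5) uv h' in \<open>auto simp: roof_def\<close>)
    then show ?thesis unfolding s1 using comp_add'[of "k \<cdot> v" l h0] kv v(3-5) h' by simp
  qed
next
  fix f X Y g Z h assume f: "f \<in> hom Q X Y" and g: "g \<in> hom Q Y Z" and h: "h \<in> hom Q Y Z"
  obtain t g0 h0 where gh: "g = rc t g0" "h = rc t h0" "roof t g0" "roof t h0" "t \<in> I" "g0 \<in> Arr C" "h0 \<in> Arr C" "Dom C g0 = Dom C t" "Dom C h0 = Dom C t"
    "Dom Q g = Cod C t" "Dom Q h = Cod C t" "Cod Q g = Cod C g0" "Cod Q h = Cod C h0"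
    by (rule common_denominator[of g h]) (use g h in \<open>auto simp: Q_hom\<close>)
  have c: "Cod C g0 = Cod C h0" using g h gh by (simp add: Q_hom)
  obtain s k where f': "f = rc s (t \<cdot> k)" "s \<in> I" "k \<in> Arr C" "Dom C k = Dom C s" "Cod C k = Dom C t" "Cod C s = Dom Q f"
    by (rule rep_through[of f t]) (use f g gh in \<open>auto simp: Q_hom\<close>)
  have r: "roof t (g0 \<oplus> h0)" using gh c by (simp add: roof_def)
  have 1: "g \<bullet> f = rc s (g0 \<cdot> k)" unfolding gh(1) f'(1) by (rule comp_rc) (use gh f' in auto)
  have 2: "h \<bullet> f = rc s (h0 \<cdot> k)" unfolding gh(2) f'(1) by (rule comp_rc) (use gh f' in auto)
  have "Add Q g h \<bullet> f = rc s ((g0 \<oplus> h0) \<cdot> k)" unfolding gh(1,2) Q_Add[OF gh(3,4) c] f'(1) by (rule comp_rc[OF r]) (use gh f' in auto)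
  also have "\<dots> = rc s (g0 \<cdot> k \<oplus> h0 \<cdot> k)" using add_comp'[of k g0 h0] gh f'(2-5) c by simp
  also have "\<dots> = Add Q (rc s (g0 \<cdot> k)) (rc s (h0 \<cdot> k))" by (rule Q_Add[symmetric]) (use gh f'(2-5) c in \<open>auto simp: roof_def\<close>)
  finally show "Add Q g h \<bullet> f = Add Q (g \<bullet> f) (h \<bullet> f)" unfolding 1 2 .
qed

end


section \<open>The Verdier quotient is triangulated\<close>

sublocale verdier \<subseteq> Q: linear_category "verdier_quotient C V"
  by (rule linear_Q)

context verdier
begin

lemma L_comp: assumes "f \<in> Arr C" "g \<in> Arr C" "Cod C f = Dom C g" shows "L (g \<cdot> f) = L g \<bullet> L f"
proof -
  have "L g \<bullet> rc (Ide C (Dom C f)) f = rc (Ide C (Dom C f)) (g \<cdot> f)"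
    by (rule L_after[OF L_roof]) (use assms in auto)
  then show ?thesis using assms by (simp add: L_rc)
qed

lemma L_add: assumes "f \<in> Arr C" "g \<in> Arr C" "Dom C f = Dom C g" "Cod C f = Cod C g"
  shows "L (f \<oplus> g) = Add Q (L f) (L g)"
proof -
  have "Add Q (rc (Ide C (Dom C g)) f) (rc (Ide C (Dom C g)) g) = rc (Ide C (Dom C g)) (f \<oplus> g)"
    by (rule Q_Add) (use assms in \<open>auto simp: roof_def\<close>)
  then show ?thesis using assms by (simp add: L_rc)
qed

lemma L_scale: assumes "f \<in> Arr C" shows "L (a \<odot> f) = Scale Q a (L f)"
  using Q_Scale[OF L_roof[OF assms], of a] assms by (simp add: L_rc)

lemma L_ide: "L (Ide C X) = Ide Q X" by (simp add: Q_Ide)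
lemma L_null: "L (Null C X Y) = Null Q X Y" by (simp add: Q_Null)

lemma rc_factor: assumes "roof s f" shows "rc s f \<bullet> L s = L f"
proof -
  note R = assms[unfolded roof_def]
  have "rc s f \<bullet> rc (Ide C (Dom C s)) (s \<cdot> Ide C (Dom C s)) = rc (Ide C (Dom C s)) (f \<cdot> Ide C (Dom C s))"
    by (rule comp_rc[OF assms]) (use R in auto)
  then show ?thesis using R by (simp add: L_rc)
qed

lemma L_I: assumes "s \<in> I" shows "is_iso Q (L s)"
proof -
  have s: "s \<in> Arr C" "roof s (Ide C (Dom C s))" using assms by (auto simp: roof_def)
  have "rc s (Ide C (Dom C s)) \<bullet> L s = Ide Q (Dom C s)" using rc_factor[OF s(2)] by (simp add: L_ide)
  moreover have "L s \<bullet> rc s (Ide C (Dom C s)) = rc s (s \<cdot> Ide C (Dom C s))" by (rule L_after[OF s(2)]) (use s in auto)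
  moreover have "L (Ide C (Cod C s)) = rc s (Ide C (Cod C s) \<cdot> s)" by (rule L_denominator(1)) (use s assms in auto)
  ultimately have "rc s (Ide C (Dom C s)) \<bullet> L s = Ide Q (Dom C s)" "L s \<bullet> rc s (Ide C (Dom C s)) = Ide Q (Cod C s)"
    using s by (simp_all add: L_ide)
  then show ?thesis using s by (intro Q.is_isoI[of "L s" "Dom C s" "Cod C s" "rc s (Ide C (Dom C s))"]) (auto simp: Q_hom)
qed

lemma L_iso: "is_iso C f \<Longrightarrow> is_iso Q (L f)" by (rule L_I[OF I_iso])

lemma isomorphic_Q: "isomorphic C X Y \<Longrightarrow> isomorphic Q X Y"
  by (elim isomorphicE) (use L_iso Q.isomorphicI L_arr in blast)

lemma L_eqD: assumes "L f = L g" "f \<in> Arr C" "g \<in> Arr C" "Dom C f = Dom C g"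
  obtains u where "u \<in> I" "Cod C u = Dom C g" "f \<cdot> u = g \<cdot> u"
proof -
  have "rc (Ide C (Dom C g)) f = rc (Ide C (Dom C g)) g" using assms by (simp add: L_rc)
  then show thesis
    by (rule rc_same_denominator) (use that assms in \<open>auto simp: roof_def\<close>)
qed

lemma zero_L: "zero_obj C Z \<Longrightarrow> zero_obj Q Z"
  by (auto simp: zero_obj_def L_ide[symmetric] L_null[symmetric])

text \<open>
  If the identity of \<open>X\<close> becomes zero, then it is killed by some \<open>u : Z \<rightarrow> X\<close> with cone in \<open>V\<close>, so \<open>u = 0\<close> and
  \<open>X\<close> is a summand of that cone. This is where closure of \<open>V\<close> under summands enters.
\<close>

lemma zero_obj_Q_iff: assumes X: "X \<in> Obj C" shows "zero_obj Q X \<longleftrightarrow> X \<in> V"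
proof
  assume "zero_obj Q X"
  then have "L (Ide C X) = L (Null C X X)" by (simp add: zero_obj_def L_ide L_null)
  then obtain u where u: "u \<in> I" "Cod C u = Dom C (Null C X X)" "Ide C X \<cdot> u = Null C X X \<cdot> u"
    by (rule L_eqD) (use X in auto)
  have u0: "Cod C u = X" "u = Null C (Dom C u) X" using u X by auto
  obtain g h where T: "(u, g, h) \<in> Tri C" using TR1_cone u by force
  note t = triD[OF T]
  have "ShA C u = Null C (Sh C (Dom C u)) (Sh C X)" by (subst u0(2)) (use t X in simp)
  then have "neg (ShA C u) = Null C (Dom C (neg (ShA C u))) (Cod C (neg (ShA C u)))" using t X u0(1) by simp
  from tri_split_biproduct[OF tri_rotI[OF T] this] have "is_biproduct C X (Cod C h) (Cod C g)" using t u0 by simp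
  then show "X \<in> V" using V_biproduct I_cone[OF u(1) T] by blast
next
  assume XV: "X \<in> V"
  obtain Z where Z: "zero_obj C Z" using ex_zero by blast
  have T: "(Null C Z X, Ide C X, Null C X (Sh C Z)) \<in> Tri C" using tri_from_zero[OF X Z] .
  have "Null C Z X \<in> I" using I_I[OF T] X XV by simp
  then have "is_iso Q (L (Null C Z X))" by (rule L_I)
  then have "isomorphic Q Z X" using Q.isomorphicI X zero_obj_Obj[OF Z] by simp
  then show "zero_obj Q X" using Q.zero_obj_iso zero_L Z by blast
qed

lemma biproduct_Q: assumes "is_biproduct C X Y B" shows "is_biproduct Q X Y B"
proof -
  obtain i j p q where *: "i \<in> Arr C" "Dom C i = X" "Cod C i = B" "j \<in> Arr C" "Dom C j = Y" "Cod C j = B"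
    "p \<in> Arr C" "Dom C p = B" "Cod C p = X" "q \<in> Arr C" "Dom C q = B" "Cod C q = Y"
    "p \<cdot> i = Ide C X" "q \<cdot> j = Ide C Y" "p \<cdot> j = Null C Y X" "q \<cdot> i = Null C X Y" "i \<cdot> p \<oplus> j \<cdot> q = Ide C B"
    using biproductE[OF assms] by metis
  have L: "L p \<bullet> L i = Ide Q X" "L q \<bullet> L j = Ide Q Y" "L p \<bullet> L j = Null Q Y X" "L q \<bullet> L i = Null Q X Y"
    using L_comp[of i p] L_comp[of j q] L_comp[of j p] L_comp[of i q] * by (simp_all add: L_ide L_null)
  have "Add Q (L i \<bullet> L p) (L j \<bullet> L q) = L (i \<cdot> p \<oplus> j \<cdot> q)"
    using L_comp[of p i] L_comp[of q j] L_add[of "i \<cdot> p" "j \<cdot> q"] *(1-12) by simp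
  then have "Add Q (L i \<bullet> L p) (L j \<bullet> L q) = Ide Q B" using *(17) by (simp add: L_ide)
  then show ?thesis unfolding is_biproduct_def
    by (intro bexI[of _ "L i"] bexI[of _ "L j"] bexI[of _ "L p"] bexI[of _ "L q"]) (use L *(1-12) in \<open>auto simp: Q_hom\<close>)
qed

lemma additive_Q: "additive_linear_category Q"
proof
  show "\<exists>Z. zero_obj Q Z" using ex_zero zero_L by blast
  show "\<exists>B. is_biproduct Q X Y B" if "X \<in> Obj Q" "Y \<in> Obj Q" for X Y
    using that ex_biproduct[of X Y] biproduct_Q by auto
qed

lemma roof_sh: assumes "f \<in> Arr C" "s \<in> Arr C" shows "roof (ShA C s) (ShA C f) \<longleftrightarrow> roof s f"
  using I_sh[OF assms(2)] assms sh_inj[of "Dom C f" "Dom C s"] by (auto simp: roof_def)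

lemma req_sh:
  assumes a: "s \<in> Arr C" "f \<in> Arr C" "t \<in> Arr C" "g \<in> Arr C" "Dom C f = Dom C s" "Dom C g = Dom C t"
  shows "req (ShA C s) (ShA C f) (ShA C t) (ShA C g) \<longleftrightarrow> req s f t g"
proof
  assume "req s f t g"
  then obtain u v where u: "u \<in> Arr C" "v \<in> Arr C" "Dom C u = Dom C v" "Cod C u = Dom C s" "Cod C v = Dom C t"
     "s \<cdot> u = t \<cdot> v" "s \<cdot> u \<in> I" "f \<cdot> u = g \<cdot> v" by (rule reqE)
  have "ShA C (s \<cdot> u) = ShA C (t \<cdot> v)" "ShA C (f \<cdot> u) = ShA C (g \<cdot> v)" "ShA C (s \<cdot> u) \<in> I"
    using u I_sh[of "s \<cdot> u"] a by auto
  then show "req (ShA C s) (ShA C f) (ShA C t) (ShA C g)"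
    by (intro reqI[of "ShA C u" "ShA C v"]) (use u(1-5) a in auto)
next
  assume "req (ShA C s) (ShA C f) (ShA C t) (ShA C g)"
  then obtain u v where u: "u \<in> Arr C" "v \<in> Arr C" "Dom C u = Dom C v" "Cod C u = Dom C (ShA C s)" "Cod C v = Dom C (ShA C t)"
     "ShA C s \<cdot> u = ShA C t \<cdot> v" "ShA C s \<cdot> u \<in> I" "ShA C f \<cdot> u = ShA C g \<cdot> v" by (rule reqE)
  obtain W where W: "W \<in> Obj C" "Dom C u = Sh C W" using sh_surj[of "Dom C u"] u by auto
  obtain u' where u': "u' \<in> Arr C" "Dom C u' = W" "Cod C u' = Dom C s" "u = ShA C u'"
    by (rule sha_surj[of u W "Dom C s"]) (use u(1-5) W a in auto)
  obtain v' where v': "v' \<in> Arr C" "Dom C v' = W" "Cod C v' = Dom C t" "v = ShA C v'"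
    by (rule sha_surj[of v W "Dom C t"]) (use u(1-5) W a in auto)
  have e: "ShA C (s \<cdot> u') = ShA C s \<cdot> u" "ShA C (t \<cdot> v') = ShA C t \<cdot> v" "ShA C (f \<cdot> u') = ShA C f \<cdot> u" "ShA C (g \<cdot> v') = ShA C g \<cdot> v"
    using u' v' a by simp_all
  have arr: "s \<cdot> u' \<in> Arr C" "t \<cdot> v' \<in> Arr C" "f \<cdot> u' \<in> Arr C" "g \<cdot> v' \<in> Arr C" using u' v' a by simp_all
  show "req s f t g"
  proof (rule reqI[of u' v'])
    show "s \<cdot> u' = t \<cdot> v'" by (rule sha_inj) (use e u(6) arr in simp_all)
    show "f \<cdot> u' = g \<cdot> v'" by (rule sha_inj) (use e u(8) arr in simp_all)
    show "s \<cdot> u' \<in> I" using I_sh[OF arr(1)] e(1) u(7) by simp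
  qed (use u' v' in auto)
qed

lemma Q_ShA_rc: assumes "roof s f" shows "ShA Q (rc s f) = rc (ShA C s) (ShA C f)"
proof (rule rc_eqI_reps)
  note R = assms[unfolded roof_def]
  have Rs: "s \<in> Arr C" "f \<in> Arr C" "Dom C f = Dom C s" using R by auto
  have S: "roof (ShA C s) (ShA C f)" using assms roof_sh R by simp
  show "fst (ShA Q (rc s f)) = Cod C (ShA C s)" using R by (simp add: Q_ShA verdier_shift_def rc_fst)
  show "fst (snd (ShA Q (rc s f))) = Cod C (ShA C f)" using R by (simp add: Q_ShA verdier_shift_def rc_fst)
  fix t g
  have "(t, g) \<in> reps (ShA Q (rc s f)) \<longleftrightarrow> (\<exists>t' g'. t = ShA C t' \<and> g = ShA C g' \<and> (t', g') \<in> reps (rc s f))"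
    by (auto simp: Q_ShA verdier_shift_def)
  also have "\<dots> \<longleftrightarrow> (t, g) \<in> reps (rc (ShA C s) (ShA C f))"
  proof
    assume "\<exists>t' g'. t = ShA C t' \<and> g = ShA C g' \<and> (t', g') \<in> reps (rc s f)"
    then obtain t' g' where t': "t = ShA C t'" "g = ShA C g'" "roof t' g'" "Cod C t' = Cod C s" "Cod C g' = Cod C f" "req t' g' s f"
      by (auto simp: rc_reps)
    note R' = t'(3)[unfolded roof_def]
    have "roof t g" "req t g (ShA C s) (ShA C f)" using roof_sh[of g' t'] req_sh[of t' g' s f] t' R R' by simp_all
    then show "(t, g) \<in> reps (rc (ShA C s) (ShA C f))" using t' R R' by (simp add: rc_reps)
  next
    assume "(t, g) \<in> reps (rc (ShA C s) (ShA C f))"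
    then have tg: "roof t g" "Cod C t = Sh C (Cod C s)" "Cod C g = Sh C (Cod C f)" "req t g (ShA C s) (ShA C f)"
      using Rs by (auto simp: rc_reps)
    note R' = tg(1)[unfolded roof_def]
    obtain W where W: "W \<in> Obj C" "Dom C t = Sh C W" using sh_surj[of "Dom C t"] R' by auto
    obtain t' where t': "t' \<in> Arr C" "Dom C t' = W" "Cod C t' = Cod C s" "t = ShA C t'"
      by (rule sha_surj[of t W "Cod C s"]) (use tg W Rs R' in auto)
    obtain g' where g': "g' \<in> Arr C" "Dom C g' = W" "Cod C g' = Cod C f" "g = ShA C g'"
      by (rule sha_surj[of g W "Cod C f"]) (use tg W Rs R' in auto)
    have "roof t' g'" "req t' g' s f" using roof_sh[of g' t'] req_sh[of t' g' s f] t' g' tg Rs by simp_all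
    then show "\<exists>t' g'. t = ShA C t' \<and> g = ShA C g' \<and> (t', g') \<in> reps (rc s f)"
      using t' g' by (auto simp: rc_reps)
  qed
  finally show "(t, g) \<in> reps (ShA Q (rc s f)) \<longleftrightarrow> (t, g) \<in> reps (rc (ShA C s) (ShA C f))" .
qed

lemma L_sh: assumes "f \<in> Arr C" shows "L (ShA C f) = ShA Q (L f)"
  using Q_ShA_rc[OF L_roof[OF assms]] assms by (simp add: L_rc)

lemma Q_sha_arr:
  assumes "c \<in> Arr Q" shows "ShA Q c \<in> Arr Q" "Dom Q (ShA Q c) = Sh C (Dom Q c)" "Cod Q (ShA Q c) = Sh C (Cod Q c)"
proof -
  obtain s f where c: "c = rc s f" "roof s f" "s \<in> I" "f \<in> Arr C" "Dom C f = Dom C s" using Q_ArrE[OF assms] by metis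
  have "roof (ShA C s) (ShA C f)" using roof_sh c by simp
  then show "ShA Q c \<in> Arr Q" "Dom Q (ShA Q c) = Sh C (Dom Q c)" "Cod Q (ShA Q c) = Sh C (Cod Q c)"
    unfolding c(1) Q_ShA_rc[OF c(2)] using c by simp_all
qed

lemma Q_sha_comp:
  assumes "c \<in> Arr Q" "d \<in> Arr Q" "Cod Q c = Dom Q d" shows "ShA Q (d \<bullet> c) = ShA Q d \<bullet> ShA Q c"
proof -
  obtain t g where d: "d = rc t g" "roof t g" "t \<in> I" "g \<in> Arr C" "Dom C g = Dom C t" "Dom Q d = Cod C t" using Q_ArrE[OF assms(2)] by metis
  obtain s k where c: "c = rc s (t \<cdot> k)" "s \<in> I" "k \<in> Arr C" "Dom C k = Dom C s" "Cod C k = Dom C t"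
    by (rule rep_through[OF assms(1) d(3)]) (use assms d in auto)
  have r: "roof s (t \<cdot> k)" "roof s (g \<cdot> k)" "roof (ShA C t) (ShA C g)" using c(2-5) d(2-5) by (auto simp: roof_def I_sh)
  have "d \<bullet> c = rc s (g \<cdot> k)" unfolding c(1) d(1) by (rule comp_rc) (use c d in auto)
  then have "ShA Q (d \<bullet> c) = rc (ShA C s) (ShA C g \<cdot> ShA C k)" using Q_ShA_rc[OF r(2)] c(2-5) d(3-5) by simp
  also have "\<dots> = rc (ShA C t) (ShA C g) \<bullet> rc (ShA C s) (ShA C t \<cdot> ShA C k)"
    by (rule comp_rc[symmetric, OF r(3)]) (use c(2-5) d(3-5) I_sh in auto)
  also have "\<dots> = ShA Q d \<bullet> ShA Q c" unfolding c(1) d(1) Q_ShA_rc[OF r(1)] Q_ShA_rc[OF d(2)] using c(2-5) d(3-5) by simp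
  finally show ?thesis .
qed

lemma Q_sha_add:
  assumes "c \<in> Arr Q" "d \<in> Arr Q" "Dom Q c = Dom Q d" "Cod Q c = Cod Q d" shows "ShA Q (Add Q c d) = Add Q (ShA Q c) (ShA Q d)"
proof -
  obtain s f g where fg: "c = rc s f" "d = rc s g" "roof s f" "roof s g" "s \<in> I" "f \<in> Arr C" "g \<in> Arr C" "Dom C f = Dom C s" "Dom C g = Dom C s"
    "Cod Q c = Cod C f" "Cod Q d = Cod C g"
    by (rule common_denominator[OF assms(1-3)])
  have c: "Cod C f = Cod C g" using assms fg by simp
  have r: "roof s (f \<oplus> g)" "roof (ShA C s) (ShA C f)" "roof (ShA C s) (ShA C g)" using fg(3-9) c by (auto simp: roof_def I_sh)
  have "ShA Q (Add Q c d) = rc (ShA C s) (ShA C f \<oplus> ShA C g)"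
    unfolding fg(1,2) Q_Add[OF fg(3,4) c] Q_ShA_rc[OF r(1)] using fg(5-9) c by simp
  also have "\<dots> = Add Q (rc (ShA C s) (ShA C f)) (rc (ShA C s) (ShA C g))"
    by (rule Q_Add[symmetric, OF r(2,3)]) (use fg(5-9) c in simp)
  finally show ?thesis unfolding fg(1,2) Q_ShA_rc[OF fg(3)] Q_ShA_rc[OF fg(4)] .
qed

lemma Q_sha_scale: assumes "c \<in> Arr Q" shows "ShA Q (Scale Q a c) = Scale Q a (ShA Q c)"
proof -
  obtain s f where c: "c = rc s f" "roof s f" "s \<in> I" "f \<in> Arr C" "Dom C f = Dom C s" using Q_ArrE[OF assms] by metis
  have r: "roof s (a \<odot> f)" "roof (ShA C s) (ShA C f)" using c(2-5) by (auto simp: roof_def I_sh)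
  show ?thesis unfolding c(1) Q_Scale[OF c(2)] Q_ShA_rc[OF r(1)] Q_ShA_rc[OF c(2)] Q_Scale[OF r(2)] using c(3-5) by simp
qed

lemma Q_sha_ide: "X \<in> Obj C \<Longrightarrow> ShA Q (Ide Q X) = Ide Q (Sh C X)"
  using L_sh[of "Ide C X"] by (simp add: L_ide)

lemma Q_sha_surj:
  assumes "c \<in> Arr Q" obtains d where "d \<in> Arr Q" "c = ShA Q d"
proof -
  obtain t g where d: "c = rc t g" "roof t g" "t \<in> I" "g \<in> Arr C" "Dom C g = Dom C t" using Q_ArrE[OF assms(1)] by metis
  obtain t' where t': "t' \<in> Arr C" "t = ShA C t'" using I_arr[OF d(3)] shift_arr unfolding bij_betw_def by (metis imageE)
  obtain g' where g': "g' \<in> Arr C" "g = ShA C g'" using d(4) shift_arr unfolding bij_betw_def by (metis imageE)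
  have r: "roof t' g'" using d(2) roof_sh[OF g'(1) t'(1)] t'(2) g'(2) by simp
  show thesis using that[of "rc t' g'"] r Q_ShA_rc[OF r] t'(2) g'(2) d(1) by simp
qed

lemma Q_sha_inj: assumes "c \<in> Arr Q" "d \<in> Arr Q" "ShA Q c = ShA Q d" shows "c = d"
proof -
  obtain s f where c: "c = rc s f" "roof s f" "s \<in> I" "f \<in> Arr C" "Dom C f = Dom C s" using Q_ArrE[OF assms(1)] by metis
  obtain t g where d: "d = rc t g" "roof t g" "t \<in> I" "g \<in> Arr C" "Dom C g = Dom C t" using Q_ArrE[OF assms(2)] by metis
  have r: "roof (ShA C s) (ShA C f)" "roof (ShA C t) (ShA C g)" using c(2-5) d(2-5) roof_sh by auto
  have "rc (ShA C s) (ShA C f) = rc (ShA C t) (ShA C g)"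
    using assms(3) unfolding c(1) d(1) Q_ShA_rc[OF c(2)] Q_ShA_rc[OF d(2)] .
  then have e: "Cod C (ShA C s) = Cod C (ShA C t)" "Cod C (ShA C f) = Cod C (ShA C g)" "req (ShA C s) (ShA C f) (ShA C t) (ShA C g)"
    using rc_eq_iff[OF r] by auto
  have "Cod C s = Cod C t" by (rule sh_inj) (use e(1) c d in auto)
  moreover have "Cod C f = Cod C g" by (rule sh_inj) (use e(2) c d in auto)
  moreover have "req s f t g" using req_sh[of s f t g] e(3) c(3-5) d(3-5) by simp
  ultimately show ?thesis unfolding c(1) d(1) using rc_eq_iff[OF c(2) d(2)] by simp
qed

lemma Q_sha_iso: assumes "is_iso Q c" shows "is_iso Q (ShA Q c)"
proof -
  obtain d where d: "c \<in> Arr Q" "d \<in> Arr Q" "Dom Q d = Cod Q c" "Cod Q d = Dom Q c" "d \<bullet> c = Ide Q (Dom Q c)" "c \<bullet> d = Ide Q (Cod Q c)"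
    using Q.is_isoE[OF assms] by metis
  have o: "Dom Q c \<in> Obj C" "Cod Q c \<in> Obj C" using Q.dom_obj Q.cod_obj d by auto
  show ?thesis
    by (rule Q.is_isoI[of _ "Sh C (Dom Q c)" "Sh C (Cod Q c)" "ShA Q d"])
      (use d o Q_sha_arr Q_sha_comp[of c d] Q_sha_comp[of d c] Q_sha_ide in \<open>auto simp: Q_hom\<close>)
qed

subsection \<open>Distinguished triangles\<close>

text \<open>
  The triangles of the quotient are defined through its underlying linear category; the two records agree in
  all fields that matter.
\<close>

lemma Q_lin: "Arr (verdier_lin_cat C V) = Arr Q" "Dom (verdier_lin_cat C V) = Dom Q" "Cod (verdier_lin_cat C V) = Cod Q"
  "Comp (verdier_lin_cat C V) = Comp Q" "Ide (verdier_lin_cat C V) = Ide Q" "hom (verdier_lin_cat C V) = hom Q"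
  "is_iso (verdier_lin_cat C V) = is_iso Q"
  by (simp_all add: verdier_quotient_def lin_cat.defs tri_cat.defs hom_def is_iso_def fun_eq_iff)

lemma Q_Tri: "Tri Q = {t. candidate_triangle Q (Sh C) t \<and>
    (\<exists>(f, g, h) \<in> Tri C. triangle_iso Q (ShA Q) (L f, L g, L h) t)}"
proof -
  have "candidate_triangle (verdier_lin_cat C V) = candidate_triangle Q"
    "triangle_iso (verdier_lin_cat C V) (verdier_shift C) = triangle_iso Q (ShA Q)"
    unfolding candidate_triangle_def triangle_iso_def Q_lin Q_ShA by auto
  moreover have "Tri Q = {t. candidate_triangle (verdier_lin_cat C V) (Sh C) t \<and>
    (\<exists>(f, g, h) \<in> Tri C. triangle_iso (verdier_lin_cat C V) (verdier_shift C) (L f, L g, L h) t)}"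
    by (simp add: verdier_quotient_def tri_cat.defs lin_cat.defs)
  ultimately show ?thesis by (simp only:)
qed

lemma Tri_Q_I:
  assumes T: "(f0, g0, h0) \<in> Tri C" and i: "is_iso Q a" "is_iso Q b" "is_iso Q c"
    and d: "Dom Q a = Dom C f0" "Dom Q b = Cod C f0" "Dom Q c = Cod C g0"
    and f: "f \<in> Arr Q" "Dom Q f = Cod Q a" "Cod Q f = Cod Q b" and g: "g \<in> Arr Q" "Dom Q g = Cod Q b" "Cod Q g = Cod Q c"
    and h: "h \<in> Arr Q" "Dom Q h = Cod Q c" "Cod Q h = Sh C (Cod Q a)"
    and sq: "b \<bullet> L f0 = f \<bullet> a" "c \<bullet> L g0 = g \<bullet> b" "ShA Q a \<bullet> L h0 = h \<bullet> c"
  shows "(f, g, h) \<in> Tri Q"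
proof -
  note t = triD[OF T]
  have "candidate_triangle Q (Sh C) (f, g, h)" using f g h by (simp add: candidate_triangle_def)
  moreover have "triangle_iso Q (ShA Q) (L f0, L g0, L h0) (f, g, h)"
    unfolding triangle_iso_def prod.case
    by (rule bexI[of _ a], rule bexI[of _ b], rule bexI[of _ c])
      (use i d f g h sq t Q.is_iso_arr in \<open>auto simp: Q_hom\<close>)
  ultimately show ?thesis unfolding Q_Tri using T by blast
qed

text \<open>
  An isomorphism \<open>(a, b, c)\<close> from the image of a triangle of \<open>C\<close>, together with the typing of all maps
  involved.
\<close>

definition presents :: "'m \<Rightarrow> 'm \<Rightarrow> 'm \<Rightarrow> ('o, 'm) roof_class \<Rightarrow> ('o, 'm) roof_class \<Rightarrow> ('o, 'm) roof_class \<Rightarrow>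
    ('o, 'm) roof_class \<Rightarrow> ('o, 'm) roof_class \<Rightarrow> ('o, 'm) roof_class \<Rightarrow> bool" where
  "presents f0 g0 h0 a b c f g h \<longleftrightarrow> (f0, g0, h0) \<in> Tri C \<and> is_iso Q a \<and> is_iso Q b \<and> is_iso Q c
    \<and> a \<in> Arr Q \<and> b \<in> Arr Q \<and> c \<in> Arr Q \<and> Dom Q a = Dom C f0
    \<and> Dom Q b = Cod C f0 \<and> Dom Q c = Cod C g0 \<and> f \<in> Arr Q \<and> g \<in> Arr Q
    \<and> h \<in> Arr Q \<and> Cod Q a = Dom Q f \<and> Cod Q b = Dom Q g \<and> Cod Q c = Dom Q h
    \<and> Cod Q f = Dom Q g \<and> Cod Q g = Dom Q h \<and> Cod Q h = Sh C (Dom Q f) \<and> b \<bullet> L f0 = f \<bullet> a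
    \<and> c \<bullet> L g0 = g \<bullet> b \<and> ShA Q a \<bullet> L h0 = h \<bullet> c"

lemma presentsD:
  assumes "presents f0 g0 h0 a b c f g h"
  shows "(f0, g0, h0) \<in> Tri C" "is_iso Q a" "is_iso Q b" "is_iso Q c" "a \<in> Arr Q"
    "b \<in> Arr Q" "c \<in> Arr Q" "Dom Q a = Dom C f0" "Dom Q b = Cod C f0" "Dom Q c = Cod C g0"
    "f \<in> Arr Q" "g \<in> Arr Q" "h \<in> Arr Q" "Cod Q a = Dom Q f" "Cod Q b = Dom Q g"
    "Cod Q c = Dom Q h" "Cod Q f = Dom Q g" "Cod Q g = Dom Q h" "Cod Q h = Sh C (Dom Q f)" "b \<bullet> L f0 = f \<bullet> a"
    "c \<bullet> L g0 = g \<bullet> b" "ShA Q a \<bullet> L h0 = h \<bullet> c"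
  using assms unfolding presents_def by blast+

lemma Tri_Q_E:
  assumes "(f, g, h) \<in> Tri Q" obtains f0 g0 h0 a b c where "presents f0 g0 h0 a b c f g h"
proof -
  obtain f0 g0 h0 where T: "(f0, g0, h0) \<in> Tri C" and i: "triangle_iso Q (ShA Q) (L f0, L g0, L h0) (f, g, h)"
    and c: "candidate_triangle Q (Sh C) (f, g, h)"
    using assms unfolding Q_Tri by blast
  note t = triD[OF T]
  obtain a b c where abc: "a \<in> hom Q (Dom Q (L f0)) (Dom Q f)" "b \<in> hom Q (Dom Q (L g0)) (Dom Q g)" "c \<in> hom Q (Dom Q (L h0)) (Dom Q h)"
    "is_iso Q a" "is_iso Q b" "is_iso Q c"
    "b \<bullet> L f0 = f \<bullet> a" "c \<bullet> L g0 = g \<bullet> b" "ShA Q a \<bullet> L h0 = h \<bullet> c"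
    using i unfolding triangle_iso_def prod.case by blast
  have d: "f \<in> Arr Q" "g \<in> Arr Q" "h \<in> Arr Q" "Cod Q f = Dom Q g" "Cod Q g = Dom Q h" "Cod Q h = Sh C (Dom Q f)"
    using c by (auto simp: candidate_triangle_def)
  have "presents f0 g0 h0 a b c f g h" unfolding presents_def using T abc d t by (simp add: Q_hom)
  then show thesis by (rule that)
qed

lemma L_Tri: assumes "(f, g, h) \<in> Tri C" shows "(L f, L g, L h) \<in> Tri Q"
proof -
  note t = triD[OF assms]
  show ?thesis
    by (rule Tri_Q_I[OF assms, of "Ide Q (Dom C f)" "Ide Q (Cod C f)" "Ide Q (Cod C g)"])
      (use t Q_sha_ide in auto)
qed

text \<open>
  A morphism of triangles supplied by the axioms alone need not be inverted on cones. Going through the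
  diagonal \<open>t f' = f s\<close> of the square gives one as a composite of two maps from octahedra, and their cones are
  the cone of \<open>t\<close> and the shifted cone of \<open>s\<close>.
\<close>

lemma square_cones:
  assumes T: "(f, g, h) \<in> Tri C" and T': "(f', g', h') \<in> Tri C"
    and s: "s \<in> I" "Dom C s = Dom C f'" "Cod C s = Dom C f" and t: "t \<in> I" "Dom C t = Dom C g'" "Cod C t = Dom C g"
    and e: "t \<cdot> f' = f \<cdot> s"
  obtains r where "r \<in> I" "Dom C r = Dom C h'" "Cod C r = Dom C h" "r \<cdot> g' = g \<cdot> t" "ShA C s \<cdot> h' = h \<cdot> r"
proof -
  note u = triD[OF T] and u' = triD[OF T']
  have c: "f \<cdot> s \<in> Arr C" "Dom C (f \<cdot> s) = Dom C f'" "Cod C (f \<cdot> s) = Dom C g" using s u by auto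
  obtain p q where P: "(f \<cdot> s, p, q) \<in> Tri C" using TR1_cone c by blast
  obtain pt qt where Pt: "(t, pt, qt) \<in> Tri C" using TR1_cone t by force
  obtain ps qs where Ps: "(s, ps, qs) \<in> Tri C" using TR1_cone s by force
  have P': "(t \<cdot> f', p, q) \<in> Tri C" using P e by simp
  have ct: "Cod C f' = Dom C t" using t u' by simp
  obtain a b where a: "a \<in> Arr C" "Dom C a = Cod C g'" "Cod C a = Cod C p" "Cod C b = Cod C pt"
    "(a, b, ShA C g' \<cdot> qt) \<in> Tri C" "a \<cdot> g' = p \<cdot> t" "q \<cdot> a = h'"
    by (rule TR4_arr[OF u'(1) I_arr[OF t(1)] ct T' P' Pt])
  obtain a' b' where b: "b' \<in> Arr C" "Dom C b' = Cod C p" "Cod C b' = Cod C g" "Dom C a' = Cod C ps"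
    "(a', b', ShA C ps \<cdot> h) \<in> Tri C" "b' \<cdot> p = g" "h \<cdot> b' = ShA C s \<cdot> q"
    by (rule TR4_arr[OF I_arr[OF s(1)] u(1) s(3) Ps P T])
  have pp: "p \<in> Arr C" "q \<in> Arr C" "Dom C p = Dom C g" "Cod C p = Dom C q" "Cod C q = Sh C (Dom C f')"
    using triD[OF P] c by auto
  have aI: "a \<in> I" using I_I[OF a(5)] a(4) I_cone[OF t(1) Pt] by simp
  have "Cod C (ShA C ps \<cdot> h) = Sh C (Cod C ps)" using triD[OF b(5)] b(4) by simp
  then have bI: "b' \<in> I" using I_I[OF tri_rotI[OF b(5)]] V_sh[of "Cod C ps"] I_cone[OF s(1) Ps] triD[OF Ps] by simp
  have 1: "(b' \<cdot> a) \<cdot> g' = g \<cdot> t"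
  proof -
    have "(b' \<cdot> a) \<cdot> g' = b' \<cdot> (p \<cdot> t)" using a(1-3,6) b(1,2) u' by simp
    also have "\<dots> = g \<cdot> t" by (rule comp_cancel[OF b(6)]) (use b(1-3) pp t in auto)
    finally show ?thesis .
  qed
  have 2: "ShA C s \<cdot> h' = h \<cdot> (b' \<cdot> a)"
  proof -
    have "h \<cdot> (b' \<cdot> a) = (ShA C s \<cdot> q) \<cdot> a" by (rule comp_cancel[OF b(7)]) (use b(1-3) a(1-3) u in auto)
    also have "\<dots> = ShA C s \<cdot> (q \<cdot> a)" by (rule comp_assoc') (use a(1-3) pp s in auto)
    finally show ?thesis using a(7) by simp
  qed
  have "b' \<cdot> a \<in> I" "Dom C (b' \<cdot> a) = Dom C h'" "Cod C (b' \<cdot> a) = Dom C h" using aI bI a(1-3) b(1-3) u(5) u'(5) by simp_all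
  then show thesis using that 1 2 by blast
qed

text \<open>
  Denominators can be chosen so that the square in the quotient comes from two commutative squares in \<open>C\<close> with a
  common side \<open>f2\<close>: one with inverted sides to \<open>f\<close>, and one with the numerators to \<open>f'\<close>. Completing both gives the
  roof that is wanted.
\<close>

lemma TR3_L:
  assumes T: "(f, g, h) \<in> Tri C" and T': "(f', g', h') \<in> Tri C"
    and a: "a \<in> Arr Q" "Dom Q a = Dom C f" "Cod Q a = Dom C f'" and b: "b \<in> Arr Q" "Dom Q b = Dom C g" "Cod Q b = Dom C g'"
    and e: "b \<bullet> L f = L f' \<bullet> a"
  obtains c where "c \<in> Arr Q" "Dom Q c = Dom C h" "Cod Q c = Dom C h'" "c \<bullet> L g = L g' \<bullet> b" "ShA Q a \<bullet> L h = L h' \<bullet> c"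
proof -
  note u = triD[OF T] and u' = triD[OF T']
  obtain s a1 where s: "a = rc s a1" "roof s a1" "s \<in> I" "a1 \<in> Arr C" "Dom C a1 = Dom C s" "Dom Q a = Cod C s" "Cod Q a = Cod C a1" using Q_ArrE[OF a(1)] .
  obtain t b1 where t: "b = rc t b1" "roof t b1" "t \<in> I" "b1 \<in> Arr C" "Dom C b1 = Dom C t" "Dom Q b = Cod C t" "Cod Q b = Cod C b1" using Q_ArrE[OF b(1)] .
  have cs: "Cod C s = Dom C f" "Cod C a1 = Dom C f'" "Cod C t = Dom C g" "Cod C b1 = Dom C g'" using a b s(6,7) t(6,7) by auto
  have sa: "s \<in> Arr C" "t \<in> Arr C" using s(3) t(3) by auto
  have fs: "f \<cdot> s \<in> Arr C" "Dom C (f \<cdot> s) = Dom C s" "Cod C (f \<cdot> s) = Cod C t" using u cs sa by simp_all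
  obtain w k where w: "w \<in> I" "Cod C w = Dom C (f \<cdot> s)" "k \<in> Arr C" "Dom C k = Dom C w" "Cod C k = Dom C t" "(f \<cdot> s) \<cdot> w = t \<cdot> k"
    by (rule ore[OF fs(1) t(3) fs(3)])
  have wa: "w \<in> Arr C" "Cod C w = Dom C s" using w fs by auto
  have sw: "s \<cdot> w \<in> I" "Cod C (s \<cdot> w) = Dom C f" "Dom C (s \<cdot> w) = Dom C w" using s(3) w(1) wa cs by simp_all
  have fsw: "f \<cdot> (s \<cdot> w) = t \<cdot> k" using w(6) u(1) sa wa cs by simp
  have Lf: "L f = rc (s \<cdot> w) (t \<cdot> k)" using L_denominator(1)[OF u(1) sw(1,2)] fsw by simp
  have 1: "b \<bullet> L f = rc (s \<cdot> w) (b1 \<cdot> k)" unfolding t(1) Lf by (rule comp_rc[OF t(2) sw(1) w(3)]) (use w sw in auto)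
  have "L f' \<bullet> a = rc s (f' \<cdot> a1)" unfolding s(1) by (rule L_after[OF s(2) u'(1)]) (use cs in simp)
  also have "\<dots> = rc (s \<cdot> w) ((f' \<cdot> a1) \<cdot> w)"
    by (rule rc_refine(2)[symmetric]) (use s(3-5) wa sw u' cs in \<open>auto simp: roof_def\<close>)
  finally have "rc (s \<cdot> w) (b1 \<cdot> k) = rc (s \<cdot> w) ((f' \<cdot> a1) \<cdot> w)" using 1 e by simp
  then obtain z where z: "z \<in> I" "Cod C z = Dom C (s \<cdot> w)" "(b1 \<cdot> k) \<cdot> z = ((f' \<cdot> a1) \<cdot> w) \<cdot> z"
    by (rule rc_same_denominator) (use sw w(3-5) t(4,5) wa s(4,5) u'(1) cs in \<open>auto simp: roof_def\<close>)
  have za: "z \<in> Arr C" "Cod C z = Dom C w" using z(1,2) sw by auto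
  define s2 a2 f2 where "s2 = s \<cdot> (w \<cdot> z)" and "a2 = a1 \<cdot> (w \<cdot> z)" and "f2 = k \<cdot> z"
  have wz: "w \<cdot> z \<in> I" "Cod C (w \<cdot> z) = Dom C s" "Dom C (w \<cdot> z) = Dom C z" using w(1) z(1) za wa by simp_all
  have s2: "s2 \<in> I" "Dom C s2 = Dom C z" "Cod C s2 = Dom C f" using s(3) wz cs unfolding s2_def by simp_all
  have a2: "a2 \<in> Arr C" "Dom C a2 = Dom C z" "Cod C a2 = Dom C f'" using s(4,5) wz cs unfolding a2_def by simp_all
  have f2: "f2 \<in> Arr C" "Dom C f2 = Dom C z" "Cod C f2 = Dom C t" using w(3-5) za unfolding f2_def by simp_all
  have "(f \<cdot> (s \<cdot> w)) \<cdot> z = (t \<cdot> k) \<cdot> z" using fsw by simp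
  then have e1: "t \<cdot> f2 = f \<cdot> s2" unfolding f2_def s2_def using u(1) sa wa za w(3-5) cs by simp
  have e2: "b1 \<cdot> f2 = f' \<cdot> a2" using z(3) unfolding f2_def a2_def using t(4,5) w(3-5) za wa u'(1) s(4,5) cs by simp
  have "rc (s \<cdot> (w \<cdot> z)) (a1 \<cdot> (w \<cdot> z)) = rc s a1" by (rule rc_refine(2)[OF s(2)]) (use wz s(3) in auto)
  then have aa: "a = rc s2 a2" using s(1) by (simp add: s2_def a2_def)
  obtain g2 h2 where T2: "(f2, g2, h2) \<in> Tri C" using TR1_cone f2 by blast
  note u2 = triD[OF T2]
  have dg2: "Dom C g2 = Dom C t" using u2(4) f2 by simp
  obtain r where r: "r \<in> I" "Dom C r = Dom C h2" "Cod C r = Dom C h" "r \<cdot> g2 = g \<cdot> t" "ShA C s2 \<cdot> h2 = h \<cdot> r"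
    by (rule square_cones[OF T T2 s2(1) _ s2(3) t(3) _ _ e1]) (use s2 f2 dg2 cs in auto)
  obtain r' where r': "r' \<in> Arr C" "Dom C r' = Dom C h2" "Cod C r' = Dom C h'" "r' \<cdot> g2 = g' \<cdot> b1" "ShA C a2 \<cdot> h2 = h' \<cdot> r'"
    by (rule TR3_arr[OF T2 T' a2(1) _ a2(3) t(4) _ cs(4) e2]) (use a2 f2 dg2 t in auto)
  have rr: "roof r r'" using r r' by (simp add: roof_def)
  have h2: "Dom C h2 = Cod C g2" using u2 by simp
  have A: "rc r r' \<bullet> L g = L g' \<bullet> b"
  proof -
    have "L g = rc t (g \<cdot> t)" by (rule L_denominator(1)[OF u(2) t(3)]) (use cs in simp)
    then have "L g = rc t (r \<cdot> g2)" using r(4) by simp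
    moreover have "rc r r' \<bullet> rc t (r \<cdot> g2) = rc t (r' \<cdot> g2)" by (rule comp_rc[OF rr t(3) u2(2) dg2]) (use r h2 in simp)
    moreover have "L g' \<bullet> rc t b1 = rc t (g' \<cdot> b1)" by (rule L_after[OF t(2) u'(2)]) (use cs in simp)
    ultimately show ?thesis using r'(4) t(1) by simp
  qed
  have B: "ShA Q a \<bullet> L h = L h' \<bullet> rc r r'"
  proof -
    have sr: "roof s2 a2" "roof (ShA C s2) (ShA C a2)" using s2 a2 by (auto simp: roof_def I_sh)
    have "ShA Q a = rc (ShA C s2) (ShA C a2)" unfolding aa by (rule Q_ShA_rc[OF sr(1)])
    moreover have "L h = rc r (h \<cdot> r)" by (rule L_denominator(1)[OF u(3) r(1) r(3)])
    then have "L h = rc r (ShA C s2 \<cdot> h2)" using r(5) by simp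
    moreover have "rc (ShA C s2) (ShA C a2) \<bullet> rc r (ShA C s2 \<cdot> h2) = rc r (ShA C a2 \<cdot> h2)"
      by (rule comp_rc[OF sr(2) r(1) u2(3)]) (use r u2 s2 f2 in auto)
    moreover have "L h' \<bullet> rc r r' = rc r (h' \<cdot> r')" by (rule L_after[OF rr u'(3)]) (use r' in simp)
    ultimately show ?thesis using r'(5) by simp
  qed
  have "rc r r' \<in> Arr Q" "Dom Q (rc r r') = Dom C h" "Cod Q (rc r r') = Dom C h'" using rr r r' by simp_all
  then show thesis using that A B by blast
qed

text \<open>
  Each axiom is proved for images of triangles and then moved along the isomorphisms that define the triangles
  of the quotient.
\<close>

lemma pretriangulated_Q: "pretriangulated_category Q"
proof -
  interpret A: additive_linear_category Q by (rule additive_Q)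
  show ?thesis
  proof
    show "bij_betw (Sh Q) (Obj Q) (Obj Q)" using shift_obj by simp
    show "bij_betw (ShA Q) (Arr Q) (Arr Q)"
      unfolding bij_betw_def inj_on_def using Q_sha_inj Q_sha_arr(1) Q_sha_surj by (metis (no_types, lifting) image_iff subsetI subset_antisym)
    show "\<And>f X Y. f \<in> hom Q X Y \<Longrightarrow> ShA Q f \<in> hom Q (Sh Q X) (Sh Q Y)" using Q_sha_arr by (simp add: Q_hom)
    show "\<And>X. X \<in> Obj Q \<Longrightarrow> ShA Q (Ide Q X) = Ide Q (Sh Q X)" using Q_sha_ide by simp
    show "\<And>f X Y g Z. f \<in> hom Q X Y \<Longrightarrow> g \<in> hom Q Y Z \<Longrightarrow> ShA Q (g \<bullet> f) = ShA Q g \<bullet> ShA Q f"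
      using Q_sha_comp by (simp add: Q_hom)
    show "\<And>f X Y g. f \<in> hom Q X Y \<Longrightarrow> g \<in> hom Q X Y \<Longrightarrow> ShA Q (Add Q f g) = Add Q (ShA Q f) (ShA Q g)"
      using Q_sha_add by (simp add: Q_hom)
    show "\<And>f X Y r. f \<in> hom Q X Y \<Longrightarrow> ShA Q (Scale Q r f) = Scale Q r (ShA Q f)"
      using Q_sha_scale by (simp add: Q_hom)
    show "\<And>t. t \<in> Tri Q \<Longrightarrow> candidate_triangle Q (Sh Q) t" by (simp add: Q_Tri)
  next
    fix t t' assume t: "t \<in> Tri Q" and c: "candidate_triangle Q (Sh Q) t'" and i: "triangle_iso Q (ShA Q) t t'"
    obtain f g h f' g' h' where tt: "t = (f, g, h)" "t' = (f', g', h')" by (cases t; cases t') auto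
    have ft: "(f, g, h) \<in> Tri Q" using t tt by simp
    obtain f0 g0 h0 a b c0 where "presents f0 g0 h0 a b c0 f g h"
      using Tri_Q_E[OF ft] .
    note T = presentsD[OF this]
    obtain x y z where xyz': "x \<in> hom Q (Dom Q f) (Dom Q f')" "y \<in> hom Q (Dom Q g) (Dom Q g')" "z \<in> hom Q (Dom Q h) (Dom Q h')"
      "is_iso Q x" "is_iso Q y" "is_iso Q z" "y \<bullet> f = f' \<bullet> x" "z \<bullet> g = g' \<bullet> y" "ShA Q x \<bullet> h = h' \<bullet> z"
      using i unfolding tt triangle_iso_def prod.case by blast
    have xyz: "x \<in> Arr Q" "Dom Q x = Dom Q f" "Cod Q x = Dom Q f'" "y \<in> Arr Q" "Dom Q y = Dom Q g" "Cod Q y = Dom Q g'"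
      "z \<in> Arr Q" "Dom Q z = Dom Q h" "Cod Q z = Dom Q h'" using xyz'(1-3) by (simp_all add: Q_hom)
    have c': "f' \<in> Arr Q" "g' \<in> Arr Q" "h' \<in> Arr Q" "Cod Q f' = Dom Q g'" "Cod Q g' = Dom Q h'" "Cod Q h' = Sh C (Dom Q f')"
      using c unfolding tt by (auto simp: candidate_triangle_def)
    note t0 = triD[OF T(1)]
    have "(f', g', h') \<in> Tri Q"
    proof (rule Tri_Q_I[OF T(1), of "x \<bullet> a" "y \<bullet> b" "z \<bullet> c0"])
      show "is_iso Q (x \<bullet> a)" by (rule Q.is_iso_comp) (use T(2) xyz'(4) xyz T(14) in auto)
      show "is_iso Q (y \<bullet> b)" by (rule Q.is_iso_comp) (use T(3) xyz'(5) xyz T(15) in auto)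
      show "is_iso Q (z \<bullet> c0)" by (rule Q.is_iso_comp) (use T(4) xyz'(6) xyz T(16) in auto)
      have "y \<bullet> (f \<bullet> a) = (f' \<bullet> x) \<bullet> a" by (rule Q.comp_cancel[OF xyz'(7)]) (use T(5-19) xyz in auto)
      then show "(y \<bullet> b) \<bullet> L f0 = f' \<bullet> (x \<bullet> a)" using T(5-20) xyz c' t0 by simp
      have "z \<bullet> (g \<bullet> b) = (g' \<bullet> y) \<bullet> b" by (rule Q.comp_cancel[OF xyz'(8)]) (use T(5-19) xyz in auto)
      then show "(z \<bullet> c0) \<bullet> L g0 = g' \<bullet> (y \<bullet> b)" using T(5-19,21) xyz c' t0 by simp
      have "ShA Q x \<bullet> (h \<bullet> c0) = (h' \<bullet> z) \<bullet> c0" by (rule Q.comp_cancel[OF xyz'(9)]) (use T(5-19) xyz Q_sha_arr in auto)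
      then show "ShA Q (x \<bullet> a) \<bullet> L h0 = h' \<bullet> (z \<bullet> c0)"
        using T(5-19,22) xyz c' t0 Q_sha_arr[of x] Q_sha_arr[of a] Q_sha_comp[of a x] by simp
    qed (use T(5-19) xyz c' in auto)
    then show "t' \<in> Tri Q" by (simp add: tt)
  next
    fix X Z assume X: "X \<in> Obj Q" and Z: "zero_obj Q Z"
    have Xo: "X \<in> Obj C" "Z \<in> Obj C" using X Q.zero_obj_Obj[OF Z] by auto
    obtain Z0 where Z0: "zero_obj C Z0" using ex_zero by blast
    have T: "(Ide C X, Null C X Z0, Null C Z0 (Sh C X)) \<in> Tri C" using TR1_ide[OF _ Z0] Xo by simp
    obtain c where c: "c \<in> Arr Q" "Dom Q c = Z0" "Cod Q c = Z" "is_iso Q c"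
      using Q.zero_isomorphic[OF zero_L[OF Z0] Z] Q.isomorphicE by metis
    have c0: "c = Null Q Z0 Z" using Q.zero_to[OF Z c(1,3)] c(2) by simp
    have o: "Z0 \<in> Obj C" using Z0 zero_obj_Obj by blast
    show "(Ide Q X, Null Q X Z, Null Q Z (Sh Q X)) \<in> Tri Q"
      by (rule Tri_Q_I[OF T, of "Ide Q X" "Ide Q X" c]) (use c c0 Xo o Q_sha_ide in \<open>auto simp: L_ide L_null\<close>)
  next
    fix f assume f: "f \<in> Arr Q"
    obtain s f0 where s: "f = rc s f0" "roof s f0" "s \<in> I" "f0 \<in> Arr C" "Dom C f0 = Dom C s" "Dom Q f = Cod C s" "Cod Q f = Cod C f0" using Q_ArrE[OF f] .
    obtain g h where T: "(f0, g, h) \<in> Tri C" using TR1_cone s by blast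
    note t = triD[OF T]
    have sL: "L s \<in> Arr Q" "Dom Q (L s) = Dom C s" "Cod Q (L s) = Cod C s" using s(3) by auto
    have "(f, L g, ShA Q (L s) \<bullet> L h) \<in> Tri Q"
    proof (rule Tri_Q_I[OF T L_I[OF s(3)], of "Ide Q (Cod C f0)" "Ide Q (Cod C g)"])
      show "Ide Q (Cod C f0) \<bullet> L f0 = f \<bullet> L s" using rc_factor[OF s(2)] s(1,4) by simp
    qed (use f s(4-7) sL t Q_sha_arr[OF sL(1)] in auto)
    then show "\<exists>g h. (f, g, h) \<in> Tri Q" by blast
  next
    fix f g h assume "candidate_triangle Q (Sh Q) (f, g, h)"
    then have c: "f \<in> Arr Q" "g \<in> Arr Q" "h \<in> Arr Q" "Cod Q f = Dom Q g" "Cod Q g = Dom Q h" "Cod Q h = Sh C (Dom Q f)"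
      by (auto simp: candidate_triangle_def)
    note sf = Q_sha_arr[OF c(1)]
    show "(f, g, h) \<in> Tri Q \<longleftrightarrow> (g, h, Scale Q (-1) (ShA Q f)) \<in> Tri Q"
    proof
      assume A: "(f, g, h) \<in> Tri Q"
      obtain f0 g0 h0 a b c0 where "presents f0 g0 h0 a b c0 f g h"
      using Tri_Q_E[OF A] .
    note T = presentsD[OF this]
      note t0 = triD[OF T(1)]
      have sq: "ShA Q b \<bullet> ShA Q (L f0) = ShA Q f \<bullet> ShA Q a"
        using Q_sha_comp[of "L f0" b] Q_sha_comp[of a f] T(5-20) c t0 by simp
      show "(g, h, Scale Q (-1) (ShA Q f)) \<in> Tri Q"
      proof (rule Tri_Q_I[OF tri_rotI[OF T(1)] T(3,4) Q_sha_iso[OF T(2)]])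
        have "L (neg (ShA C f0)) = Scale Q (-1) (ShA Q (L f0))" using L_scale[of "ShA C f0" "-1"] L_sh t0 by simp
        then show "ShA Q b \<bullet> L (neg (ShA C f0)) = Scale Q (-1) (ShA Q f) \<bullet> ShA Q a"
          using sq sf Q_sha_arr[OF T(5)] Q_sha_arr[OF T(6)] Q_sha_arr[of "L f0"] T(5-19) c t0 by simp
      qed (use T(5-22) c t0 sf Q_sha_arr[OF T(5)] in auto)
    next
      assume A: "(g, h, Scale Q (-1) (ShA Q f)) \<in> Tri Q"
      obtain g0 h0 k0 b c0 a' where "presents g0 h0 k0 b c0 a' g h (Scale Q (-1) (ShA Q f))"
      using Tri_Q_E[OF A] .
    note T = presentsD[OF this]
      obtain f0 where F: "(f0, g0, h0) \<in> Tri C" "k0 = neg (ShA C f0)" using tri_rot_back[OF T(1)] .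
      note t0 = triD[OF F(1)]
      have a': "Cod Q a' = Sh C (Dom Q f)" "Dom Q a' = Sh C (Dom C f0)" using T(10,16) sf t0 by simp_all
      obtain a where a: "a \<in> Arr Q" "a' = ShA Q a" using Q_sha_surj[OF T(7)] .
      note sa = Q_sha_arr[OF a(1)]
      have ao: "Dom Q a \<in> Obj C" "Cod Q a \<in> Obj C" "Dom Q f \<in> Obj C" using Q.dom_obj Q.cod_obj a c by auto
      have da: "Dom Q a = Dom C f0" "Cod Q a = Dom Q f" using sh_inj[of "Dom Q a" "Dom C f0"] sh_inj[of "Cod Q a" "Dom Q f"] a' a(2) sa ao t0 by auto
      obtain x' where x': "x' \<in> Arr Q" "Dom Q x' = Cod Q a'" "Cod Q x' = Dom Q a'" "x' \<bullet> a' = Ide Q (Dom Q a')" "a' \<bullet> x' = Ide Q (Cod Q a')"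
        using Q.is_isoE[OF T(4)] by metis
      obtain x where x: "x \<in> Arr Q" "x' = ShA Q x" using Q_sha_surj[OF x'(1)] .
      note sx = Q_sha_arr[OF x(1)]
      have xo: "Dom Q x \<in> Obj C" "Cod Q x \<in> Obj C" using Q.dom_obj Q.cod_obj x by auto
      have dx: "Dom Q x = Dom Q f" "Cod Q x = Dom C f0"
        using sh_inj[of "Dom Q x" "Dom Q f"] sh_inj[of "Cod Q x" "Dom C f0"] x' x(2) sx a' xo ao t0 by auto
      have "ShA Q (x \<bullet> a) = ShA Q (Ide Q (Dom C f0))" using Q_sha_comp[of a x] x'(4) x a da dx a' Q_sha_ide t0 by simp
      then have xa: "x \<bullet> a = Ide Q (Dom C f0)" by (rule Q_sha_inj[rotated 2]) (use x a da dx t0 in auto)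
      have "ShA Q (a \<bullet> x) = ShA Q (Ide Q (Dom Q f))" using Q_sha_comp[of x a] x'(5) x a da dx a' Q_sha_ide ao by simp
      then have ax: "a \<bullet> x = Ide Q (Dom Q f)" by (rule Q_sha_inj[rotated 2]) (use x a da dx ao in auto)
      have ia: "is_iso Q a" by (rule Q.is_isoI[of a "Dom C f0" "Dom Q f" x]) (use xa ax a x da dx in \<open>auto simp: Q_hom\<close>)
      have Lk: "L k0 = Scale Q (-1) (ShA Q (L f0))" using L_scale[of "ShA C f0" "-1"] L_sh t0 F(2) by simp
      have db: "Dom Q b = Cod C f0" using T(8) t0 by simp
      have lf: "ShA Q (L f0) \<in> Arr Q" "Dom Q (ShA Q (L f0)) = Sh C (Dom C f0)" "Cod Q (ShA Q (L f0)) = Sh C (Cod C f0)"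
        using Q_sha_arr[of "L f0"] t0 by simp_all
      have "Scale Q (-1) (ShA Q b \<bullet> ShA Q (L f0)) = Scale Q (-1) (ShA Q f \<bullet> a')"
        using T(22) Lk lf Q_sha_arr[OF T(5)] db sf T(7) a' by simp
      then have "Scale Q (-1) (Scale Q (-1) (ShA Q b \<bullet> ShA Q (L f0))) = Scale Q (-1) (Scale Q (-1) (ShA Q f \<bullet> a'))" by simp
      then have "ShA Q b \<bullet> ShA Q (L f0) = ShA Q f \<bullet> a'"
        using lf Q_sha_arr[OF T(5)] db sf T(7) a' by simp
      then have "ShA Q (b \<bullet> L f0) = ShA Q (f \<bullet> a)"
        using Q_sha_comp[of "L f0" b] Q_sha_comp[of a f] T(5) db t0 a da c by simp
      then have sq: "b \<bullet> L f0 = f \<bullet> a" by (rule Q_sha_inj[rotated 2]) (use T(5) db t0 a da c in auto)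
      show "(f, g, h) \<in> Tri Q"
        by (rule Tri_Q_I[OF F(1) ia T(2,3)]) (use da db T(5-21) c sq a in auto)
    qed
  next
    fix f g h f' g' h' a b assume T: "(f, g, h) \<in> Tri Q" and T': "(f', g', h') \<in> Tri Q" and a: "a \<in> hom Q (Dom Q f) (Dom Q f')"
      and b: "b \<in> hom Q (Dom Q g) (Dom Q g')" and e: "b \<bullet> f = f' \<bullet> a"
    have ab: "a \<in> Arr Q" "Dom Q a = Dom Q f" "Cod Q a = Dom Q f'" "b \<in> Arr Q" "Dom Q b = Dom Q g" "Cod Q b = Dom Q g'"
      using a b by (simp_all add: Q_hom)
    obtain f0 g0 h0 x y z where "presents f0 g0 h0 x y z f g h"
      using Tri_Q_E[OF T] .
    note U = presentsD[OF this]
    obtain f1 g1 h1 x' y' z' where "presents f1 g1 h1 x' y' z' f' g' h'"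
      using Tri_Q_E[OF T'] .
    note U' = presentsD[OF this]
    note t0 = triD[OF U(1)] and t1 = triD[OF U'(1)]
    obtain xi where xi: "xi \<in> Arr Q" "Dom Q xi = Cod Q x'" "Cod Q xi = Dom Q x'" "xi \<bullet> x' = Ide Q (Dom Q x')" "x' \<bullet> xi = Ide Q (Cod Q x')"
      using Q.is_isoE[OF U'(2)] by metis
    obtain yi where yi: "yi \<in> Arr Q" "Dom Q yi = Cod Q y'" "Cod Q yi = Dom Q y'" "yi \<bullet> y' = Ide Q (Dom Q y')" "y' \<bullet> yi = Ide Q (Cod Q y')"
      using Q.is_isoE[OF U'(3)] by metis
    obtain zi where zi: "zi \<in> Arr Q" "Dom Q zi = Cod Q z" "Cod Q zi = Dom Q z" "zi \<bullet> z = Ide Q (Dom Q z)" "z \<bullet> zi = Ide Q (Cod Q z)"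
      using Q.is_isoE[OF U(4)] by metis
    define a0 b0 where "a0 = xi \<bullet> (a \<bullet> x)" and "b0 = yi \<bullet> (b \<bullet> y)"
    have a0: "a0 \<in> Arr Q" "Dom Q a0 = Dom C f0" "Cod Q a0 = Dom C f1" unfolding a0_def using xi(1-3) ab U(5-19) U'(5-19) by simp_all
    have b0: "b0 \<in> Arr Q" "Dom Q b0 = Dom C g0" "Cod Q b0 = Dom C g1" unfolding b0_def using yi(1-3) ab U(5-19) U'(5-19) t0 t1 by simp_all
    have xa: "x' \<bullet> a0 = a \<bullet> x"
      unfolding a0_def using Q.comp_cancel[OF xi(5), of "a \<bullet> x"] xi(1-3) ab U(5-19) U'(5-19) by simp
    have yb: "y' \<bullet> b0 = b \<bullet> y"
      unfolding b0_def using Q.comp_cancel[OF yi(5), of "b \<bullet> y"] yi(1-3) ab U(5-19) U'(5-19) by simp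
    have e0: "b0 \<bullet> L f0 = L f1 \<bullet> a0"
    proof -
      have "b0 \<bullet> L f0 = yi \<bullet> (b \<bullet> (y \<bullet> L f0))"
        unfolding b0_def using yi(1-3) ab U(5-19) U'(5-19) t0 by simp
      also have "\<dots> = yi \<bullet> (b \<bullet> (f \<bullet> x))" using U(20) by simp
      also have "b \<bullet> (f \<bullet> x) = (f' \<bullet> a) \<bullet> x" by (rule Q.comp_cancel[OF e]) (use ab U(5-19) in auto)
      also have "\<dots> = f' \<bullet> (x' \<bullet> a0)" unfolding xa using ab U(5-19) U'(5-19) by simp
      also have "\<dots> = (y' \<bullet> L f1) \<bullet> a0" by (rule Q.comp_cancel[OF U'(20)[symmetric]]) (use a0 U'(5-19) in auto)
      also have "yi \<bullet> \<dots> = L f1 \<bullet> a0"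
        using Q.comp_cancel[OF yi(4), of "L f1 \<bullet> a0"] yi(1-3) a0 U'(5-19) t1 by simp
      finally show ?thesis .
    qed
    obtain c0 where c0: "c0 \<in> Arr Q" "Dom Q c0 = Dom C h0" "Cod Q c0 = Dom C h1" "c0 \<bullet> L g0 = L g1 \<bullet> b0" "ShA Q a0 \<bullet> L h0 = L h1 \<bullet> c0"
      by (rule TR3_L[OF U(1) U'(1) a0 b0 e0])
    define c where "c = z' \<bullet> (c0 \<bullet> zi)"
    have c: "c \<in> Arr Q" "Dom Q c = Dom Q h" "Cod Q c = Dom Q h'" unfolding c_def using c0(1-3) zi(1-3) U(5-19) U'(5-19) t0 t1 by simp_all
    have cz: "c \<bullet> z = z' \<bullet> c0" unfolding c_def using zi U(5-19) U'(5-19) c0(1-3) t0 t1 by simp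
    obtain yj where yj: "yj \<in> Arr Q" "Dom Q yj = Cod Q y" "Cod Q yj = Dom Q y" "y \<bullet> yj = Ide Q (Cod Q y)"
      using Q.is_isoE[OF U(3)] by metis
    have 1: "(c \<bullet> g) \<bullet> y = (g' \<bullet> b) \<bullet> y"
    proof -
      have "(c \<bullet> g) \<bullet> y = c \<bullet> (z \<bullet> L g0)" unfolding U(21) using c U(5-19) by simp
      also have "\<dots> = (z' \<bullet> c0) \<bullet> L g0" by (rule Q.comp_cancel[OF cz]) (use c U(5-19) t0 in auto)
      also have "\<dots> = z' \<bullet> (L g1 \<bullet> b0)" using c0 U(5-19) U'(5-19) t0 t1 by simp
      also have "\<dots> = (g' \<bullet> y') \<bullet> b0" by (rule Q.comp_cancel[OF U'(21)]) (use b0 U'(5-19) t1 in auto)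
      also have "\<dots> = g' \<bullet> (b \<bullet> y)" using yb b0 U'(5-19) t1 by simp
      finally show ?thesis using ab U(5-19) U'(5-19) by simp
    qed
    have cg: "c \<bullet> g = g' \<bullet> b"
    proof -
      have "((c \<bullet> g) \<bullet> y) \<bullet> yj = ((g' \<bullet> b) \<bullet> y) \<bullet> yj" using 1 by simp
      then show ?thesis using yj ab U(5-19) U'(5-19) c by simp
    qed
    have 2: "(ShA Q a \<bullet> h) \<bullet> z = (h' \<bullet> c) \<bullet> z"
    proof -
      note sh = Q_sha_arr[OF ab(1)] Q_sha_arr[OF U(5)] Q_sha_arr[OF U'(5)] Q_sha_arr[OF a0(1)]
      have s: "ShA Q a \<bullet> ShA Q x = ShA Q x' \<bullet> ShA Q a0"
        using Q_sha_comp[of x a] Q_sha_comp[of a0 x'] xa ab a0 U(5-19) U'(5-19) by simp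
      have "(ShA Q a \<bullet> h) \<bullet> z = ShA Q a \<bullet> (ShA Q x \<bullet> L h0)" unfolding U(22) using sh ab U(5-19) by simp
      also have "\<dots> = (ShA Q x' \<bullet> ShA Q a0) \<bullet> L h0" by (rule Q.comp_cancel[OF s]) (use sh ab U(5-19) t0 in auto)
      also have "\<dots> = ShA Q x' \<bullet> (L h1 \<bullet> c0)" using c0(5) sh a0 U'(5-19) t0 by simp
      also have "\<dots> = (h' \<bullet> z') \<bullet> c0" by (rule Q.comp_cancel[OF U'(22)]) (use sh c0(1-3) U'(5-19) t1 in auto)
      also have "\<dots> = h' \<bullet> (c \<bullet> z)" unfolding cz using c0(1-3) U'(5-19) t1 by simp
      finally show ?thesis using c U(5-19) U'(5-19) by simp
    qed
    have hc: "ShA Q a \<bullet> h = h' \<bullet> c"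
    proof -
      have "((ShA Q a \<bullet> h) \<bullet> z) \<bullet> zi = ((h' \<bullet> c) \<bullet> z) \<bullet> zi" using 2 by simp
      then show ?thesis using zi ab U(5-19) U'(5-19) c Q_sha_arr[OF ab(1)] by simp
    qed
    show "\<exists>c\<in>hom Q (Dom Q h) (Dom Q h'). c \<bullet> g = g' \<bullet> b \<and> ShA Q a \<bullet> h = h' \<bullet> c"
      by (rule bexI[of _ c]) (use c cg hc in \<open>auto simp: Q_hom\<close>)
  qed
qed

end

sublocale verdier \<subseteq> Q: pretriangulated_category "verdier_quotient C V"
  by (rule pretriangulated_Q)

context verdier
begin

text \<open>
  A composable pair of roofs is isomorphic to the image of a composable pair in \<open>C\<close>. The image of an octahedron
  on that pair is carried to the given triangles by isomorphisms that exist by the five lemma.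
\<close>

lemma TR4_Q:
  assumes f: "f \<in> hom Q X Y" and g: "g \<in> hom Q Y Z" and T1: "(f, p1, d1) \<in> Tri Q"
    and T2: "(g \<bullet> f, p2, d2) \<in> Tri Q" and T3: "(g, p3, d3) \<in> Tri Q"
  shows "\<exists>a b. (a, b, ShA Q p1 \<bullet> d3) \<in> Tri Q \<and> a \<bullet> p1 = p2 \<bullet> g \<and> d2 \<bullet> a = d1 \<and>
      b \<bullet> p2 = p3 \<and> d3 \<bullet> b = ShA Q f \<bullet> d2"
proof -
  have fg: "f \<in> Arr Q" "Dom Q f = X" "Cod Q f = Y" "g \<in> Arr Q" "Dom Q g = Y" "Cod Q g = Z" using f g by (simp_all add: Q_hom)
  obtain t g1 where t: "g = rc t g1" "roof t g1" "t \<in> I" "g1 \<in> Arr C" "Dom C g1 = Dom C t" "Dom Q g = Cod C t" "Cod Q g = Cod C g1" using Q_ArrE[OF fg(4)] .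
  obtain s f1 where s: "f = rc s (t \<cdot> f1)" "s \<in> I" "f1 \<in> Arr C" "Dom C f1 = Dom C s" "Cod C f1 = Dom C t" "Cod C s = Dom Q f"
    by (rule rep_through[OF fg(1) t(3)]) (use fg t(6) in simp)
  have ob: "X \<in> Obj C" "Y \<in> Obj C" "Z \<in> Obj C" using Q.hom_obj[OF f] Q.hom_obj[OF g] by auto
  have cs: "Cod C s = X" "Cod C t = Y" "Cod C g1 = Z" using s(6) t(6,7) fg by auto
  have sa: "s \<in> Arr C" "t \<in> Arr C" using s(2) t(3) by auto
  have fs: "f \<bullet> L s = L t \<bullet> L f1"
  proof -
    have "roof s (t \<cdot> f1)" using s(2-5) t(3) by (simp add: roof_def)
    then have "f \<bullet> L s = L (t \<cdot> f1)" unfolding s(1) by (rule rc_factor)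
    then show ?thesis using L_comp[of f1 t] s(3,5) sa by simp
  qed
  have gt: "g \<bullet> L t = L g1" unfolding t(1) by (rule rc_factor[OF t(2)])
  have c1: "Cod C f1 = Dom C g1" using s(5) t(5) by simp
  have gf1: "g1 \<cdot> f1 \<in> Arr C" "Dom C (g1 \<cdot> f1) = Dom C s" "Cod C (g1 \<cdot> f1) = Z" using t(4) s(3,4) c1 cs by simp_all
  obtain P1 D1 where U1: "(f1, P1, D1) \<in> Tri C" using TR1_cone[OF s(3)] by blast
  obtain P2 D2 where U2: "(g1 \<cdot> f1, P2, D2) \<in> Tri C" using TR1_cone[OF gf1(1)] by blast
  obtain P3 D3 where U3: "(g1, P3, D3) \<in> Tri C" using TR1_cone[OF t(4)] by blast
  note u1 = triD[OF U1] and u2 = triD[OF U2] and u3 = triD[OF U3]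
  note t1 = Q.triD[OF T1] and t2 = Q.triD[OF T2] and t3 = Q.triD[OF T3]
  obtain A B where AB: "A \<in> Arr C" "Dom C A = Cod C P1" "Cod C A = Cod C P2" "B \<in> Arr C" "Dom C B = Cod C P2" "Cod C B = Cod C P3"
    "(A, B, ShA C P1 \<cdot> D3) \<in> Tri C" "A \<cdot> P1 = P2 \<cdot> g1" "D2 \<cdot> A = D1" "B \<cdot> P2 = P3" "D3 \<cdot> B = ShA C f1 \<cdot> D2"
    by (rule TR4_arr[OF s(3) t(4) c1 U1 U2 U3])
  note L1 = L_Tri[OF U1] and L2 = L_Tri[OF U2] and L3 = L_Tri[OF U3]
  have dP: "Dom C P1 = Dom C t" "Dom C P2 = Z" "Dom C P3 = Z" using u1(4) u2(4) u3(4) s(5) gf1 cs by simp_all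
  have dD: "Dom C D1 = Cod C P1" "Dom C D2 = Cod C P2" "Dom C D3 = Cod C P3"
    "Cod C D1 = Sh C (Dom C s)" "Cod C D2 = Sh C (Dom C s)" "Cod C D3 = Sh C (Dom C t)"
    using u1(5,6) u2(5,6) u3(5,6) s(4) gf1 t(5) by simp_all
  have dp: "Dom Q p1 = Y" "Dom Q p2 = Z" "Dom Q p3 = Z" "Dom Q d1 = Cod Q p1" "Dom Q d2 = Cod Q p2" "Dom Q d3 = Cod Q p3"
    "Cod Q d1 = Sh C X" "Cod Q d2 = Sh C X" "Cod Q d3 = Sh C Y"
    using t1(4,5,6) t2(4,5,6) t3(4,5,6) fg by simp_all
  have p: "p1 \<in> Arr Q" "p2 \<in> Arr Q" "p3 \<in> Arr Q" "d1 \<in> Arr Q" "d2 \<in> Arr Q" "d3 \<in> Arr Q" using t1(2,3) t2(2,3) t3(2,3) by auto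
  have PD: "P1 \<in> Arr C" "P2 \<in> Arr C" "P3 \<in> Arr C" "D1 \<in> Arr C" "D2 \<in> Arr C" "D3 \<in> Arr C" using u1(2,3) u2(2,3) u3(2,3) by auto
  have LP: "L P1 \<in> Arr Q" "Dom Q (L P1) = Dom C t" "Cod Q (L P1) = Cod C P1" "L P2 \<in> Arr Q" "Dom Q (L P2) = Z" "Cod Q (L P2) = Cod C P2"
    "L P3 \<in> Arr Q" "Dom Q (L P3) = Z" "Cod Q (L P3) = Cod C P3"
    "L D1 \<in> Arr Q" "Dom Q (L D1) = Cod C P1" "Cod Q (L D1) = Sh C (Dom C s)" "L D2 \<in> Arr Q" "Dom Q (L D2) = Cod C P2" "Cod Q (L D2) = Sh C (Dom C s)"
    "L D3 \<in> Arr Q" "Dom Q (L D3) = Cod C P3" "Cod Q (L D3) = Sh C (Dom C t)"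
    using PD dP dD by simp_all
  have Ls: "L s \<in> Arr Q" "Dom Q (L s) = Dom C s" "Cod Q (L s) = X" "is_iso Q (L s)"
    and Lt: "L t \<in> Arr Q" "Dom Q (L t) = Dom C t" "Cod Q (L t) = Y" "is_iso Q (L t)" using sa cs L_I s(2) t(3) by simp_all
  have Lf: "L f1 \<in> Arr Q" "Dom Q (L f1) = Dom C s" "Cod Q (L f1) = Dom C t" "L g1 \<in> Arr Q" "Dom Q (L g1) = Dom C t" "Cod Q (L g1) = Z"
    using s(3-5) t(4,5) cs by simp_all
  have LA: "L A \<in> Arr Q" "Dom Q (L A) = Cod C P1" "Cod Q (L A) = Cod C P2" "L B \<in> Arr Q" "Dom Q (L B) = Cod C P2" "Cod Q (L B) = Cod C P3"
    using AB(1-6) by simp_all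
  obtain x1 where x1: "x1 \<in> Arr Q" "Dom Q x1 = Dom Q (L D1)" "Cod Q x1 = Dom Q d1" "is_iso Q x1" "x1 \<bullet> L P1 = p1 \<bullet> L t" "ShA Q (L s) \<bullet> L D1 = d1 \<bullet> x1"
    by (rule Q.tri_iso_extend[OF L1 T1, of "L s" "L t"]) (use Ls Lt Lf LP dp fg fs in \<open>auto simp: Q_hom\<close>)
  have e2: "Ide Q Z \<bullet> L (g1 \<cdot> f1) = (g \<bullet> f) \<bullet> L s"
  proof -
    have "L (g1 \<cdot> f1) = (g \<bullet> L t) \<bullet> L f1" using L_comp[OF s(3) t(4) c1] gt by simp
    also have "\<dots> = g \<bullet> (f \<bullet> L s)" unfolding fs using Lt Lf fg by simp
    finally show ?thesis using Ls fg gf1 by simp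
  qed
  obtain x2 where x2: "x2 \<in> Arr Q" "Dom Q x2 = Dom Q (L D2)" "Cod Q x2 = Dom Q d2" "is_iso Q x2" "x2 \<bullet> L P2 = p2 \<bullet> Ide Q Z" "ShA Q (L s) \<bullet> L D2 = d2 \<bullet> x2"
    by (rule Q.tri_iso_extend[OF L2 T2, of "L s" "Ide Q Z"]) (use Ls LP dp fg e2 gf1 ob in \<open>auto simp: Q_hom\<close>)
  have e3: "Ide Q Z \<bullet> L g1 = g \<bullet> L t" using gt Lf by simp
  obtain x3 where x3: "x3 \<in> Arr Q" "Dom Q x3 = Dom Q (L D3)" "Cod Q x3 = Dom Q d3" "is_iso Q x3" "x3 \<bullet> L P3 = p3 \<bullet> Ide Q Z" "ShA Q (L t) \<bullet> L D3 = d3 \<bullet> x3"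
    by (rule Q.tri_iso_extend[OF L3 T3, of "L t" "Ide Q Z"]) (use Lt Lf LP dp fg e3 ob in \<open>auto simp: Q_hom\<close>)
  have X: "Dom Q x1 = Cod C P1" "Cod Q x1 = Cod Q p1" "Dom Q x2 = Cod C P2" "Cod Q x2 = Cod Q p2" "Dom Q x3 = Cod C P3" "Cod Q x3 = Cod Q p3"
    using x1(2,3) x2(2,3) x3(2,3) LP dp by simp_all
  have xP: "x2 \<bullet> L P2 = p2" "x3 \<bullet> L P3 = p3" using x2(5) x3(5) p dp by simp_all
  obtain y1 where y1: "y1 \<in> Arr Q" "Dom Q y1 = Cod Q p1" "Cod Q y1 = Cod C P1" "y1 \<bullet> x1 = Ide Q (Cod C P1)" "x1 \<bullet> y1 = Ide Q (Cod Q p1)"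
    using Q.is_isoE[OF x1(4)] X by metis
  obtain y2 where y2: "y2 \<in> Arr Q" "Dom Q y2 = Cod Q p2" "Cod Q y2 = Cod C P2" "y2 \<bullet> x2 = Ide Q (Cod C P2)" "x2 \<bullet> y2 = Ide Q (Cod Q p2)"
    using Q.is_isoE[OF x2(4)] X by metis
  define a b where "a = x2 \<bullet> (L A \<bullet> y1)" and "b = x3 \<bullet> (L B \<bullet> y2)"
  have a: "a \<in> Arr Q" "Dom Q a = Cod Q p1" "Cod Q a = Cod Q p2" unfolding a_def using x2(1) X LA y1(1-3) by simp_all
  have b: "b \<in> Arr Q" "Dom Q b = Cod Q p2" "Cod Q b = Cod Q p3" unfolding b_def using x3(1) X LA y2(1-3) by simp_all
  have ax: "a \<bullet> x1 = x2 \<bullet> L A" unfolding a_def using x2(1) x1(1) X LA y1 by simp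
  have bx: "b \<bullet> x2 = x3 \<bullet> L B" unfolding b_def using x2(1) x3(1) X LA y2 by simp
  have can: "v = w" if "v \<bullet> i = w \<bullet> i" "is_iso Q i" "v \<in> Arr Q" "w \<in> Arr Q" "Dom Q v = Cod Q i" "Dom Q w = Cod Q i" for v w i
  proof -
    obtain j where j: "i \<in> Arr Q" "j \<in> Arr Q" "Dom Q j = Cod Q i" "Cod Q j = Dom Q i" "i \<bullet> j = Ide Q (Cod Q i)"
      using Q.is_isoE[OF \<open>is_iso Q i\<close>] by metis
    have "(v \<bullet> i) \<bullet> j = (w \<bullet> i) \<bullet> j" using that(1) by simp
    then show ?thesis using j that(3-6) by simp
  qed
  note Sh = Q_sha_arr[OF Ls(1)] Q_sha_arr[OF Lt(1)] Q_sha_arr[OF p(1)] Q_sha_arr[OF LP(1)] Q_sha_arr[OF x1(1)] Q_sha_arr[OF Lf(1)] Q_sha_arr[OF fg(1)]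
  have R1: "a \<bullet> p1 = p2 \<bullet> g"
  proof (rule can[OF _ Lt(4)])
    have "(a \<bullet> p1) \<bullet> L t = a \<bullet> (x1 \<bullet> L P1)" unfolding x1(5) using a p(1) dp Lt by simp
    also have "\<dots> = (x2 \<bullet> L A) \<bullet> L P1" by (rule Q.comp_cancel[OF ax]) (use a x1(1) X LP in auto)
    also have "\<dots> = x2 \<bullet> L (A \<cdot> P1)" using L_comp[of P1 A] AB(1,2) PD x2(1) X LA LP by simp
    also have "\<dots> = x2 \<bullet> (L P2 \<bullet> L g1)" unfolding AB(8) using L_comp[of g1 P2] PD t(4) dP cs by simp
    also have "\<dots> = p2 \<bullet> L g1" by (rule Q.comp_cancel[OF xP(1)]) (use x2(1) X LP Lf in auto)
    also have "\<dots> = (p2 \<bullet> g) \<bullet> L t" unfolding gt[symmetric] using p dp fg Lt by simp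
    finally show "(a \<bullet> p1) \<bullet> L t = (p2 \<bullet> g) \<bullet> L t" .
  qed (use a p dp fg Lt in auto)
  have R2: "d2 \<bullet> a = d1"
  proof (rule can[OF _ x1(4)])
    have "(d2 \<bullet> a) \<bullet> x1 = d2 \<bullet> (x2 \<bullet> L A)" unfolding ax[symmetric] using p dp a x1(1) X by simp
    also have "\<dots> = (ShA Q (L s) \<bullet> L D2) \<bullet> L A" by (rule Q.comp_cancel[OF x2(6)[symmetric]]) (use p dp x2(1) X LA in auto)
    also have "\<dots> = ShA Q (L s) \<bullet> L (D2 \<cdot> A)" using L_comp[of A D2] AB(1,3) PD dD Sh LP LA Ls by simp
    also have "\<dots> = d1 \<bullet> x1" unfolding AB(9) x1(6) ..
    finally show "(d2 \<bullet> a) \<bullet> x1 = d1 \<bullet> x1" .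
  qed (use a p dp X in auto)
  have R3: "b \<bullet> p2 = p3"
  proof -
    have "b \<bullet> p2 = b \<bullet> (x2 \<bullet> L P2)" using xP by simp
    also have "\<dots> = (x3 \<bullet> L B) \<bullet> L P2" by (rule Q.comp_cancel[OF bx]) (use b x2(1) X LP in auto)
    also have "\<dots> = x3 \<bullet> L (B \<cdot> P2)" using L_comp[of P2 B] AB(4,5) PD x3(1) X LA LP by simp
    finally show ?thesis using AB(10) xP by simp
  qed
  have R4: "d3 \<bullet> b = ShA Q f \<bullet> d2"
  proof (rule can[OF _ x2(4)])
    have "(d3 \<bullet> b) \<bullet> x2 = d3 \<bullet> (x3 \<bullet> L B)" unfolding bx[symmetric] using p dp b x2(1) X by simp
    also have "\<dots> = (ShA Q (L t) \<bullet> L D3) \<bullet> L B" by (rule Q.comp_cancel[OF x3(6)[symmetric]]) (use p dp x3(1) X LA in auto)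
    also have "\<dots> = ShA Q (L t) \<bullet> L (D3 \<cdot> B)" using L_comp[of B D3] AB(4,6) PD dD Sh LP LA Lt by simp
    also have "L (D3 \<cdot> B) = ShA Q (L f1) \<bullet> L D2" unfolding AB(11) using L_comp[of D2 "ShA C f1"] L_sh[OF s(3)] PD dD s(3,4) by simp
    also have "ShA Q (L t) \<bullet> (ShA Q (L f1) \<bullet> L D2) = (ShA Q f \<bullet> ShA Q (L s)) \<bullet> L D2"
    proof (rule Q.comp_cancel)
      show "ShA Q (L t) \<bullet> ShA Q (L f1) = ShA Q f \<bullet> ShA Q (L s)"
        using Q_sha_comp[of "L f1" "L t"] Q_sha_comp[of "L s" f] fs Lt Lf Ls fg by simp
    qed (use Sh Lt Lf LP in auto)
    also have "\<dots> = ShA Q f \<bullet> (d2 \<bullet> x2)" unfolding x2(6)[symmetric] using Sh Ls fg LP by simp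
    also have "\<dots> = (ShA Q f \<bullet> d2) \<bullet> x2" using Sh fg p dp x2(1) X by simp
    finally show "(d3 \<bullet> b) \<bullet> x2 = (ShA Q f \<bullet> d2) \<bullet> x2" .
  qed (use b p dp X Sh fg in auto)
  have PD3: "ShA Q p1 \<bullet> d3 \<in> Arr Q" "Dom Q (ShA Q p1 \<bullet> d3) = Cod Q p3" "Cod Q (ShA Q p1 \<bullet> d3) = Sh C (Cod Q p1)"
    using Sh p dp by simp_all
  have "(a, b, ShA Q p1 \<bullet> d3) \<in> Tri Q"
  proof (rule Tri_Q_I[OF AB(7) x1(4) x2(4) x3(4)])
    show "x2 \<bullet> L A = a \<bullet> x1" "x3 \<bullet> L B = b \<bullet> x2" using ax bx by simp_all
    have "L (ShA C P1 \<cdot> D3) = ShA Q (L P1) \<bullet> L D3" using L_comp[of D3 "ShA C P1"] L_sh[of P1] PD dD dP by simp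
    then have "ShA Q x1 \<bullet> L (ShA C P1 \<cdot> D3) = ShA Q x1 \<bullet> (ShA Q (L P1) \<bullet> L D3)" by simp
    also have "\<dots> = (ShA Q p1 \<bullet> ShA Q (L t)) \<bullet> L D3"
    proof (rule Q.comp_cancel)
      show "ShA Q x1 \<bullet> ShA Q (L P1) = ShA Q p1 \<bullet> ShA Q (L t)"
        using Q_sha_comp[of "L P1" x1] Q_sha_comp[of "L t" p1] x1(1,5) X LP Lt p dp by simp
    qed (use Sh x1(1) X LP in auto)
    also have "\<dots> = ShA Q p1 \<bullet> (d3 \<bullet> x3)" unfolding x3(6)[symmetric] using Sh Lt p dp LP by simp
    also have "\<dots> = (ShA Q p1 \<bullet> d3) \<bullet> x3" using Sh p dp x3(1) X by simp
    finally show "ShA Q x1 \<bullet> L (ShA C P1 \<cdot> D3) = (ShA Q p1 \<bullet> d3) \<bullet> x3" .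
  qed (use X AB(2,3,6) a b PD3 in auto)
  then show ?thesis
    using R1 R2 R3 R4 by blast
qed

theorem triangulated_Q: "triangulated_category Q"
  by unfold_locales (fact Q.shift_obj Q.shift_arr Q.shift_hom Q.shift_ide Q.shift_comp Q.shift_add Q.shift_scale
      Q.tri_candidate Q.tri_iso Q.TR1_ide Q.TR1_cone Q.TR2 Q.TR3 TR4_Q)+

end

sublocale verdier \<subseteq> Q: triangulated_category "verdier_quotient C V"
  by (rule triangulated_Q)


section \<open>The quotient heart\<close>

context pretriangulated_category
begin

text \<open>
  Rotate both triangles until the connecting map comes first; the isomorphism then extends to the
  shifted middle terms, and the shift reflects isomorphism.
\<close>

lemma tri_iso_of_connecting:
  assumes T: "(f, g, h) \<in> Tri C" and T': "(f', g', h') \<in> Tri C"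
    and a: "a \<in> Arr C" "is_iso C a" "Dom C a = Dom C h" "Cod C a = Dom C h'"
    and b: "b \<in> Arr C" "is_iso C b" "Dom C b = Cod C h" "Cod C b = Cod C h'"
    and e: "b \<cdot> h = h' \<cdot> a"
  shows "isomorphic C (Cod C f) (Cod C f')"
proof -
  note t = triD[OF T] and t' = triD[OF T']
  have R: "(h, neg (ShA C f), neg (ShA C g)) \<in> Tri C" and R': "(h', neg (ShA C f'), neg (ShA C g')) \<in> Tri C"
    using tri_rotI[OF tri_rotI[OF T]] tri_rotI[OF tri_rotI[OF T']] by auto
  have d: "Dom C (neg (ShA C f)) = Cod C h" "Dom C (neg (ShA C f')) = Cod C h'"
    "Dom C (neg (ShA C g)) = Sh C (Cod C f)" "Dom C (neg (ShA C g')) = Sh C (Cod C f')" using t t' by simp_all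
  have ab: "a \<in> hom C (Dom C h) (Dom C h')" "b \<in> hom C (Dom C (neg (ShA C f))) (Dom C (neg (ShA C f')))"
    using a b d by (simp_all add: in_hom)
  obtain c where c: "c \<in> Arr C" "Dom C c = Dom C (neg (ShA C g))" "Cod C c = Dom C (neg (ShA C g'))" "is_iso C c"
    using tri_iso_extend[OF R R' ab(1) a(2) ab(2) b(2) e] by blast
  then have "isomorphic C (Sh C (Cod C f)) (Sh C (Cod C f'))" using isomorphicI d by metis
  then show ?thesis using isomorphic_sh_iff t t' by simp
qed

text \<open>Rotate a triangle that starts with \<open>h\<close> backwards twice.\<close>

lemma tri_of_connecting:
  assumes "h \<in> Arr C" "Cod C h = Sh C X" "X \<in> Obj C"
  obtains f g where "(f, g, h) \<in> Tri C" "Dom C f = X"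
proof -
  obtain u v where T: "(h, u, v) \<in> Tri C" using TR1_cone assms by blast
  obtain g where G: "(g, h, u) \<in> Tri C" using tri_rot_back[OF T] .
  obtain f where F: "(f, g, h) \<in> Tri C" using tri_rot_back[OF G] .
  have "Dom C f = X" by (rule sh_inj) (use triD[OF F] assms in auto)
  then show thesis using that F by blast
qed

end

context bounded_t
begin

text \<open>
  Only the topmost short exact sequence has to be moved along the isomorphism.
\<close>

lemma comp_series_iso: assumes "comp_series C H X Ts" "isomorphic C X Y" shows "comp_series C H Y Ts"
  using assms(1)
proof cases
  case Nil
  then show ?thesis using comp_series.Nil[of Y H C] H_iso zero_obj_iso assms(2) by blast
next
  case (Cons f g Ts')
  obtain h where T: "(f, g, h) \<in> Tri C" using short_exact_triangle[OF Cons(3)] .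
  note t = triD[OF T]
  obtain a b where a: "a \<in> Arr C" "Dom C a = X" "Cod C a = Y" "b \<in> Arr C" "Dom C b = Y" "Cod C b = X"
    "b \<cdot> a = Ide C X" "is_iso C a" using isomorphicE[OF assms(2)] by metis
  have H: "Dom C f \<in> H" "Cod C f \<in> H" "Cod C g \<in> H"
    using Cons(3) by (auto simp: short_exact_def is_kernel_def arr_in_def)
  have X: "Dom C g = X" "Cod C f = X" using Cons(1) t by auto
  have T': "(a \<cdot> f, g \<cdot> b, h) \<in> Tri C"
    by (rule tri_cong[OF T, of "Ide C (Dom C f)" a "Ide C (Cod C g)"]) (use t a X in \<open>auto simp: in_hom\<close>)
  have d: "Dom C (a \<cdot> f) = Dom C f" "Cod C (a \<cdot> f) = Y" "Cod C (g \<cdot> b) = Cod C g" using t a X by simp_all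
  have "short_exact C H (a \<cdot> f) (g \<cdot> b)"
    by (rule heart_short_exact[OF T']) (use d H H_iso[OF H(2)] X assms(2) in auto)
  from comp_series.Cons[OF this, of Ts'] show ?thesis using Cons d by simp
qed

end

sublocale thick_simples \<subseteq> verdier C W
  by unfold_locales (rule thick_W)

context thick_simples
begin

lemma image_iff: "Y \<in> verdier_image C W A \<longleftrightarrow> Y \<in> Obj C \<and> (\<exists>X\<in>A. isomorphic Q X Y)"
  by (simp add: verdier_image_def verdier_obj_def)

lemma image_I: "X \<in> A \<Longrightarrow> isomorphic Q X Y \<Longrightarrow> Y \<in> verdier_image C W A"
  using Q.isomorphic_obj image_iff by auto

lemma image_self: "X \<in> A \<Longrightarrow> X \<in> Obj C \<Longrightarrow> X \<in> verdier_image C W A"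
  using image_I Q.isomorphic_refl by simp

lemma tri_Q: assumes "tri X Y Z" shows "Q.tri X Y Z"
proof -
  obtain f g h where t: "(f, g, h) \<in> Tri C" "f \<in> Arr C" "g \<in> Arr C" "Dom C f = X" "Cod C f = Y" "Cod C g = Z"
    using triE[OF assms] by metis
  show ?thesis using Q.triI[OF L_Tri[OF t(1)]] t by simp
qed

lemma filt_Q: "filt As X \<Longrightarrow> Q.filt As X"
proof (induction rule: filt.induct)
  case (filt_Nil X)
  then show ?case by (intro Q.filt_Nil zero_L)
next
  case (filt_Cons A X Y As)
  show ?case by (rule Q.filt_Cons[OF tri_Q[OF filt_Cons(1)] filt_Cons(3)])
qed

text \<open>
  A class of roofs is zero as soon as one of its representatives starts at an object without maps to the target.
\<close>

lemma hom_zero_Q_I: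
  assumes "X \<in> Obj C" "Y \<in> Obj C"
    and "\<And>s f. roof s f \<Longrightarrow> Cod C s = X \<Longrightarrow> Cod C f = Y \<Longrightarrow>
      \<exists>s' f'. rc s f = rc s' f' \<and> roof s' f' \<and> hom_zero C (Dom C s') Y"
  shows "hom_zero Q X Y"
proof (rule Q.hom_zeroI)
  fix c assume c: "c \<in> Arr Q" "Dom Q c = X" "Cod Q c = Y"
  obtain s f where s: "c = rc s f" "roof s f" "Dom Q c = Cod C s" "Cod Q c = Cod C f" using Q_ArrE[OF c(1)] by metis
  obtain s' f' where s': "rc s f = rc s' f'" "roof s' f'" "hom_zero C (Dom C s') Y" using assms(3)[OF s(2)] s c by metis
  note R = roofD[OF s'(2)]
  have d: "Cod C s' = X" "Cod C f' = Y" using Q_Dom[of s' f'] Q_Cod[of s' f'] s' s c by metis+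
  have "f' = Null C (Dom C s') Y" by (rule hom_zeroD[OF s'(3)]) (use R d in auto)
  then show "c = Null Q X Y" using Q_Null_rc[OF assms(2) R(1)] d s s' by simp
qed (use assms in auto)

lemma SK_P: "T \<in> SK \<Longrightarrow> T \<in> P" and SK_H: "T \<in> SK \<Longrightarrow> T \<in> H"
  using SK_Sim Sim_H H_P by blast+

text \<open>
  A map out of an object of the aisle is a fraction whose numerator starts in the aisle as well: the
  letters of negative degree in the apex come from the cone, so the truncation map is inverted.
\<close>

lemma roof_word:
  assumes x: "word x X" "snd ` set x \<subseteq> Sim C H" "\<forall>a\<in>set x. 0 \<le> fst a"
    and r: "roof s f" "Cod C s = X"
  obtains s' f' w g h where "rc s f = rc s' f'" "roof s' f'" "Cod C s' = X" "Cod C f' = Cod C f" "word w (Dom C s')"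
    "\<forall>a\<in>set w. 0 \<le> fst a \<and> (a \<in> set x \<or> snd a \<in> SK)" "(s', g, h) \<in> Tri C" "tri (Dom C s') X (Cod C g)"
    "Cod C g \<in> W" "Cod C g \<in> P"
proof -
  note R = roofD[OF r(1)]
  have s: "s \<in> Arr C" using R by simp
  obtain g h where T: "(s, g, h) \<in> Tri C" "tri (Dom C s) (Cod C s) (Cod C g)" using cone_ex[OF s] .
  obtain E1 where E1: "E1 \<in> Obj C" "Cod C g = Sh C E1" "tri E1 (Dom C s) X" using tri_unrot_ex[OF T(2)] r(2) by metis
  have "E1 \<in> W" using I_cone[OF R(1) T(1)] E1 W_sh_iff by simp
  then obtain v where v: "word v E1" "snd ` set v \<subseteq> SK" by (auto simp: W_def)
  have vx: "word (v @ x) (Dom C s)" by (rule word_append[OF E1(3) v(1) x(1)])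
  have vxS: "snd ` set (v @ x) \<subseteq> Sim C H" using v x SK_Sim by auto
  obtain w1 w2 Z1 Z2 where Z: "tri Z1 (Dom C s) Z2" "word w1 Z1" "word w2 Z2" "set w1 \<subseteq> set (v @ x)" "set w2 \<subseteq> set (v @ x)"
    "\<forall>a\<in>set w1. 0 \<le> fst a" "\<forall>a\<in>set w2. fst a < 0" using word_trunc[OF vx vxS, of 0] by metis
  have w2: "snd ` set w2 \<subseteq> SK"
  proof (intro image_subsetI)
    fix a assume a: "a \<in> set w2"
    then have "a \<notin> set x" using Z(7) x(3) by force
    then show "snd a \<in> SK" using a Z(5) v(2) by auto
  qed
  obtain j p q where J: "(j, p, q) \<in> Tri C" "j \<in> Arr C" "Dom C j = Z1" "Cod C j = Dom C s" "Cod C p = Z2" using triE[OF Z(1)] by metis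
  have jI: "j \<in> I" using I_I[OF J(1)] J(5) W_I[OF Z(3) w2] by simp
  have sj: "s \<cdot> j \<in> I" "s \<cdot> j \<in> Arr C" "Dom C (s \<cdot> j) = Z1" "Cod C (s \<cdot> j) = X" using jI R J r by simp_all
  obtain g' h' where T': "(s \<cdot> j, g', h') \<in> Tri C" "tri (Dom C (s \<cdot> j)) (Cod C (s \<cdot> j)) (Cod C g')" using cone_ex[OF sj(2)] .
  have t': "tri Z1 X (Cod C g')" using T'(2) sj by simp
  have XP: "X \<in> P" using word_P[OF x] .
  have w1S: "snd ` set w1 \<subseteq> Sim C H" using Z(4) vxS by auto
  have Z1P: "Z1 \<in> P" using word_P[OF Z(2) w1S Z(6)] .
  have E: "Cod C g' \<in> W" "Cod C g' \<in> P" using I_cone[OF sj(1) T'(1)] P_cone[OF t' Z1P XP] by auto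
  have rr: "roof (s \<cdot> j) (f \<cdot> j)" "rc (s \<cdot> j) (f \<cdot> j) = rc s f" using rc_refine[OF r(1) J(2,4) sj(1)] by auto
  have "\<forall>a\<in>set w1. 0 \<le> fst a \<and> (a \<in> set x \<or> snd a \<in> SK)" using Z(4,6) v(2) by auto
  moreover have "Cod C (f \<cdot> j) = Cod C f" using R J by simp
  ultimately show thesis using that[OF rr(2)[symmetric] rr(1) sj(4) _ _ _ T'(1)] t' E Z(2) sj(3) by simp
qed

lemma W_P_word:
  assumes "E \<in> W" "E \<in> P" obtains v where "word v E" "snd ` set v \<subseteq> SK" "\<forall>a\<in>set v. 0 \<le> fst a"
proof -
  obtain w where w: "word w E" "snd ` set w \<subseteq> SK" using assms by (auto simp: W_def)
  have wS: "snd ` set w \<subseteq> Sim C H" using w SK_Sim by auto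
  obtain w1 w2 X1 X2 where X: "tri X1 E X2" "word w1 X1" "word w2 X2" "set w1 \<subseteq> set w" "set w2 \<subseteq> set w"
    "\<forall>a\<in>set w1. 0 \<le> fst a" "\<forall>a\<in>set w2. fst a < 0" using word_trunc[OF w(1) wS, of 0] by metis
  have s: "snd ` set w1 \<subseteq> Sim C H" "snd ` set w2 \<subseteq> Sim C H" using wS X by auto
  have X1: "X1 \<in> P" using word_P[OF X(2) s(1) X(6)] .
  have X2: "X2 \<in> R" using word_R[OF X(3) s(2) X(7)] .
  have "retract X2 (Sh C X1)" using retract_of_zero_second[OF X(1) PR[OF assms(2) X2]] .
  then have "zero_obj C X2" using hom_zero_retract_left[OF _ PR[OF P_sh[OF X1] X2]] hom_zero_self by blast
  then have "word w1 E" using tri_iso_of_zero_right[OF X(1)] word_iso X by blast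
  moreover have "snd ` set w1 \<subseteq> SK" using X(4) w(2) by auto
  ultimately show thesis using that X(6) by blast
qed

text \<open>
  After refining the roof its apex lies in the aisle, and its numerator is zero.
\<close>

lemma PR_Q: assumes "X \<in> P" "Y \<in> R" shows "hom_zero Q X Y"
proof (rule hom_zero_Q_I)
  show "X \<in> Obj C" "Y \<in> Obj C" using assms P_obj R_obj by auto
  fix s f assume r: "roof s f" "Cod C s = X" "Cod C f = Y"
  obtain x where x: "word x X" "snd ` set x \<subseteq> Sim C H" "\<forall>a\<in>set x. 0 \<le> fst a" using P_word[OF assms(1)] .
  obtain s' f' w where w: "rc s f = rc s' f'" "roof s' f'" "word w (Dom C s')"
    "\<forall>a\<in>set w. 0 \<le> fst a \<and> (a \<in> set x \<or> snd a \<in> SK)" using roof_word[OF x r(1,2)] by metis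
  have "snd ` set w \<subseteq> Sim C H" using w(4) x(2) SK_Sim by auto
  then have "Dom C s' \<in> P" using word_P[OF w(3)] w(4) by blast
  then show "\<exists>s' f'. rc s f = rc s' f' \<and> roof s' f' \<and> hom_zero C (Dom C s') Y" using w PR assms by blast
qed

definition PQ :: "'o set" where "PQ = verdier_image C W P"

lemma P_PQ: "X \<in> P \<Longrightarrow> X \<in> PQ" unfolding PQ_def using image_self P_obj by blast

lemma R_right_perp: "R \<subseteq> right_perp Q PQ"
proof
  fix Y assume Y: "Y \<in> R"
  have "hom_zero Q X Y" if X: "X \<in> PQ" for X
  proof -
    obtain X0 where X0: "X0 \<in> P" "isomorphic Q X0 X" using X unfolding PQ_def image_iff by blast
    show ?thesis using Q.hom_zero_iso[OF X0(2) Q.isomorphic_refl PR_Q[OF X0(1) Y]] R_obj[OF Y] by simp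
  qed
  then show "Y \<in> right_perp Q PQ" using R_obj[OF Y] by (simp add: right_perp_def)
qed

lemma bounded_t_Q: "bounded_t_structure Q PQ"
  unfolding bounded_t_structure_def t_structure_def
proof (intro conjI ballI allI impI)
  show "PQ \<subseteq> Obj Q" unfolding PQ_def by (auto simp: image_iff)
  show "\<And>X Y. X \<in> PQ \<Longrightarrow> isomorphic Q X Y \<Longrightarrow> Y \<in> PQ"
    unfolding PQ_def image_iff using Q.isomorphic_trans Q.isomorphic_obj by auto
  show "Sh Q X \<in> PQ" if X: "X \<in> PQ" for X
  proof -
    obtain X0 where X0: "X0 \<in> P" "isomorphic Q X0 X" using X unfolding PQ_def image_iff by blast
    have "isomorphic Q (Sh C X0) (Sh C X)" using Q.isomorphic_sh[OF X0(2)] by simp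
    then show ?thesis unfolding PQ_def using image_I P_sh[OF X0(1)] by simp
  qed
next
  fix X assume "X \<in> Obj Q"
  then have X: "X \<in> Obj C" by simp
  obtain A B where AB: "tri A X B" "A \<in> P" "B \<in> R" using trunc[OF X] .
  obtain f g h where f: "(f, g, h) \<in> Tri Q" "Dom Q f = A" "Cod Q f = X" "Cod Q g = B" using tri_Q[OF AB(1)] unfolding Q.tri_def by blast
  show "\<exists>f g h. (f, g, h) \<in> Tri Q \<and> Dom Q f \<in> PQ \<and> Cod Q f = X \<and> Cod Q g \<in> right_perp Q PQ"
    using f P_PQ[OF AB(2)] R_right_perp AB(3) by blast
  obtain m where "(Sh C ^^ m) X \<in> P" using bts X by (auto simp: bounded_t_structure_def)
  then show "\<exists>m. (Sh Q ^^ m) X \<in> PQ" using P_PQ by auto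
  obtain n where "X \<in> (Sh C ^^ n) ` R" using bts X unfolding bounded_t_structure_def R_def by blast
  then show "\<exists>n. X \<in> (Sh Q ^^ n) ` right_perp Q PQ" using R_right_perp by auto
qed

end

sublocale thick_simples \<subseteq> QB: bounded_t "verdier_quotient C W" PQ
  by unfold_locales (rule bounded_t_Q)

context thick_simples
begin

lemma R_QR: "R \<subseteq> QB.R" using R_right_perp by (simp add: QB.R_def)

lemma N_QN: "X \<in> N \<Longrightarrow> X \<in> QB.N"
  using R_QR by (auto simp: N_def QB.N_def)

lemma H_QH: "X \<in> H \<Longrightarrow> X \<in> QB.H"
  using P_PQ N_QN H_P H_N QB.H_I by blast

text \<open>
  Let \<open>X\<close> in the aisle become isomorphic to an object of the quotient heart. The part of \<open>X\<close> in degrees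
  \<open>\<le> -1\<close> then maps to \<open>X\<close> by zero, so it is zero in the quotient by a splitting argument, and \<open>X\<close> becomes
  isomorphic to its cohomology in degree \<open>0\<close>.
\<close>

theorem quotient_heart: "QB.H = verdier_image C W H"
proof (intro set_eqI iffI)
  fix Y assume "Y \<in> verdier_image C W H"
  then obtain X where "X \<in> H" "isomorphic Q X Y" unfolding image_iff by blast
  then show "Y \<in> QB.H" using H_QH QB.H_iso by blast
next
  fix Y assume Y: "Y \<in> QB.H"
  obtain X where X: "X \<in> P" "isomorphic Q X Y" using QB.H_P[OF Y] unfolding PQ_def image_iff by blast
  have XN: "X \<in> QB.N" using QB.N_iso[OF QB.H_N[OF Y]] Q.isomorphic_sym X by blast
  obtain A B where AB: "tri (Sh C A) X B" "A \<in> P" "B \<in> H" using trunc_P[OF X(1)] .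
  have t: "Q.tri (Sh C A) X B" using tri_Q[OF AB(1)] .
  have "hom_zero Q (Sh C A) X" using QB.PN[OF P_PQ[OF AB(2)] XN] by simp
  then have "Q.retract (Sh C (Sh C A)) B" using Q.retract_of_zero_first(2)[OF t] by simp
  moreover have "hom_zero Q (Sh C (Sh C A)) B" using QB.PN[OF P_PQ[OF P_sh[OF AB(2)]] QB.H_N[OF H_QH[OF AB(3)]]] by simp
  ultimately have "zero_obj Q (Sh C (Sh C A))" using Q.hom_zero_retract_right Q.hom_zero_self by blast
  then have "zero_obj Q (Sh C A)" using Q.zero_obj_sh_iff[of "Sh C A"] P_obj[OF AB(2)] by simp
  then have "isomorphic Q X B" using Q.tri_iso_of_zero_left[OF t] by blast
  then have "isomorphic Q B Y" using Q.isomorphic_sym Q.isomorphic_trans X(2) by blast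
  then show "Y \<in> verdier_image C W H" using image_I AB(3) by blast
qed

lemma QH_E: assumes "Y \<in> QB.H" obtains X where "X \<in> H" "isomorphic Q X Y"
  using assms unfolding quotient_heart image_iff by blast

text \<open>
  The apex of a refined roof has cohomology in degree \<open>0\<close> and, below that, only generators in positive shifts.
  These do not map to \<open>Y\<close>, so the numerator factors through the cohomology \<open>Z\<close> in degree \<open>0\<close>, which is
  isomorphic to the apex in the quotient.
\<close>

lemma map_from_heart:
  assumes X: "X \<in> H" and c: "c \<in> Arr Q" "Dom Q c = X" "Cod Q c = Y"
    and z: "\<And>n T. 1 \<le> n \<Longrightarrow> T \<in> SK \<Longrightarrow> hom_zero C (shz n T) Y"
  obtains Z i f where "Z \<in> H" "i \<in> Arr Q" "is_iso Q i" "Dom Q i = Z" "Cod Q i = X" "f \<in> Arr C" "Dom C f = Z" "Cod C f = Y"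
    "c \<cdot>\<^bsub>Q\<^esub> i = L f"
proof -
  obtain x where x: "word x X" "snd ` set x \<subseteq> Sim C H" "\<forall>a\<in>set x. fst a = 0" using H_word[OF X] .
  have x0: "\<forall>a\<in>set x. 0 \<le> fst a" using x(3) by auto
  have Y: "Y \<in> Obj C" using Q.cod_obj[OF c(1)] c by simp
  obtain s0 f0 where s0: "c = rc s0 f0" "roof s0 f0" "Dom Q c = Cod C s0" "Cod Q c = Cod C f0" using Q_ArrE[OF c(1)] by metis
  have cs0: "Cod C s0 = X" using s0 c by simp
  obtain s f1 w where s: "rc s0 f0 = rc s f1" "roof s f1" "Cod C s = X" "Cod C f1 = Cod C f0" "word w (Dom C s)"
    "\<forall>a\<in>set w. 0 \<le> fst a \<and> (a \<in> set x \<or> snd a \<in> SK)" using roof_word[OF x(1,2) x0 s0(2) cs0] by metis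
  note R = roofD[OF s(2)]
  have cf: "Cod C f1 = Y" using s s0 c by simp
  have wS: "snd ` set w \<subseteq> Sim C H" using s(6) x(2) SK_Sim by auto
  obtain w1 w2 Z1 Z where Z: "tri Z1 (Dom C s) Z" "word w1 Z1" "word w2 Z" "set w1 \<subseteq> set w" "set w2 \<subseteq> set w"
    "\<forall>a\<in>set w1. 1 \<le> fst a" "\<forall>a\<in>set w2. fst a < 1" using word_trunc[OF s(5) wS, of 1] by metis
  have w1: "snd a \<in> SK" if a: "a \<in> set w1" for a
  proof -
    have "a \<notin> set x" using a Z(6) x(3) by force
    then show ?thesis using a Z(4) s(6) by auto
  qed
  have w1S: "snd ` set w1 \<subseteq> SK" using w1 by auto
  have "\<forall>a\<in>set w2. fst a = 0" using Z(5,7) s(6) by force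
  moreover have "snd ` set w2 \<subseteq> Sim C H" using Z(5) wS by auto
  ultimately have ZH: "Z \<in> H" using word_H[OF Z(3)] by blast
  obtain j p q where J: "(j, p, q) \<in> Tri C" "j \<in> Arr C" "p \<in> Arr C" "Dom C j = Z1" "Cod C j = Dom C s" "Dom C p = Dom C s" "Cod C p = Z"
    "Dom C q = Z" "Cod C q = Sh C Z1"
    using triE[OF Z(1)] by metis
  have "hom_zero C Z1 Y"
  proof (rule word_hom_left[OF Z(2) Y])
    fix n T assume nT: "(n, T) \<in> set w1"
    show "hom_zero C (shz n T) Y" by (rule z) (use nT Z(6) w1[OF nT] in auto)
  qed
  then have "f1 \<cdot> j = Null C Z1 Y" by (rule hom_zeroD) (use R J cf in auto)
  then obtain f where f: "f \<in> Arr C" "Dom C f = Z" "Cod C f = Y" "f \<cdot> p = f1"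
    using weak_coker[OF J(1), of f1] R J cf by auto
  have "Sh C Z1 \<in> W" using W_I[OF Z(2) w1S] W_sh_iff tri_obj(1)[OF Z(1)] by simp
  then have pI: "p \<in> I" using I_I[OF tri_rotI[OF J(1)]] J(9) by simp
  obtain r where r: "r \<in> Arr Q" "Dom Q r = Z" "Cod Q r = Dom C s" "L p \<cdot>\<^bsub>Q\<^esub> r = Ide Q Z" "is_iso Q r"
    using Q.is_isoE[OF L_I[OF pI]] J by (metis L_arr(2,3))
  have sa: "s \<in> Arr C" using R by simp
  have i: "L s \<cdot>\<^bsub>Q\<^esub> r \<in> Arr Q" "Dom Q (L s \<cdot>\<^bsub>Q\<^esub> r) = Z" "Cod Q (L s \<cdot>\<^bsub>Q\<^esub> r) = X" using r sa s(3) by simp_all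
  have ii: "is_iso Q (L s \<cdot>\<^bsub>Q\<^esub> r)" by (rule Q.is_iso_comp[OF r(5) L_I[OF R(1)]]) (use r sa in simp)
  have "c \<cdot>\<^bsub>Q\<^esub> L s = L f1" unfolding s0(1) s(1) by (rule rc_factor[OF s(2)])
  also have "\<dots> = L f \<cdot>\<^bsub>Q\<^esub> L p" using L_comp[OF J(3) f(1)] f J by simp
  finally have cs: "c \<cdot>\<^bsub>Q\<^esub> L s = L f \<cdot>\<^bsub>Q\<^esub> L p" .
  have "c \<cdot>\<^bsub>Q\<^esub> (L s \<cdot>\<^bsub>Q\<^esub> r) = (L f \<cdot>\<^bsub>Q\<^esub> L p) \<cdot>\<^bsub>Q\<^esub> r" by (rule Q.comp_cancel[OF cs]) (use c sa r s(3) in auto)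
  also have "\<dots> = L f \<cdot>\<^bsub>Q\<^esub> (L p \<cdot>\<^bsub>Q\<^esub> r)" using f(1,2) J r(1,3) by simp
  also have "\<dots> = L f" using r(4) f by simp
  finally show thesis using that[OF ZH i(1) ii i(2,3) f(1-3)] by blast
qed

section \<open>Simple objects of the quotient heart\<close>

lemma SK_zero_Q: "T \<in> SK \<Longrightarrow> zero_obj Q T"
  using zero_obj_Q_iff[OF SK_obj] W_I[OF word_single[OF SK_obj, of T 0]] by simp

lemma H_hom_SK: assumes "Y \<in> H" "1 \<le> n" "T \<in> SK" shows "hom_zero C (shz n T) Y"
proof -
  have "hom_zero C (Sh C (shz (n - 1) T)) Y" using PN shz_P' SK_P H_N assms by simp
  then show ?thesis using Sh_shz[OF SK_obj[OF assms(3)], of "n - 1"] by simp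
qed

text \<open>
  A nonzero map to \<open>T\<close> in the quotient heart comes from a nonzero map \<open>f : Z \<rightarrow> T\<close> in the heart, which is an
  epimorphism since \<open>T\<close> is simple; so the fibre of the image of \<open>f\<close> lies in the quotient heart.
\<close>

theorem simple_Q:
  assumes T: "T \<in> Sim C H" "T \<notin> SK" shows "T \<in> Sim Q QB.H"
proof (rule QB.simpleI)
  have TH: "T \<in> H" using T Sim_H by blast
  show "T \<in> QB.H" using H_QH TH by blast
  show "\<not> zero_obj Q T" using zero_obj_Q_iff H_obj[OF TH] W_simple T by blast
  fix u k h assume u: "u \<in> Arr Q" "Dom Q u \<in> QB.H" "Cod Q u = T" "u \<noteq> Null Q (Dom Q u) T" and F: "(k, u, h) \<in> Tri Q"
  note tF = Q.triD[OF F]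
  have To: "T \<in> Obj C" using TH H_obj by blast
  obtain X where X: "X \<in> H" "isomorphic Q X (Dom Q u)" using QH_E[OF u(2)] .
  obtain a b where a: "a \<in> Arr Q" "Dom Q a = X" "Cod Q a = Dom Q u" "is_iso Q a" "b \<in> Arr Q" "Dom Q b = Dom Q u" "Cod Q b = X" "a \<cdot>\<^bsub>Q\<^esub> b = Ide Q (Dom Q u)"
    using Q.isomorphicE[OF X(2)] by metis
  have ua: "u \<cdot>\<^bsub>Q\<^esub> a \<in> Arr Q" "Dom Q (u \<cdot>\<^bsub>Q\<^esub> a) = X" "Cod Q (u \<cdot>\<^bsub>Q\<^esub> a) = T" using u a by simp_all
  obtain Z i f where Z: "Z \<in> H" "i \<in> Arr Q" "is_iso Q i" "Dom Q i = Z" "Cod Q i = X" "f \<in> Arr C" "Dom C f = Z" "Cod C f = T"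
    "(u \<cdot>\<^bsub>Q\<^esub> a) \<cdot>\<^bsub>Q\<^esub> i = L f" using map_from_heart[OF X(1) ua H_hom_SK[OF TH]] by metis
  have ai: "a \<cdot>\<^bsub>Q\<^esub> i \<in> Arr Q" "Dom Q (a \<cdot>\<^bsub>Q\<^esub> i) = Z" "Cod Q (a \<cdot>\<^bsub>Q\<^esub> i) = Dom Q u" using a Z by simp_all
  have aii: "is_iso Q (a \<cdot>\<^bsub>Q\<^esub> i)" by (rule Q.is_iso_comp[OF Z(3) a(4)]) (use Z a in simp)
  have uai: "u \<cdot>\<^bsub>Q\<^esub> (a \<cdot>\<^bsub>Q\<^esub> i) = L f" using Z(2,5,9) a u by simp
  have "f \<noteq> Null C Z T"
  proof
    assume "f = Null C Z T"
    then have "u \<cdot>\<^bsub>Q\<^esub> (a \<cdot>\<^bsub>Q\<^esub> i) = Null Q Z T" using uai by (simp add: L_null)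
    moreover obtain v where v: "v \<in> Arr Q" "Dom Q v = Dom Q u" "Cod Q v = Z" "(a \<cdot>\<^bsub>Q\<^esub> i) \<cdot>\<^bsub>Q\<^esub> v = Ide Q (Dom Q u)"
      using Q.is_isoE[OF aii] ai by metis
    ultimately have "u \<cdot>\<^bsub>Q\<^esub> ((a \<cdot>\<^bsub>Q\<^esub> i) \<cdot>\<^bsub>Q\<^esub> v) = Null Q Z T \<cdot>\<^bsub>Q\<^esub> v"
      by (intro Q.comp_cancel) (use ai v(1-3) u in auto)
    then have "u = Null Q (Dom Q u) T" using v u To by simp
    then show False using u(4) by simp
  qed
  then have fn: "f \<noteq> Null C (Dom C f) T" using Z by simp
  obtain k0 h0 where G: "(k0, f, h0) \<in> Tri C" using fibre_ex[OF Z(6)] by metis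
  note tG = triD[OF G]
  have K: "Dom C k0 \<in> H" by (rule epi_to_simple[OF T(1) Z(6) _ Z(8) fn G]) (use Z in simp)
  have lf: "L f \<in> Arr Q" "Dom Q (L f) = Z" "Cod Q (L f) = T" using Z by simp_all
  have R1: "(L f, L h0, Scale Q (-1) (ShA Q (L k0))) \<in> Tri Q" using Q.tri_rotI[OF L_Tri[OF G]] .
  have R2: "(u, h, Scale Q (-1) (ShA Q k)) \<in> Tri Q" using Q.tri_rotI[OF F] .
  have dd: "Dom Q (L h0) = T" "Dom Q h = T" "Cod Q (L h0) = Sh C (Dom C k0)" "Cod Q h = Sh C (Dom Q k)"
    using tG tF Z u by simp_all
  have e: "Ide Q T \<cdot>\<^bsub>Q\<^esub> L f = u \<cdot>\<^bsub>Q\<^esub> (a \<cdot>\<^bsub>Q\<^esub> i)" using uai lf by simp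
  have m: "a \<cdot>\<^bsub>Q\<^esub> i \<in> hom Q (Dom Q (L f)) (Dom Q u)" "Ide Q T \<in> hom Q (Dom Q (L h0)) (Dom Q h)" "is_iso Q (Ide Q T)"
    using ai lf dd To by (simp_all add: Q_hom)
  obtain c where c: "c \<in> Arr Q" "Dom Q c = Dom Q (Scale Q (-1) (ShA Q (L k0)))" "Cod Q c = Dom Q (Scale Q (-1) (ShA Q k))" "is_iso Q c"
    using Q.tri_iso_extend[OF R1 R2 m(1) aii m(2,3) e] by blast
  have "Dom Q (Scale Q (-1) (ShA Q (L k0))) = Sh C (Dom C k0)" "Dom Q (Scale Q (-1) (ShA Q k)) = Sh C (Dom Q k)"
    using tG tF by simp_all
  then have "isomorphic Q (Sh C (Dom C k0)) (Sh C (Dom Q k))" using c Q.isomorphicI by metis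
  then have "isomorphic Q (Dom C k0) (Dom Q k)" using Q.isomorphic_sh_iff[of "Dom C k0" "Dom Q k"] tG tF Q.dom_obj[of k] by simp
  then show "Dom Q k \<in> QB.H" using QB.H_iso H_QH[OF K] by blast
qed

text \<open>
  In the quotient the letters in \<open>SK\<close> become zero and drop out of a filtration.
\<close>

lemma filt_Q_simples:
  "filt As X \<Longrightarrow> set As \<subseteq> Sim C H \<Longrightarrow> \<exists>M. set M \<subseteq> Sim C H - SK \<and> Q.filt M X"
proof (induction rule: filt.induct)
  case (filt_Nil X)
  then show ?case using Q.filt_Nil[OF zero_L] by (intro exI[of _ "[]"]) auto
next
  case (filt_Cons A X Y As)
  then obtain M where M: "set M \<subseteq> Sim C H - SK" "Q.filt M Y" by auto
  have t: "Q.tri A X Y" using tri_Q[OF filt_Cons(1)] .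
  show ?case
  proof (cases "A \<in> SK")
    case True
    then have "isomorphic Q Y X" using Q.tri_iso_of_zero_left[OF t SK_zero_Q] Q.isomorphic_sym by blast
    then show ?thesis using M Q.filt_iso by blast
  next
    case False
    then show ?thesis using M Q.filt_Cons[OF t M(2)] filt_Cons.prems by (intro exI[of _ "A # M"]) auto
  qed
qed

lemma QH_filt: assumes "Y \<in> QB.H" obtains M where "set M \<subseteq> Sim C H - SK" "Q.filt M Y"
proof -
  obtain X where X: "X \<in> H" "isomorphic Q X Y" using QH_E[OF assms] .
  obtain K where "set K \<subseteq> Sim C H" "filt K X" using H_filtE[OF X(1)] .
  then obtain M where "set M \<subseteq> Sim C H - SK" "Q.filt M X" using filt_Q_simples by blast
  then show thesis using that Q.filt_iso X by blast
qed

theorem finite_length_Q: "finite_length Q QB.H"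
  unfolding finite_length_def
proof (intro conjI ballI QB.abelian_heart)
  fix Y assume "Y \<in> QB.H"
  then obtain M where "set M \<subseteq> Sim C H - SK" "Q.filt M Y" by (rule QH_filt)
  then show "\<exists>Ts. comp_series Q QB.H Y Ts" using QB.filt_comp_series simple_Q by blast
qed

end

sublocale thick_simples \<subseteq> QL: length_heart "verdier_quotient C W" PQ
  by unfold_locales (rule finite_length_Q)

context thick_simples
begin

text \<open>
  The bottom factor of a filtration of \<open>Y\<close> has a nonzero map to \<open>Y\<close>, which is an isomorphism by Schur's lemma.
\<close>

lemma simple_Q_lift: assumes Y: "Y \<in> Sim Q QB.H" obtains T where "T \<in> Sim C H" "isomorphic Q T Y"
proof -
  obtain M where M: "set M \<subseteq> Sim C H - SK" "Q.filt M Y" using QH_filt QB.Sim_H[OF Y] by blast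
  have "M \<noteq> []" using M(2) QB.Sim_nonzero[OF Y] Q.filt_NilE by blast
  then obtain T M' where TM: "M = T # M'" by (cases M) auto
  then have T: "T \<in> Sim C H" "T \<notin> SK" "set M' \<subseteq> Sim C H - SK" using M by auto
  note TQ = simple_Q[OF T(1,2)]
  obtain Y' where Y': "Q.tri T Y Y'" "Q.filt M' Y'" using M(2) TM Q.filt_ConsE by blast
  have "set M' \<subseteq> QB.H" using T(3) simple_Q QB.Sim_H by blast
  then have Y'H: "Y' \<in> QB.H" using QB.filt_H[OF Y'(2)] by blast
  obtain f where f: "f \<in> Arr Q" "Dom Q f = T" "Cod Q f = Y" "f \<noteq> Null Q T Y"
  proof (cases "hom_zero Q T Y")
    case True
    then have "Q.retract (Sh C T) Y'" using Q.retract_of_zero_first(2)[OF Y'(1)] by simp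
    moreover have "hom_zero Q (Sh C T) Y'" using QB.HH[OF QB.Sim_H[OF TQ] Y'H] by simp
    ultimately have "zero_obj Q (Sh C T)" using Q.hom_zero_retract_right Q.hom_zero_self by blast
    then have "zero_obj Q T" using Q.zero_obj_sh_iff[of T] H_obj Sim_H T(1) by simp
    then show ?thesis using QB.Sim_nonzero[OF TQ] by blast
  next
    case False
    then show ?thesis using that Q.hom_zeroI[of T Y] Q.tri_obj[OF Y'(1)] by blast
  qed
  have "is_iso Q f" by (rule QB.schur[OF TQ Y f])
  then show thesis using that T(1) Q.isomorphicI f by blast
qed

theorem finitely_many_simples_Q: assumes "finitely_many_simples C H" shows "finitely_many_simples Q QB.H"
proof -
  obtain X where X: "finite X" "\<And>T. T \<in> Sim C H \<Longrightarrow> \<exists>T'\<in>X. isomorphic C T T'"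
    using assms unfolding finitely_many_simples_def by blast
  have "\<exists>T'\<in>X. isomorphic Q Y T'" if Y: "Y \<in> Sim Q QB.H" for Y
  proof -
    obtain T where T: "T \<in> Sim C H" "isomorphic Q T Y" using simple_Q_lift[OF Y] .
    obtain T' where T': "T' \<in> X" "isomorphic C T T'" using X(2)[OF T(1)] by blast
    have "isomorphic Q Y T'" using Q.isomorphic_trans[OF Q.isomorphic_sym[OF T(2)] isomorphic_Q[OF T'(2)]] .
    then show ?thesis using T' by blast
  qed
  then show ?thesis using X(1) unfolding finitely_many_simples_def by blast
qed

section \<open>Tilting the quotient heart\<close>

context
  fixes S :: 'o
  assumes S: "S \<in> Sim C H" "S \<notin> SK" and ext_S: "\<And>T. T \<in> SK \<Longrightarrow> hom_zero C T (Sh C S)"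
begin

lemma So: "S \<in> Obj C" using S Sim_H H_obj by blast

text \<open>
  In the case \<open>m = n + 1\<close> this is the vanishing of \<open>Ext\<^sup>1\<close> from the generators to \<open>S\<close>.
\<close>

lemma SK_hom_shift: assumes "T \<in> SK" "m \<le> n + 1" shows "hom_zero C (shz n T) (shz m S)"
proof (cases "m = n + 1")
  case True
  have "hom_zero C (shz n T) (shz n (Sh C S))" using hom_zero_shz[OF SK_obj[OF assms(1)], of "Sh C S"] ext_S[OF assms(1)] So by simp
  moreover have "shz n (Sh C S) = shz (n + 1) S" using shz_shz[OF So, of n 1] shz_1[OF So] by simp
  ultimately show ?thesis using True by simp
next
  case False
  then show ?thesis using SK_hom_zero(1)[OF assms(1) S, of m n] assms by simp
qed

lemma word_hom_shift: assumes "word v E" "snd ` set v \<subseteq> SK" "\<forall>a\<in>set v. m \<le> fst a + 1" shows "hom_zero C E (shz m S)"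
proof (rule word_hom_left[OF assms(1)])
  show "shz m S \<in> Obj C" using So by simp
  fix n T assume nT: "(n, T) \<in> set v"
  have "T \<in> SK" using assms(2) nT by force
  moreover have "m \<le> n + 1" using assms(3) nT by force
  ultimately show "hom_zero C (shz n T) (shz m S)" by (rule SK_hom_shift)
qed

text \<open>
  The apex of a refined roof is an extension of \<open>X\<close> by \<open>E[-1]\<close> with \<open>E\<close> made of generators in shifts \<open>n \<ge> 0\<close>. The only
  possible maps from \<open>E[-1]\<close> to \<open>S\<close> would be elements of \<open>Ext\<^sup>1\<close> from a generator to \<open>S\<close>.
\<close>

lemma hom_to_S_Q: assumes X: "X \<in> P" and z: "hom_zero C X S" shows "hom_zero Q X S"
proof (rule hom_zero_Q_I[OF P_obj[OF X] So])
  fix s f assume r: "roof s f" "Cod C s = X" "Cod C f = S"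
  obtain x where x: "word x X" "snd ` set x \<subseteq> Sim C H" "\<forall>a\<in>set x. 0 \<le> fst a" using P_word[OF X] .
  obtain s' f' g h where E0: "rc s f = rc s' f'" "roof s' f'" "tri (Dom C s') X (Cod C g)" "Cod C g \<in> W" "Cod C g \<in> P"
    using roof_word[OF x r(1,2)] by metis
  define E where "E = Cod C g"
  note E = E0[folded E_def]
  obtain E' where E': "E' \<in> Obj C" "E = Sh C E'" "tri E' (Dom C s') X" using tri_unrot_ex[OF E(3)] .
  obtain v where v: "word v E" "snd ` set v \<subseteq> SK" "\<forall>a\<in>set v. 0 \<le> fst a" using W_P_word[OF E(4,5)] .
  have "hom_zero C E (shz 1 S)" by (rule word_hom_shift[OF v(1,2)]) (use v(3) in auto)
  then have "hom_zero C E' S" using E' So hom_zero_sh shz_1 by simp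
  then have "hom_zero C (Dom C s') S" using hom_zero_mid'[OF E'(3)] z by blast
  then show "\<exists>s' f'. rc s f = rc s' f' \<and> roof s' f' \<and> hom_zero C (Dom C s') S" using E by blast
qed

text \<open>
  A nonzero map to \<open>S\<close> has its kernel in the heart. If it became zero, then \<open>S\<close> would be a retract of the shift of
  that kernel in the quotient, hence zero there.
\<close>

lemma hom_to_S_C: assumes X: "X \<in> H" and z: "hom_zero Q X S" shows "hom_zero C X S"
proof (rule ccontr)
  assume "\<not> hom_zero C X S"
  then obtain e where e: "e \<in> Arr C" "Dom C e = X" "Cod C e = S" "e \<noteq> Null C X S"
    using hom_zeroI[of X S] H_obj[OF X] So by blast
  obtain k h where F: "(k, e, h) \<in> Tri C" "tri (Dom C k) (Dom C e) (Cod C e)" using fibre_ex[OF e(1)] .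
  have K: "Dom C k \<in> H" by (rule epi_to_simple[OF S(1) e(1) _ e(3) _ F(1)]) (use e X in auto)
  have t: "Q.tri (Dom C k) X S" using tri_Q[OF F(2)] e by simp
  have "Q.retract S (Sh C (Dom C k))" using Q.retract_of_zero_second[OF t z] by simp
  moreover have "hom_zero Q (Sh C (Dom C k)) S" using QB.HH[OF H_QH[OF K] H_QH[OF Sim_H[OF S(1)]]] by simp
  ultimately have "zero_obj Q S" using Q.hom_zero_retract_left Q.hom_zero_self by blast
  then show False using QB.Sim_nonzero[OF simple_Q[OF S]] by blast
qed

text \<open>
  For a general roof the cone of the denominator contributes \<open>Ext\<^sup>2\<close> from generators to \<open>S\<close>. But \<open>S\<close> has no maps
  to the generators, so the cone can be cut down to shifts \<open>n \<ge> 1\<close>, where only \<open>Ext\<^sup>1\<close> is left.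
\<close>

lemma rigid_Q: assumes rigid: "hom_zero C S (Sh C S)" shows "hom_zero Q S (Sh C S)"
proof (rule hom_zero_Q_I[OF So])
  show "Sh C S \<in> Obj C" using So by simp
  fix s f assume r: "roof s f" "Cod C s = S" "Cod C f = Sh C S"
  have x: "word [(0, S)] S" "snd ` set [(0::int, S)] \<subseteq> Sim C H" "\<forall>a\<in>set [(0::int, S)]. 0 \<le> fst a" using word_single[OF So, of 0] S by simp_all
  obtain s' f' p q where E: "rc s f = rc s' f'" "roof s' f'" "Cod C s' = S" "(s', p, q) \<in> Tri C" "tri (Dom C s') S (Cod C p)"
    "Cod C p \<in> W" "Cod C p \<in> P"
    using roof_word[OF x r(1,2)] by metis
  note R = roofD[OF E(2)] and tp = triD[OF E(4)]
  have sa: "s' \<in> Arr C" using R by simp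
  obtain v where v: "word v (Cod C p)" "snd ` set v \<subseteq> SK" "\<forall>a\<in>set v. 0 \<le> fst a" using W_P_word[OF E(6,7)] .
  have vS: "snd ` set v \<subseteq> Sim C H" using v SK_Sim by auto
  obtain v1 v2 E1 E0 where X: "tri E1 (Cod C p) E0" "word v1 E1" "word v2 E0" "set v1 \<subseteq> set v" "set v2 \<subseteq> set v"
    "\<forall>a\<in>set v1. 1 \<le> fst a" "\<forall>a\<in>set v2. fst a < 1" using word_trunc[OF v(1) vS, of 1] by metis
  obtain j r t where J: "(j, r, t) \<in> Tri C" "j \<in> Arr C" "r \<in> Arr C" "Dom C j = E1" "Cod C j = Cod C p" "Dom C r = Cod C p" "Cod C r = E0"
    using triE[OF X(1)] by metis
  have "hom_zero C S E0"
  proof (rule word_hom_right[OF X(3) So])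
    fix n T assume nT: "(n, T) \<in> set v2"
    have "T \<in> SK" using nT X(5) v(2) by force
    moreover have "n = 0" using nT X(5,7) v(3) by force
    ultimately show "hom_zero C S (shz n T)" using SK_hom_zero(2)[OF _ S, of T 0 0] by simp
  qed
  then have "r \<cdot> p = Null C S E0" by (rule hom_zeroD) (use J tp E(3) in auto)
  then obtain p1 where p1: "p1 \<in> Arr C" "Dom C p1 = S" "Cod C p1 = E1" "j \<cdot> p1 = p"
    using weak_ker[OF J(1), of p] J tp E(3) by auto
  obtain s1 k1 where F: "(s1, p1, k1) \<in> Tri C" "tri (Dom C s1) (Dom C p1) (Cod C p1)" using fibre_ex[OF p1(1)] .
  note t1 = triD[OF F(1)]
  have "E1 \<in> W" by (rule W_I[OF X(2)]) (use X(4) v(2) in auto)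
  then have s1I: "s1 \<in> I" using I_I[OF F(1)] p1 by simp
  have cs1: "Cod C s1 = S" using t1(4) p1 by simp
  have "j \<cdot> (p1 \<cdot> s1) = p \<cdot> s1" by (rule comp_cancel[OF p1(4)]) (use J p1(1-3) t1 cs1 in auto)
  then have "p \<cdot> s1 = Null C (Dom C s1) (Cod C p)" using tri_comp_zero[OF F(1)] J p1(1-3) t1 by simp
  then obtain m where m: "m \<in> Arr C" "Dom C m = Dom C s1" "Cod C m = Dom C s'" "s' \<cdot> m = s1"
    using weak_ker[OF E(4), of s1] t1 tp E(3) cs1 by auto
  have m': "roof (s' \<cdot> m) (f' \<cdot> m)" "rc (s' \<cdot> m) (f' \<cdot> m) = rc s' f'" using rc_refine[OF E(2) m(1,3)] m(4) s1I by auto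
  have T1: "tri (Dom C s1) S E1" using F(2) p1 by simp
  obtain E1' where E1': "E1' \<in> Obj C" "E1 = Sh C E1'" "tri E1' (Dom C s1) S" using tri_unrot_ex[OF T1] .
  have "hom_zero C E1 (shz 2 S)" by (rule word_hom_shift[OF X(2)]) (use X(4,6) v(2) in auto)
  moreover have "shz 2 S = Sh C (Sh C S)" using Sh_shz[OF So, of 1] shz_1[OF So] by simp
  ultimately have "hom_zero C E1' (Sh C S)" using E1' So hom_zero_sh by simp
  then have "hom_zero C (Dom C s1) (Sh C S)" using hom_zero_mid'[OF E1'(3)] rigid by blast
  then have "hom_zero C (Dom C (s' \<cdot> m)) (Sh C S)" using m(4) by simp
  then show "\<exists>s' f'. rc s f = rc s' f' \<and> roof s' f' \<and> hom_zero C (Dom C s') (Sh C S)" using m' E(1) by metis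
qed

text \<open>As \<open>S\<close> is rigid in the quotient, an iterated extension of it splits, and split triangles lift.\<close>

lemma filt_S_lift: assumes rigid: "hom_zero Q S (Sh C S)"
  shows "Q.filt As X \<Longrightarrow> set As \<subseteq> {S} \<Longrightarrow> \<exists>X0. filt As X0 \<and> isomorphic Q X0 X"
proof (induction rule: Q.filt.induct)
  case (filt_Nil X)
  obtain Z where Z: "zero_obj C Z" using ex_zero by blast
  then show ?case using Q.zero_isomorphic[OF zero_L[OF Z] filt_Nil(1)] filt.filt_Nil by blast
next
  case (filt_Cons A X Y As)
  have A: "A = S" and LS: "set As \<subseteq> {S}" using filt_Cons.prems by auto
  obtain Y0 where Y0: "filt As Y0" "isomorphic Q Y0 Y" using filt_Cons.IH LS by blast
  have Y0o: "Y0 \<in> Obj C" using filt_obj[OF Y0(1)] .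
  obtain f g where T: "(f, g, Null C Y0 (Sh C S)) \<in> Tri C" "Dom C f = S"
    by (rule tri_of_connecting[of "Null C Y0 (Sh C S)" S]) (use Y0o So in auto)
  note t = triD[OF T(1)]
  have gY: "Cod C g = Y0" using t Y0o So by simp
  have X0: "tri S (Cod C f) Y0" using triI[OF T(1)] T(2) gY by simp
  have LT: "(L f, L g, L (Null C Y0 (Sh C S))) \<in> Tri Q" by (rule L_Tri[OF T(1)])
  obtain f' g' h' where T': "(f', g', h') \<in> Tri Q" "Dom Q f' = S" "Cod Q f' = X" "Cod Q g' = Y" "h' \<in> Arr Q" "Dom Q h' = Y" "Cod Q h' = Sh C S"
    using Q.triE[OF filt_Cons(1)] A by (metis Q_Sh)
  have "hom_zero Q Y (Sh C S)" by (rule Q.filt_hom_left[OF filt_Cons(2)]) (use LS rigid So in auto)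
  then have h'0: "h' = Null Q Y (Sh C S)" by (rule Q.hom_zeroD) (use T' in auto)
  obtain a where a: "a \<in> Arr Q" "Dom Q a = Y0" "Cod Q a = Y" "is_iso Q a" using Q.isomorphicE[OF Y0(2)] by metis
  have "isomorphic Q (Cod Q (L f)) (Cod Q f')"
    by (rule Q.tri_iso_of_connecting[OF LT T'(1) a(1,4), of "Ide Q (Sh C S)"])
      (use a T'(5-7) h'0 Y0o So in \<open>auto simp: L_null\<close>)
  then have "isomorphic Q (Cod C f) X" using T'(3) t by simp
  moreover have "filt (A # As) (Cod C f)" using filt.filt_Cons[OF X0 Y0(1)] A by simp
  ultimately show ?case by blast
qed

text \<open>
  Both sides consist of the extensions of a torsion object by \<open>F[1]\<close>, with \<open>F\<close> an iterated extension of \<open>S\<close>. Torsion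
  objects and the objects \<open>F\<close> correspond by the previous lemmas. What remains is to lift the connecting map
  \<open>T \<rightarrow> F[2]\<close>, and \<open>map_from_heart\<close> does this at the price of replacing \<open>T\<close> by an object of the heart that is isomorphic
  to it in the quotient.
\<close>

theorem tilt_image:
  assumes rigid: "hom_zero C S (Sh C S)"
  shows "simple_forward_tilt Q QB.H S = verdier_image C W (simple_forward_tilt C H S)"
proof (intro set_eqI iffI)
  note SQ = simple_Q[OF S]
  have SoC: "{S} \<subseteq> Obj C" and SoQ: "{S} \<subseteq> Obj Q" using So by auto
  note tcC = torsion_class_iff[OF S(1)] and tcQ = QL.torsion_class_iff[OF SQ]
  note ecC = ext_closure_filt[OF SoC] and ecQ = Q.ext_closure_filt[OF SoQ]
  have tiltI: "Y \<in> simple_forward_tilt Q QB.H S" if Y: "Q.tri (Sh C F) Y T" "F \<in> ext_closure Q {S}" "T \<in> torsion_class Q QB.H (ext_closure Q {S})" for Y F T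
  proof -
    obtain f g h where "(f, g, h) \<in> Tri Q" "Dom Q f = Sh C F" "Cod Q f = Y" "Cod Q g = T" using Y(1) unfolding Q.tri_def by blast
    moreover have "Y \<in> Obj Q" using Q.tri_obj[OF Y(1)] by blast
    moreover have "Dom Q f \<in> Sh Q ` ext_closure Q {S}" "Cod Q g \<in> torsion_class Q QB.H (ext_closure Q {S})"
      using Y(2,3) calculation by auto
    ultimately show ?thesis unfolding simple_forward_tilt_def forward_tilt_def by blast
  qed
  fix Y
  {
    assume "Y \<in> verdier_image C W (simple_forward_tilt C H S)"
    then obtain X where X: "X \<in> simple_forward_tilt C H S" "isomorphic Q X Y" unfolding image_iff by blast
    then obtain f g h where fg: "(f, g, h) \<in> Tri C" "Dom C f \<in> Sh C ` ext_closure C {S}" "Cod C f = X"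
      "Cod C g \<in> torsion_class C H (ext_closure C {S})"
      unfolding simple_forward_tilt_def forward_tilt_def by blast
    then obtain F where F: "Dom C f = Sh C F" "F \<in> ext_closure C {S}" by blast
    have t: "Q.tri (Sh C F) Y (Cod C g)" using Q.tri_iso_mid[OF tri_Q[OF triI[OF fg(1)]]] fg(3) F(1) X(2) by simp
    have g: "Cod C g \<in> H" "hom_zero C (Cod C g) S" using fg(4) tcC by auto
    have "Cod C g \<in> torsion_class Q QB.H (ext_closure Q {S})"
      using tcQ H_QH[OF g(1)] hom_to_S_Q[OF H_P[OF g(1)] g(2)] by blast
    moreover have "F \<in> ext_closure Q {S}" using F(2) filt_Q ecC ecQ by blast
    ultimately show "Y \<in> simple_forward_tilt Q QB.H S" using tiltI t by blast
  next
    assume "Y \<in> simple_forward_tilt Q QB.H S"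
    then obtain f g h where fg: "(f, g, h) \<in> Tri Q" "Dom Q f \<in> Sh C ` ext_closure Q {S}" "Cod Q f = Y"
      "Cod Q g \<in> torsion_class Q QB.H (ext_closure Q {S})"
      unfolding simple_forward_tilt_def forward_tilt_def by auto
    note t = Q.triD[OF fg(1)]
    obtain F where F: "Dom Q f = Sh C F" "F \<in> ext_closure Q {S}" using fg(2) by blast
    obtain L' where L': "set L' \<subseteq> {S}" "Q.filt L' F" using F(2) ecQ by blast
    obtain F0 where F0: "filt L' F0" "isomorphic Q F0 F" using filt_S_lift[OF rigid_Q[OF rigid] L'(2,1)] by blast
    have F0o: "F0 \<in> Obj C" using filt_obj[OF F0(1)] .
    have gT: "Cod Q g \<in> QB.H" "hom_zero Q (Cod Q g) S" using fg(4) tcQ by auto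
    obtain X where X: "X \<in> H" "isomorphic Q X (Cod Q g)" using QH_E[OF gT(1)] .
    obtain a where a: "a \<in> Arr Q" "Dom Q a = X" "Cod Q a = Cod Q g" "is_iso Q a" using Q.isomorphicE[OF X(2)] by metis
    have "isomorphic Q (Sh C (Sh C F0)) (Sh C (Sh C F))" using Q.isomorphic_sh[OF Q.isomorphic_sh[OF F0(2)]] by simp
    then obtain b' b where b: "b' \<in> Arr Q" "Dom Q b' = Sh C (Sh C F0)" "Cod Q b' = Sh C (Sh C F)" "b \<in> Arr Q" "Dom Q b = Sh C (Sh C F)"
      "Cod Q b = Sh C (Sh C F0)" "b' \<cdot>\<^bsub>Q\<^esub> b = Ide Q (Sh C (Sh C F))" "is_iso Q b'" using Q.isomorphicE by metis
    have h: "Dom Q h = Cod Q g" "Cod Q h = Sh C (Sh C F)" using t F by simp_all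
    define c where "c = b \<cdot>\<^bsub>Q\<^esub> (h \<cdot>\<^bsub>Q\<^esub> a)"
    have c: "c \<in> Arr Q" "Dom Q c = X" "Cod Q c = Sh C (Sh C F0)" unfolding c_def using a b h t(3) by simp_all
    have z: "hom_zero C (shz n T) (Sh C (Sh C F0))" if n: "1 \<le> n" "T \<in> SK" for n T
    proof -
      have f2: "filt (map (shz 2) L') (shz 2 F0)" by (rule filt_shz[OF F0(1)])
      have "hom_zero C (shz n T) (shz 2 F0)"
      proof (rule filt_hom_right[OF f2])
        show "shz n T \<in> Obj C" using SK_obj n by simp
        fix A assume "A \<in> set (map (shz 2) L')"
        then have "A = shz 2 S" using L'(1) by auto
        then show "hom_zero C (shz n T) A" using SK_hom_shift[OF n(2), of 2 n] n(1) by simp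
      qed
      moreover have "shz 2 F0 = Sh C (Sh C F0)" using Sh_shz[OF F0o, of 1] shz_1[OF F0o] by simp
      ultimately show ?thesis by simp
    qed
    obtain Z i f1 where Z: "Z \<in> H" "i \<in> Arr Q" "is_iso Q i" "Dom Q i = Z" "Cod Q i = X" "f1 \<in> Arr C" "Dom C f1 = Z" "Cod C f1 = Sh C (Sh C F0)"
      "c \<cdot>\<^bsub>Q\<^esub> i = L f1" using map_from_heart[OF X(1) c z] by metis
    obtain x y where T: "(x, y, f1) \<in> Tri C" "Dom C x = Sh C F0"
      by (rule tri_of_connecting[OF Z(6,8)]) (use F0o in auto)
    note tT = triD[OF T(1)]
    have ai: "a \<cdot>\<^bsub>Q\<^esub> i \<in> Arr Q" "Dom Q (a \<cdot>\<^bsub>Q\<^esub> i) = Z" "Cod Q (a \<cdot>\<^bsub>Q\<^esub> i) = Cod Q g" using a Z by simp_all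
    have aii: "is_iso Q (a \<cdot>\<^bsub>Q\<^esub> i)" by (rule Q.is_iso_comp[OF Z(3) a(4)]) (use Z a in simp)
    have "b' \<cdot>\<^bsub>Q\<^esub> L f1 = b' \<cdot>\<^bsub>Q\<^esub> (b \<cdot>\<^bsub>Q\<^esub> (h \<cdot>\<^bsub>Q\<^esub> (a \<cdot>\<^bsub>Q\<^esub> i)))"
      unfolding Z(9)[symmetric] c_def using a b h t(3) Z(2,4,5) by simp
    also have "\<dots> = Ide Q (Sh C (Sh C F)) \<cdot>\<^bsub>Q\<^esub> (h \<cdot>\<^bsub>Q\<^esub> (a \<cdot>\<^bsub>Q\<^esub> i))"
      by (rule Q.comp_cancel[OF b(7)]) (use b h t(3) ai in auto)
    finally have e: "b' \<cdot>\<^bsub>Q\<^esub> L f1 = h \<cdot>\<^bsub>Q\<^esub> (a \<cdot>\<^bsub>Q\<^esub> i)" using h t(3) ai by simp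
    have "isomorphic Q (Cod Q (L x)) (Cod Q f)"
      by (rule Q.tri_iso_of_connecting[OF L_Tri[OF T(1)] fg(1) ai(1) aii _ _ b(1,8) _ _ e]) (use ai b h Z(6-8) in auto)
    then have M: "isomorphic Q (Cod C x) Y" using fg(3) tT by simp
    have "isomorphic Q (Cod Q g) Z" using Q.isomorphic_sym[OF Q.isomorphicI[OF aii ai(2,3)]] .
    then have "hom_zero Q Z S" using Q.hom_zero_iso[OF _ Q.isomorphic_refl gT(2)] So by simp
    then have "Z \<in> torsion_class C H (ext_closure C {S})" using tcC hom_to_S_C Z(1) by blast
    moreover have "Cod C y = Z" using tT Z(7) by simp
    moreover have "F0 \<in> ext_closure C {S}" using ecC F0(1) L'(1) by blast
    moreover have "Cod C x \<in> Obj C" using tT by simp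
    ultimately have "Cod C x \<in> simple_forward_tilt C H S"
      using T unfolding simple_forward_tilt_def forward_tilt_def by blast
    then show "Y \<in> verdier_image C W (simple_forward_tilt C H S)" using image_I M by blast
  }
qed

end

end

section \<open>Simple tilts descend to the quotient\<close>

theorem proposition6p8:
  fixes D :: "('o, 'm, 'k::alg_closed_field) tri_cat"
    and H K V :: "'o set" and S :: 'o
    and Q :: "('o, ('o, 'm) roof_class, 'k) tri_cat"
  assumes "triangulated_category D"
    and "finite_heart D H" and "rigid_heart D H"
    and "abelian_subcategory D H K"
    and "K = {X \<in> H. \<forall>T. comp_factor D H X T \<longrightarrow> T \<in> Sim D K}"
    and "Sim D K \<subseteq> Sim D H"
    and "V = thick D K"
    and "Q = verdier_quotient D V"
    and "S \<in> Sim D H - Sim D K"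
    and "\<forall>X \<in> K. ext1_zero D X S"
  shows "simple_forward_tilting D H S (simple_forward_tilt D H S) \<and>
    finite_heart Q (verdier_image D V H) \<and>
    ext1_zero Q (verdier_obj D V S) (verdier_obj D V S) \<and>
    simple_forward_tilt Q (verdier_image D V H) (verdier_obj D V S)
      = verdier_image D V (simple_forward_tilt D H S) \<and>
    simple_forward_tilting Q (verdier_image D V H) (verdier_obj D V S)
      (verdier_image D V (simple_forward_tilt D H S))"
proof -
  have fin: "is_heart D H" "finite_length D H" "finitely_many_simples D H" using assms(2) by (auto simp: finite_heart_def)
  obtain P where P: "bounded_t_structure D P" "H = P \<inter> Sh D ` right_perp D P" using fin(1) by (auto simp: is_heart_def)
  interpret D: triangulated_category D by (rule assms(1))
  interpret B: bounded_t D P by unfold_locales (rule P(1))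
  have BH: "B.H = H" by (simp add: B.H_def B.N_def B.R_def P(2))
  interpret LH: length_heart D P by unfold_locales (simp add: BH fin(2))
  have K: "X \<in> K \<longleftrightarrow> X \<in> H \<and> (\<forall>T. comp_factor D H X T \<longrightarrow> T \<in> Sim D K)" for X
    by (subst assms(5)) simp
  have Sim_K: "Sim D K \<subseteq> K" by (auto simp: Sim_def)
  interpret TS: thick_simples D P "Sim D K"
  proof unfold_locales
    show "Sim D K \<subseteq> Sim D B.H" using assms(6) BH by simp
    fix T T' assume T: "T \<in> Sim D K" and i: "isomorphic D T T'"
    have "T' \<in> K"
      unfolding K
    proof (intro conjI allI impI)
      show "T' \<in> H" using B.H_iso[OF _ i] T Sim_K K BH by blast
      fix U assume "comp_factor D H T' U"
      then obtain Ts where "comp_series D H T' Ts" "U \<in> set Ts" by (auto simp: comp_factor_def)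
      then have "comp_factor D H T U" using B.comp_series_iso[of T' Ts T] D.isomorphic_sym[OF i] BH by (auto simp: comp_factor_def)
      then show "U \<in> Sim D K" using T Sim_K K by blast
    qed
    then show "T' \<in> Sim D K" using D.Sim_iso[OF T _ i] by blast
  qed
  have "K \<subseteq> TS.W"
  proof
    fix X assume X: "X \<in> K"
    obtain Ts where Ts: "comp_series D H X Ts" using fin(2) X K by (auto simp: finite_length_def)
    have "set Ts \<subseteq> Sim D K" using Ts X K by (auto simp: comp_factor_def)
    moreover have "D.filt (rev Ts) X" using LH.comp_series_filt Ts BH by simp
    moreover have "map (\<lambda>(n, T). D.shz n T) (map (Pair 0) (rev Ts)) = rev Ts" by (simp add: comp_def)
    ultimately have "LH.word (map (Pair 0) (rev Ts)) X" "snd ` set (map (Pair 0) (rev Ts)) \<subseteq> Sim D K"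
      by (auto simp: LH.word_def)
    then show "X \<in> TS.W" by (rule TS.W_I)
  qed
  then have V: "V = TS.W" using TS.thick_eq_W[OF Sim_K] assms(7) by simp
  have Q: "Q = verdier_quotient D TS.W" using assms(8) V by simp
  have S: "S \<in> Sim D B.H" "S \<notin> Sim D K" using assms(9) BH by auto
  have ext: "hom_zero D T (Sh D S)" if "T \<in> Sim D K" for T
    using assms(10) that Sim_K by (auto simp: ext1_zero_def)
  have rigid: "hom_zero D S (Sh D S)" using assms(3,9) by (auto simp: rigid_heart_def ext1_zero_def)
  have im: "verdier_image D V H = TS.QB.H" using TS.quotient_heart V BH by simp
  have so: "verdier_obj D V S = S" by (simp add: verdier_obj_def)
  have tilt: "simple_forward_tilt Q TS.QB.H S = verdier_image D V (simple_forward_tilt D H S)"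
    using TS.tilt_image[OF S ext rigid] unfolding Q V BH .
  show ?thesis
    unfolding im so
  proof (intro conjI)
    show "simple_forward_tilting D H S (simple_forward_tilt D H S)" using LH.simple_tilting[OF S(1)] BH by simp
    show "finite_heart Q TS.QB.H" unfolding finite_heart_def Q
      using TS.QB.is_heart_H TS.finite_length_Q TS.finitely_many_simples_Q fin(3) BH by simp
    show "ext1_zero Q S S" unfolding ext1_zero_def Q using TS.rigid_Q[OF S ext rigid] by simp
    show "simple_forward_tilt Q TS.QB.H S = verdier_image D V (simple_forward_tilt D H S)" by (rule tilt)
    show "simple_forward_tilting Q TS.QB.H S (verdier_image D V (simple_forward_tilt D H S))"
      using TS.QL.simple_tilting[OF TS.simple_Q[OF S]] tilt Q by simp
  qed
qed

end
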